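(* Let $k$ be a commutative ring with unit. There is an equivalence of categories $\mathscr M^k_d\simeq\Omega^k\mathit{Mod}$ between the category of deflative objects of $\mathscr M^k$ and the category of modules over the Green functor $(\Omega^k,\ell'_{\Omega^k},\mathbf p)$.
   Context: All groups are finite, $\mathbf 1$ is a one-point set, $e$ is the trivial group. The 2-category $\mathbb S$. 0-cells: pairs $\frac XG$ with $G$ a finite group and $X$ a finite left $G$-set. A 1-cell $\frac\alpha\theta\colon\frac XG\to\frac YH$ (often written $\alpha$) is a map $\alpha\colon X\to Y$ with maps $\theta_x\colon G\to H$ ($x\in X$) such that $\alpha(gx)=\theta_x(g)\alpha(x)$ and $\theta_x(gg')=\theta_{g'x}(g)\theta_x(g')$; composition is $\beta\circ\alpha$ with $(\tau\circ\theta)_x=\tau_{\alpha(x)}\circ\theta_x$. Write $\frac\alpha G$ if $H=G$ and all $\theta_x=\mathrm{id}_G$. A 2-cell $\varepsilon\colon\frac\alpha\theta\Rightarrow\frac{\alpha'}{\theta'}$ is a family $\varepsilon_x\in H$ with $\alpha'(x)=\varepsilon_x\alpha(x)$ and $\varepsilon_{gx}\theta_x(g)\varepsilon_x^{-1}=\theta'_x(g)$; vertical composition is $(\varepsilon'\cdot\varepsilon)_x=\varepsilon'_x\varepsilon_x$, whiskering is $(\frac\beta\tau\circ\varepsilon)_x=\tau_{\alpha(x)}(\varepsilon_x)$, $(\rho\circ\frac\alpha\theta)_x=\rho_{\alpha(x)}$. The category $\mathscr C$. Objects: 0-cells of $\mathbb S$; morphisms: isomorphism classes $\underline\alpha$ of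 1-cells under (always invertible) 2-cells. It has finite coproducts $\amalg$ and finite products, $\frac XG\times\frac YH=\frac{X\times Y}{G\times H}$, terminal object $\frac{\mathbf 1}e$. A natural weak pullback is a commutative square in $\mathscr C$ that is the image of a bipullback in $\mathbb S$; the bipullback of $\frac\alpha\theta\colon\frac XG\to\frac ZK$ and $\frac\beta\tau\colon\frac YH\to\frac ZK$ is $\frac F{G\times H}$ with $F=\{(x,y,c)\in X\times Y\times K\mid\beta(y)=c\,\alpha(x)\}$, $(g,h)(x,y,c)=(gx,hy,\tau_y(h)c\,\theta_x(g)^{-1})$, the projections, and the 2-cell with components $c$. A 1-cell $\frac\alpha\theta\colon\frac XG\to\frac YH$ (or its class) is stab-surjective if $Y=H\alpha(X)$ and, whenever $h\alpha(x)=h'\alpha(x')$, there is $g\in G$ with $x'=gx$ and $h=h'\theta_x(g)$. Mackey functors. $\mathcal S=\mathrm{Sp}(\mathscr C)$ has the objects of $\mathscr C$; morphisms $\frac XG\to\frac YH$ are isomorphism classes of spans $[\frac YH\xleftarrow{\underline\beta}\frac WL\xrightarrow{\underline\alpha}\frac XG]$ in $\mathscr C$, composed by natural weak pullbacks. Coproducts of $\mathscr C$ are finite products in $\mathcal S$, and $\times$ of $\mathscr C$ induces a symmetric monoidal structure on $\mathcal S$. $\mathscr M^k$ is the category of finite-product-preserving functors $M\colon\mathcal S\to k\mathrm{Mod}$ and natural transformations; equivalently Mackey functors $(M_!,M^* )$ on $\mathscr C$, via $M([\beta,\frac WL,\alpha])=M_!(\beta)M^*(\alpha)$. $\mathscr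 M^k_d\subseteq\mathscr M^k$ is the full subcategory of deflative objects: those with $M(s)=\mathrm{id}$ for every $s=[\frac XG\xleftarrow{\underline\alpha}\frac WL\xrightarrow{\underline\alpha}\frac XG]$ with $\alpha$ stab-surjective. Tensor product. Put $M_{\frac XG}=M(-\times\frac XG)$ and $M_s=M(-\times s)$. Then $(M\otimes N)(\frac XG)=\int^{\frac YH\in\mathcal S}M(\frac YH\times\frac XG)\otimes_kN(\frac YH)$ (contravariance in the $M$-factor via the span-reversing involution $\mathcal S^{\mathrm{op}}\cong\mathcal S$), and $(M\otimes N)(s)$ is induced by $M_s$. With internal Hom $\mathscr H(M,N)(\frac XG)=\mathscr M^k(M,N_{\frac XG})$, $(\mathscr M^k,\otimes,\Omega^k_{\mathrm{big}})$ is symmetric closed monoidal, with unit isomorphism $\ell_M\colon\Omega^k_{\mathrm{big}}\otimes M\to M$. Burnside functors. $\Omega^k_{\mathrm{big}}(\frac XG)=k\otimes_{\mathbb Z}K_0$ of the monoid (under $\amalg$) of isomorphism classes $[\frac AK\to\frac XG]$ of objects of $\mathscr C/\frac XG$; covariant by composition, contravariant by natural weak pullback. $\Omega^k(\frac XG)=k\otimes_{\mathbb Z}K_0$ of the monoid of isomorphism classes of finite $G$-sets over $X$. Let $\mathbf i([A\xrightarrow pX])=[\frac AG\xrightarrow{p/G}\frac XG]$ and $\mathbf p([\frac AK\xrightarrow{\mathfrak a}\frac XG])=[\mathrm{SIm}(\mathfrak a)\xrightarrow{\tilde{\mathfrak a}}X]$, where for a 1-cell $\frac\alpha\theta\colon\frac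 XG\to\frac YH$, $\mathrm{SIm}(\alpha)=(H\times X)/\!\sim$, $(\eta,x)\sim(\eta',x')$ iff there is $g\in G$ with $x'=gx$, $\eta=\eta'\theta_x(g)$, with left $H$-action and $\tilde\alpha([\eta,x])=\eta\alpha(x)$. Then $\Omega^k\in\mathscr M^k_d$ with $\Omega^k_!(\alpha)=\mathbf p\circ\Omega^k_{\mathrm{big}\,!}(\alpha)\circ\mathbf i$ and $\Omega^{k*}(\alpha)=\mathbf p\circ\Omega_{\mathrm{big}}^{k*}(\alpha)\circ\mathbf i$, and $\mathbf p\colon\Omega^k_{\mathrm{big}}\to\Omega^k$ is an epimorphism in $\mathscr M^k$. Green functors and modules. A Green functor on $\mathscr C$ is a monoid object $(\Gamma,m,u)$ in $(\mathscr M^k,\otimes,\Omega^k_{\mathrm{big}})$. A $\Gamma$-module is an object $M\in\mathscr M^k$ with an action $\mathrm{ac}\colon\Gamma\otimes M\to M$ that is associative and satisfies $\mathrm{ac}\circ(u\otimes M)=\ell_M$; morphisms of modules are morphisms of $\mathscr M^k$ commuting with the actions; the category is $\Gamma\mathit{Mod}$. $\Omega^k$ is a Green functor with unit $\mathbf p$ and multiplication the unique morphism $\ell'_{\Omega^k}\colon\Omega^k\otimes\Omega^k\to\Omega^k$ with $\ell'_{\Omega^k}\circ(\mathbf p\otimes\Omega^k)=\ell_{\Omega^k}$. *)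

theory Defs
  imports "HOL-Algebra.Module" "HOL-Algebra.AbelCoset" "HOL-Algebra.Group_Action"
    "HOL-Library.FSet"
begin

section \<open>Categories\<close>

record ('o, 'a) cat =
  ob :: "'o set"
  ar :: "'a set"
  src :: "'a \<Rightarrow> 'o"
  tgt :: "'a \<Rightarrow> 'o"
  idn :: "'o \<Rightarrow> 'a"
  cmp :: "'a \<Rightarrow> 'a \<Rightarrow> 'a"  (infixl "\<cdot>\<index>" 70)

definition arrows :: "('o, 'a) cat \<Rightarrow> 'o \<Rightarrow> 'o \<Rightarrow> 'a set" where
  "arrows C X Y = {f \<in> ar C. src C f = X \<and> tgt C f = Y}"

definition is_category :: "('o, 'a) cat \<Rightarrow> bool" where
  "is_category C \<longleftrightarrow>
     (\<forall>f \<in> ar C. src C f \<in> ob C \<and> tgt C f \<in> ob C) \<and>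
     (\<forall>X \<in> ob C. idn C X \<in> arrows C X X) \<and>
     (\<forall>f \<in> ar C. \<forall>g \<in> ar C. tgt C f = src C g \<longrightarrow>
        g \<cdot>\<^bsub>C\<^esub> f \<in> arrows C (src C f) (tgt C g)) \<and>
     (\<forall>f \<in> ar C. f \<cdot>\<^bsub>C\<^esub> idn C (src C f) = f \<and> idn C (tgt C f) \<cdot>\<^bsub>C\<^esub> f = f) \<and>
     (\<forall>f \<in> ar C. \<forall>g \<in> ar C. \<forall>h \<in> ar C. tgt C f = src C g \<longrightarrow> tgt C g = src C h \<longrightarrow>
        h \<cdot>\<^bsub>C\<^esub> (g \<cdot>\<^bsub>C\<^esub> f) = (h \<cdot>\<^bsub>C\<^esub> g) \<cdot>\<^bsub>C\<^esub> f)"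

definition is_iso :: "('o, 'a) cat \<Rightarrow> 'a \<Rightarrow> bool" where
  "is_iso C f \<longleftrightarrow> f \<in> ar C \<and> (\<exists>g \<in> arrows C (tgt C f) (src C f).
     g \<cdot>\<^bsub>C\<^esub> f = idn C (src C f) \<and> f \<cdot>\<^bsub>C\<^esub> g = idn C (tgt C f))"

definition isomorphic :: "('o, 'a) cat \<Rightarrow> 'o \<Rightarrow> 'o \<Rightarrow> bool" where
  "isomorphic C X Y \<longleftrightarrow> (\<exists>f \<in> arrows C X Y. is_iso C f)"

definition iso_class :: "('o, 'a) cat \<Rightarrow> 'o \<Rightarrow> 'o set" where
  "iso_class C X = {Y \<in> ob C. isomorphic C X Y}"

definition is_terminal :: "('o, 'a) cat \<Rightarrow> 'o \<Rightarrow> bool" where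
  "is_terminal C T \<longleftrightarrow> T \<in> ob C \<and> (\<forall>X \<in> ob C. \<exists>!f. f \<in> arrows C X T)"

definition is_product :: "('o, 'a) cat \<Rightarrow> 'o \<Rightarrow> 'o \<Rightarrow> 'o \<Rightarrow> 'a \<Rightarrow> 'a \<Rightarrow> bool" where
  "is_product C A B P p q \<longleftrightarrow>
     A \<in> ob C \<and> B \<in> ob C \<and> P \<in> ob C \<and> p \<in> arrows C P A \<and> q \<in> arrows C P B \<and>
     (\<forall>T \<in> ob C. \<forall>f \<in> arrows C T A. \<forall>g \<in> arrows C T B.
        \<exists>!h. h \<in> arrows C T P \<and> p \<cdot>\<^bsub>C\<^esub> h = f \<and> q \<cdot>\<^bsub>C\<^esub> h = g)"

definition is_coproduct :: "('o, 'a) cat \<Rightarrow> 'o \<Rightarrow> 'o \<Rightarrow> 'o \<Rightarrow> 'a \<Rightarrow> 'a \<Rightarrow> bool" where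
  "is_coproduct C A B S i j \<longleftrightarrow>
     A \<in> ob C \<and> B \<in> ob C \<and> S \<in> ob C \<and> i \<in> arrows C A S \<and> j \<in> arrows C B S \<and>
     (\<forall>T \<in> ob C. \<forall>f \<in> arrows C A T. \<forall>g \<in> arrows C B T.
        \<exists>!h. h \<in> arrows C S T \<and> h \<cdot>\<^bsub>C\<^esub> i = f \<and> h \<cdot>\<^bsub>C\<^esub> j = g)"

definition slice :: "('o, 'a) cat \<Rightarrow> 'o \<Rightarrow> ('a, 'a \<times> 'a \<times> 'a) cat" where
  "slice C X =
     \<lparr> ob = {f \<in> ar C. tgt C f = X},
       ar = {(f, g, h). f \<in> ar C \<and> tgt C f = X \<and> g \<in> ar C \<and> tgt C g = X \<and>
               h \<in> arrows C (src C f) (src C g) \<and> g \<cdot>\<^bsub>C\<^esub> h = f},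
       src = (\<lambda>(f, g, h). f),
       tgt = (\<lambda>(f, g, h). g),
       idn = (\<lambda>f. (f, f, idn C (src C f))),
       cmp = (\<lambda>(f', g', h') (f, g, h). (f, g', h' \<cdot>\<^bsub>C\<^esub> h)) \<rparr>"

definition full_subcategory :: "('o, 'a) cat \<Rightarrow> ('o \<Rightarrow> bool) \<Rightarrow> ('o, 'a) cat" where
  "full_subcategory C P =
     C\<lparr> ob := {X \<in> ob C. P X}, ar := {f \<in> ar C. P (src C f) \<and> P (tgt C f)} \<rparr>"

record ('o, 'a, 'p, 'b) fctr =
  on_ob :: "'o \<Rightarrow> 'p"
  on_ar :: "'a \<Rightarrow> 'b"

definition is_functor :: "('o, 'a) cat \<Rightarrow> ('p, 'b) cat \<Rightarrow> ('o, 'a, 'p, 'b) fctr \<Rightarrow> bool" where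
  "is_functor C D F \<longleftrightarrow>
     (\<forall>X \<in> ob C. on_ob F X \<in> ob D) \<and>
     (\<forall>f \<in> ar C. on_ar F f \<in> arrows D (on_ob F (src C f)) (on_ob F (tgt C f))) \<and>
     (\<forall>X \<in> ob C. on_ar F (idn C X) = idn D (on_ob F X)) \<and>
     (\<forall>f \<in> ar C. \<forall>g \<in> ar C. tgt C f = src C g \<longrightarrow>
        on_ar F (g \<cdot>\<^bsub>C\<^esub> f) = on_ar F g \<cdot>\<^bsub>D\<^esub> on_ar F f)"

definition id_functor :: "('o, 'a, 'o, 'a) fctr" where
  "id_functor = \<lparr> on_ob = (\<lambda>X. X), on_ar = (\<lambda>f. f) \<rparr>"

definition comp_functor ::
  "('p, 'b, 'q, 'c) fctr \<Rightarrow> ('o, 'a, 'p, 'b) fctr \<Rightarrow> ('o, 'a, 'q, 'c) fctr" where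
  "comp_functor G F = \<lparr> on_ob = on_ob G \<circ> on_ob F, on_ar = on_ar G \<circ> on_ar F \<rparr>"

definition is_natural_iso ::
  "('o, 'a) cat \<Rightarrow> ('p, 'b) cat \<Rightarrow> ('o, 'a, 'p, 'b) fctr \<Rightarrow> ('o, 'a, 'p, 'b) fctr \<Rightarrow> ('o \<Rightarrow> 'b) \<Rightarrow> bool"
  where
  "is_natural_iso C D F G \<eta> \<longleftrightarrow>
     (\<forall>X \<in> ob C. \<eta> X \<in> arrows D (on_ob F X) (on_ob G X) \<and> is_iso D (\<eta> X)) \<and>
     (\<forall>f \<in> ar C. \<eta> (tgt C f) \<cdot>\<^bsub>D\<^esub> on_ar F f = on_ar G f \<cdot>\<^bsub>D\<^esub> \<eta> (src C f))"

definition equivalent_categories :: "('o, 'a) cat \<Rightarrow> ('p, 'b) cat \<Rightarrow> bool" where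
  "equivalent_categories C D \<longleftrightarrow> is_category C \<and> is_category D \<and>
     (\<exists>F G \<eta> \<epsilon>. is_functor C D F \<and> is_functor D C G \<and>
        is_natural_iso C C id_functor (comp_functor G F) \<eta> \<and>
        is_natural_iso D D (comp_functor F G) id_functor \<epsilon>)"


section \<open>Finite groups acting on finite sets\<close>

text \<open>
  A universe of points. All elements of groups and of sets with a group action are taken from this
  countably infinite type, so every finite group and every finite set with an action of it has an
  isomorphic copy here; the type is closed under pairs (for products) and under finite subsets
  (for quotients).
\<close>

datatype pt = Atom nat | PPair (pfst: pt) (psnd: pt) | Cls (elems: "pt fset")

text \<open>The 0-cell \<open>X/G\<close>, the 1-cell \<open>\<alpha>/\<theta>\<close> with \<open>Tw a x g\<close> standing for \<open>\<theta>\<^sub>x(g)\<close>.\<close>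

record zero_cell =
  Grp :: "pt monoid"
  Pts :: "pt set"
  Act :: "pt \<Rightarrow> pt \<Rightarrow> pt"

definition is_zero_cell :: "zero_cell \<Rightarrow> bool" where
  "is_zero_cell P \<longleftrightarrow>
     group (Grp P) \<and> finite (carrier (Grp P)) \<and> finite (Pts P) \<and>
     group_action (Grp P) (Pts P) (Act P)"

record one_cell =
  Fn :: "pt \<Rightarrow> pt"
  Tw :: "pt \<Rightarrow> pt \<Rightarrow> pt"

definition is_one_cell :: "zero_cell \<Rightarrow> zero_cell \<Rightarrow> one_cell \<Rightarrow> bool" where
  "is_one_cell P Q a \<longleftrightarrow>
     (\<forall>x \<in> Pts P. Fn a x \<in> Pts Q) \<and>
     (\<forall>x \<in> Pts P. \<forall>g \<in> carrier (Grp P). Tw a x g \<in> carrier (Grp Q)) \<and>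
     (\<forall>x \<in> Pts P. \<forall>g \<in> carrier (Grp P). Fn a (Act P g x) = Act Q (Tw a x g) (Fn a x)) \<and>
     (\<forall>x \<in> Pts P. \<forall>g \<in> carrier (Grp P). \<forall>g' \<in> carrier (Grp P).
        Tw a x (g \<otimes>\<^bsub>Grp P\<^esub> g') = Tw a (Act P g' x) g \<otimes>\<^bsub>Grp Q\<^esub> Tw a x g')"

definition id_cell :: one_cell where
  "id_cell = \<lparr> Fn = (\<lambda>x. x), Tw = (\<lambda>x g. g) \<rparr>"

definition comp_cell :: "one_cell \<Rightarrow> one_cell \<Rightarrow> one_cell" where
  "comp_cell b a = \<lparr> Fn = (\<lambda>x. Fn b (Fn a x)), Tw = (\<lambda>x g. Tw b (Fn a x) (Tw a x g)) \<rparr>"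

definition is_two_cell ::
  "zero_cell \<Rightarrow> zero_cell \<Rightarrow> one_cell \<Rightarrow> one_cell \<Rightarrow> (pt \<Rightarrow> pt) \<Rightarrow> bool" where
  "is_two_cell P Q a a' e \<longleftrightarrow>
     (\<forall>x \<in> Pts P. e x \<in> carrier (Grp Q)) \<and>
     (\<forall>x \<in> Pts P. Fn a' x = Act Q (e x) (Fn a x)) \<and>
     (\<forall>x \<in> Pts P. \<forall>g \<in> carrier (Grp P).
        e (Act P g x) \<otimes>\<^bsub>Grp Q\<^esub> Tw a x g \<otimes>\<^bsub>Grp Q\<^esub> inv\<^bsub>Grp Q\<^esub> (e x) = Tw a' x g)"

definition stab_surjective :: "zero_cell \<Rightarrow> zero_cell \<Rightarrow> one_cell \<Rightarrow> bool" where
  "stab_surjective P Q a \<longleftrightarrow>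
     (\<forall>y \<in> Pts Q. \<exists>h \<in> carrier (Grp Q). \<exists>x \<in> Pts P. y = Act Q h (Fn a x)) \<and>
     (\<forall>h \<in> carrier (Grp Q). \<forall>h' \<in> carrier (Grp Q). \<forall>x \<in> Pts P. \<forall>x' \<in> Pts P.
        Act Q h (Fn a x) = Act Q h' (Fn a x') \<longrightarrow>
        (\<exists>g \<in> carrier (Grp P). x' = Act P g x \<and> h = h' \<otimes>\<^bsub>Grp Q\<^esub> Tw a x g))"

definition prod_cell :: "zero_cell \<Rightarrow> zero_cell \<Rightarrow> zero_cell" where
  "prod_cell P Q =
     (let X = {PPair x y | x y. x \<in> Pts P \<and> y \<in> Pts Q} in
      \<lparr> Grp = \<lparr> carrier = {PPair g h | g h. g \<in> carrier (Grp P) \<and> h \<in> carrier (Grp Q)},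
               mult = (\<lambda>u v. PPair (pfst u \<otimes>\<^bsub>Grp P\<^esub> pfst v) (psnd u \<otimes>\<^bsub>Grp Q\<^esub> psnd v)),
               one = PPair \<one>\<^bsub>Grp P\<^esub> \<one>\<^bsub>Grp Q\<^esub> \<rparr>,
        Pts = X,
        Act = (\<lambda>u. \<lambda>z \<in> X. PPair (Act P (pfst u) (pfst z)) (Act Q (psnd u) (psnd z))) \<rparr>)"

definition fst_cell :: one_cell where
  "fst_cell = \<lparr> Fn = pfst, Tw = (\<lambda>x. pfst) \<rparr>"

definition snd_cell :: one_cell where
  "snd_cell = \<lparr> Fn = psnd, Tw = (\<lambda>x. psnd) \<rparr>"

definition pair_cell :: "one_cell \<Rightarrow> one_cell \<Rightarrow> one_cell" where
  "pair_cell a b =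
     \<lparr> Fn = (\<lambda>x. PPair (Fn a x) (Fn b x)), Tw = (\<lambda>x g. PPair (Tw a x g) (Tw b x g)) \<rparr>"

text \<open>
  The apex of the bipullback of \<open>a : P \<rightarrow> R\<close> and \<open>b : Q \<rightarrow> R\<close>. Triples \<open>(x, y, c)\<close> are encoded as
  \<open>PPair x (PPair y c)\<close>.
\<close>

definition bipullback :: "zero_cell \<Rightarrow> zero_cell \<Rightarrow> zero_cell \<Rightarrow> one_cell \<Rightarrow> one_cell \<Rightarrow> zero_cell" where
  "bipullback P Q R a b =
     (let F = {PPair x (PPair y c) | x y c. x \<in> Pts P \<and> y \<in> Pts Q \<and> c \<in> carrier (Grp R) \<and>
                 Fn b y = Act R c (Fn a x)} in
      \<lparr> Grp = Grp (prod_cell P Q),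
        Pts = F,
        Act = (\<lambda>u. \<lambda>z \<in> F.
          (let g = pfst u; h = psnd u; x = pfst z; y = pfst (psnd z); c = psnd (psnd z) in
           PPair (Act P g x) (PPair (Act Q h y)
             (Tw b y h \<otimes>\<^bsub>Grp R\<^esub> c \<otimes>\<^bsub>Grp R\<^esub> inv\<^bsub>Grp R\<^esub> (Tw a x g))))) \<rparr>)"

definition bipullback_fst :: one_cell where
  "bipullback_fst = \<lparr> Fn = pfst, Tw = (\<lambda>z. pfst) \<rparr>"

definition bipullback_snd :: one_cell where
  "bipullback_snd = \<lparr> Fn = (\<lambda>z. pfst (psnd z)), Tw = (\<lambda>z. psnd) \<rparr>"


section \<open>The category \<open>\<C>\<close>\<close>

text \<open>
  A morphism is an isomorphism class of 1-cells together with its end points. The class contains all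
  representations of its members by total functions, whatever their values outside the carriers.
\<close>

record c_arrow =
  cdom :: zero_cell
  ccod :: zero_cell
  ccls :: "one_cell set"

definition c_arr :: "zero_cell \<Rightarrow> zero_cell \<Rightarrow> one_cell \<Rightarrow> c_arrow" where
  "c_arr P Q a =
     \<lparr> cdom = P, ccod = Q, ccls = {a'. is_one_cell P Q a' \<and> (\<exists>e. is_two_cell P Q a a' e)} \<rparr>"

definition c_rep :: "c_arrow \<Rightarrow> one_cell" where
  "c_rep f = (SOME a. a \<in> ccls f)"

definition CC :: "(zero_cell, c_arrow) cat" where
  "CC = \<lparr> ob = {P. is_zero_cell P},
          ar = {c_arr P Q a | P Q a. is_zero_cell P \<and> is_zero_cell Q \<and> is_one_cell P Q a},
          src = cdom,
          tgt = ccod,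
          idn = (\<lambda>P. c_arr P P id_cell),
          cmp = (\<lambda>g f. c_arr (cdom f) (ccod g) (comp_cell (c_rep g) (c_rep f))) \<rparr>"

definition c_fst :: "zero_cell \<Rightarrow> zero_cell \<Rightarrow> c_arrow" where
  "c_fst P Q = c_arr (prod_cell P Q) P fst_cell"

definition c_snd :: "zero_cell \<Rightarrow> zero_cell \<Rightarrow> c_arrow" where
  "c_snd P Q = c_arr (prod_cell P Q) Q snd_cell"

definition c_pair :: "c_arrow \<Rightarrow> c_arrow \<Rightarrow> c_arrow" where
  "c_pair f g = c_arr (cdom f) (prod_cell (ccod f) (ccod g)) (pair_cell (c_rep f) (c_rep g))"

definition c_times :: "c_arrow \<Rightarrow> c_arrow \<Rightarrow> c_arrow" where
  "c_times f g =
     c_pair (f \<cdot>\<^bsub>CC\<^esub> c_fst (cdom f) (cdom g)) (g \<cdot>\<^bsub>CC\<^esub> c_snd (cdom f) (cdom g))"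

text \<open>The apex and the two legs of the natural weak pullback of \<open>f\<close> and \<open>g\<close> (arrows with the same target).\<close>

definition c_wpb :: "c_arrow \<Rightarrow> c_arrow \<Rightarrow> zero_cell" where
  "c_wpb f g = bipullback (cdom f) (cdom g) (ccod f) (c_rep f) (c_rep g)"

definition c_wpb_fst :: "c_arrow \<Rightarrow> c_arrow \<Rightarrow> c_arrow" where
  "c_wpb_fst f g = c_arr (c_wpb f g) (cdom f) bipullback_fst"

definition c_wpb_snd :: "c_arrow \<Rightarrow> c_arrow \<Rightarrow> c_arrow" where
  "c_wpb_snd f g = c_arr (c_wpb f g) (cdom g) bipullback_snd"


section \<open>The category of spans\<close>

text \<open>A span \<open>Y \<leftarrow>\<beta>- W -\<alpha>\<rightarrow> X\<close> is the pair \<open>(\<beta>, \<alpha>)\<close>; it represents a morphism from \<open>X\<close> to \<open>Y\<close>.\<close>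

record s_arrow =
  sdom :: zero_cell
  scod :: zero_cell
  scls :: "(c_arrow \<times> c_arrow) set"

definition is_span :: "c_arrow \<Rightarrow> c_arrow \<Rightarrow> bool" where
  "is_span \<beta> \<alpha> \<longleftrightarrow> \<beta> \<in> ar CC \<and> \<alpha> \<in> ar CC \<and> cdom \<beta> = cdom \<alpha>"

definition span_iso :: "c_arrow \<times> c_arrow \<Rightarrow> c_arrow \<times> c_arrow \<Rightarrow> bool" where
  "span_iso = (\<lambda>(\<beta>, \<alpha>) (\<beta>', \<alpha>'). \<exists>\<gamma>. is_iso CC \<gamma> \<and> cdom \<gamma> = cdom \<beta> \<and> ccod \<gamma> = cdom \<beta>' \<and>
     \<beta>' \<cdot>\<^bsub>CC\<^esub> \<gamma> = \<beta> \<and> \<alpha>' \<cdot>\<^bsub>CC\<^esub> \<gamma> = \<alpha>)"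

definition s_arr :: "c_arrow \<Rightarrow> c_arrow \<Rightarrow> s_arrow" where
  "s_arr \<beta> \<alpha> =
     \<lparr> sdom = ccod \<alpha>, scod = ccod \<beta>,
       scls = {(\<beta>', \<alpha>'). is_span \<beta>' \<alpha>' \<and> span_iso (\<beta>, \<alpha>) (\<beta>', \<alpha>')} \<rparr>"

definition s_rep :: "s_arrow \<Rightarrow> c_arrow \<times> c_arrow" where
  "s_rep s = (SOME r. r \<in> scls s)"

definition s_comp :: "s_arrow \<Rightarrow> s_arrow \<Rightarrow> s_arrow" where
  "s_comp t s =
     (let (\<beta>, \<alpha>) = s_rep s; (\<beta>', \<alpha>') = s_rep t in
      s_arr (\<beta>' \<cdot>\<^bsub>CC\<^esub> c_wpb_snd \<beta> \<alpha>') (\<alpha> \<cdot>\<^bsub>CC\<^esub> c_wpb_fst \<beta> \<alpha>'))"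

definition SpC :: "(zero_cell, s_arrow) cat" where
  "SpC = \<lparr> ob = ob CC,
           ar = {s_arr \<beta> \<alpha> | \<beta> \<alpha>. is_span \<beta> \<alpha>},
           src = sdom,
           tgt = scod,
           idn = (\<lambda>P. s_arr (idn CC P) (idn CC P)),
           cmp = s_comp \<rparr>"

definition s_times :: "s_arrow \<Rightarrow> s_arrow \<Rightarrow> s_arrow" where
  "s_times s t =
     (let (\<beta>, \<alpha>) = s_rep s; (\<beta>', \<alpha>') = s_rep t in s_arr (c_times \<beta> \<beta>') (c_times \<alpha> \<alpha>'))"

definition s_op :: "s_arrow \<Rightarrow> s_arrow" where
  "s_op s = (let (\<beta>, \<alpha>) = s_rep s in s_arr \<alpha> \<beta>)"


section \<open>Modules\<close>

definition linear_maps ::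
  "'k ring \<Rightarrow> ('k, 'm) module \<Rightarrow> ('k, 'n) module \<Rightarrow> ('m \<Rightarrow> 'n) set" where
  "linear_maps k M N = {f \<in> carrier M \<rightarrow>\<^sub>E carrier N.
     (\<forall>x \<in> carrier M. \<forall>y \<in> carrier M. f (x \<oplus>\<^bsub>M\<^esub> y) = f x \<oplus>\<^bsub>N\<^esub> f y) \<and>
     (\<forall>c \<in> carrier k. \<forall>x \<in> carrier M. f (c \<odot>\<^bsub>M\<^esub> x) = c \<odot>\<^bsub>N\<^esub> f x)}"

text \<open>The fields \<open>mult\<close> and \<open>one\<close> of the record type for modules have no meaning for a module.\<close>

definition free_module :: "'k ring \<Rightarrow> 'b set \<Rightarrow> ('k, 'b \<Rightarrow> 'k) module" where
  "free_module k B =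
     \<lparr> carrier = {\<phi>. (\<forall>b. \<phi> b \<in> carrier k) \<and> finite {b. \<phi> b \<noteq> \<zero>\<^bsub>k\<^esub>} \<and> {b. \<phi> b \<noteq> \<zero>\<^bsub>k\<^esub>} \<subseteq> B},
       mult = undefined,
       one = undefined,
       zero = (\<lambda>b. \<zero>\<^bsub>k\<^esub>),
       add = (\<lambda>\<phi> \<psi> b. \<phi> b \<oplus>\<^bsub>k\<^esub> \<psi> b),
       smult = (\<lambda>c \<phi> b. c \<otimes>\<^bsub>k\<^esub> \<phi> b) \<rparr>"

definition basis_vec :: "'k ring \<Rightarrow> 'b \<Rightarrow> 'b \<Rightarrow> 'k" where
  "basis_vec k b = (\<lambda>b'. if b' = b then \<one>\<^bsub>k\<^esub> else \<zero>\<^bsub>k\<^esub>)"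

definition submodule_span :: "'k ring \<Rightarrow> ('k, 'm) module \<Rightarrow> 'm set \<Rightarrow> 'm set" where
  "submodule_span k M S = \<Inter>{H. submodule H k M \<and> S \<subseteq> H}"

definition quotient_module :: "('k, 'm) module \<Rightarrow> 'm set \<Rightarrow> ('k, 'm set) module" where
  "quotient_module M H =
     \<lparr> carrier = a_rcosets\<^bsub>M\<^esub> H,
       mult = undefined,
       one = undefined,
       zero = H,
       add = set_add M,
       smult = (\<lambda>c A. \<Union>x \<in> A. H +>\<^bsub>M\<^esub> (c \<odot>\<^bsub>M\<^esub> x)) \<rparr>"

text \<open>
  The module with generators \<open>B\<close> and relators \<open>R\<close>, its generators, and the linear map to \<open>N\<close> taking
  the generator \<open>b\<close> to \<open>h b\<close> (meaningful only if \<open>h\<close> respects the relators).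
\<close>

definition presented :: "'k ring \<Rightarrow> 'b set \<Rightarrow> ('b \<Rightarrow> 'k) set \<Rightarrow> ('k, ('b \<Rightarrow> 'k) set) module" where
  "presented k B R =
     quotient_module (free_module k B) (submodule_span k (free_module k B) R)"

definition presented_gen :: "'k ring \<Rightarrow> 'b set \<Rightarrow> ('b \<Rightarrow> 'k) set \<Rightarrow> 'b \<Rightarrow> ('b \<Rightarrow> 'k) set" where
  "presented_gen k B R b =
     submodule_span k (free_module k B) R +>\<^bsub>free_module k B\<^esub> basis_vec k b"

definition presented_lift ::
  "'k ring \<Rightarrow> 'b set \<Rightarrow> ('b \<Rightarrow> 'k) set \<Rightarrow> ('k, 'n) module \<Rightarrow> ('b \<Rightarrow> 'n) \<Rightarrow> ('b \<Rightarrow> 'k) set \<Rightarrow> 'n" where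
  "presented_lift k B R N h =
     (\<lambda>A \<in> carrier (presented k B R).
        let \<phi> = (SOME \<phi>. \<phi> \<in> A) in (\<Oplus>\<^bsub>N\<^esub> b \<in> {b. \<phi> b \<noteq> \<zero>\<^bsub>k\<^esub>}. \<phi> b \<odot>\<^bsub>N\<^esub> h b))"


subsection \<open>Tensor products over \<open>k\<close>\<close>

type_synonym ('k, 'm, 'n) tensor = "('m \<times> 'n \<Rightarrow> 'k) set"

definition tensor_rels ::
  "'k ring \<Rightarrow> ('k, 'm) module \<Rightarrow> ('k, 'n) module \<Rightarrow> ('m \<times> 'n \<Rightarrow> 'k) set" where
  "tensor_rels k M N =
     (let F = free_module k (carrier M \<times> carrier N); \<delta> = basis_vec k in
      {\<delta> (u \<oplus>\<^bsub>M\<^esub> u', v) \<ominus>\<^bsub>F\<^esub> (\<delta> (u, v) \<oplus>\<^bsub>F\<^esub> \<delta> (u', v)) | u u' v.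
         u \<in> carrier M \<and> u' \<in> carrier M \<and> v \<in> carrier N} \<union>
      {\<delta> (u, v \<oplus>\<^bsub>N\<^esub> v') \<ominus>\<^bsub>F\<^esub> (\<delta> (u, v) \<oplus>\<^bsub>F\<^esub> \<delta> (u, v')) | u v v'.
         u \<in> carrier M \<and> v \<in> carrier N \<and> v' \<in> carrier N} \<union>
      {\<delta> (c \<odot>\<^bsub>M\<^esub> u, v) \<ominus>\<^bsub>F\<^esub> (c \<odot>\<^bsub>F\<^esub> \<delta> (u, v)) | c u v.
         c \<in> carrier k \<and> u \<in> carrier M \<and> v \<in> carrier N} \<union>
      {\<delta> (u, c \<odot>\<^bsub>N\<^esub> v) \<ominus>\<^bsub>F\<^esub> (c \<odot>\<^bsub>F\<^esub> \<delta> (u, v)) | c u v.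
         c \<in> carrier k \<and> u \<in> carrier M \<and> v \<in> carrier N})"

definition tensor_module ::
  "'k ring \<Rightarrow> ('k, 'm) module \<Rightarrow> ('k, 'n) module \<Rightarrow> ('k, ('k, 'm, 'n) tensor) module" where
  "tensor_module k M N = presented k (carrier M \<times> carrier N) (tensor_rels k M N)"

definition pure_tensor ::
  "'k ring \<Rightarrow> ('k, 'm) module \<Rightarrow> ('k, 'n) module \<Rightarrow> 'm \<Rightarrow> 'n \<Rightarrow> ('k, 'm, 'n) tensor" where
  "pure_tensor k M N u v = presented_gen k (carrier M \<times> carrier N) (tensor_rels k M N) (u, v)"

definition tensor_lift ::
  "'k ring \<Rightarrow> ('k, 'm) module \<Rightarrow> ('k, 'n) module \<Rightarrow> ('k, 'q) module \<Rightarrow>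
     ('m \<Rightarrow> 'n \<Rightarrow> 'q) \<Rightarrow> ('k, 'm, 'n) tensor \<Rightarrow> 'q" where
  "tensor_lift k M N Q h =
     presented_lift k (carrier M \<times> carrier N) (tensor_rels k M N) Q (\<lambda>(u, v). h u v)"

definition tensor_map ::
  "'k ring \<Rightarrow> ('k, 'm) module \<Rightarrow> ('k, 'n) module \<Rightarrow> ('k, 'm2) module \<Rightarrow> ('k, 'n2) module \<Rightarrow>
     ('m \<Rightarrow> 'm2) \<Rightarrow> ('n \<Rightarrow> 'n2) \<Rightarrow> ('k, 'm, 'n) tensor \<Rightarrow> ('k, 'm2, 'n2) tensor" where
  "tensor_map k M N M' N' f g =
     tensor_lift k M N (tensor_module k M' N') (\<lambda>u v. pure_tensor k M' N' (f u) (g v))"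


subsection \<open>Coends in \<open>k\<close>-modules\<close>

text \<open>
  A functor \<open>T : \<C>\<^sup>o\<^sup>p \<times> \<C> \<rightarrow> kMod\<close>: \<open>bi_ob T A B = T(A, B)\<close>, \<open>bi_left T f B = T(f, B)\<close> and
  \<open>bi_right T A f = T(A, f)\<close>.
\<close>

record ('o, 'a, 'k, 't) bifctr =
  bi_ob :: "'o \<Rightarrow> 'o \<Rightarrow> ('k, 't) module"
  bi_left :: "'a \<Rightarrow> 'o \<Rightarrow> 't \<Rightarrow> 't"
  bi_right :: "'o \<Rightarrow> 'a \<Rightarrow> 't \<Rightarrow> 't"

type_synonym ('o, 'k, 't) coend_elt = "('o \<times> 't \<Rightarrow> 'k) set"

definition coend_gens ::
  "('o, 'a) cat \<Rightarrow> ('o, 'a, 'k, 't) bifctr \<Rightarrow> ('o \<times> 't) set" where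
  "coend_gens C T = (SIGMA A : ob C. carrier (bi_ob T A A))"

text \<open>
  The first two families of relators turn the free module on the generators into the direct sum of
  the modules \<open>T(A, A)\<close>; the third one coequalizes the two maps from \<open>T(B, A)\<close> to it for each
  \<open>f : A \<rightarrow> B\<close>.
\<close>

definition coend_rels ::
  "'k ring \<Rightarrow> ('o, 'a) cat \<Rightarrow> ('o, 'a, 'k, 't) bifctr \<Rightarrow> ('o \<times> 't \<Rightarrow> 'k) set" where
  "coend_rels k C T =
     (let F = free_module k (coend_gens C T); \<delta> = basis_vec k in
      {\<delta> (A, t \<oplus>\<^bsub>bi_ob T A A\<^esub> t') \<ominus>\<^bsub>F\<^esub> (\<delta> (A, t) \<oplus>\<^bsub>F\<^esub> \<delta> (A, t')) | A t t'.
         A \<in> ob C \<and> t \<in> carrier (bi_ob T A A) \<and> t' \<in> carrier (bi_ob T A A)} \<union>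
      {\<delta> (A, c \<odot>\<^bsub>bi_ob T A A\<^esub> t) \<ominus>\<^bsub>F\<^esub> (c \<odot>\<^bsub>F\<^esub> \<delta> (A, t)) | A c t.
         A \<in> ob C \<and> c \<in> carrier k \<and> t \<in> carrier (bi_ob T A A)} \<union>
      {\<delta> (src C f, bi_left T f (src C f) t) \<ominus>\<^bsub>F\<^esub> \<delta> (tgt C f, bi_right T (tgt C f) f t) | f t.
         f \<in> ar C \<and> t \<in> carrier (bi_ob T (tgt C f) (src C f))})"

definition coend ::
  "'k ring \<Rightarrow> ('o, 'a) cat \<Rightarrow> ('o, 'a, 'k, 't) bifctr \<Rightarrow> ('k, ('o, 'k, 't) coend_elt) module" where
  "coend k C T = presented k (coend_gens C T) (coend_rels k C T)"

definition coend_in ::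
  "'k ring \<Rightarrow> ('o, 'a) cat \<Rightarrow> ('o, 'a, 'k, 't) bifctr \<Rightarrow> 'o \<Rightarrow> 't \<Rightarrow> ('o, 'k, 't) coend_elt" where
  "coend_in k C T A t = presented_gen k (coend_gens C T) (coend_rels k C T) (A, t)"

definition coend_lift ::
  "'k ring \<Rightarrow> ('o, 'a) cat \<Rightarrow> ('o, 'a, 'k, 't) bifctr \<Rightarrow> ('k, 'q) module \<Rightarrow>
     ('o \<Rightarrow> 't \<Rightarrow> 'q) \<Rightarrow> ('o, 'k, 't) coend_elt \<Rightarrow> 'q" where
  "coend_lift k C T Q h =
     presented_lift k (coend_gens C T) (coend_rels k C T) Q (\<lambda>(A, t). h A t)"


subsection \<open>Grothendieck groups with coefficients in \<open>k\<close>\<close>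

text \<open>
  \<open>k \<otimes>\<^sub>\<int> K\<^sub>0\<close> of the monoid of isomorphism classes of a category with finite coproducts: the free
  \<open>k\<close>-module on the isomorphism classes modulo \<open>[A \<amalg> B] - ([A] + [B])\<close>. The relation
  \<open>[0] = 0\<close> follows from \<open>[0 \<amalg> 0] = [0]\<close>.
\<close>

type_synonym ('o, 'k) k0_elt = "('o set \<Rightarrow> 'k) set"

definition k0_gens :: "('o, 'a) cat \<Rightarrow> 'o set set" where
  "k0_gens C = iso_class C ` ob C"

definition k0_rels :: "'k ring \<Rightarrow> ('o, 'a) cat \<Rightarrow> ('o set \<Rightarrow> 'k) set" where
  "k0_rels k C =
     (let F = free_module k (k0_gens C); \<delta> = (\<lambda>A. basis_vec k (iso_class C A)) in
      {\<delta> S \<ominus>\<^bsub>F\<^esub> (\<delta> A \<oplus>\<^bsub>F\<^esub> \<delta> B) | A B S. \<exists>i j. is_coproduct C A B S i j})"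

definition k0_module :: "'k ring \<Rightarrow> ('o, 'a) cat \<Rightarrow> ('k, ('o, 'k) k0_elt) module" where
  "k0_module k C = presented k (k0_gens C) (k0_rels k C)"

definition k0_class :: "'k ring \<Rightarrow> ('o, 'a) cat \<Rightarrow> 'o \<Rightarrow> ('o, 'k) k0_elt" where
  "k0_class k C A = presented_gen k (k0_gens C) (k0_rels k C) (iso_class C A)"

definition k0_lift ::
  "'k ring \<Rightarrow> ('o, 'a) cat \<Rightarrow> ('k, 'n) module \<Rightarrow> ('o \<Rightarrow> 'n) \<Rightarrow> ('o, 'k) k0_elt \<Rightarrow> 'n" where
  "k0_lift k C N h = presented_lift k (k0_gens C) (k0_rels k C) N (\<lambda>c. h (SOME A. A \<in> c))"


section \<open>Mackey functors\<close>

text \<open>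
  A functor from the category of spans to \<open>k\<close>-modules. The type \<open>'m\<close> of the elements of the modules
  plays the role of the universe in which the modules live. Natural transformations may go between
  functors with different universes, since tensor products and Burnside functors come with their own
  type of elements.
\<close>

record ('k, 'm) kfctr =
  fob :: "zero_cell \<Rightarrow> ('k, 'm) module"
  far :: "s_arrow \<Rightarrow> 'm \<Rightarrow> 'm"

definition is_kfunctor :: "'k ring \<Rightarrow> ('k, 'm) kfctr \<Rightarrow> bool" where
  "is_kfunctor k M \<longleftrightarrow>
     (\<forall>X \<in> ob SpC. module k (fob M X)) \<and>
     (\<forall>s \<in> ar SpC. far M s \<in> linear_maps k (fob M (sdom s)) (fob M (scod s))) \<and>
     (\<forall>X \<in> ob SpC. far M (idn SpC X) = (\<lambda>x \<in> carrier (fob M X). x)) \<and>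
     (\<forall>s \<in> ar SpC. \<forall>t \<in> ar SpC. scod s = sdom t \<longrightarrow>
        far M (t \<cdot>\<^bsub>SpC\<^esub> s) = compose (carrier (fob M (sdom s))) (far M t) (far M s))"

definition preserves_finite_products :: "('k, 'm) kfctr \<Rightarrow> bool" where
  "preserves_finite_products M \<longleftrightarrow>
     (\<forall>T. is_terminal SpC T \<longrightarrow> carrier (fob M T) = {\<zero>\<^bsub>fob M T\<^esub>}) \<and>
     (\<forall>A B P p q. is_product SpC A B P p q \<longrightarrow>
        bij_betw (\<lambda>z. (far M p z, far M q z))
          (carrier (fob M P)) (carrier (fob M A) \<times> carrier (fob M B)))"

definition is_mackey :: "'k ring \<Rightarrow> ('k, 'm) kfctr \<Rightarrow> bool" where
  "is_mackey k M \<longleftrightarrow> is_kfunctor k M \<and> preserves_finite_products M"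

definition is_deflative :: "('k, 'm) kfctr \<Rightarrow> bool" where
  "is_deflative M \<longleftrightarrow>
     (\<forall>W X a. is_zero_cell W \<longrightarrow> is_zero_cell X \<longrightarrow> is_one_cell W X a \<longrightarrow> stab_surjective W X a \<longrightarrow>
        far M (s_arr (c_arr W X a) (c_arr W X a)) = (\<lambda>x \<in> carrier (fob M X). x))"

definition nat_trans ::
  "'k ring \<Rightarrow> ('k, 'm) kfctr \<Rightarrow> ('k, 'n) kfctr \<Rightarrow> (zero_cell \<Rightarrow> 'm \<Rightarrow> 'n) set" where
  "nat_trans k M N = {\<eta> \<in> (\<Pi>\<^sub>E X \<in> ob SpC. linear_maps k (fob M X) (fob N X)).
     \<forall>s \<in> ar SpC. \<forall>x \<in> carrier (fob M (sdom s)).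
       \<eta> (scod s) (far M s x) = far N s (\<eta> (sdom s) x)}"

definition nt_id :: "('k, 'm) kfctr \<Rightarrow> zero_cell \<Rightarrow> 'm \<Rightarrow> 'm" where
  "nt_id M = (\<lambda>X \<in> ob SpC. \<lambda>x \<in> carrier (fob M X). x)"

text \<open>\<open>nt_comp M \<theta> \<eta>\<close> is \<open>\<theta> \<circ> \<eta>\<close>, where \<open>M\<close> is the source of \<open>\<eta>\<close>.\<close>

definition nt_comp ::
  "('k, 'm) kfctr \<Rightarrow> (zero_cell \<Rightarrow> 'n \<Rightarrow> 'p) \<Rightarrow> (zero_cell \<Rightarrow> 'm \<Rightarrow> 'n) \<Rightarrow> zero_cell \<Rightarrow> 'm \<Rightarrow> 'p" where
  "nt_comp M \<theta> \<eta> = (\<lambda>X \<in> ob SpC. compose (carrier (fob M X)) (\<theta> X) (\<eta> X))"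

type_synonym ('k, 'm) mackey_arrow =
  "('k, 'm) kfctr \<times> ('k, 'm) kfctr \<times> (zero_cell \<Rightarrow> 'm \<Rightarrow> 'm)"

definition mackey_cat :: "'k ring \<Rightarrow> (('k, 'm) kfctr, ('k, 'm) mackey_arrow) cat" where
  "mackey_cat k =
     \<lparr> ob = {M. is_mackey k M},
       ar = {(M, N, \<eta>). is_mackey k M \<and> is_mackey k N \<and> \<eta> \<in> nat_trans k M N},
       src = (\<lambda>(M, N, \<eta>). M),
       tgt = (\<lambda>(M, N, \<eta>). N),
       idn = (\<lambda>M. (M, M, nt_id M)),
       cmp = (\<lambda>(M', N', \<theta>) (M, N, \<eta>). (M, N', nt_comp M \<theta> \<eta>)) \<rparr>"

definition deflative_mackey_cat :: "'k ring \<Rightarrow> (('k, 'm) kfctr, ('k, 'm) mackey_arrow) cat" where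
  "deflative_mackey_cat k = full_subcategory (mackey_cat k) is_deflative"


subsection \<open>The tensor product\<close>

type_synonym ('k, 'm, 'n) mtensor = "(zero_cell, 'k, ('k, 'm, 'n) tensor) coend_elt"

text \<open>
  The functor \<open>(Y', Y) \<mapsto> M(Y' \<times> X) \<otimes>\<^sub>k N(Y)\<close>, contravariant in \<open>Y'\<close> by reversal of spans.
\<close>

definition day_bifctr ::
  "'k ring \<Rightarrow> ('k, 'm) kfctr \<Rightarrow> ('k, 'n) kfctr \<Rightarrow> zero_cell \<Rightarrow>
     (zero_cell, s_arrow, 'k, ('k, 'm, 'n) tensor) bifctr" where
  "day_bifctr k M N X =
     \<lparr> bi_ob = (\<lambda>Y' Y. tensor_module k (fob M (prod_cell Y' X)) (fob N Y)),
       bi_left = (\<lambda>f Y. tensor_map k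
          (fob M (prod_cell (scod f) X)) (fob N Y) (fob M (prod_cell (sdom f) X)) (fob N Y)
          (far M (s_times (s_op f) (idn SpC X))) (\<lambda>v. v)),
       bi_right = (\<lambda>Y' f. tensor_map k
          (fob M (prod_cell Y' X)) (fob N (sdom f)) (fob M (prod_cell Y' X)) (fob N (scod f))
          (\<lambda>u. u) (far N f)) \<rparr>"

definition mtensor_ob ::
  "'k ring \<Rightarrow> ('k, 'm) kfctr \<Rightarrow> ('k, 'n) kfctr \<Rightarrow> zero_cell \<Rightarrow> ('k, ('k, 'm, 'n) mtensor) module" where
  "mtensor_ob k M N X = coend k SpC (day_bifctr k M N X)"

text \<open>The class in \<open>(M \<otimes> N)(X)\<close> of \<open>t \<in> M(Y \<times> X) \<otimes>\<^sub>k N(Y)\<close>.\<close>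

definition mtensor_in ::
  "'k ring \<Rightarrow> ('k, 'm) kfctr \<Rightarrow> ('k, 'n) kfctr \<Rightarrow> zero_cell \<Rightarrow> zero_cell \<Rightarrow>
     ('k, 'm, 'n) tensor \<Rightarrow> ('k, 'm, 'n) mtensor" where
  "mtensor_in k M N X = coend_in k SpC (day_bifctr k M N X)"

definition mtensor_lift ::
  "'k ring \<Rightarrow> ('k, 'm) kfctr \<Rightarrow> ('k, 'n) kfctr \<Rightarrow> zero_cell \<Rightarrow> ('k, 'q) module \<Rightarrow>
     (zero_cell \<Rightarrow> ('k, 'm, 'n) tensor \<Rightarrow> 'q) \<Rightarrow> ('k, 'm, 'n) mtensor \<Rightarrow> 'q" where
  "mtensor_lift k M N X = coend_lift k SpC (day_bifctr k M N X)"

definition mtensor ::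
  "'k ring \<Rightarrow> ('k, 'm) kfctr \<Rightarrow> ('k, 'n) kfctr \<Rightarrow> ('k, ('k, 'm, 'n) mtensor) kfctr" where
  "mtensor k M N =
     \<lparr> fob = mtensor_ob k M N,
       far = (\<lambda>s. mtensor_lift k M N (sdom s) (mtensor_ob k M N (scod s))
          (\<lambda>Y t. mtensor_in k M N (scod s) Y
             (tensor_map k
                (fob M (prod_cell Y (sdom s))) (fob N Y) (fob M (prod_cell Y (scod s))) (fob N Y)
                (far M (s_times (idn SpC Y) s)) (\<lambda>v. v) t))) \<rparr>"

text \<open>\<open>mtensor_map k M N M' N' \<eta> \<theta> : M \<otimes> N \<rightarrow> M' \<otimes> N'\<close> is \<open>\<eta> \<otimes> \<theta>\<close>.\<close>

definition mtensor_map ::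
  "'k ring \<Rightarrow> ('k, 'm) kfctr \<Rightarrow> ('k, 'n) kfctr \<Rightarrow> ('k, 'm2) kfctr \<Rightarrow> ('k, 'n2) kfctr \<Rightarrow>
     (zero_cell \<Rightarrow> 'm \<Rightarrow> 'm2) \<Rightarrow> (zero_cell \<Rightarrow> 'n \<Rightarrow> 'n2) \<Rightarrow>
     zero_cell \<Rightarrow> ('k, 'm, 'n) mtensor \<Rightarrow> ('k, 'm2, 'n2) mtensor" where
  "mtensor_map k M N M' N' \<eta> \<theta> =
     (\<lambda>X \<in> ob SpC. mtensor_lift k M N X (mtensor_ob k M' N' X)
        (\<lambda>Y t. mtensor_in k M' N' X Y
           (tensor_map k
              (fob M (prod_cell Y X)) (fob N Y) (fob M' (prod_cell Y X)) (fob N' Y)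
              (\<eta> (prod_cell Y X)) (\<theta> Y) t)))"

text \<open>
  The associativity constraint \<open>(L \<otimes> M) \<otimes> N \<rightarrow> L \<otimes> (M \<otimes> N)\<close>. It takes the class of
  \<open>[a \<otimes> b] \<otimes> c\<close>, with \<open>a \<in> L(Z \<times> (Y \<times> X))\<close>, \<open>b \<in> M(Z)\<close>, \<open>c \<in> N(Y)\<close>, to the class of
  \<open>a' \<otimes> [b' \<otimes> c]\<close> in the summand indexed by \<open>Z \<times> Y\<close>. Here \<open>a' \<in> L((Z \<times> Y) \<times> X)\<close> is the
  re-bracketed \<open>a\<close>, and \<open>b' \<in> M(Y \<times> (Z \<times> Y))\<close> is the image of \<open>b\<close> under the span
  \<open>Y \<times> (Z \<times> Y) \<leftarrow> Z \<times> Y \<rightarrow> Z\<close> with legs \<open>(z, y) \<mapsto> (y, (z, y))\<close> and the projection, so that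
  \<open>[b' \<otimes> c] \<in> (M \<otimes> N)(Z \<times> Y)\<close> is the external product of \<open>b\<close> and \<open>c\<close>.
\<close>

definition s_rebracket :: "zero_cell \<Rightarrow> zero_cell \<Rightarrow> zero_cell \<Rightarrow> s_arrow" where
  "s_rebracket Z Y X =
     (let P = prod_cell Z (prod_cell Y X); pr = c_snd Z (prod_cell Y X) in
      s_arr (c_pair (c_pair (c_fst Z (prod_cell Y X)) (c_fst Y X \<cdot>\<^bsub>CC\<^esub> pr)) (c_snd Y X \<cdot>\<^bsub>CC\<^esub> pr))
            (idn CC P))"

definition s_insert :: "zero_cell \<Rightarrow> zero_cell \<Rightarrow> s_arrow" where
  "s_insert Z Y = s_arr (c_pair (c_snd Z Y) (idn CC (prod_cell Z Y))) (c_fst Z Y)"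

definition mtensor_assoc ::
  "'k ring \<Rightarrow> ('k, 'l) kfctr \<Rightarrow> ('k, 'm) kfctr \<Rightarrow> ('k, 'n) kfctr \<Rightarrow> zero_cell \<Rightarrow>
     ('k, ('k, 'l, 'm) mtensor, 'n) mtensor \<Rightarrow> ('k, 'l, ('k, 'm, 'n) mtensor) mtensor" where
  "mtensor_assoc k L M N =
     (\<lambda>X \<in> ob SpC.
        let Q = mtensor_ob k L (mtensor k M N) X in
        mtensor_lift k (mtensor k L M) N X Q
          (\<lambda>Y. tensor_lift k (mtensor_ob k L M (prod_cell Y X)) (fob N Y) Q
            (\<lambda>w c. mtensor_lift k L M (prod_cell Y X) Q
              (\<lambda>Z. tensor_lift k (fob L (prod_cell Z (prod_cell Y X))) (fob M Z) Q
                (\<lambda>a b. mtensor_in k L (mtensor k M N) X (prod_cell Z Y)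
                   (pure_tensor k
                      (fob L (prod_cell (prod_cell Z Y) X)) (mtensor_ob k M N (prod_cell Z Y))
                      (far L (s_rebracket Z Y X) a)
                      (mtensor_in k M N (prod_cell Z Y) Y
                         (pure_tensor k (fob M (prod_cell Y (prod_cell Z Y))) (fob N Y)
                            (far M (s_insert Z Y) b) c))))) w)))"


section \<open>Burnside functors\<close>

text \<open>
  The functor on spans determined by a covariant part \<open>lo\<close> and a contravariant part \<open>up\<close>, via
  \<open>[\<beta>, W, \<alpha>] \<mapsto> lo(\<beta>) \<circ> up(\<alpha>)\<close>.
\<close>

definition kfctr_of ::
  "(zero_cell \<Rightarrow> ('k, 'm) module) \<Rightarrow> (c_arrow \<Rightarrow> 'm \<Rightarrow> 'm) \<Rightarrow> (c_arrow \<Rightarrow> 'm \<Rightarrow> 'm) \<Rightarrow> ('k, 'm) kfctr" where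
  "kfctr_of D lo up =
     \<lparr> fob = D,
       far = (\<lambda>s. let (\<beta>, \<alpha>) = s_rep s in compose (carrier (D (sdom s))) (lo \<beta>) (up \<alpha>)) \<rparr>"

subsection \<open>The big Burnside functor, the unit of the tensor product\<close>

type_synonym 'k big_elt = "(c_arrow, 'k) k0_elt"

definition Omega_big_ob :: "'k ring \<Rightarrow> zero_cell \<Rightarrow> ('k, 'k big_elt) module" where
  "Omega_big_ob k X = k0_module k (slice CC X)"

definition Omega_big_lower :: "'k ring \<Rightarrow> c_arrow \<Rightarrow> 'k big_elt \<Rightarrow> 'k big_elt" where
  "Omega_big_lower k f = k0_lift k (slice CC (cdom f)) (Omega_big_ob k (ccod f))
     (\<lambda>a. k0_class k (slice CC (ccod f)) (f \<cdot>\<^bsub>CC\<^esub> a))"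

definition Omega_big_upper :: "'k ring \<Rightarrow> c_arrow \<Rightarrow> 'k big_elt \<Rightarrow> 'k big_elt" where
  "Omega_big_upper k f = k0_lift k (slice CC (ccod f)) (Omega_big_ob k (cdom f))
     (\<lambda>a. k0_class k (slice CC (cdom f)) (c_wpb_fst f a))"

definition Omega_big :: "'k ring \<Rightarrow> ('k, 'k big_elt) kfctr" where
  "Omega_big k = kfctr_of (Omega_big_ob k) (Omega_big_lower k) (Omega_big_upper k)"

text \<open>
  The unit constraint \<open>\<ell>\<^sub>M : \<Omega>\<^sub>b\<^sub>i\<^sub>g \<otimes> M \<rightarrow> M\<close>: for \<open>a : A \<rightarrow> Y \<times> X\<close> with components \<open>a\<^sub>1\<close> and \<open>a\<^sub>2\<close>, and
  for \<open>v \<in> M(Y)\<close>, the class of \<open>[a] \<otimes> v\<close> goes to \<open>M([X \<leftarrow>a\<^sub>2- A -a\<^sub>1\<rightarrow> Y])(v)\<close>.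
\<close>

definition ell :: "'k ring \<Rightarrow> ('k, 'm) kfctr \<Rightarrow> zero_cell \<Rightarrow> ('k, 'k big_elt, 'm) mtensor \<Rightarrow> 'm" where
  "ell k M =
     (\<lambda>X \<in> ob SpC. mtensor_lift k (Omega_big k) M X (fob M X)
        (\<lambda>Y. tensor_lift k (Omega_big_ob k (prod_cell Y X)) (fob M Y) (fob M X)
          (\<lambda>w v. k0_lift k (slice CC (prod_cell Y X)) (fob M X)
             (\<lambda>a. far M (s_arr (c_snd Y X \<cdot>\<^bsub>CC\<^esub> a) (c_fst Y X \<cdot>\<^bsub>CC\<^esub> a)) v) w)))"

subsection \<open>The Burnside functor of finite \<open>G\<close>-sets\<close>

text \<open>The category of finite \<open>G\<close>-sets, the \<open>G\<close>-set \<open>A\<close> being represented by the 0-cell \<open>A/G\<close>.\<close>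

type_synonym gset_arrow = "zero_cell \<times> zero_cell \<times> (pt \<Rightarrow> pt)"

definition gset_cat :: "pt monoid \<Rightarrow> (zero_cell, gset_arrow) cat" where
  "gset_cat G =
     \<lparr> ob = {P. is_zero_cell P \<and> Grp P = G},
       ar = {(P, Q, f). is_zero_cell P \<and> Grp P = G \<and> is_zero_cell Q \<and> Grp Q = G \<and>
               f \<in> Pts P \<rightarrow>\<^sub>E Pts Q \<and>
               (\<forall>g \<in> carrier G. \<forall>x \<in> Pts P. f (Act P g x) = Act Q g (f x))},
       src = (\<lambda>(P, Q, f). P),
       tgt = (\<lambda>(P, Q, f). Q),
       idn = (\<lambda>P. (P, P, \<lambda>x \<in> Pts P. x)),
       cmp = (\<lambda>(P', Q', f') (P, Q, f). (P, Q', compose (Pts P) f' f)) \<rparr>"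

abbreviation gsets_over :: "zero_cell \<Rightarrow> (gset_arrow, gset_arrow \<times> gset_arrow \<times> gset_arrow) cat" where
  "gsets_over X \<equiv> slice (gset_cat (Grp X)) X"

type_synonym 'k burn_elt = "(gset_arrow, 'k) k0_elt"

definition Omega_ob :: "'k ring \<Rightarrow> zero_cell \<Rightarrow> ('k, 'k burn_elt) module" where
  "Omega_ob k X = k0_module k (gsets_over X)"

text \<open>
  The stabilizer image \<open>SIm(a) = (H \<times> X)/\<sim>\<close> of \<open>a : X/G \<rightarrow> Y/H\<close>. The class of \<open>(\<eta>, x)\<close> is
  represented by the point \<open>Cls\<close> of the finite set of all pairs equivalent to \<open>(\<eta>, x)\<close>.
\<close>

definition sim_class :: "zero_cell \<Rightarrow> zero_cell \<Rightarrow> one_cell \<Rightarrow> pt \<Rightarrow> pt \<Rightarrow> pt" where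
  "sim_class P Q a \<eta> x =
     Cls (Abs_fset {PPair \<eta>' x' | \<eta>' x'. \<eta>' \<in> carrier (Grp Q) \<and> x' \<in> Pts P \<and>
       (\<exists>g \<in> carrier (Grp P). x' = Act P g x \<and> \<eta> = \<eta>' \<otimes>\<^bsub>Grp Q\<^esub> Tw a x g)})"

definition SIm :: "zero_cell \<Rightarrow> zero_cell \<Rightarrow> one_cell \<Rightarrow> zero_cell" where
  "SIm P Q a =
     (let S = {sim_class P Q a \<eta> x | \<eta> x. \<eta> \<in> carrier (Grp Q) \<and> x \<in> Pts P} in
      \<lparr> Grp = Grp Q,
        Pts = S,
        Act = (\<lambda>h. \<lambda>z \<in> S. Cls ((\<lambda>p. PPair (h \<otimes>\<^bsub>Grp Q\<^esub> pfst p) (psnd p)) |`| elems z)) \<rparr>)"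

definition SIm_map :: "zero_cell \<Rightarrow> zero_cell \<Rightarrow> one_cell \<Rightarrow> pt \<Rightarrow> pt" where
  "SIm_map P Q a =
     (\<lambda>z \<in> Pts (SIm P Q a). let p = (SOME p. p |\<in>| elems z) in Act Q (pfst p) (Fn a (psnd p)))"

definition Omega_p :: "'k ring \<Rightarrow> zero_cell \<Rightarrow> 'k big_elt \<Rightarrow> 'k burn_elt" where
  "Omega_p k = (\<lambda>X \<in> ob SpC. k0_lift k (slice CC X) (Omega_ob k X)
     (\<lambda>f. k0_class k (gsets_over X)
        (SIm (cdom f) X (c_rep f), X, SIm_map (cdom f) X (c_rep f))))"

definition Omega_i :: "'k ring \<Rightarrow> zero_cell \<Rightarrow> 'k burn_elt \<Rightarrow> 'k big_elt" where
  "Omega_i k = (\<lambda>X \<in> ob SpC. k0_lift k (gsets_over X) (Omega_big_ob k X)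
     (\<lambda>(A, X', p). k0_class k (slice CC X) (c_arr A X \<lparr> Fn = p, Tw = (\<lambda>x g. g) \<rparr>)))"

definition Omega_lower :: "'k ring \<Rightarrow> c_arrow \<Rightarrow> 'k burn_elt \<Rightarrow> 'k burn_elt" where
  "Omega_lower k f = (\<lambda>w \<in> carrier (Omega_ob k (cdom f)).
     Omega_p k (ccod f) (Omega_big_lower k f (Omega_i k (cdom f) w)))"

definition Omega_upper :: "'k ring \<Rightarrow> c_arrow \<Rightarrow> 'k burn_elt \<Rightarrow> 'k burn_elt" where
  "Omega_upper k f = (\<lambda>w \<in> carrier (Omega_ob k (ccod f)).
     Omega_p k (cdom f) (Omega_big_upper k f (Omega_i k (ccod f) w)))"

definition Omega :: "'k ring \<Rightarrow> ('k, 'k burn_elt) kfctr" where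
  "Omega k = kfctr_of (Omega_ob k) (Omega_lower k) (Omega_upper k)"

text \<open>The multiplication \<open>\<ell>' : \<Omega> \<otimes> \<Omega> \<rightarrow> \<Omega>\<close>, characterized by \<open>\<ell>' \<circ> (p \<otimes> \<Omega>) = \<ell>\<close>.\<close>

definition Omega_mult ::
  "'k ring \<Rightarrow> zero_cell \<Rightarrow> ('k, 'k burn_elt, 'k burn_elt) mtensor \<Rightarrow> 'k burn_elt" where
  "Omega_mult k =
     (THE \<mu>. \<mu> \<in> nat_trans k (mtensor k (Omega k) (Omega k)) (Omega k) \<and>
        nt_comp (mtensor k (Omega_big k) (Omega k)) \<mu>
          (mtensor_map k (Omega_big k) (Omega k) (Omega k) (Omega k) (Omega_p k) (nt_id (Omega k)))
        = ell k (Omega k))"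


section \<open>Modules over a Green functor\<close>

text \<open>The data of a Green functor: the underlying functor, the multiplication and the unit.\<close>

record ('k, 'l) green =
  gr_fctr :: "('k, 'l) kfctr"
  gr_mult :: "zero_cell \<Rightarrow> ('k, 'l, 'l) mtensor \<Rightarrow> 'l"
  gr_unit :: "zero_cell \<Rightarrow> 'k big_elt \<Rightarrow> 'l"

type_synonym ('k, 'l, 'm) green_module =
  "('k, 'm) kfctr \<times> (zero_cell \<Rightarrow> ('k, 'l, 'm) mtensor \<Rightarrow> 'm)"

definition is_green_module :: "'k ring \<Rightarrow> ('k, 'l) green \<Rightarrow> ('k, 'l, 'm) green_module \<Rightarrow> bool" where
  "is_green_module k R = (\<lambda>(M, ac).
     let \<Gamma> = gr_fctr R; \<Gamma>\<Gamma> = mtensor k \<Gamma> \<Gamma>; \<Gamma>M = mtensor k \<Gamma> M; \<Gamma>\<Gamma>_M = mtensor k \<Gamma>\<Gamma> M in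
     is_mackey k M \<and>
     ac \<in> nat_trans k \<Gamma>M M \<and>
     nt_comp \<Gamma>\<Gamma>_M ac (mtensor_map k \<Gamma>\<Gamma> M \<Gamma> M (gr_mult R) (nt_id M)) =
     nt_comp \<Gamma>\<Gamma>_M ac (nt_comp \<Gamma>\<Gamma>_M (mtensor_map k \<Gamma> \<Gamma>M \<Gamma> M (nt_id \<Gamma>) ac) (mtensor_assoc k \<Gamma> \<Gamma> M)) \<and>
     nt_comp (mtensor k (Omega_big k) M) ac
       (mtensor_map k (Omega_big k) M \<Gamma> M (gr_unit R) (nt_id M)) = ell k M)"

definition green_module_maps ::
  "'k ring \<Rightarrow> ('k, 'l) green \<Rightarrow> ('k, 'l, 'm) green_module \<Rightarrow> ('k, 'l, 'm) green_module \<Rightarrow>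
     (zero_cell \<Rightarrow> 'm \<Rightarrow> 'm) set" where
  "green_module_maps k R = (\<lambda>(M, ac) (N, ac').
     let \<Gamma> = gr_fctr R; \<Gamma>M = mtensor k \<Gamma> M in
     {\<eta> \<in> nat_trans k M N.
        nt_comp \<Gamma>M \<eta> ac = nt_comp \<Gamma>M ac' (mtensor_map k \<Gamma> M \<Gamma> N (nt_id \<Gamma>) \<eta>)})"

type_synonym ('k, 'l, 'm) green_module_arrow =
  "('k, 'l, 'm) green_module \<times> ('k, 'l, 'm) green_module \<times> (zero_cell \<Rightarrow> 'm \<Rightarrow> 'm)"

definition green_module_cat ::
  "'k ring \<Rightarrow> ('k, 'l) green \<Rightarrow> (('k, 'l, 'm) green_module, ('k, 'l, 'm) green_module_arrow) cat" where
  "green_module_cat k R =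
     \<lparr> ob = {m. is_green_module k R m},
       ar = {(m, n, \<eta>). is_green_module k R m \<and> is_green_module k R n \<and> \<eta> \<in> green_module_maps k R m n},
       src = (\<lambda>(m, n, \<eta>). m),
       tgt = (\<lambda>(m, n, \<eta>). n),
       idn = (\<lambda>m. (m, m, nt_id (fst m))),
       cmp = (\<lambda>(m', n', \<theta>) (m, n, \<eta>). (m, n', nt_comp (fst m) \<theta> \<eta>)) \<rparr>"

definition Omega_green :: "'k ring \<Rightarrow> ('k, 'k burn_elt) green" where
  "Omega_green k =
     \<lparr> gr_fctr = Omega k, gr_mult = Omega_mult k, gr_unit = Omega_p k \<rparr>"

end

theory Submission
  imports Defs
begin

text \<open>
  Since \<open>p : \<Omega>\<^sub>b\<^sub>i\<^sub>g \<rightarrow> \<Omega>\<close> is an epimorphism and stays one after tensoring with \<open>M\<close>, the unit law determines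
  the action of \<open>\<Omega>\<close> on a module \<open>M\<close> completely: for \<open>a : A \<rightarrow> Y \<times> X\<close> and \<open>v \<in> M(Y)\<close> the class of \<open>p[a] \<otimes> v\<close>
  acts as \<open>M(\<langle>a\<rangle>)(v)\<close>, where \<open>\<langle>a\<rangle>\<close> is \<open>a\<close> regarded as a span from \<open>Y\<close> to \<open>X\<close>. So a Mackey functor has at
  most one module structure and every morphism of Mackey functors respects it.

  Every \<open>a\<close> factors, up to a 2-cell, through a stab-surjective 1-cell onto its stabilizer image, and
  \<open>p[a]\<close> only depends on that image. Hence \<open>M(\<langle>a\<rangle>)(v)\<close> is a function of \<open>p[a]\<close> when \<open>M\<close> is deflative, which gives the action;
  conversely, a stab-surjective \<open>\<alpha> : W \<rightarrow> X\<close> has the same image under \<open>p\<close> as the identity of \<open>X\<close>, and applying this to the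
  diagonal of \<open>\<alpha>\<close> the unit law forces \<open>M\<close> to be deflative. For associativity, the co-Yoneda identity
  \<open>p[a] \<otimes> v = \<Delta> \<otimes> N(\<langle>a\<rangle>)(v)\<close>, with \<open>\<Delta>\<close> the class of the diagonal of \<open>X\<close>, makes \<open>\<Omega> \<otimes> N \<rightarrow> N\<close> injective,
  so both ways of acting need only be compared in \<open>M\<close>, where they are evaluated by pasting homotopy pullbacks.
\<close>

text \<open>A 0-cell is the action groupoid of its group action, with g as a morphism from x to gx;
  a 1-cell is a functor and a 2-cell a natural transformation. In these terms stab-surjective means
  full and essentially surjective, and isomorphisms of \<open>CC\<close> are equivalences. Fullness
  and essential surjectivity survive homotopy pullback, which lets stab-surjective 1-cells be
  carried through the Mackey calculus. The obstacle is choice: a composite of spans goes through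
  chosen representatives of spans and of 1-cells and through one particular bipullback. Computations
  are therefore stated for an arbitrary homotopy pullback of arbitrary representatives. Product
  preservation enters as the decomposition of an element along a coproduct, which rests on
  coproducts of \<open>CC\<close> being products of \<open>SpC\<close>. The associativity constraint
  is given by nested lifts of formulas whose compatibility with the relators is not obvious. It
  follows from the injectivity of the action: the formulas agree on elementary tensors with a map
  already known to be linear.\<close>

abbreviation zc where "zc \<equiv> is_zero_cell"
abbreviation oc where "oc \<equiv> is_one_cell"
abbreviation lin where "lin \<equiv> linear_maps"
abbreviation gp where "gp P \<equiv> carrier (Grp P)"
abbreviation gmult ("_ *[_] _" [70, 0, 71] 70) where "x *[P] y \<equiv> x \<otimes>\<^bsub>Grp P\<^esub> y"
abbreviation ginv ("inv[_] _" [0, 81] 80) where "inv[P] x \<equiv> inv\<^bsub>Grp P\<^esub> x"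
abbreviation gone ("1[_]") where "1[P] \<equiv> \<one>\<^bsub>Grp P\<^esub>"
abbreviation madd ("_ +[_] _" [65, 0, 66] 65) where "x +[M] y \<equiv> x \<oplus>\<^bsub>M\<^esub> y"
abbreviation mminus ("_ -[_] _" [65, 0, 66] 65) where "x -[M] y \<equiv> x \<ominus>\<^bsub>M\<^esub> y"
abbreviation mscale ("_ .[_] _" [71, 0, 70] 70) where "c .[M] x \<equiv> c \<odot>\<^bsub>M\<^esub> x"
abbreviation mzero ("0[_]") where "0[M] \<equiv> \<zero>\<^bsub>M\<^esub>"
abbreviation ccomp ("_ o[_] _" [70, 0, 71] 70) where "g o[C] f \<equiv> g \<cdot>\<^bsub>C\<^esub> f"
notation prod_cell (infixl "**" 71)
notation comp_cell (infixl "oo" 71)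
abbreviation mcoset ("_ +>[_] _" [65, 0, 66] 65) where "H +>[M] x \<equiv> H +>\<^bsub>M\<^esub> x"
abbreviation fm where "fm \<equiv> free_module"
abbreviation bv where "bv \<equiv> basis_vec"
abbreviation el where "el M X \<equiv> carrier (fob M X)"

section \<open>Modules given by generators and relators\<close>

lemma linI:
  assumes "!!x. x : carrier M ==> f x : carrier N" and "f : extensional (carrier M)"
    and "!!x y. x : carrier M ==> y : carrier M ==> f (x +[M] y) = f x +[N] f y"
    and "!!c x. c : carrier k ==> x : carrier M ==> f (c .[M] x) = c .[N] f x"
  shows "f : lin k M N"
  using assms by (auto simp: linear_maps_def PiE_def)

lemma linD:
  assumes "f : lin k M N"
  shows "x : carrier M ==> f x : carrier N" and "f : extensional (carrier M)"
    and "x : carrier M ==> y : carrier M ==> f (x +[M] y) = f x +[N] f y"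
    and "c : carrier k ==> x : carrier M ==> f (c .[M] x) = c .[N] f x"
  using assms by (auto simp: linear_maps_def PiE_def)

locale base_ring = k: cring k for k :: "'k ring"
begin

lemma linear_map_zero:
  assumes "module k M" "module k N" "f : lin k M N"
  shows "f 0[M] = 0[N]"
proof -
  interpret M: module k M by fact
  interpret N: module k N by fact
  have "f (0[k] .[M] 0[M]) = 0[k] .[N] f 0[M]"
    using linD(4)[OF assms(3)] by blast
  then show ?thesis using linD(1)[OF assms(3)] by simp
qed

lemma lin_id:
  assumes "module k M"
  shows "(\<lambda>x \<in> carrier M. x) : lin k M M"
proof -
  interpret M: module k M by fact
  show ?thesis by (rule linI) auto
qed

lemma lin_comp:
  assumes "module k M" "f : lin k M N" "g : lin k N P"
  shows "compose (carrier M) g f : lin k M P"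
proof -
  interpret M: module k M by fact
  show ?thesis
    using linD[OF assms(2)] linD[OF assms(3)]
    by (intro linI) (auto simp: compose_def)
qed

section \<open>Free modules and linear extension\<close>

lemma free_mod: "module k (fm k B)"
proof (rule moduleI)
  let ?F = "fm k B"
  have fin: "finite {b. \<phi> b +[k] \<psi> b ~= 0[k]}" if "finite {b. \<phi> b ~= 0[k]}" "finite {b. \<psi> b ~= 0[k]}"
    for \<phi> \<psi> :: "'b => 'k"
    by (rule finite_subset[OF _ finite_UnI[OF that]]) auto
  show "abelian_group ?F"
  proof (rule abelian_groupI)
    fix \<phi> \<psi> assume "\<phi> : carrier ?F" "\<psi> : carrier ?F"
    then show "\<phi> +[?F] \<psi> : carrier ?F"
      using fin[of \<phi> \<psi>] by (auto simp: free_module_def)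
        (metis (mono_tags, lifting) k.add.l_one k.zero_closed mem_Collect_eq subset_eq)
  next
    fix \<phi> assume h: "\<phi> : carrier ?F"
    then have z: "\<ominus>\<^bsub>k\<^esub> \<phi> b ~= 0[k] \<longleftrightarrow> \<phi> b ~= 0[k]" for b
      by (simp add: free_module_def)
    show "EX \<psi>:carrier ?F. \<psi> +[?F] \<phi> = 0[?F]"
      using h z
      by (intro bexI[of _ "%b. \<ominus>\<^bsub>k\<^esub> \<phi> b"]) (auto simp: free_module_def k.l_neg fun_eq_iff)
  qed (auto simp: free_module_def k.a_ac fun_eq_iff)
  fix c \<phi> assume c: "c : carrier k" "\<phi> : carrier ?F"
  have "{b. c \<otimes>\<^bsub>k\<^esub> \<phi> b ~= 0[k]} \<subseteq> {b. \<phi> b ~= 0[k]}" using c by auto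
  then show "c .[?F] \<phi> : carrier ?F"
    using c finite_subset by (fastforce simp: free_module_def)
qed (auto simp: free_module_def k.l_distr k.r_distr k.m_assoc fun_eq_iff intro: k.cring_axioms)

lemma bvec_closed: "b : B ==> bv k b : carrier (fm k B)"
proof -
  assume "b : B"
  moreover have "{b'. b' = b & \<one>\<^bsub>k\<^esub> ~= 0[k]} \<subseteq> {b}" by auto
  ultimately show ?thesis
    by (auto simp: free_module_def basis_vec_def intro: finite_subset)
qed

text \<open>Induction on the finite support: one basis element is split off by setting the function
  to zero there.\<close>

lemma free_module_induct [consumes 1, case_names zero add]:
  assumes "\<phi> : carrier (fm k B)"
    and zero: "P 0[fm k B]"
    and add: "!!\<psi> c b. \<psi> : carrier (fm k B) ==> c : carrier k ==> b : B ==> P \<psi> ==>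
      P (\<psi> +[fm k B] (c .[fm k B] bv k b))"
  shows "P \<phi>"
proof -
  have "finite {b. \<phi> b ~= 0[k]}" using assms(1) by (simp add: free_module_def)
  then show ?thesis using assms(1)
  proof (induction "{b. \<phi> b ~= 0[k]}" arbitrary: \<phi> rule: finite_induct)
    case empty
    then have "\<phi> = 0[fm k B]" by (auto simp: free_module_def fun_eq_iff)
    then show ?case using zero by simp
  next
    case (insert b S)
    define \<psi> where "\<psi> = \<phi>(b := 0[k])"
    have S: "S = {x. \<psi> x ~= 0[k]}" using insert(2,4) by (auto simp: \<psi>_def)
    have m: "!!b. \<phi> b : carrier k" "{b. \<phi> b ~= 0[k]} \<subseteq> B" "b : B"
      using insert by (auto simp: free_module_def)
    have \<psi>: "\<psi> : carrier (fm k B)"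
      using m insert(1,4) S by (auto simp: free_module_def \<psi>_def)
    have "\<phi> = \<psi> +[fm k B] (\<phi> b .[fm k B] bv k b)"
      using m by (auto simp: free_module_def \<psi>_def basis_vec_def fun_eq_iff)
    then show ?case
      using add[OF \<psi> m(1) m(3) insert(3)[OF S \<psi>]] by metis
  qed
qed

definition free_lift :: "('k, 'n) module => ('b => 'n) => ('b => 'k) => 'n" where
  "free_lift N h \<phi> = (\<Oplus>\<^bsub>N\<^esub> b \<in> {b. \<phi> b ~= 0[k]}. \<phi> b .[N] h b)"

text \<open>The supports of two functions and of their sum are different sets. Padding with zero
  terms moves all three sums to one finite index set, which is how additivity is shown.\<close>

lemma free_lift_superset:
  assumes "module k N" "h : B \<rightarrow> carrier N" "finite A" "A \<subseteq> B" "{b. \<phi> b ~= 0[k]} \<subseteq> A"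
    "!!b. \<phi> b : carrier k"
  shows "free_lift N h \<phi> = (\<Oplus>\<^bsub>N\<^esub> b \<in> A. \<phi> b .[N] h b)"
proof -
  interpret N: module k N by fact
  have h: "h b : carrier N" if "b : A" for b using assms that by auto
  show ?thesis unfolding free_lift_def
    by (rule N.add.finprod_mono_neutral_cong_left) (use assms h in auto)
qed

lemma free_lift_linear:
  assumes N: "module k N" and h: "h : B \<rightarrow> carrier N"
  shows "restrict (free_lift N h) (carrier (fm k B)) : lin k (fm k B) N" (is "?l : _")
proof -
  interpret N: module k N by fact
  interpret F: module k "fm k B" by (rule free_mod)
  have hb: "h b : carrier N" if "b : B" for b using h that by auto
  have c: "free_lift N h \<phi> : carrier N" if "\<phi> : carrier (fm k B)" for \<phi>
    unfolding free_lift_def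
    by (rule N.finsum_closed) (use that hb in "auto simp: free_module_def")
  show ?thesis
  proof (rule linI)
    fix \<phi> \<psi> assume f: "\<phi> : carrier (fm k B)" "\<psi> : carrier (fm k B)"
    let ?A = "{b. \<phi> b ~= 0[k]} \<union> {b. \<psi> b ~= 0[k]}"
    have A: "finite ?A" "?A \<subseteq> B" using f by (auto simp: free_module_def)
    have v: "\<phi> b : carrier k" "\<psi> b : carrier k" for b using f by (auto simp: free_module_def)
    have s: "\<phi> +[fm k B] \<psi> = (%b. \<phi> b +[k] \<psi> b)" by (simp add: free_module_def)
    have "free_lift N h (%b. \<phi> b +[k] \<psi> b) = (\<Oplus>\<^bsub>N\<^esub> b \<in> ?A. (\<phi> b +[k] \<psi> b) .[N] h b)"
      by (rule free_lift_superset[OF N h]) (use A v in auto)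
    also have "... = (\<Oplus>\<^bsub>N\<^esub> b \<in> ?A. \<phi> b .[N] h b +[N] \<psi> b .[N] h b)"
      by (rule N.finsum_cong') (use A v hb in "auto simp: N.smult_l_distr")
    also have "... = (\<Oplus>\<^bsub>N\<^esub> b \<in> ?A. \<phi> b .[N] h b) +[N] (\<Oplus>\<^bsub>N\<^esub> b \<in> ?A. \<psi> b .[N] h b)"
      by (rule N.finsum_addf) (use A v hb in auto)
    also have "(\<Oplus>\<^bsub>N\<^esub> b \<in> ?A. \<phi> b .[N] h b) = free_lift N h \<phi>"
      by (rule free_lift_superset[OF N h, symmetric]) (use A v in auto)
    also have "(\<Oplus>\<^bsub>N\<^esub> b \<in> ?A. \<psi> b .[N] h b) = free_lift N h \<psi>"
      by (rule free_lift_superset[OF N h, symmetric]) (use A v in auto)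
    finally show "?l (\<phi> +[fm k B] \<psi>) = ?l \<phi> +[N] ?l \<psi>"
      using f F.a_closed[OF f] by (simp add: s)
  next
    fix a \<phi> assume f: "a : carrier k" "\<phi> : carrier (fm k B)"
    let ?A = "{b. \<phi> b ~= 0[k]}"
    have A: "finite ?A" "?A \<subseteq> B" using f by (auto simp: free_module_def)
    have v: "\<phi> b : carrier k" for b using f by (auto simp: free_module_def)
    have s: "a .[fm k B] \<phi> = (%b. a \<otimes>\<^bsub>k\<^esub> \<phi> b)" by (simp add: free_module_def)
    have "free_lift N h (%b. a \<otimes>\<^bsub>k\<^esub> \<phi> b) = (\<Oplus>\<^bsub>N\<^esub> b \<in> ?A. (a \<otimes>\<^bsub>k\<^esub> \<phi> b) .[N] h b)"
      by (rule free_lift_superset[OF N h]) (use A v f in auto)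
    also have "... = (\<Oplus>\<^bsub>N\<^esub> b \<in> ?A. a .[N] (\<phi> b .[N] h b))"
      by (rule N.finsum_cong') (use A v hb f in "auto simp: N.smult_assoc1")
    also have "... = a .[N] free_lift N h \<phi>"
      unfolding free_lift_def by (rule N.finsum_smult_ldistr[symmetric]) (use A v hb f in auto)
    finally show "?l (a .[fm k B] \<phi>) = a .[N] ?l \<phi>"
      using f F.smult_closed[OF f] by (simp add: s)
  qed (use c in auto)
qed

lemma free_lift_basis:
  assumes "module k N" "h : B \<rightarrow> carrier N" "b : B"
  shows "free_lift N h (bv k b) = h b"
proof -
  interpret N: module k N by fact
  have hb: "h b : carrier N" using assms by auto
  have "free_lift N h (bv k b) = (\<Oplus>\<^bsub>N\<^esub> b' \<in> {b}. bv k b b' .[N] h b')"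
    by (rule free_lift_superset[OF assms(1,2)]) (use assms in "auto simp: basis_vec_def")
  also have "... = bv k b b .[N] h b"
    using hb by (subst N.finsum_insert) (auto simp: basis_vec_def)
  finally show ?thesis using hb by (simp add: basis_vec_def)
qed

text \<open>The scalar action on a coset is defined as a union over its representatives. All cosets
  in that union coincide because \<open>H\<close> is closed under scalars.\<close>

lemma quot_facts:
  assumes M: "module k M" and H: "submodule H k M"
  shows "abelian_subgroup H M"
    and "carrier (quotient_module M H) = (%x. H +>[M] x) ` carrier M" (is ?C)
    and "x : carrier M ==> y : carrier M ==>
      (H +>[M] x) +[quotient_module M H] (H +>[M] y) = H +>[M] (x +[M] y)" (is "PROP ?S")
    and "c : carrier k ==> x : carrier M ==>
      c .[quotient_module M H] (H +>[M] x) = H +>[M] (c .[M] x)"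
    and "x : carrier M ==> y : carrier M ==> H +>[M] x = H +>[M] y \<longleftrightarrow> x -[M] y : H"
    and "0[quotient_module M H] = H +>[M] 0[M]"
proof -
  interpret M: module k M by fact
  show sg: "abelian_subgroup H M"
    using H by (intro abelian_subgroupI3 additive_subgroupI M.abelian_group_axioms)
      (simp add: submodule_def)
  interpret S: abelian_subgroup H M by (fact sg)
  show ?C by (auto simp: quotient_module_def A_RCOSETS_def')
  show "PROP ?S" by (simp add: quotient_module_def S.a_rcos_sum)
  show eq: "H +>[M] x = H +>[M] y \<longleftrightarrow> x -[M] y : H"
    if "x : carrier M" "y : carrier M" for x y
  proof
    assume "H +>[M] x = H +>[M] y"
    then have "x : H +>[M] y" using S.a_rcos_self[OF that(1)] by simp
    then show "x -[M] y : H" using S.a_rcos_module[OF that(2,1)] by (simp add: M.minus_eq)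
  next
    assume "x -[M] y : H"
    then have "x : H +>[M] y" using S.a_rcos_module[OF that(2,1)] by (simp add: M.minus_eq)
    then show "H +>[M] x = H +>[M] y" using S.a_repr_independence'[OF _ that(2)] by simp
  qed
  show "c .[quotient_module M H] (H +>[M] x) = H +>[M] (c .[M] x)"
    if c: "c : carrier k" and x: "x : carrier M"
  proof -
    have "H +>[M] (c .[M] y) = H +>[M] (c .[M] x)" if y: "y : H +>[M] x" for y
    proof -
      have ym: "y : carrier M" using y x M.a_r_coset_subset_G[OF S.a_subset] by blast
      have "y -[M] x : H" using S.a_rcos_module[OF x ym] y by (simp add: M.minus_eq)
      then have "c .[M] (y -[M] x) : H" using submodule.smult_closed[OF H c] by blast
      also have "c .[M] (y -[M] x) = c .[M] y -[M] c .[M] x"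
        using c x ym by (simp add: M.minus_eq M.smult_r_distr M.smult_r_minus)
      finally show ?thesis using eq c x ym by simp
    qed
    then have "(\<Union>y \<in> H +>[M] x. H +>[M] (c .[M] y)) = (\<Union>y \<in> H +>[M] x. H +>[M] (c .[M] x))"
      by (rule SUP_cong[OF refl])
    also have "... = H +>[M] (c .[M] x)" using S.a_rcos_self[OF x] by (intro SUP_const) blast
    finally show ?thesis by (simp add: quotient_module_def)
  qed
  show "0[quotient_module M H] = H +>[M] 0[M]"
    by (simp add: quotient_module_def S.a_subset)
qed

lemma quotient_module_module:
  assumes M: "module k M" and H: "submodule H k M"
  shows "module k (quotient_module M H)"
proof -
  interpret M: module k M by fact
  note q = quot_facts[OF M H]
  let ?Q = "quotient_module M H"
  show ?thesis
  proof (rule moduleI)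
    show "cring k" by (rule k.cring_axioms)
    show "abelian_group ?Q"
    proof (rule abelian_groupI)
      fix A assume "A : carrier ?Q"
      then obtain x where x: "x : carrier M" "A = H +>[M] x" by (auto simp: q(2))
      have "(H +>[M] (\<ominus>\<^bsub>M\<^esub> x)) +[?Q] A = 0[?Q]" using x by (simp add: q(3,6) M.l_neg)
      then show "EX B:carrier ?Q. B +[?Q] A = 0[?Q]" using x by (auto simp: q(2))
    next
      fix A B C assume "A : carrier ?Q" "B : carrier ?Q" "C : carrier ?Q"
      then show "A +[?Q] B +[?Q] C = A +[?Q] (B +[?Q] C)"
        by (auto simp: q(2,3) M.a_assoc)
    next
      fix A B assume "A : carrier ?Q" "B : carrier ?Q"
      then show "A +[?Q] B = B +[?Q] A"
        by (auto simp: q(2,3) M.a_comm)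
    qed (auto simp: q(2,3,6))
  qed (auto simp: q(2,3,4) M.smult_l_distr M.smult_r_distr M.smult_assoc1)
qed

lemma sub_span:
  assumes M: "module k M" and S: "S \<subseteq> carrier M"
  shows "submodule (submodule_span k M S) k M"
proof -
  interpret M: module k M by fact
  have c: "submodule (carrier M) k M" by (rule M.carrier_is_submodule)
  note e = M.submoduleE
  have z: "0[M] : H" if "submodule H k M" for H
    using submodule.axioms(1)[OF that] subgroup.one_closed by fastforce
  show ?thesis
  proof (rule M.submoduleI)
    show "submodule_span k M S \<subseteq> carrier M" using c S by (auto simp: submodule_span_def)
  qed (auto simp: submodule_span_def dest: z intro: e(3-5))
qed

lemma submodule_span_superset: "S \<subseteq> submodule_span k M S"
  by (auto simp: submodule_span_def)

lemma submodule_kernel: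
  assumes "module k M" "module k N" "f : lin k M N"
  shows "submodule {x : carrier M. f x = 0[N]} k M"
proof -
  interpret M: module k M by fact
  interpret N: module k N by fact
  note l = linD[OF assms(3)] linear_map_zero[OF assms]
  have "f (\<ominus>\<^bsub>M\<^esub> x) = 0[N]" if "x : carrier M" "f x = 0[N]" for x
    using l(3)[of x "\<ominus>\<^bsub>M\<^esub> x"] l(1)[of "\<ominus>\<^bsub>M\<^esub> x"] l(5) that by (simp add: M.r_neg)
  then show ?thesis by (intro M.submoduleI) (auto simp: l)
qed

section \<open>Presented modules and their universal property\<close>

lemma presented_module:
  assumes "R \<subseteq> carrier (fm k B)"
  shows "module k (presented k B R)"
  unfolding presented_def
  by (intro quotient_module_module free_mod sub_span assms)

lemma presented_gen_closed:
  assumes "R \<subseteq> carrier (fm k B)" "b : B"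
  shows "presented_gen k B R b : carrier (presented k B R)"
  using quot_facts(2)[OF free_mod sub_span[OF free_mod assms(1)]]
    bvec_closed[OF assms(2)]
  by (auto simp: presented_gen_def presented_def)

text \<open>The relators are dealt with by the existence of \<open>g\<close>: on every
  representative of a coset the formula gives the value of \<open>g\<close> there. This identifies
  lifts whose compatibility with the relators would be laborious to verify directly.\<close>

lemma presented_lift_eqI:
  assumes R: "R \<subseteq> carrier (fm k B)" and N: "module k N"
    and g: "g : lin k (presented k B R) N"
    and h: "!!b. b : B ==> h b = g (presented_gen k B R b)"
  shows "presented_lift k B R N h = g"
proof (rule extensionalityI)
  show "presented_lift k B R N h : extensional (carrier (presented k B R))"
    by (simp add: presented_lift_def)
  show "g : extensional (carrier (presented k B R))" by (rule linD(2)[OF g])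
  let ?F = "fm k B" and ?H = "submodule_span k (fm k B) R"
  interpret F: module k ?F by (rule free_mod)
  interpret N: module k N by (rule N)
  interpret P: module k "presented k B R" by (rule presented_module[OF R])
  note q = quot_facts[OF free_mod sub_span[OF free_mod R]]
  interpret S: abelian_subgroup ?H ?F by (rule q(1))
  have hc: "h : B \<rightarrow> carrier N"
    using h linD(1)[OF g presented_gen_closed[OF R]] by auto
  note fl = free_lift_linear[OF N hc]
  have *: "free_lift N h \<phi> = g (?H +>[?F] \<phi>)" if "\<phi> : carrier ?F" for \<phi>
    using that
  proof (induction rule: free_module_induct)
    case zero
    have "free_lift N h 0[?F] = 0[N]"
      using linear_map_zero[OF free_mod N fl] by simp
    also have "... = g 0[presented k B R]"
      using linear_map_zero[OF presented_module[OF R] N g] by simp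
    finally show ?case by (simp add: q(6) presented_def)
  next
    case (add \<psi> c b)
    have b: "bv k b : carrier ?F" by (rule bvec_closed) fact
    have "free_lift N h (\<psi> +[?F] (c .[?F] bv k b)) = free_lift N h \<psi> +[N] c .[N] h b"
      using linD(3,4)[OF fl] add b free_lift_basis[OF N hc] by simp
    also have "h b = g (?H +>[?F] bv k b)"
      using h[OF add(3)] by (simp add: presented_gen_def)
    also have "c .[N] g (?H +>[?F] bv k b) = g (?H +>[?F] (c .[?F] bv k b))"
      using linD(4)[OF g, of c "?H +>[?F] bv k b"] add b
      by (auto simp: q(2,4) presented_def)
    also have "free_lift N h \<psi> +[N] ... = g (?H +>[?F] (\<psi> +[?F] (c .[?F] bv k b)))"
      using linD(3)[OF g, of "?H +>[?F] \<psi>" "?H +>[?F] (c .[?F] bv k b)"] add b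
      by (auto simp: q(2,3) presented_def)
    finally show ?case .
  qed
  fix A assume A: "A : carrier (presented k B R)"
  then obtain \<psi> where \<psi>: "\<psi> : carrier ?F" "A = ?H +>[?F] \<psi>" by (auto simp: q(2) presented_def)
  define \<phi> where "\<phi> = (SOME \<phi>. \<phi> : A)"
  have "\<phi> : A" unfolding \<phi>_def by (rule someI[of _ \<psi>]) (use S.a_rcos_self[OF \<psi>(1)] \<psi>(2) in simp)
  then have "\<phi> : carrier ?F" "A = ?H +>[?F] \<phi>"
    using \<psi> F.a_r_coset_subset_G[OF S.a_subset \<psi>(1)] S.a_repr_independence'[OF _ \<psi>(1)] by auto
  then have "free_lift N h \<phi> = g A" using * by simp
  then show "presented_lift k B R N h A = g A"
    using A by (simp add: presented_lift_def \<phi>_def free_lift_def)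
qed

text \<open>The kernel of the linear extension is a submodule containing the relators, hence their
  span; so the extension is constant on cosets.\<close>

lemma presented_lift_linear:
  assumes R: "R \<subseteq> carrier (fm k B)" and N: "module k N"
    and h: "h : B \<rightarrow> carrier N" and r: "!!r. r : R ==> free_lift N h r = 0[N]"
  shows "presented_lift k B R N h : lin k (presented k B R) N" (is ?L)
    and "b : B ==> presented_lift k B R N h (presented_gen k B R b) = h b" (is "PROP ?G")
proof -
  let ?F = "fm k B" and ?H = "submodule_span k (fm k B) R"
  interpret F: module k ?F by (rule free_mod)
  interpret N: module k N by (rule N)
  note q = quot_facts[OF free_mod sub_span[OF free_mod R]]
  interpret S: abelian_subgroup ?H ?F by (rule q(1))
  note fl = free_lift_linear[OF N h]
  let ?f = "restrict (free_lift N h) (carrier ?F)"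
  have "?H \<subseteq> {x : carrier ?F. ?f x = 0[N]}"
    unfolding submodule_span_def
    by (rule Inter_lower) (use submodule_kernel[OF free_mod N fl] R r in auto)
  then have ker: "free_lift N h x = 0[N]" if "x : ?H" for x using that by auto
  have wd: "free_lift N h x = free_lift N h y"
    if "x : carrier ?F" "y : carrier ?F" "?H +>[?F] x = ?H +>[?F] y" for x y
  proof -
    have "x -[?F] y : ?H" using that q(5) by blast
    moreover have "x = (x -[?F] y) +[?F] y"
      using that by (simp add: F.minus_eq F.a_assoc F.l_neg)
    ultimately show ?thesis
      using linD(3)[OF fl, of "x -[?F] y" y] linD(1)[OF fl, of y] ker that by simp
  qed
  \<comment> \<open>A second lift, whose representative is chosen within the carrier. Its linearity
    is immediate from that of the extension, and \<open>presented_lift_eqI\<close> identifies it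
    with \<open>presented_lift\<close>.\<close>
  define g where "g = (\<lambda>A \<in> carrier (presented k B R). free_lift N h (SOME x. x : carrier ?F & A = ?H +>[?F] x))"
  have ga: "g (?H +>[?F] x) = free_lift N h x" if "x : carrier ?F" for x
  proof -
    let ?y = "SOME y. y : carrier ?F & ?H +>[?F] x = ?H +>[?F] y"
    have "?y : carrier ?F & ?H +>[?F] x = ?H +>[?F] ?y"
      by (rule someI[of "%y. y : carrier ?F & ?H +>[?F] x = ?H +>[?F] y" x]) (use that in simp)
    then show ?thesis using wd[of ?y x] that by (auto simp: g_def presented_def q(2))
  qed
  have g: "g : lin k (presented k B R) N"
  proof (rule linI)
    show "g : extensional (carrier (presented k B R))" by (simp add: g_def)
  qed (use linD(1,3,4)[OF fl] in "auto simp: presented_def q(2-4) ga")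
  have hg: "h b = g (presented_gen k B R b)" if "b : B" for b
    using ga[OF bvec_closed[OF that]] free_lift_basis[OF N h that] by (simp add: presented_gen_def)
  have "presented_lift k B R N h = g" by (rule presented_lift_eqI[OF R N g hg])
  then show ?L "PROP ?G" using g hg by auto
qed

text \<open>Both maps equal the lift of their common values on the generators.\<close>

lemma presented_ext:
  assumes R: "R \<subseteq> carrier (fm k B)" and N: "module k N"
    and f: "f : lin k (presented k B R) N" and g: "g : lin k (presented k B R) N"
    and e: "!!b. b : B ==> f (presented_gen k B R b) = g (presented_gen k B R b)"
  shows "f = g"
  using presented_lift_eqI[OF R N f] presented_lift_eqI[OF R N g e] by metis

text \<open>The relators of tensor products, coends and Grothendieck groups all have one of the following three shapes.\<close>

lemma relator_closed:
  assumes "x : B" "y : B" "z : B" "c : carrier k"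
  shows "bv k x -[fm k B] (bv k y +[fm k B] bv k z) : carrier (fm k B)" (is ?A)
    and "bv k x -[fm k B] (c .[fm k B] bv k y) : carrier (fm k B)" (is ?S)
    and "bv k x -[fm k B] bv k y : carrier (fm k B)" (is ?M)
proof -
  interpret F: module k "fm k B" by (rule free_mod)
  show ?A ?S ?M
    using assms by (auto intro!: F.minus_closed F.a_closed F.smult_closed bvec_closed)
qed

lemma free_lift_minus:
  assumes N: "module k N" and h: "h : B \<rightarrow> carrier N"
    and x: "x : carrier (fm k B)" "y : carrier (fm k B)"
    and e: "free_lift N h x = free_lift N h y"
  shows "free_lift N h (x -[fm k B] y) = 0[N]"
proof -
  interpret F: module k "fm k B" by (rule free_mod)
  interpret N: module k N by (rule N)
  note l = linD[OF free_lift_linear[OF N h]]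
  have xy: "x = (x -[fm k B] y) +[fm k B] y"
    using x by (simp add: F.minus_eq F.a_assoc F.l_neg)
  have "free_lift N h x = free_lift N h (x -[fm k B] y) +[N] free_lift N h y"
    using l(3)[of "x -[fm k B] y" y] x xy by simp
  then show ?thesis
    using e l(1)[of y] l(1)[of "x -[fm k B] y"] x
    by (metis F.minus_closed N.add.r_cancel_one' restrict_apply')
qed

lemma free_lift_relator:
  assumes N: "module k N" and h: "h : B \<rightarrow> carrier N"
    and b: "x : B" "y : B" "z : B" "c : carrier k"
  shows "h x = h y +[N] h z ==> free_lift N h (bv k x -[fm k B] (bv k y +[fm k B] bv k z)) = 0[N]" (is "PROP ?A")
    and "h x = c .[N] h y ==> free_lift N h (bv k x -[fm k B] (c .[fm k B] bv k y)) = 0[N]" (is "PROP ?S")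
    and "h x = h y ==> free_lift N h (bv k x -[fm k B] bv k y) = 0[N]" (is "PROP ?M")
proof -
  interpret F: module k "fm k B" by (rule free_mod)
  note l = linD[OF free_lift_linear[OF N h]] and fb = free_lift_basis[OF N h]
  show "PROP ?A" "PROP ?S" "PROP ?M"
    using l(3)[of "bv k y" "bv k z"] l(4)[of c "bv k y"] b
    by (auto intro!: free_lift_minus[OF N h] simp: fb bvec_closed)
qed

lemma presented_gen_eqI:
  assumes R: "R \<subseteq> carrier (fm k B)"
    and b: "x : B" "y : B"
  shows "z : B ==> bv k x -[fm k B] (bv k y +[fm k B] bv k z) : R ==>
      presented_gen k B R x = presented_gen k B R y +[presented k B R] presented_gen k B R z" (is "PROP ?A")
    and "c : carrier k ==> bv k x -[fm k B] (c .[fm k B] bv k y) : R ==>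
      presented_gen k B R x = c .[presented k B R] presented_gen k B R y" (is "PROP ?S")
    and "bv k x -[fm k B] bv k y : R ==> presented_gen k B R x = presented_gen k B R y" (is "PROP ?M")
proof -
  interpret F: module k "fm k B" by (rule free_mod)
  note q = quot_facts[OF free_mod sub_span[OF free_mod R]]
  note d = presented_gen_def presented_def bvec_closed
  have eq: "submodule_span k (fm k B) R +>[fm k B] u = submodule_span k (fm k B) R +>[fm k B] v"
    if "u -[fm k B] v : R" "u : carrier (fm k B)" "v : carrier (fm k B)" for u v
    by (rule iffD2[OF q(5)[OF that(2,3)] subsetD[OF submodule_span_superset that(1)]])
  show "PROP ?A" by (drule eq) (use b in "auto simp: d q(3)")
  show "PROP ?S" by (drule eq) (use b in "auto simp: d q(4)")
  show "PROP ?M" by (drule eq) (use b in "auto simp: d")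
qed

end

context base_ring
begin

subsection \<open>Tensor products\<close>

lemma tensor_rels_subset:
  assumes "module k M" "module k N"
  shows "tensor_rels k M N \<subseteq> carrier (fm k (carrier M \<times> carrier N))"
proof -
  interpret M: module k M by fact
  interpret N: module k N by fact
  show ?thesis by (auto simp: tensor_rels_def Let_def intro!: relator_closed)
qed

lemma tm_mod:
  assumes "module k M" "module k N"
  shows "module k (tensor_module k M N)"
  unfolding tensor_module_def by (rule presented_module[OF tensor_rels_subset[OF assms]])

lemma pure_tensor_closed:
  assumes "module k M" "module k N" "u : carrier M" "v : carrier N"
  shows "pure_tensor k M N u v : carrier (tensor_module k M N)"
  unfolding tensor_module_def pure_tensor_def
  by (rule presented_gen_closed[OF tensor_rels_subset]) (use assms in auto)

lemma pure_tensor_bilinear: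
  assumes M: "module k M" and N: "module k N" and c: "c : carrier k"
    and u: "u : carrier M" "u' : carrier M" and v: "v : carrier N" "v' : carrier N"
  shows "pure_tensor k M N (u +[M] u') v =
      pure_tensor k M N u v +[tensor_module k M N] pure_tensor k M N u' v" (is ?A)
    and "pure_tensor k M N u (v +[N] v') =
      pure_tensor k M N u v +[tensor_module k M N] pure_tensor k M N u v'" (is ?B)
    and "pure_tensor k M N (c .[M] u) v = c .[tensor_module k M N] pure_tensor k M N u v" (is ?C)
    and "pure_tensor k M N u (c .[N] v) = c .[tensor_module k M N] pure_tensor k M N u v" (is ?D)
proof -
  interpret M: module k M by fact
  interpret N: module k N by fact
  note e = presented_gen_eqI[OF tensor_rels_subset[OF M N]]
  note d = tensor_module_def pure_tensor_def
  show ?A ?B unfolding d by (rule e(1); use u v in "auto simp: tensor_rels_def Let_def")+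
  show ?C unfolding d by (rule e(2)) (use c u v in "auto simp: tensor_rels_def Let_def")
  show ?D
    unfolding d
  proof (rule e(2))
    show "bv k (u, c .[N] v) -[fm k (carrier M \<times> carrier N)]
        (c .[fm k (carrier M \<times> carrier N)] bv k (u, v)) : tensor_rels k M N"
      unfolding tensor_rels_def Let_def
      by (rule UnI2, rule CollectI, intro exI conjI, rule refl) (use c u v in auto)
  qed (use c u v in auto)
qed

definition bilinear_map ::
  "('k, 'm) module => ('k, 'n) module => ('k, 'q) module => ('m => 'n => 'q) => bool" where
  "bilinear_map M N Q h \<longleftrightarrow>
     (ALL u:carrier M. ALL v:carrier N. h u v : carrier Q) &
     (ALL u:carrier M. ALL u':carrier M. ALL v:carrier N. h (u +[M] u') v = h u v +[Q] h u' v) &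
     (ALL u:carrier M. ALL v:carrier N. ALL v':carrier N. h u (v +[N] v') = h u v +[Q] h u v') &
     (ALL c:carrier k. ALL u:carrier M. ALL v:carrier N. h (c .[M] u) v = c .[Q] h u v) &
     (ALL c:carrier k. ALL u:carrier M. ALL v:carrier N. h u (c .[N] v) = c .[Q] h u v)"

lemma bilinD:
  assumes "bilinear_map M N Q h"
  shows "u : carrier M ==> v : carrier N ==> h u v : carrier Q"
    and "u : carrier M ==> u' : carrier M ==> v : carrier N ==> h (u +[M] u') v = h u v +[Q] h u' v"
    and "u : carrier M ==> v : carrier N ==> v' : carrier N ==> h u (v +[N] v') = h u v +[Q] h u v'"
    and "c : carrier k ==> u : carrier M ==> v : carrier N ==> h (c .[M] u) v = c .[Q] h u v"
    and "c : carrier k ==> u : carrier M ==> v : carrier N ==> h u (c .[N] v) = c .[Q] h u v"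
  using assms by (auto simp: bilinear_map_def)

lemma tensor_lift_linear:
  assumes M: "module k M" and N: "module k N" and Q: "module k Q" and h: "bilinear_map M N Q h"
  shows "tensor_lift k M N Q h : lin k (tensor_module k M N) Q" (is ?L)
    and "u : carrier M ==> v : carrier N ==> tensor_lift k M N Q h (pure_tensor k M N u v) = h u v" (is "PROP ?G")
proof -
  interpret M: module k M by fact
  interpret N: module k N by fact
  note R = tensor_rels_subset[OF M N]
  have hc: "(%(u, v). h u v) : carrier M \<times> carrier N \<rightarrow> carrier Q"
    using bilinD(1)[OF h] by auto
  have k1: "\<one>\<^bsub>k\<^esub> : carrier k" by simp
  have r: "free_lift Q (%(u, v). h u v) r = 0[Q]" if "r : tensor_rels k M N" for r
    using that unfolding tensor_rels_def Let_def
    by (elim UnE CollectE exE conjE; hypsubst)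
      (rule free_lift_relator(1)[OF Q hc _ _ _ k1] free_lift_relator(2)[OF Q hc]; use bilinD[OF h] in auto)+
  note l = presented_lift_linear[OF R Q hc r]
  show ?L unfolding tensor_lift_def tensor_module_def by (rule l(1))
  show "PROP ?G" using l(2)[of "(u, v)"] by (simp add: tensor_lift_def pure_tensor_def)
qed

lemma tensor_lift_eqI:
  assumes "module k M" "module k N" "module k Q" "g : lin k (tensor_module k M N) Q"
    and "!!u v. u : carrier M ==> v : carrier N ==> h u v = g (pure_tensor k M N u v)"
  shows "tensor_lift k M N Q h = g"
  unfolding tensor_lift_def
  by (rule presented_lift_eqI[OF tensor_rels_subset[OF assms(1,2)] assms(3)])
    (use assms(4,5) in "auto simp: tensor_module_def pure_tensor_def")

lemma tensor_ext:
  assumes "module k M" "module k N" "module k Q"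
    and f: "f : lin k (tensor_module k M N) Q" and g: "g : lin k (tensor_module k M N) Q"
    and e: "!!u v. u : carrier M ==> v : carrier N ==> f (pure_tensor k M N u v) = g (pure_tensor k M N u v)"
  shows "f = g"
  using tensor_lift_eqI[OF assms(1-3) f] tensor_lift_eqI[OF assms(1-3) g e] by metis

lemma tensor_map_linear:
  assumes M: "module k M" and N: "module k N" and M': "module k M'" and N': "module k N'"
    and f: "f : lin k M M'" and g: "g : lin k N N'"
  shows "tensor_map k M N M' N' f g : lin k (tensor_module k M N) (tensor_module k M' N')" (is ?L)
    and "u : carrier M ==> v : carrier N ==>
      tensor_map k M N M' N' f g (pure_tensor k M N u v) = pure_tensor k M' N' (f u) (g v)" (is "PROP ?G")
proof -
  have c: "\<one>\<^bsub>k\<^esub> : carrier k" by simp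
  interpret M': module k M' by fact
  interpret N': module k N' by fact
  have "bilinear_map M N (tensor_module k M' N') (%u v. pure_tensor k M' N' (f u) (g v))"
    unfolding bilinear_map_def
    using linD[OF f] linD[OF g] pure_tensor_closed[OF M' N']
      pure_tensor_bilinear[OF M' N' _ _ M'.zero_closed _ N'.zero_closed]
      pure_tensor_bilinear(1)[OF M' N' c _ _ _ N'.zero_closed]
      pure_tensor_bilinear(2)[OF M' N' c _ M'.zero_closed]
    by simp
  note l = tensor_lift_linear[OF M N tm_mod[OF M' N'] this]
  show ?L "PROP ?G" unfolding tensor_map_def by (rule l)+
qed

text \<open>\<^const>\<open>mtensor\<close> and \<^const>\<open>day_bifctr\<close> pass the identity of a factor as an unrestricted function.\<close>

lemma tensor_map_id_cong:
  assumes M: "module k M" and N: "module k N" and M': "module k M'" and N': "module k N'"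
  shows "f : lin k M M' ==>
      tensor_map k M N M' N f (%v. v) = tensor_map k M N M' N f (\<lambda>v \<in> carrier N. v)" (is "PROP ?L")
    and "g : lin k N N' ==>
      tensor_map k M N M N' (%v. v) g = tensor_map k M N M N' (\<lambda>v \<in> carrier M. v) g" (is "PROP ?R")
proof -
  note m = tensor_map_linear[OF M N M' N _ lin_id[OF N]] tensor_map_linear[OF M N M N' lin_id[OF M]]
  show "PROP ?L" by (subst tensor_map_def, rule tensor_lift_eqI[OF M N tm_mod[OF M' N] m(1)]) (simp_all add: m(2))
  show "PROP ?R" by (subst tensor_map_def, rule tensor_lift_eqI[OF M N tm_mod[OF M N'] m(3)]) (simp_all add: m(4))
qed

lemma tensor_map_id_left:
  assumes M: "module k M" and N: "module k N" and N': "module k N'" and g: "g : lin k N N'"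
  shows "tensor_map k M N M N' (%v. v) g : lin k (tensor_module k M N) (tensor_module k M N')"
    and "u : carrier M ==> v : carrier N ==>
      tensor_map k M N M N' (%v. v) g (pure_tensor k M N u v) = pure_tensor k M N' u (g v)"
  using tensor_map_linear[OF M N M N' lin_id[OF M] g] tensor_map_id_cong(2)[OF M N M N' g] by auto

lemma tensor_map_id_right:
  assumes M: "module k M" and N: "module k N" and M': "module k M'" and f: "f : lin k M M'"
  shows "tensor_map k M N M' N f (%v. v) : lin k (tensor_module k M N) (tensor_module k M' N)"
    and "u : carrier M ==> v : carrier N ==>
      tensor_map k M N M' N f (%v. v) (pure_tensor k M N u v) = pure_tensor k M' N (f u) v"
  using tensor_map_linear[OF M N M' N f lin_id[OF N]] tensor_map_id_cong(1)[OF M N M' N f] by auto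

subsection \<open>Coends\<close>

text \<open>What gives sense to the coend relators: modules as values and, for every arrow
  \<open>f\<close>, the two linear maps out of the module at \<open>tgt C f\<close>,
  \<open>src C f\<close>.\<close>

definition is_bifctr :: "('o, 'a) cat => ('o, 'a, 'k, 't) bifctr => bool" where
  "is_bifctr C T \<longleftrightarrow>
     (ALL A:ob C. ALL B:ob C. module k (bi_ob T A B)) &
     (ALL f:ar C. src C f : ob C & tgt C f : ob C &
        bi_left T f (src C f) : lin k (bi_ob T (tgt C f) (src C f)) (bi_ob T (src C f) (src C f)) &
        bi_right T (tgt C f) f : lin k (bi_ob T (tgt C f) (src C f)) (bi_ob T (tgt C f) (tgt C f)))"

definition is_cowedge :: "('o, 'a) cat => ('o, 'a, 'k, 't) bifctr => ('k, 'q) module => ('o => 't => 'q) => bool" where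
  "is_cowedge C T Q h \<longleftrightarrow>
     (ALL A:ob C. h A : lin k (bi_ob T A A) Q) &
     (ALL f:ar C. ALL t:carrier (bi_ob T (tgt C f) (src C f)).
        h (src C f) (bi_left T f (src C f) t) = h (tgt C f) (bi_right T (tgt C f) f t))"

lemma coend_gens_simps:
  assumes "is_bifctr C T" "A : ob C" "t : carrier (bi_ob T A A)" "t' : carrier (bi_ob T A A)" "c : carrier k"
  shows "(A, t) : coend_gens C T" "(A, t +[bi_ob T A A] t') : coend_gens C T" "(A, c .[bi_ob T A A] t) : coend_gens C T"
proof -
  interpret A: module k "bi_ob T A A" using assms by (simp add: is_bifctr_def)
  show "(A, t) : coend_gens C T" "(A, t +[bi_ob T A A] t') : coend_gens C T" "(A, c .[bi_ob T A A] t) : coend_gens C T"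
    using assms by (auto simp: coend_gens_def)
qed

lemma coend_gens_wedge:
  assumes "is_bifctr C T" "f : ar C" "t : carrier (bi_ob T (tgt C f) (src C f))"
  shows "(src C f, bi_left T f (src C f) t) : coend_gens C T" "(tgt C f, bi_right T (tgt C f) f t) : coend_gens C T"
  using assms linD(1) by (fastforce simp: is_bifctr_def coend_gens_def)+

lemma coend_rels_subset:
  assumes T: "is_bifctr C T"
  shows "coend_rels k C T \<subseteq> carrier (fm k (coend_gens C T))"
proof -
  have k0: "0[k] : carrier k" by simp
  note g = coend_gens_simps[OF T]
  show ?thesis
    unfolding coend_rels_def Let_def
    by (intro Un_least subsetI; elim CollectE exE conjE; hypsubst; intro relator_closed)
      (auto intro: g(1)[OF _ _ _ k0] g(2)[OF _ _ _ k0] g(3) coend_gens_wedge[OF T] k0)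
qed

lemma coend_module: "is_bifctr C T ==> module k (coend k C T)"
  unfolding coend_def by (rule presented_module[OF coend_rels_subset])

lemma coend_in_linear:
  assumes T: "is_bifctr C T" and A: "A : ob C"
  shows "restrict (coend_in k C T A) (carrier (bi_ob T A A)) : lin k (bi_ob T A A) (coend k C T)" (is "?i : _")
proof -
  interpret A: module k "bi_ob T A A" using T A by (auto simp: is_bifctr_def)
  note R = coend_rels_subset[OF T]
  have g: "(A, t) : coend_gens C T" if "t : carrier (bi_ob T A A)" for t
    using A that by (auto simp: coend_gens_def)
  show ?thesis
  proof (rule linI)
    fix t t' assume t: "t : carrier (bi_ob T A A)" "t' : carrier (bi_ob T A A)"
    have "coend_in k C T A (t +[bi_ob T A A] t') = coend_in k C T A t +[coend k C T] coend_in k C T A t'"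
      unfolding coend_in_def coend_def
      by (rule presented_gen_eqI(1)[OF R]) (use t g A in "auto simp: coend_rels_def Let_def")
    then show "?i (t +[bi_ob T A A] t') = ?i t +[coend k C T] ?i t'" using t by simp
  next
    fix c t assume t: "c : carrier k" "t : carrier (bi_ob T A A)"
    have "coend_in k C T A (c .[bi_ob T A A] t) = c .[coend k C T] coend_in k C T A t"
      unfolding coend_in_def coend_def
      by (rule presented_gen_eqI(2)[OF R]) (use t g A in "auto simp: coend_rels_def Let_def")
    then show "?i (c .[bi_ob T A A] t) = c .[coend k C T] ?i t" using t by simp
  qed (auto simp: coend_in_def coend_def intro!: presented_gen_closed[OF R] g)
qed

lemma coend_in_wedge:
  assumes T: "is_bifctr C T" and f: "f : ar C" "t : carrier (bi_ob T (tgt C f) (src C f))"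
  shows "coend_in k C T (src C f) (bi_left T f (src C f) t) = coend_in k C T (tgt C f) (bi_right T (tgt C f) f t)"
  unfolding coend_in_def
  by (rule presented_gen_eqI(3)[OF coend_rels_subset[OF T] coend_gens_wedge[OF T f]])
    (use f in "auto simp: coend_rels_def Let_def")

lemma coend_lift_eqI:
  assumes "is_bifctr C T" "module k Q" "g : lin k (coend k C T) Q"
    "!!A t. A : ob C ==> t : carrier (bi_ob T A A) ==> h A t = g (coend_in k C T A t)"
  shows "coend_lift k C T Q h = g"
  unfolding coend_lift_def
  by (rule presented_lift_eqI[OF coend_rels_subset[OF assms(1)] assms(2)])
    (use assms(3,4) in "auto simp: coend_def coend_in_def coend_gens_def")

lemma coend_lift_linear:
  assumes T: "is_bifctr C T" and Q: "module k Q" and h: "is_cowedge C T Q h"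
  shows "coend_lift k C T Q h : lin k (coend k C T) Q" (is ?L)
    and "A : ob C ==> t : carrier (bi_ob T A A) ==> coend_lift k C T Q h (coend_in k C T A t) = h A t" (is "PROP ?G")
proof -
  have l: "h A : lin k (bi_ob T A A) Q" if "A : ob C" for A
    using h that by (auto simp: is_cowedge_def)
  have hc: "(%(A, t). h A t) : coend_gens C T \<rightarrow> carrier Q"
    using linD(1)[OF l] by (auto simp: coend_gens_def)
  have k0: "0[k] : carrier k" by simp
  note g = coend_gens_simps[OF T]
  have r: "free_lift Q (%(A, t). h A t) r = 0[Q]" if "r : coend_rels k C T" for r
    using that unfolding coend_rels_def Let_def
    by (elim UnE CollectE exE conjE; hypsubst; intro free_lift_relator[OF Q hc])
      (use linD(3,4)[OF l] h in "auto intro: g(1)[OF _ _ _ k0] g(2)[OF _ _ _ k0] g(3) coend_gens_wedge[OF T] k0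
        simp: is_cowedge_def")
  note L = presented_lift_linear[OF coend_rels_subset[OF T] Q hc r]
  show ?L unfolding coend_lift_def coend_def by (rule L(1))
  show "PROP ?G" using L(2)[of "(A, t)"] by (simp add: coend_lift_def coend_in_def coend_gens_def)
qed

subsection \<open>Grothendieck groups\<close>

end

section \<open>Isomorphism in a category\<close>

lemma catD:
  assumes "is_category C"
  shows "f : ar C ==> src C f : ob C" and "f : ar C ==> tgt C f : ob C"
    and "X : ob C ==> idn C X : arrows C X X"
    and "f : arrows C X Y ==> g : arrows C Y Z ==> g o[C] f : arrows C X Z"
    and "f : arrows C X Y ==> f o[C] idn C X = f" and "f : arrows C X Y ==> idn C Y o[C] f = f"
    and "f : arrows C X Y ==> g : arrows C Y Z ==> h : arrows C Z W ==> h o[C] (g o[C] f) = (h o[C] g) o[C] f"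
  using assms by (auto simp: is_category_def arrows_def)

lemma arrowsD:
  assumes "f : arrows C X Y"
  shows "f : ar C" "src C f = X" "tgt C f = Y"
  using assms by (auto simp: arrows_def)

lemma arrows_ob:
  assumes "is_category C" "f : arrows C X Y"
  shows "X : ob C" "Y : ob C"
  using assms catD(1,2)[OF assms(1)] by (auto simp: arrows_def)

lemma isomorphic_iff:
  "isomorphic C X Y \<longleftrightarrow> (EX f:arrows C X Y. EX g:arrows C Y X. g o[C] f = idn C X & f o[C] g = idn C Y)"
  by (auto simp: isomorphic_def is_iso_def arrows_def)

lemma isomorphic_refl:
  assumes "is_category C" "X : ob C"
  shows "isomorphic C X X"
  using catD(3,5)[OF assms(1)] assms(2) unfolding isomorphic_iff by blast

lemma isomorphic_sym: "isomorphic C X Y ==> isomorphic C Y X"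
  unfolding isomorphic_iff by blast

lemma isomorphic_trans:
  assumes C: "is_category C" and "isomorphic C X Y" "isomorphic C Y Z"
  shows "isomorphic C X Z"
proof -
  note c = catD[OF C]
  obtain f g where f: "f : arrows C X Y" "g : arrows C Y X" "g o[C] f = idn C X" "f o[C] g = idn C Y"
    using assms(2) by (auto simp: isomorphic_iff)
  obtain h l where h: "h : arrows C Y Z" "l : arrows C Z Y" "l o[C] h = idn C Y" "h o[C] l = idn C Z"
    using assms(3) by (auto simp: isomorphic_iff)
  have "(g o[C] l) o[C] (h o[C] f) = g o[C] ((l o[C] h) o[C] f)"
    using c(7)[OF c(4)[OF f(1) h(1)] h(2) f(2)] c(7)[OF f(1) h(1,2)] by simp
  moreover have "(h o[C] f) o[C] (g o[C] l) = h o[C] ((f o[C] g) o[C] l)"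
    using c(7)[OF c(4)[OF h(2) f(2)] f(1) h(1)] c(7)[OF h(2) f(2,1)] by simp
  ultimately have "(g o[C] l) o[C] (h o[C] f) = idn C X & (h o[C] f) o[C] (g o[C] l) = idn C Z"
    using f h c(6)[OF f(1)] c(6)[OF h(2)] by simp
  then show ?thesis
    unfolding isomorphic_iff by (intro bexI[OF _ c(4)[OF f(1) h(1)]] bexI[OF _ c(4)[OF h(2) f(2)]])
qed

lemma iso_class_eq_iff:
  assumes "is_category C" "X : ob C" "Y : ob C"
  shows "iso_class C X = iso_class C Y \<longleftrightarrow> isomorphic C X Y"
proof
  assume "iso_class C X = iso_class C Y"
  then have "Y : iso_class C X" using isomorphic_refl[OF assms(1,3)] assms(3) by (simp add: iso_class_def)
  then show "isomorphic C X Y" by (simp add: iso_class_def)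
next
  assume "isomorphic C X Y"
  then have "isomorphic C X Z \<longleftrightarrow> isomorphic C Y Z" for Z
    using isomorphic_sym[of C X Y] isomorphic_trans[OF assms(1)] by metis
  then show "iso_class C X = iso_class C Y" by (simp add: iso_class_def)
qed

context base_ring
begin

lemma k0_rels_subset: "k0_rels k C \<subseteq> carrier (fm k (k0_gens C))"
  by (auto simp: k0_rels_def k0_gens_def Let_def is_coproduct_def intro!: relator_closed)

lemma k0_module_module: "module k (k0_module k C)"
  unfolding k0_module_def by (rule presented_module[OF k0_rels_subset])

lemma k0_class_closed: "A : ob C ==> k0_class k C A : carrier (k0_module k C)"
  unfolding k0_module_def k0_class_def by (rule presented_gen_closed[OF k0_rels_subset]) (auto simp: k0_gens_def)

lemma k0_class_coproduct:
  assumes "is_coproduct C A B S i j"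
  shows "k0_class k C S = k0_class k C A +[k0_module k C] k0_class k C B"
  unfolding k0_module_def k0_class_def
proof (rule presented_gen_eqI(1)[OF k0_rels_subset])
  show "bv k (iso_class C S) -[fm k (k0_gens C)]
      (bv k (iso_class C A) +[fm k (k0_gens C)] bv k (iso_class C B)) : k0_rels k C"
    unfolding k0_rels_def Let_def using assms by blast
qed (use assms in "auto simp: k0_gens_def is_coproduct_def")

lemma k0_class_cong:
  assumes "is_category C" "isomorphic C A B"
  shows "k0_class k C A = k0_class k C B"
proof -
  have "A : ob C" "B : ob C"
    using assms(2) by (auto simp: isomorphic_def dest: arrows_ob[OF assms(1)])
  then have "iso_class C A = iso_class C B" using iso_class_eq_iff[OF assms(1)] assms(2) by blast
  then show ?thesis by (simp add: k0_class_def)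
qed

text \<open>\<open>k0_lift\<close> evaluates \<open>h\<close> at a chosen member of an isomorphism
  class, whence the invariance hypothesis \<open>iso\<close>; compatibility with coproducts sends
  the relators to zero.\<close>

lemma k0_lift_linear:
  assumes C: "is_category C" and N: "module k N"
    and h: "!!A. A : ob C ==> h A : carrier N"
    and iso: "!!A B. A : ob C ==> B : ob C ==> isomorphic C A B ==> h A = h B"
    and add: "!!A B S i j. is_coproduct C A B S i j ==> h S = h A +[N] h B"
  shows "k0_lift k C N h : lin k (k0_module k C) N" (is ?L)
    and "A : ob C ==> k0_lift k C N h (k0_class k C A) = h A"
proof -
  define h' where "h' c = h (SOME A. A : c)" for c
  have h': "h' (iso_class C A) = h A" if A: "A : ob C" for A
  proof -
    have "(SOME B. B : iso_class C A) : iso_class C A"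
      by (rule someI[of _ A]) (use A isomorphic_refl[OF C] in "simp add: iso_class_def")
    then show ?thesis using iso[OF A] by (auto simp: h'_def iso_class_def)
  qed
  have hc: "h' : k0_gens C \<rightarrow> carrier N" using h' h by (auto simp: k0_gens_def)
  have k0: "0[k] : carrier k" by simp
  have r: "free_lift N h' r = 0[N]" if "r : k0_rels k C" for r
    using that unfolding k0_rels_def Let_def
    by clarify (intro free_lift_relator(1)[OF N hc _ _ _ k0];
      use add h' in "auto simp: k0_gens_def is_coproduct_def")
  note L = presented_lift_linear[OF k0_rels_subset N hc r]
  show ?L unfolding k0_lift_def k0_module_def h'_def[symmetric] by (rule L(1))
  show "k0_lift k C N h (k0_class k C A) = h A" if "A : ob C"
    using L(2)[of "iso_class C A"] h'[OF that] that
    by (simp add: k0_lift_def k0_class_def k0_gens_def h'_def[symmetric])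
qed

lemma k0_ext:
  assumes N: "module k N" and f: "f : lin k (k0_module k C) N" and g: "g : lin k (k0_module k C) N"
    and e: "!!A. A : ob C ==> f (k0_class k C A) = g (k0_class k C A)"
  shows "f = g"
proof (rule presented_ext[OF k0_rels_subset N])
  show "f (presented_gen k (k0_gens C) (k0_rels k C) b) = g (presented_gen k (k0_gens C) (k0_rels k C) b)"
    if "b : k0_gens C" for b
    using that e by (auto simp: k0_class_def k0_gens_def)
qed (use f g in "simp_all add: k0_module_def")

end

section \<open>Action groupoids\<close>

locale zcell = group "Grp P" for P +
  assumes zero_cell: "zc P"
begin

lemma finite_grp: "finite (gp P)" and finite_pts: "finite (Pts P)"
  using zero_cell by (auto simp: is_zero_cell_def)

lemma act_closed [simp]: "g : gp P ==> x : Pts P ==> Act P g x : Pts P"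
  using zero_cell group_action.element_image by (fastforce simp: is_zero_cell_def)

lemma act_one [simp]: "x : Pts P ==> Act P 1[P] x = x"
  using zero_cell group_action.id_eq_one[of "Grp P" "Pts P" "Act P"]
  by (metis is_zero_cell_def restrict_apply')

lemma act_mult: "g : gp P ==> h : gp P ==> x : Pts P ==> Act P (g *[P] h) x = Act P g (Act P h x)"
  using zero_cell group_action.composition_rule[of "Grp P" "Pts P" "Act P"] by (auto simp: is_zero_cell_def)

lemma act_inv [simp]:
  assumes "g : gp P" "x : Pts P"
  shows "Act P (inv[P] g) (Act P g x) = x" "Act P g (Act P (inv[P] g) x) = x"
  using assms act_mult[of "inv[P] g" g x] act_mult[of g "inv[P] g" x] by simp_all

lemma act_eqD: "g : gp P ==> x : Pts P ==> Act P g x = y ==> Act P (inv[P] g) y = x"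
  using act_inv by blast

lemma cancel_simps [simp]:
  assumes "g : gp P" "h : gp P"
  shows "inv[P] g *[P] (g *[P] h) = h" "g *[P] (inv[P] g *[P] h) = h"
    "h *[P] inv[P] g *[P] g = h" "h *[P] g *[P] inv[P] g = h"
  using assms m_assoc[of "inv[P] g" g h] m_assoc[of g "inv[P] g" h]
  by (simp_all add: m_assoc)

end

lemma zcellI [simp]: "zc P ==> zcell P"
  by (simp add: zcell_def zcell_axioms_def is_zero_cell_def)

text \<open>\<open>group_action\<close> asks for a homomorphism into the group of extensional
  bijections of the point set, which is the source of the hypothesis \<open>ext\<close>. Bijectivity
  comes from the action of the inverse.\<close>

lemma zcI:
  assumes G: "group (Grp P)" and f: "finite (gp P)" "finite (Pts P)"
    and ext: "!!g. g : gp P ==> Act P g : extensional (Pts P)"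
    and cl: "!!g x. g : gp P ==> x : Pts P ==> Act P g x : Pts P"
    and one: "!!x. x : Pts P ==> Act P 1[P] x = x"
    and mult: "!!g h x. g : gp P ==> h : gp P ==> x : Pts P ==> Act P (g *[P] h) x = Act P g (Act P h x)"
  shows "zc P"
proof -
  interpret group "Grp P" by (rule G)
  have inv: "Act P (inv[P] g) (Act P g x) = x" "Act P g (Act P (inv[P] g) x) = x"
    if "g : gp P" "x : Pts P" for g x
    using that mult[of "inv[P] g" g x] mult[of g "inv[P] g" x] one by simp_all
  have b: "Act P g : Bij (Pts P)" if "g : gp P" for g
  proof -
    have "bij_betw (Act P g) (Pts P) (Pts P)"
      by (rule bij_betw_byWitness[of _ "Act P (inv[P] g)"]) (use that inv cl in auto)
    then show ?thesis using ext[OF that] by (simp add: Bij_def)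
  qed
  have "Act P : hom (Grp P) (BijGroup (Pts P))"
    using b mult cl ext
    by (auto simp: hom_def BijGroup_def compose_def fun_eq_iff restrict_def extensional_def)
  then have "group_action (Grp P) (Pts P) (Act P)"
    by (simp add: group_action_def group_hom_def group_hom_axioms_def G group_BijGroup)
  then show ?thesis using G f by (simp add: is_zero_cell_def)
qed

section \<open>1-cells and 2-cells as functors and natural transformations\<close>

lemma ocD:
  assumes "oc P Q a"
  shows "x : Pts P ==> Fn a x : Pts Q" and "x : Pts P ==> g : gp P ==> Tw a x g : gp Q"
    and "x : Pts P ==> g : gp P ==> Fn a (Act P g x) = Act Q (Tw a x g) (Fn a x)"
    and "x : Pts P ==> g : gp P ==> g' : gp P ==> Tw a x (g *[P] g') = Tw a (Act P g' x) g *[Q] Tw a x g'"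
  using assms by (auto simp: is_one_cell_def)

lemma ocI:
  assumes "!!x. x : Pts P ==> Fn a x : Pts Q" and "!!x g. x : Pts P ==> g : gp P ==> Tw a x g : gp Q"
    and "!!x g. x : Pts P ==> g : gp P ==> Fn a (Act P g x) = Act Q (Tw a x g) (Fn a x)"
    and "!!x g g'. x : Pts P ==> g : gp P ==> g' : gp P ==> Tw a x (g *[P] g') = Tw a (Act P g' x) g *[Q] Tw a x g'"
  shows "oc P Q a"
  using assms by (auto simp: is_one_cell_def)

text \<open>The cocycle condition at the unit makes its image idempotent, and the only idempotent of
  a group is the unit.\<close>

lemma one_cell_one:
  assumes P: "zc P" and Q: "zc Q" and a: "oc P Q a" and x: "x : Pts P"
  shows "Tw a x 1[P] = 1[Q]"
proof -
  interpret P: zcell P + Q: zcell Q by (simp_all add: P Q)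
  have "Tw a x 1[P] *[Q] Tw a x 1[P] = Tw a x 1[P]"
    using ocD(4)[OF a x, of "1[P]" "1[P]"] x by simp
  then show ?thesis using ocD(2)[OF a x] by (metis P.one_closed Q.r_cancel_one')
qed

lemma is_two_cell_iff:
  assumes P: "zc P" and Q: "zc Q" and a: "oc P Q a" and a': "oc P Q a'"
  shows "is_two_cell P Q a a' e \<longleftrightarrow> (ALL x:Pts P. e x : gp Q) & (ALL x:Pts P. Act Q (e x) (Fn a x) = Fn a' x) &
    (ALL x:Pts P. ALL g:gp P. e (Act P g x) *[Q] Tw a x g = Tw a' x g *[Q] e x)"
proof -
  interpret P: zcell P + Q: zcell Q by (simp_all add: P Q)
  have "e (Act P g x) *[Q] Tw a x g *[Q] inv[Q] (e x) = Tw a' x g \<longleftrightarrow>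
      e (Act P g x) *[Q] Tw a x g = Tw a' x g *[Q] e x"
    if "ALL x:Pts P. e x : gp Q" "x : Pts P" "g : gp P" for x g
    using that ocD(2)[OF a that(2,3)] ocD(2)[OF a' that(2,3)]
    by (metis P.act_closed Q.cancel_simps(3,4) Q.m_closed Q.inv_closed)
  then show ?thesis unfolding is_two_cell_def by (auto 4 4)
qed

text \<open>For two 1-cells this is equality of the morphisms of \<open>CC\<close> that they
  represent, see \<open>c_arr_eq_iff\<close>.\<close>

definition iso2 :: "zero_cell => zero_cell => one_cell => one_cell => bool" where
  "iso2 P Q a a' \<longleftrightarrow> oc P Q a & oc P Q a' & (EX e. is_two_cell P Q a a' e)"

text \<open>A named 2-cell, with naturality freed from the inverse so that it rewrites as a
  commuting square.\<close>

definition cell2 :: "zero_cell => zero_cell => one_cell => one_cell => (pt => pt) => bool" where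
  "cell2 P Q a a' e \<longleftrightarrow> oc P Q a & oc P Q a' & (ALL x:Pts P. e x : gp Q) &
    (ALL x:Pts P. Act Q (e x) (Fn a x) = Fn a' x) &
    (ALL x:Pts P. ALL g:gp P. e (Act P g x) *[Q] Tw a x g = Tw a' x g *[Q] e x)"

lemma cell2D:
  assumes "cell2 P Q a a' e"
  shows "oc P Q a" "oc P Q a'" "x : Pts P ==> e x : gp Q" "x : Pts P ==> Act Q (e x) (Fn a x) = Fn a' x"
    "x : Pts P ==> g : gp P ==> e (Act P g x) *[Q] Tw a x g = Tw a' x g *[Q] e x"
  using assms by (auto simp: cell2_def)

lemma iso2_iff: "zc P ==> zc Q ==> iso2 P Q a a' \<longleftrightarrow> (EX e. cell2 P Q a a' e)"
  unfolding iso2_def cell2_def using is_two_cell_iff by blast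

lemma iso2I:
  assumes P: "zc P" and Q: "zc Q" and a: "oc P Q a" and a': "oc P Q a'"
    and "!!x. x : Pts P ==> e x : gp Q" "!!x. x : Pts P ==> Act Q (e x) (Fn a x) = Fn a' x"
    "!!x g. x : Pts P ==> g : gp P ==> e (Act P g x) *[Q] Tw a x g = Tw a' x g *[Q] e x"
  shows "iso2 P Q a a'"
  unfolding iso2_iff[OF P Q] cell2_def using assms(3-) by blast

lemma iso2E:
  assumes "iso2 P Q a a'" "zc P" "zc Q"
  obtains e where "cell2 P Q a a' e"
  using assms iso2_iff by blast

lemma iso2_cells: "iso2 P Q a a' ==> oc P Q a" "iso2 P Q a a' ==> oc P Q a'"
  by (auto simp: iso2_def)

text \<open>1-cells are total functions with arbitrary values off the carriers; the identity 2-cell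
  identifies those that agree on the carriers.\<close>

lemma iso2_eq_on:
  assumes P: "zc P" and Q: "zc Q" and a: "oc P Q a" and a': "oc P Q a'"
    and "!!x. x : Pts P ==> Fn a x = Fn a' x" "!!x g. x : Pts P ==> g : gp P ==> Tw a x g = Tw a' x g"
  shows "iso2 P Q a a'"
proof -
  interpret Q: zcell Q by (rule zcellI[OF Q])
  show ?thesis
    by (rule iso2I[OF P Q a a', of "%x. 1[Q]"])
      (use assms(5,6) ocD(1,2)[OF a] ocD(1,2)[OF a'] in auto)
qed

lemma iso2_refl: "zc P ==> zc Q ==> oc P Q a ==> iso2 P Q a a"
  by (rule iso2_eq_on; simp)

lemma iso2_sym:
  assumes P: "zc P" and Q: "zc Q" and i: "iso2 P Q a a'"
  shows "iso2 P Q a' a"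
proof -
  interpret P: zcell P + Q: zcell Q by (simp_all add: P Q)
  obtain e where "cell2 P Q a a' e" using iso2E[OF i P Q] .
  note e = cell2D[OF this]
  show ?thesis
  proof (rule iso2I[OF P Q e(2,1), of "%x. inv[Q] (e x)"])
    fix x g assume x: "x : Pts P" "g : gp P"
    have c: "e (Act P g x) : gp Q" "Tw a x g : gp Q" "Tw a' x g : gp Q" "e x : gp Q"
      using x e ocD(2)[OF e(1) x] ocD(2)[OF e(2) x] by auto
    have "Tw a x g *[Q] inv[Q] (e x) = inv[Q] (e (Act P g x)) *[Q] (e (Act P g x) *[Q] Tw a x g) *[Q] inv[Q] (e x)"
      using c by (simp del: Q.m_assoc)
    also have "... = inv[Q] (e (Act P g x)) *[Q] Tw a' x g"
      using c by (simp add: e(5)[OF x] Q.m_assoc)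
    finally show "inv[Q] (e (Act P g x)) *[Q] Tw a' x g = Tw a x g *[Q] inv[Q] (e x)" by simp
  qed (use e ocD(1)[OF e(1)] Q.act_eqD in auto)
qed

lemma iso2_trans [trans]:
  assumes P: "zc P" and Q: "zc Q" and i: "iso2 P Q a b" and j: "iso2 P Q b c"
  shows "iso2 P Q a c"
proof -
  interpret P: zcell P + Q: zcell Q by (simp_all add: P Q)
  obtain e where "cell2 P Q a b e" using iso2E[OF i P Q] .
  note e = cell2D[OF this]
  obtain d where "cell2 P Q b c d" using iso2E[OF j P Q] .
  note d = cell2D[OF this]
  show ?thesis
  proof (rule iso2I[OF P Q e(1) d(2), of "%x. d x *[Q] e x"])
    fix x g assume x: "x : Pts P" "g : gp P"
    have cl: "e (Act P g x) : gp Q" "d (Act P g x) : gp Q" "Tw a x g : gp Q" "Tw b x g : gp Q" "Tw c x g : gp Q" "e x : gp Q" "d x : gp Q"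
      using x e d ocD(2)[OF e(1) x] ocD(2)[OF e(2) x] ocD(2)[OF d(2) x] by auto
    have "d (Act P g x) *[Q] e (Act P g x) *[Q] Tw a x g = d (Act P g x) *[Q] (Tw b x g *[Q] e x)"
      using cl by (simp add: Q.m_assoc e(5)[OF x])
    also have "... = Tw c x g *[Q] (d x *[Q] e x)"
      using cl d(5)[OF x] by (simp add: Q.m_assoc[symmetric])
    finally show "d (Act P g x) *[Q] e (Act P g x) *[Q] Tw a x g = Tw c x g *[Q] (d x *[Q] e x)" .
  qed (use e d ocD(1)[OF e(1)] Q.act_mult in auto)
qed

lemma id_cell_simps [simp]: "Fn id_cell x = x" "Tw id_cell x g = g"
  by (simp_all add: id_cell_def)

lemma oo_simps [simp]: "Fn (b oo a) x = Fn b (Fn a x)"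
  "Tw (b oo a) x g = Tw b (Fn a x) (Tw a x g)"
  by (simp_all add: comp_cell_def)

lemma oc_eqI:
  assumes "!!x. Fn a x = Fn b x" "!!x g. Tw a x g = Tw b x g"
  shows "(a :: one_cell) = b"
  using assms by (cases a, cases b) (auto simp: fun_eq_iff)

lemma oo_assoc: "c oo (b oo a) = (c oo b) oo a"
  by (simp add: comp_cell_def)

lemma comp_cell_id [simp]: "a oo id_cell = a" "id_cell oo a = a"
  by (rule oc_eqI; simp)+

lemma oc_id: "oc P P id_cell"
  by (simp add: is_one_cell_def)

lemma oc_comp:
  assumes "zc P" "oc P Q a" "oc Q R b"
  shows "oc P R (b oo a)"
proof (rule ocI)
  fix x g g' assume x: "x : Pts P" "g : gp P" "g' : gp P"
  note a = ocD[OF assms(2)]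
  show "Tw (b oo a) x (g *[P] g') = Tw (b oo a) (Act P g' x) g *[R] Tw (b oo a) x g'"
    using x ocD(4)[OF assms(3), of "Fn a x" "Tw a (Act P g' x) g" "Tw a x g'"] a
      zcell.act_closed[OF zcellI[OF assms(1)] x(3,1)] by simp
qed (use ocD[OF assms(2)] ocD[OF assms(3)] in auto)

text \<open>Horizontal composition as two whiskerings: first \<open>b\<close> is applied to the
  2-cell \<open>e\<close>, then the 2-cell \<open>d\<close> is restricted along
  \<open>a'\<close>.\<close>

lemma iso2_comp:
  assumes P: "zc P" and Q: "zc Q" and R: "zc R"
    and i: "iso2 P Q a a'" and j: "iso2 Q R b b'"
  shows "iso2 P R (b oo a) (b' oo a')"
proof -
  interpret P: zcell P + Q: zcell Q + R: zcell R by (simp_all add: P Q R)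
  obtain e where "cell2 P Q a a' e" using iso2E[OF i P Q] .
  note e = cell2D[OF this]
  obtain d where "cell2 Q R b b' d" using iso2E[OF j Q R] .
  note d = cell2D[OF this]
  note a = ocD[OF e(1)] and a' = ocD[OF e(2)] and b = ocD[OF d(1)] and b' = ocD[OF d(2)]
  have ba: "iso2 P R (b oo a) (b oo a')"
  proof (rule iso2I[OF P R oc_comp[OF P e(1) d(1)] oc_comp[OF P e(2) d(1)], of "%x. Tw b (Fn a x) (e x)"])
    fix x g assume x: "x : Pts P" "g : gp P"
    have "Tw b (Fn a (Act P g x)) (e (Act P g x)) *[R] Tw b (Fn a x) (Tw a x g) = Tw b (Fn a x) (e (Act P g x) *[Q] Tw a x g)"
      using x a e(3) b(4)[of "Fn a x" "e (Act P g x)" "Tw a x g"] by simp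
    also have "... = Tw b (Fn a' x) (Tw a' x g) *[R] Tw b (Fn a x) (e x)"
      unfolding e(5)[OF x] using x a a' e(3,4) b(4)[of "Fn a x" "Tw a' x g" "e x"] by simp
    finally show "Tw b (Fn a (Act P g x)) (e (Act P g x)) *[R] Tw (b oo a) x g =
         Tw (b oo a') x g *[R] Tw b (Fn a x) (e x)" by simp
  qed (use a b e(3,4) in "auto simp flip: b(3)")
  have "iso2 P R (b oo a') (b' oo a')"
    by (rule iso2I[OF P R oc_comp[OF P e(2) d(1)] oc_comp[OF P e(2) d(2)], of "%x. d (Fn a' x)"])
      (use a' b b' d(3,4,5) in "auto simp: a'(3)")
  then show ?thesis by (rule iso2_trans[OF P R ba])
qed

subsection \<open>The category \<open>CC\<close>\<close>

lemma c_arr_sel [simp]: "cdom (c_arr P Q a) = P" "ccod (c_arr P Q a) = Q"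
  by (simp_all add: c_arr_def)

lemma c_arr_eq_iff:
  assumes P: "zc P" and Q: "zc Q" and a: "oc P Q a"
  shows "c_arr P Q a = c_arr P Q b & oc P Q b \<longleftrightarrow> iso2 P Q a b"
proof
  assume h: "c_arr P Q a = c_arr P Q b & oc P Q b"
  then have "b : ccls (c_arr P Q b)" using iso2_refl[OF P Q] by (auto simp: c_arr_def iso2_def)
  then have "b : ccls (c_arr P Q a)" using h by simp
  then show "iso2 P Q a b" using a by (auto simp: c_arr_def iso2_def)
next
  assume i: "iso2 P Q a b"
  have "oc P Q c & (EX e. is_two_cell P Q a c e) \<longleftrightarrow> oc P Q c & (EX e. is_two_cell P Q b c e)" for c
    using iso2_trans[OF P Q i, of c] iso2_trans[OF P Q iso2_sym[OF P Q i], of c] iso2_cells[OF i]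
    unfolding iso2_def by blast
  then show "c_arr P Q a = c_arr P Q b & oc P Q b"
    using iso2_cells[OF i] by (simp add: c_arr_def)
qed

lemma c_arr_eqI: "zc P ==> zc Q ==> iso2 P Q a b ==> c_arr P Q a = c_arr P Q b"
  using c_arr_eq_iff iso2_cells by blast

lemma c_arr_eqD:
  "zc P ==> zc Q ==> oc P Q a ==> oc P Q b ==>
    c_arr P Q a = c_arr P Q b ==> iso2 P Q a b"
  using c_arr_eq_iff by blast

lemma c_rep_iso2:
  assumes "zc P" "zc Q" "oc P Q a"
  shows "iso2 P Q a (c_rep (c_arr P Q a))"
proof -
  have "a : ccls (c_arr P Q a)" using iso2_refl[OF assms] by (simp add: c_arr_def iso2_def)
  then have "c_rep (c_arr P Q a) : ccls (c_arr P Q a)" unfolding c_rep_def by (rule someI)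
  then show ?thesis using assms(3) by (auto simp: c_arr_def iso2_def)
qed

lemma CC_simps [simp]: "src CC = cdom" "tgt CC = ccod" "ob CC = {P. zc P}"
  "idn CC P = c_arr P P id_cell"
  by (simp_all add: CC_def)

lemma ar_CC_iff: "f : ar CC \<longleftrightarrow> (EX P Q a. zc P & zc Q & oc P Q a & f = c_arr P Q a)"
  by (auto simp: CC_def)

lemma c_arr_in [simp]: "zc P ==> zc Q ==> oc P Q a ==> c_arr P Q a : ar CC"
  by (auto simp: ar_CC_iff)

lemma arr_CC:
  "f : arrows CC P Q \<longleftrightarrow> zc P & zc Q & (EX a. oc P Q a & f = c_arr P Q a)"
  by (auto simp: arrows_def ar_CC_iff)

lemma c_arr_arrows [simp]: "zc P ==> zc Q ==> oc P Q a ==> c_arr P Q a : arrows CC P Q"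
  by (auto simp: arr_CC)

text \<open>Composition in \<open>CC\<close> uses chosen representatives; by
  \<open>iso2_comp\<close> the given ones yield the same class.\<close>

lemma c_comp:
  assumes P: "zc P" and Q: "zc Q" and R: "zc R"
    and a: "oc P Q a" and b: "oc Q R b"
  shows "c_arr Q R b o[CC] c_arr P Q a = c_arr P R (b oo a)"
  using c_arr_eqI[OF P R iso2_comp[OF P Q R c_rep_iso2[OF P Q a] c_rep_iso2[OF Q R b]]]
  by (simp add: CC_def)

lemma cat_CC: "is_category CC"
proof -
  have obt: "EX a. oc P Q a & f = c_arr P Q a & zc P & zc Q" if "f : ar CC" "cdom f = P" "ccod f = Q" for f P Q
    using that by (auto simp: ar_CC_iff)
  show ?thesis
    unfolding is_category_def
  proof (intro conjI ballI impI)
    fix f g assume f: "f : ar CC" "g : ar CC" "tgt CC f = src CC g"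
    obtain a where a: "oc (cdom f) (cdom g) a" "f = c_arr (cdom f) (cdom g) a"
        "zc (cdom f)" "zc (cdom g)"
      using obt[OF f(1) refl] f(3) by auto
    obtain b where b: "oc (cdom g) (ccod g) b" "g = c_arr (cdom g) (ccod g) b" "zc (ccod g)"
      using obt[OF f(2) refl refl] by auto
    have gf: "g o[CC] f = c_arr (cdom f) (ccod g) (b oo a)"
      using c_comp[OF a(3,4) b(3) a(1) b(1)] a(2) b(2) by simp
    then show "g o[CC] f : arrows CC (src CC f) (tgt CC g)"
      using oc_comp[OF a(3,1) b(1)] a(3) b(3) by (auto simp: arr_CC)
    fix h assume h: "h : ar CC" "tgt CC g = src CC h"
    obtain c where c: "oc (ccod g) (ccod h) c" "h = c_arr (ccod g) (ccod h) c" "zc (ccod h)"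
      using obt[OF h(1) refl refl] h(2) by auto
    have hg: "h o[CC] g = c_arr (cdom g) (ccod h) (c oo b)"
      using c_comp[OF a(4) b(3) c(3) b(1) c(1)] c(2) b(2) by simp
    show "h o[CC] (g o[CC] f) = (h o[CC] g) o[CC] f"
      unfolding gf hg
      using c_comp[OF a(3) b(3) c(3) oc_comp[OF a(3,1) b(1)] c(1)]
        c_comp[OF a(3,4) c(3) a(1) oc_comp[OF a(4) b(1) c(1)]] a(2) c(2)
      by (simp add: oo_assoc)
  qed (auto simp: ar_CC_iff c_comp oc_id)
qed

subsection \<open>Full, faithful and essentially surjective 1-cells\<close>

text \<open>In the action groupoid, \<open>g\<close> is a morphism from \<open>x\<close> to
  \<open>Act P g x\<close>. This and the next two definitions are the usual properties of functors,
  and \<open>eqv\<close> is an equivalence of groupoids.\<close>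

definition full :: "zero_cell => zero_cell => one_cell => bool" where
  "full P Q a \<longleftrightarrow> (ALL x:Pts P. ALL x':Pts P. ALL h:gp Q. Act Q h (Fn a x) = Fn a x' -->
     (EX g:gp P. Act P g x = x' & Tw a x g = h))"

definition faithful :: "zero_cell => zero_cell => one_cell => bool" where
  "faithful P Q a \<longleftrightarrow> (ALL x:Pts P. ALL g:gp P. ALL g':gp P. Act P g x = Act P g' x --> Tw a x g = Tw a x g' --> g = g')"

definition eso :: "zero_cell => zero_cell => one_cell => bool" where
  "eso P Q a \<longleftrightarrow> (ALL y:Pts Q. EX x:Pts P. EX h:gp Q. Act Q h (Fn a x) = y)"

definition eqv :: "zero_cell => zero_cell => one_cell => bool" where
  "eqv P Q a \<longleftrightarrow> oc P Q a & full P Q a & faithful P Q a & eso P Q a"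

lemmas fullD = full_def[THEN iffD1, rule_format]

lemmas faithfulD = faithful_def[THEN iffD1, rule_format]

lemmas eso_cellD = eso_def[THEN iffD1, rule_format]

text \<open>A pair \<open>h\<close>, \<open>h'\<close> with equal values amounts to the single
  morphism \<open>inv[Q] h' *[Q] h\<close> from \<open>Fn a x\<close> to \<open>Fn a x'\<close>, and
  the condition on pairs says that this morphism lifts.\<close>

lemma stab_surjective_iff:
  assumes P: "zc P" and Q: "zc Q" and a: "oc P Q a"
  shows "stab_surjective P Q a \<longleftrightarrow> full P Q a & eso P Q a"
proof -
  interpret P: zcell P + Q: zcell Q by (simp_all add: P Q)
  show ?thesis
  proof (intro iffI conjI)
    assume s: "stab_surjective P Q a"
    show "eso P Q a" using s unfolding stab_surjective_def eso_def by metis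
    show "full P Q a"
      unfolding full_def
    proof (intro ballI impI)
      fix x x' h assume h: "x : Pts P" "x' : Pts P" "h : gp Q" "Act Q h (Fn a x) = Fn a x'"
      have "Act Q h (Fn a x) = Act Q 1[Q] (Fn a x')" using h ocD(1)[OF a] by simp
      then obtain g where "g : gp P" "x' = Act P g x" "h = 1[Q] *[Q] Tw a x g"
        using s h unfolding stab_surjective_def by blast
      then show "EX g:gp P. Act P g x = x' & Tw a x g = h" using ocD(2)[OF a h(1)] by auto
    qed
  next
    assume s: "full P Q a & eso P Q a"
    show "stab_surjective P Q a"
      unfolding stab_surjective_def
    proof (intro conjI ballI impI)
      fix y assume "y : Pts Q" then show "EX h: gp Q. EX x:Pts P. y = Act Q h (Fn a x)"
        using s unfolding eso_def by metis
    next
      fix h h' x x' assume h: "h : gp Q" "h' : gp Q" "x : Pts P" "x' : Pts P" "Act Q h (Fn a x) = Act Q h' (Fn a x')"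
      have "Act Q (inv[Q] h' *[Q] h) (Fn a x) = Fn a x'"
        using h ocD(1)[OF a] by (simp add: Q.act_mult)
      then obtain g where "g : gp P" "Act P g x = x'" "Tw a x g = inv[Q] h' *[Q] h"
        using s h fullD[of P Q a x x' "inv[Q] h' *[Q] h"] by auto
      then show "EX g: gp P. x' = Act P g x & h = h' *[Q] Tw a x g" using h by auto
    qed
  qed
qed

lemma iso_cell_full_faithful_eso:
  assumes P: "zc P" and Q: "zc Q" and a: "oc P Q a" and b: "oc Q P b"
    and ba: "iso2 P P (b oo a) id_cell" and ab: "iso2 Q Q (a oo b) id_cell"
  shows "eqv P Q a"
proof -
  interpret P: zcell P + Q: zcell Q by (simp_all add: P Q)
  \<comment> \<open>A left inverse up to a 2-cell forces faithfulness. Applied to both composites it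
    gives faithfulness of \<open>a\<close> and of \<open>b\<close>.\<close>
  have key: "faithful P Q a"
    if P: "zc P" and Q: "zc Q" and a: "oc P Q a" and b: "oc Q P b"
      and ba: "iso2 P P (b oo a) id_cell" for P Q a b
  proof -
    interpret P: zcell P by (rule zcellI[OF P])
    obtain e where "cell2 P P (b oo a) id_cell e" using iso2E[OF ba P P] .
  note e = cell2D(3-5)[OF this, unfolded oo_simps id_cell_simps]
    show ?thesis unfolding faithful_def
      by (metis P.right_cancel P.act_closed e(1,3))
  qed
  have fa: "faithful P Q a" by (rule key[OF P Q a b ba])
  have fb: "faithful Q P b" by (rule key[OF Q P b a ab])
  obtain e where "cell2 P P (b oo a) id_cell e" using iso2E[OF ba P P] .
  note e = cell2D(3-5)[OF this, unfolded oo_simps id_cell_simps]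
  obtain d where "cell2 Q Q (a oo b) id_cell d" using iso2E[OF ab Q Q] .
  note d = cell2D(3-5)[OF this, unfolded oo_simps id_cell_simps]
  have "eso P Q a" unfolding eso_def using d ocD(1)[OF b] by blast
  moreover have "full P Q a"
    unfolding full_def
  proof (intro ballI impI)
    fix x x' h assume h: "x : Pts P" "x' : Pts P" "h : gp Q" "Act Q h (Fn a x) = Fn a x'"
    note c = ocD[OF a] ocD[OF b]
    \<comment> \<open>The image of \<open>h\<close> under \<open>b\<close>, conjugated by the 2-cell
      so that it runs from \<open>x\<close> to \<open>x'\<close>. Faithfulness of \<open>b\<close>
      then shows that \<open>a\<close> sends it to \<open>h\<close>.\<close>
    define g where "g = e x' *[P] Tw b (Fn a x) h *[P] inv[P] (e x)"
    have bh: "Tw b (Fn a x) h : gp P" using c h by simp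
    have g: "g : gp P" unfolding g_def using e h bh by simp
    have gx: "Act P g x = x'"
    proof -
      have "Act P (inv[P] (e x)) x = Fn b (Fn a x)" using P.act_eqD e h c by simp
      then have "Act P g x = Act P (e x') (Act P (Tw b (Fn a x) h) (Fn b (Fn a x)))"
        unfolding g_def using e h bh by (simp add: P.act_mult c)
      also have "... = x'" using e(2)[OF h(2)] c(7)[of "Fn a x" h] h c(1)[OF h(1)] by simp
      finally show ?thesis .
    qed
    have "e x' *[P] Tw b (Fn a x) (Tw a x g) = e x' *[P] Tw b (Fn a x) h"
      using e(3)[OF h(1) g] gx e(1) h bh by (simp add: g_def P.m_assoc)
    then have "Tw b (Fn a x) (Tw a x g) = Tw b (Fn a x) h" using e(1)[OF h(2)] bh c h g by simp
    moreover have "Act Q (Tw a x g) (Fn a x) = Act Q h (Fn a x)" using c(3)[OF h(1) g] gx h by simp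
    ultimately have "Tw a x g = h" using faithfulD[OF fb, of "Fn a x" "Tw a x g" h] c h g by simp
    then show "EX g: gp P. Act P g x = x' & Tw a x g = h" using g gx by blast
  qed
  ultimately show ?thesis using fa a by (simp add: eqv_def)
qed

text \<open>For every \<open>y\<close> a point \<open>r y\<close> and a morphism \<open>h y\<close>
  from \<open>Fn a (r y)\<close> to \<open>y\<close> are chosen. Fullness lifts the conjugates of
  morphisms by \<open>h\<close> to \<open>T\<close>; faithfulness reduces the cocycle condition for
  \<open>T\<close> to one that can be checked after applying \<open>a\<close>.\<close>

lemma equiv_cell_inverse:
  assumes P: "zc P" and Q: "zc Q" and eq: "eqv P Q a"
  obtains b where "oc Q P b" "iso2 P P (b oo a) id_cell" "iso2 Q Q (a oo b) id_cell"
proof -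
  interpret P: zcell P + Q: zcell Q by (simp_all add: P Q)
  have a: "oc P Q a" and fu: "full P Q a" and fa: "faithful P Q a" and es: "eso P Q a"
    using eq by (auto simp: eqv_def)
  note c = ocD[OF a]
  obtain r h where r: "!!y. y : Pts Q ==> r y : Pts P" "!!y. y : Pts Q ==> h y : gp Q" "!!y. y : Pts Q ==> Act Q (h y) (Fn a (r y)) = y"
    using eso_cellD[OF es] by metis
  have "EX u. u : gp P & Act P u (r y) = r (Act Q g y) & Tw a (r y) u = inv[Q] (h (Act Q g y)) *[Q] g *[Q] h y"
    if y: "y : Pts Q" "g : gp Q" for y g
  proof -
    have "Act Q (inv[Q] (h (Act Q g y)) *[Q] g *[Q] h y) (Fn a (r y)) = Fn a (r (Act Q g y))"
      using y r c Q.act_eqD[OF r(2) _ r(3)[OF Q.act_closed[OF y(2,1)]]] by (simp add: Q.act_mult)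
    then show ?thesis
      using fullD[OF fu, of "r y" "r (Act Q g y)" "inv[Q] (h (Act Q g y)) *[Q] g *[Q] h y"] y r by auto
  qed
  then obtain T where T: "!!y g. y : Pts Q ==> g : gp Q ==> T y g : gp P"
    "!!y g. y : Pts Q ==> g : gp Q ==> Act P (T y g) (r y) = r (Act Q g y)"
    "!!y g. y : Pts Q ==> g : gp Q ==> Tw a (r y) (T y g) = inv[Q] (h (Act Q g y)) *[Q] g *[Q] h y"
    by metis
  define b where "b = \<lparr> Fn = r, Tw = T \<rparr>"
  have bs: "Fn b = r" "Tw b = T" by (simp_all add: b_def)
  have b: "oc Q P b"
  proof (rule ocI)
    fix y g g' assume y: "y : Pts Q" "g : gp Q" "g' : gp Q"
    have "T y (g *[Q] g') = T (Act Q g' y) g *[P] T y g'"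
    proof (rule faithfulD[OF fa])
      show "Tw a (r y) (T y (g *[Q] g')) = Tw a (r y) (T (Act Q g' y) g *[P] T y g')"
        using y r T c(4)[of "r y" "T (Act Q g' y) g" "T y g'"] by (simp add: Q.m_assoc Q.act_mult)
    qed (use y r T in "simp_all add: P.act_mult Q.act_mult")
    then show "Tw b y (g *[Q] g') = Tw b (Act Q g' y) g *[P] Tw b y g'" by (simp add: bs)
  qed (use r T in "auto simp: bs")
  have ab: "iso2 Q Q (a oo b) id_cell"
    by (rule iso2I[OF Q Q oc_comp[OF Q b a] oc_id, of h]) (use r T c in "auto simp: bs Q.m_assoc")
  \<comment> \<open>The 2-cell from \<open>b oo a\<close> to the identity is the lift of
    \<open>h\<close> at \<open>Fn a x\<close> through the full 1-cell \<open>a\<close>.\<close>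
  have "EX u. u : gp P & Act P u (r (Fn a x)) = x & Tw a (r (Fn a x)) u = h (Fn a x)" if "x : Pts P" for x
    using fullD[OF fu, of "r (Fn a x)" x "h (Fn a x)"] that r c by auto
  then obtain d where d: "!!x. x : Pts P ==> d x : gp P" "!!x. x : Pts P ==> Act P (d x) (r (Fn a x)) = x"
    "!!x. x : Pts P ==> Tw a (r (Fn a x)) (d x) = h (Fn a x)" by metis
  have ba: "iso2 P P (b oo a) id_cell"
  proof (rule iso2I[OF P P oc_comp[OF P a b] oc_id, of d])
    fix x g assume x: "x : Pts P" "g : gp P"
    have t: "T (Fn a x) (Tw a x g) : gp P" "Act P (T (Fn a x) (Tw a x g)) (r (Fn a x)) = r (Fn a (Act P g x))"
      using T[of "Fn a x" "Tw a x g"] x c by auto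
    have "d (Act P g x) *[P] T (Fn a x) (Tw a x g) = g *[P] d x"
    proof (rule faithfulD[OF fa, of "r (Fn a x)"])
      show "Tw a (r (Fn a x)) (d (Act P g x) *[P] T (Fn a x) (Tw a x g)) = Tw a (r (Fn a x)) (g *[P] d x)"
        using x r c(1,2,4) d t T(3)[of "Fn a x" "Tw a x g"] by (simp add: Q.m_assoc flip: c(3))
    qed (use x r c(1,2) d t in "simp_all add: P.act_mult")
    then show "d (Act P g x) *[P] Tw (b oo a) x g = Tw id_cell x g *[P] d x" by (simp add: bs)
  qed (use d in "auto simp: bs")
  show ?thesis by (rule that[OF b ba ab])
qed

lemma is_iso_CC_iff:
  assumes P: "zc P" and Q: "zc Q" and a: "oc P Q a"
  shows "is_iso CC (c_arr P Q a) \<longleftrightarrow> eqv P Q a"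
proof
  assume "is_iso CC (c_arr P Q a)"
  then obtain b where b: "oc Q P b" "c_arr P P (b oo a) = c_arr P P id_cell" "c_arr Q Q (a oo b) = c_arr Q Q id_cell"
    using P Q a by (auto simp: is_iso_def arr_CC c_comp)
  have "iso2 P P (b oo a) id_cell"
    by (rule c_arr_eqD[OF P P oc_comp[OF P a b(1)] oc_id b(2)])
  moreover have "iso2 Q Q (a oo b) id_cell"
    by (rule c_arr_eqD[OF Q Q oc_comp[OF Q b(1) a] oc_id b(3)])
  ultimately show "eqv P Q a" by (rule iso_cell_full_faithful_eso[OF P Q a b(1)])
next
  assume "eqv P Q a"
  then obtain b where b: "oc Q P b" "iso2 P P (b oo a) id_cell" "iso2 Q Q (a oo b) id_cell"
    using equiv_cell_inverse[OF P Q] by metis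
  then have "c_arr Q P b : arrows CC Q P" "c_arr Q P b o[CC] c_arr P Q a = c_arr P P id_cell" "c_arr P Q a o[CC] c_arr Q P b = c_arr Q Q id_cell"
    using P Q a c_arr_eqI[OF P P b(2)] c_arr_eqI[OF Q Q b(3)] by (auto simp: arr_CC c_comp)
  then show "is_iso CC (c_arr P Q a)" using P Q a by (auto simp: is_iso_def)
qed

subsection \<open>Products\<close>

lemma prod_sel:
  "gp (P ** Q) = {PPair g h | g h. g : gp P & h : gp Q}"
  "Pts (P ** Q) = {PPair x y | x y. x : Pts P & y : Pts Q}"
  "PPair g h *[P ** Q] PPair g' h' = PPair (g *[P] g') (h *[Q] h')"
  "1[P ** Q] = PPair 1[P] 1[Q]"
  "x : Pts P ==> y : Pts Q ==> Act (P ** Q) (PPair g h) (PPair x y) = PPair (Act P g x) (Act Q h y)"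
  by (simp_all add: prod_cell_def Let_def)

lemma finite_PPair: "finite A ==> finite B ==> finite {PPair x y | x y. x : A & y : B}"
  by (rule finite_subset[of _ "(%(x, y). PPair x y) ` (A \<times> B)"]) auto

lemma prod_group:
  assumes "group (Grp P)" "group (Grp Q)"
  shows "group (Grp (P ** Q))"
proof -
  interpret P: group "Grp P" by fact
  interpret Q: group "Grp Q" by fact
  show ?thesis
  proof (rule groupI)
    fix u assume "u : gp (P ** Q)"
    then obtain g h where u: "u = PPair g h" "g : gp P" "h : gp Q" by (auto simp: prod_sel)
    then show "EX v:gp (P ** Q). v *[P ** Q] u = 1[P ** Q]"
      by (intro bexI[of _ "PPair (inv[P] g) (inv[Q] h)"]) (auto simp: prod_sel)
  qed (auto simp: prod_sel P.m_assoc Q.m_assoc)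
qed

lemma zc_prod [simp]:
  assumes P: "zc P" and Q: "zc Q"
  shows "zc (P ** Q)"
proof -
  interpret P: zcell P + Q: zcell Q by (simp_all add: P Q)
  show ?thesis
  proof (rule zcI)
    show "group (Grp (P ** Q))" by (rule prod_group) unfold_locales
    show "finite (gp (P ** Q))" "finite (Pts (P ** Q))"
      using finite_PPair[OF P.finite_grp Q.finite_grp] finite_PPair[OF P.finite_pts Q.finite_pts]
      by (simp_all add: prod_sel)
    show "Act (P ** Q) g : extensional (Pts (P ** Q))" for g
      by (simp add: prod_cell_def Let_def)
  qed (auto simp: prod_sel P.act_mult Q.act_mult)
qed

lemma fst_cell_simps [simp]: "Fn fst_cell = pfst" "Tw fst_cell x = pfst"
  and snd_cell_simps [simp]: "Fn snd_cell = psnd" "Tw snd_cell x = psnd"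
  and pair_cell_simps [simp]: "Fn (pair_cell a b) x = PPair (Fn a x) (Fn b x)"
    "Tw (pair_cell a b) x g = PPair (Tw a x g) (Tw b x g)"
  by (simp_all add: fst_cell_def snd_cell_def pair_cell_def)

lemma oc_fst [simp]: "oc (P ** Q) P fst_cell"
  and oc_snd [simp]: "oc (P ** Q) Q snd_cell"
  by (auto intro!: ocI simp: prod_sel)

lemma pair_one_cell [simp]:
  assumes a: "oc P Q a" and b: "oc P R b"
  shows "oc P (Q ** R) (pair_cell a b)"
  using ocD[OF a] ocD[OF b] by (intro ocI) (auto simp: prod_sel)

lemma pair_iso2:
  assumes P: "zc P" and Q: "zc Q" and R: "zc R"
    and i: "iso2 P Q a a'" and j: "iso2 P R b b'"
  shows "iso2 P (Q ** R) (pair_cell a b) (pair_cell a' b')"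
proof -
  obtain e where "cell2 P Q a a' e" using iso2E[OF i P Q] .
  note e = cell2D[OF this]
  obtain d where "cell2 P R b b' d" using iso2E[OF j P R] .
  note d = cell2D[OF this]
  show ?thesis
    by (rule iso2I[OF P zc_prod[OF Q R] pair_one_cell[OF e(1) d(1)] pair_one_cell[OF e(2) d(2)],
          of "%x. PPair (e x) (d x)"])
      (use e(3-5) d(3-5) ocD(1)[OF e(1)] ocD(1)[OF d(1)] in "auto simp: prod_sel")
qed

text \<open>Off the carriers a value of \<open>a\<close> may fail to be a pair, so the two sides are
  compared by \<open>iso2\<close> instead of equality.\<close>

lemma pair_eta:
  assumes P: "zc P" and Q: "zc Q" and R: "zc R"
    and a: "oc P (Q ** R) a"
  shows "iso2 P (Q ** R) (pair_cell (fst_cell oo a) (snd_cell oo a)) a"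
proof (rule iso2_eq_on[OF P zc_prod[OF Q R] _ a])
  show "oc P (Q ** R) (pair_cell (fst_cell oo a) (snd_cell oo a))"
    by (intro pair_one_cell oc_comp[OF P a]) auto
next
  fix x assume "x : Pts P"
  then show "Fn (pair_cell (fst_cell oo a) (snd_cell oo a)) x = Fn a x"
    using ocD(1)[OF a] by (fastforce simp: prod_sel(2))
next
  fix x g assume "x : Pts P" "g : gp P"
  then have "Tw a x g : gp (Q ** R)" by (rule ocD(2)[OF a])
  then show "Tw (pair_cell (fst_cell oo a) (snd_cell oo a)) x g = Tw a x g"
    by (auto simp: prod_sel(1))
qed

definition times :: "one_cell => one_cell => one_cell" where
  "times a b = pair_cell (a oo fst_cell) (b oo snd_cell)"

lemma times_cell_simps [simp]: "Fn (times a b) z = PPair (Fn a (pfst z)) (Fn b (psnd z))"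
  "Tw (times a b) z u = PPair (Tw a (pfst z) (pfst u)) (Tw b (psnd z) (psnd u))"
  by (simp_all add: times_def)

lemma times_one_cell [simp]:
  assumes "zc P" "zc P'" "oc P Q a" "oc P' Q' b"
  shows "oc (P ** P') (Q ** Q') (times a b)"
  unfolding times_def
  by (intro pair_one_cell oc_comp[OF _ oc_fst] oc_comp[OF _ oc_snd])
    (use assms in auto)

lemma c_pair_eq:
  assumes P: "zc P" and Q: "zc Q" and R: "zc R"
    and a: "oc P Q a" and b: "oc P R b"
  shows "c_pair (c_arr P Q a) (c_arr P R b) = c_arr P (Q ** R) (pair_cell a b)"
  using c_arr_eqI[OF P zc_prod[OF Q R] pair_iso2[OF P Q R c_rep_iso2[OF P Q a] c_rep_iso2[OF P R b]]]
  by (simp add: c_pair_def)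

lemma c_times_eq:
  assumes P: "zc P" and Q: "zc Q" and P': "zc P'" and Q': "zc Q'"
    and a: "oc P Q a" and b: "oc P' Q' b"
  shows "c_times (c_arr P Q a) (c_arr P' Q' b) = c_arr (P ** P') (Q ** Q') (times a b)"
  unfolding times_def
  using c_pair_eq[OF zc_prod[OF P P'] Q Q' oc_comp[OF _ oc_fst a] oc_comp[OF _ oc_snd b]]
    c_comp[OF zc_prod[OF P P'] P Q oc_fst a] c_comp[OF zc_prod[OF P P'] P' Q' oc_snd b] P P'
  by (simp add: c_times_def c_fst_def c_snd_def)

subsection \<open>Homotopy pullbacks\<close>

text \<open>
  \<open>bpb P A B R a b p q\<close>: the square with sides \<open>p : P \<rightarrow> A\<close>, \<open>q : P \<rightarrow> B\<close> over \<open>a : A \<rightarrow> R\<close>, \<open>b : B \<rightarrow> R\<close>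
  commutes up to a 2-cell and the induced 1-cell from \<open>P\<close> to the bipullback is an equivalence.
\<close>

definition bpb_on where
  "bpb_on P A B R a b p q e \<longleftrightarrow>
     (ALL z:Pts P. e z : gp R) &
     (ALL z:Pts P. Act R (e z) (Fn a (Fn p z)) = Fn b (Fn q z)) &
     (ALL z:Pts P. ALL g:gp P. e (Act P g z) *[R] Tw a (Fn p z) (Tw p z g) = Tw b (Fn q z) (Tw q z g) *[R] e z) &
     (ALL x:Pts A. ALL y:Pts B. ALL c:gp R. Act R c (Fn a x) = Fn b y -->
        (EX z:Pts P. EX u:gp A. EX w:gp B. Act A u (Fn p z) = x & Act B w (Fn q z) = y &
           Tw b (Fn q z) w *[R] e z = c *[R] Tw a (Fn p z) u)) &
     (ALL z:Pts P. ALL z':Pts P. ALL u:gp A. ALL w:gp B.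
        Act A u (Fn p z) = Fn p z' --> Act B w (Fn q z) = Fn q z' -->
        Tw b (Fn q z) w *[R] e z = e z' *[R] Tw a (Fn p z) u -->
        (EX g:gp P. Act P g z = z' & Tw p z g = u & Tw q z g = w)) &
     (ALL z:Pts P. ALL g:gp P. ALL g':gp P. Act P g z = Act P g' z --> Tw p z g = Tw p z g' --> Tw q z g = Tw q z g' --> g = g')"

definition bpb where
  "bpb P A B R a b p q \<longleftrightarrow> zc P & zc A & zc B & zc R &
     oc A R a & oc B R b & oc P A p & oc P B q &
     (EX e. bpb_on P A B R a b p q e)"

text \<open>In the numbering used below, (1) to (3) say that \<open>e\<close> is a 2-cell filling
  the square, while (4), (5) and (6) are essential surjectivity, fullness and faithfulness of the
  comparison with the bipullback.\<close>

lemmas bpb_onD =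
  bpb_on_def[THEN iffD1, THEN conjunct1, rule_format]
  bpb_on_def[THEN iffD1, THEN conjunct2, THEN conjunct1, rule_format]
  bpb_on_def[THEN iffD1, THEN conjunct2, THEN conjunct2, THEN conjunct1, rule_format]
  bpb_on_def[THEN iffD1, THEN conjunct2, THEN conjunct2, THEN conjunct2, THEN conjunct1, rule_format]
  bpb_on_def[THEN iffD1, THEN conjunct2, THEN conjunct2, THEN conjunct2, THEN conjunct2, THEN conjunct1, rule_format]
  bpb_on_def[THEN iffD1, THEN conjunct2, THEN conjunct2, THEN conjunct2, THEN conjunct2, THEN conjunct2, rule_format]

lemma bpbD:
  assumes "bpb P A B R a b p q"
  shows "zc P" "zc A" "zc B" "zc R"
    "oc A R a" "oc B R b" "oc P A p" "oc P B q"
  using assms by (auto simp: bpb_def)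

lemma bpbI:
  assumes "zc P" "zc A" "zc B" "zc R"
    "oc A R a" "oc B R b" "oc P A p" "oc P B q"
    and "!!z. z : Pts P ==> e z : gp R"
    and "!!z. z : Pts P ==> Act R (e z) (Fn a (Fn p z)) = Fn b (Fn q z)"
    and "!!z g. z : Pts P ==> g : gp P ==>
      e (Act P g z) *[R] Tw a (Fn p z) (Tw p z g) = Tw b (Fn q z) (Tw q z g) *[R] e z"
    and "!!x y c. x : Pts A ==> y : Pts B ==> c : gp R ==> Act R c (Fn a x) = Fn b y ==>
        EX z:Pts P. EX u:gp A. EX w:gp B. Act A u (Fn p z) = x & Act B w (Fn q z) = y &
           Tw b (Fn q z) w *[R] e z = c *[R] Tw a (Fn p z) u"
    and "!!z z' u w. z : Pts P ==> z' : Pts P ==> u : gp A ==> w : gp B ==>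
        Act A u (Fn p z) = Fn p z' ==> Act B w (Fn q z) = Fn q z' ==>
        Tw b (Fn q z) w *[R] e z = e z' *[R] Tw a (Fn p z) u ==>
        EX g:gp P. Act P g z = z' & Tw p z g = u & Tw q z g = w"
    and "!!z g g'. z : Pts P ==> g : gp P ==> g' : gp P ==> Act P g z = Act P g' z ==> Tw p z g = Tw p z g' ==>
      Tw q z g = Tw q z g' ==> g = g'"
  shows "bpb P A B R a b p q"
proof -
  have "bpb_on P A B R a b p q e"
    unfolding bpb_on_def by (intro conjI ballI impI) (rule assms(9-); assumption)+
  then show ?thesis using assms(1-8) unfolding bpb_def by blast
qed

lemma bpbE:
  assumes "bpb P A B R a b p q"
  obtains e where "bpb_on P A B R a b p q e"
  using assms by (auto simp: bpb_def)

lemma bp_sel: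
  "gp (bipullback P Q R a b) = {PPair g h | g h. g : gp P & h : gp Q}"
  "Grp (bipullback P Q R a b) = Grp (P ** Q)"
  "Pts (bipullback P Q R a b) = {PPair x (PPair y c) | x y c. x : Pts P & y : Pts Q & c : gp R &
                 Fn b y = Act R c (Fn a x)}"
  "PPair x (PPair y c) : Pts (bipullback P Q R a b) ==>
    Act (bipullback P Q R a b) (PPair g h) (PPair x (PPair y c)) =
      PPair (Act P g x) (PPair (Act Q h y) (Tw b y h *[R] c *[R] inv[R] (Tw a x g)))"
  by (simp_all add: bipullback_def Let_def prod_sel)

lemma bipullback_cell_simps [simp]: "Fn bipullback_fst = pfst" "Tw bipullback_fst z = pfst"
  "Fn bipullback_snd z = pfst (psnd z)" "Tw bipullback_snd z = psnd"
  by (simp_all add: bipullback_fst_def bipullback_snd_def)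

lemma bipullback_zero_cell:
  assumes P: "zc P" and Q: "zc Q" and R: "zc R"
    and a: "oc P R a" and b: "oc Q R b"
  shows "zc (bipullback P Q R a b)"
proof -
  interpret P: zcell P + Q: zcell Q + R: zcell R by (simp_all add: P Q R)
  note c = ocD[OF a] ocD[OF b] one_cell_one[OF P R a] one_cell_one[OF Q R b]
  let ?F = "bipullback P Q R a b"
  have cl: "Act ?F (PPair g h) (PPair x (PPair y c)) : Pts ?F"
    if "PPair x (PPair y c) : Pts ?F" "g : gp P" "h : gp Q" for x y c g h
  proof -
    have f: "x : Pts P" "y : Pts Q" "c : gp R" "Fn b y = Act R c (Fn a x)" using that by (auto simp: bp_sel)
    have "Act R (Tw b y h *[R] c *[R] inv[R] (Tw a x g)) (Fn a (Act P g x)) = Fn b (Act Q h y)"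
      using f that c by (simp add: R.act_mult)
    then show ?thesis unfolding bp_sel(4)[OF that(1)]
      using f that c by (auto simp: bp_sel(3))
  qed
  show ?thesis
  proof (rule zcI)
    show "group (Grp ?F)" unfolding bp_sel(2) by (rule prod_group) unfold_locales
    show "finite (gp ?F)" using finite_PPair[OF P.finite_grp Q.finite_grp] by (simp add: bp_sel(1))
    have "Pts ?F \<subseteq> {PPair x z | x z. x : Pts P & z : {PPair y c | y c. y : Pts Q & c : gp R}}"
      by (auto simp: bp_sel(3))
    then show "finite (Pts ?F)"
      by (rule finite_subset) (intro finite_PPair P.finite_pts Q.finite_pts R.finite_grp)
    show "Act ?F g : extensional (Pts ?F)" for g by (simp add: bipullback_def Let_def)
    fix g z assume "g : gp ?F" "z : Pts ?F"
    then show "Act ?F g z : Pts ?F" using cl by (auto simp: bp_sel(1,3))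
  next
    fix z assume z: "z : Pts ?F"
    then obtain x y c' where z': "z = PPair x (PPair y c')" "x : Pts P" "y : Pts Q" "c' : gp R" by (auto simp: bp_sel(3))
    then show "Act ?F 1[?F] z = z" using bp_sel(4)[of x y c' P Q R a b "1[P]" "1[Q]"] z c
      by (simp add: bp_sel(2) prod_sel)
  next
    fix g h z assume g: "g : gp ?F" "h : gp ?F" and z: "z : Pts ?F"
    obtain x y d where z': "z = PPair x (PPair y d)" "x : Pts P" "y : Pts Q" "d : gp R" using z by (auto simp: bp_sel(3))
    obtain g1 g2 h1 h2 where gh: "g = PPair g1 g2" "h = PPair h1 h2" "g1 : gp P" "g2 : gp Q" "h1 : gp P" "h2 : gp Q"
      using g by (auto simp: bp_sel(1))
    have m: "PPair g1 g2 *[?F] PPair h1 h2 = PPair (g1 *[P] h1) (g2 *[Q] h2)"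
      by (simp add: bp_sel(2) prod_sel(3))
    have z1: "PPair x (PPair y d) : Pts ?F" using z z' by simp
    have z2: "PPair (Act P h1 x) (PPair (Act Q h2 y) (Tw b y h2 *[R] d *[R] inv[R] (Tw a x h1))) : Pts ?F"
      using cl[OF z1 gh(5,6)] bp_sel(4)[OF z1] by simp
    show "Act ?F (g *[?F] h) z = Act ?F g (Act ?F h z)"
      unfolding gh(1,2) m z'(1) bp_sel(4)[OF z1] bp_sel(4)[OF z2]
      using c z' gh by (simp add: P.act_mult Q.act_mult R.m_assoc R.inv_mult_group)
  qed
qed

text \<open>The 2-cell of the standard bipullback is the third component of a triple.\<close>

lemma bp_bpb:
  assumes P: "zc P" and Q: "zc Q" and R: "zc R"
    and a: "oc P R a" and b: "oc Q R b"
  shows "bpb (bipullback P Q R a b) P Q R a b bipullback_fst bipullback_snd"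
proof -
  interpret P: zcell P + Q: zcell Q + R: zcell R by (simp_all add: P Q R)
  note c = ocD[OF a] ocD[OF b] one_cell_one[OF P R a] one_cell_one[OF Q R b]
  let ?F = "bipullback P Q R a b"
  have pt: "EX x y d. z = PPair x (PPair y d) & x : Pts P & y : Pts Q & d : gp R & Act R d (Fn a x) = Fn b y" if "z : Pts ?F" for z
    using that by (auto simp: bp_sel(3))
  have el: "EX g1 g2. g = PPair g1 g2 & g1 : gp P & g2 : gp Q" if "g : gp ?F" for g
    using that by (auto simp: bp_sel(1))
  have ac: "Act ?F (PPair g h) (PPair x (PPair y d)) = PPair (Act P g x) (PPair (Act Q h y) (Tw b y h *[R] d *[R] inv[R] (Tw a x g)))"
    if "x : Pts P" "y : Pts Q" "d : gp R" "Act R d (Fn a x) = Fn b y" for x y d g h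
    using that by (intro bp_sel(4)) (auto simp: bp_sel(3))
  have p1: "oc ?F P bipullback_fst"
    by (rule ocI) (auto dest!: pt simp: ac bp_sel(2) prod_sel(1,3))
  have p2: "oc ?F Q bipullback_snd"
    by (rule ocI) (auto dest!: pt simp: ac bp_sel(2) prod_sel(1,3))
  show ?thesis
  proof (rule bpbI[OF bipullback_zero_cell[OF assms] P Q R a b p1 p2, of "%z. psnd (psnd z)"])
    fix z g assume zg: "z : Pts ?F" "g : gp ?F"
    obtain x y d g1 g2 where z: "z = PPair x (PPair y d)" "x : Pts P" "y : Pts Q" "d : gp R" "Act R d (Fn a x) = Fn b y"
      and g: "g = PPair g1 g2" "g1 : gp P" "g2 : gp Q" using pt[OF zg(1)] el[OF zg(2)] by blast
    show "psnd (psnd (Act ?F g z)) *[R] Tw a (Fn bipullback_fst z) (Tw bipullback_fst z g) =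
       Tw b (Fn bipullback_snd z) (Tw bipullback_snd z g) *[R] psnd (psnd z)"
      using z g c by (simp add: ac[OF z(2-5)])
  next
    fix x y d assume h: "x : Pts P" "y : Pts Q" "d : gp R" "Act R d (Fn a x) = Fn b y"
    then show "EX z:Pts ?F. EX u: gp P. EX w: gp Q. Act P u (Fn bipullback_fst z) = x & Act Q w (Fn bipullback_snd z) = y &
       Tw b (Fn bipullback_snd z) w *[R] psnd (psnd z) = d *[R] Tw a (Fn bipullback_fst z) u"
      by (intro bexI[of _ "PPair x (PPair y d)"] bexI[of _ "1[P]"] bexI[of _ "1[Q]"]) (auto simp: bp_sel(3) c)
  next
    fix z z' u w assume zz: "z : Pts ?F" "z' : Pts ?F" and uw: "u : gp P" "w : gp Q"
      "Act P u (Fn bipullback_fst z) = Fn bipullback_fst z'" "Act Q w (Fn bipullback_snd z) = Fn bipullback_snd z'"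
      "Tw b (Fn bipullback_snd z) w *[R] psnd (psnd z) = psnd (psnd z') *[R] Tw a (Fn bipullback_fst z) u"
    obtain x y d x' y' d' where z: "z = PPair x (PPair y d)" "x : Pts P" "y : Pts Q" "d : gp R" "Act R d (Fn a x) = Fn b y"
      and z': "z' = PPair x' (PPair y' d')" "x' : Pts P" "y' : Pts Q" "d' : gp R" "Act R d' (Fn a x') = Fn b y'"
      using pt[OF zz(1)] pt[OF zz(2)] by blast
    have "Tw b y w *[R] d = d' *[R] Tw a x u" using uw z z' by simp
    then have "Tw b y w *[R] d *[R] inv[R] (Tw a x u) = d'" using z z' uw c by simp
    then show "EX g:gp ?F. Act ?F g z = z' & Tw bipullback_fst z g = u & Tw bipullback_snd z g = w"
      using uw z z' by (intro bexI[of _ "PPair u w"]) (auto simp: ac bp_sel(1))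
  qed (auto dest!: pt simp: bp_sel(2) prod_sel(1))
qed

text \<open>The comparison sends \<open>z\<close> to the triple of \<open>Fn p z\<close>,
  \<open>Fn q z\<close> and the component of the 2-cell at \<open>z\<close>. The last three clauses
  of \<open>bpb_on\<close> make it an equivalence, and it commutes with the projections on the
  nose.\<close>

lemma bpb_unique:
  assumes "bpb P A B R a b p q"
  obtains h where "eqv P (bipullback A B R a b) h"
    "bipullback_fst oo h = p" "bipullback_snd oo h = q"
proof -
  note z = bpbD[OF assms]
  obtain e where e: "bpb_on P A B R a b p q e" using bpbE[OF assms] .
  note E = bpb_onD[OF e]
  interpret P: zcell P + A: zcell A + B: zcell B + R: zcell R by (simp_all add: z(1,2,3,4))
  note c = ocD[OF z(5)] and d = ocD[OF z(6)] and P = ocD[OF z(7)] and Q = ocD[OF z(8)]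
  let ?F = "bipullback A B R a b"
  define h where "h = \<lparr> Fn = (%x. PPair (Fn p x) (PPair (Fn q x) (e x))), Tw = (%x g. PPair (Tw p x g) (Tw q x g)) \<rparr>"
  have hs: "Fn h x = PPair (Fn p x) (PPair (Fn q x) (e x))" "Tw h x g = PPair (Tw p x g) (Tw q x g)" for x g
    by (simp_all add: h_def)
  have F: "Fn h x : Pts ?F" if "x : Pts P" for x using that E(1,2) P Q by (auto simp: hs bp_sel(3))
  have ac: "Act ?F (PPair u w) (Fn h x) = PPair (Act A u (Fn p x)) (PPair (Act B w (Fn q x)) (Tw b (Fn q x) w *[R] e x *[R] inv[R] (Tw a (Fn p x) u)))"
    if "x : Pts P" for x u w using bp_sel(4)[of "Fn p x" "Fn q x" "e x" A B R a b u w] F[OF that] by (simp add: hs)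
  \<comment> \<open>Translates between the action on third components, which involves an inverse,
    and the form used in \<open>bpb_on\<close>.\<close>
  have conj: "Tw b (Fn q x) w *[R] e x *[R] inv[R] (Tw a (Fn p x) u) = e' \<longleftrightarrow> Tw b (Fn q x) w *[R] e x = e' *[R] Tw a (Fn p x) u"
    if "x : Pts P" "u : gp A" "w : gp B" "e' : gp R" for x u w e'
    using that P(1) Q(1) E(1) c(2) d(2) by (metis R.cancel_simps(3,4) R.inv_closed R.m_closed)
  have one: "oc P ?F h"
  proof (rule ocI)
    fix x g assume x: "x : Pts P" "g : gp P"
    show "Fn h (Act P g x) = Act ?F (Tw h x g) (Fn h x)"
      using conj[OF x(1) P(2)[OF x] Q(2)[OF x] E(1)[of "Act P g x"]] x E(3)[OF x] P Q
      unfolding hs(2) ac[OF x(1)] by (simp add: hs)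
    show "Tw h x g : gp ?F" using P(2)[OF x] Q(2)[OF x] by (auto simp: hs bp_sel(1))
  next
    fix x g g' assume x: "x : Pts P" "g : gp P" "g' : gp P"
    show "Tw h x (g *[P] g') = Tw h (Act P g' x) g *[?F] Tw h x g'"
      by (simp add: hs bp_sel(2) prod_sel(3) P(4)[OF x] Q(4)[OF x])
  qed (rule F)
  have "full P ?F h" unfolding full_def
  proof (intro ballI impI)
    fix x x' g assume x: "x : Pts P" "x' : Pts P" and "g : gp ?F" and eq: "Act ?F g (Fn h x) = Fn h x'"
    then obtain u w where g: "g = PPair u w" "u : gp A" "w : gp B" by (auto simp: bp_sel(1))
    then have "Act A u (Fn p x) = Fn p x'" "Act B w (Fn q x) = Fn q x'" "Tw b (Fn q x) w *[R] e x = e x' *[R] Tw a (Fn p x) u"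
      using eq conj[OF x(1) g(2,3) E(1)[OF x(2)]] unfolding g(1) ac[OF x(1)] by (auto simp: hs)
    from E(5)[OF x g(2,3) this] show "EX k: gp P. Act P k x = x' & Tw h x k = g" by (auto simp: hs g)
  qed
  moreover have "faithful P ?F h" unfolding faithful_def
    by (intro ballI impI, rule E(6)) (auto simp: hs)
  moreover have "eso P ?F h" unfolding eso_def
  proof
    fix y assume "y : Pts ?F"
    then obtain s t c' where y: "y = PPair s (PPair t c')" "s : Pts A" "t : Pts B" "c' : gp R" "Act R c' (Fn a s) = Fn b t"
      by (auto simp: bp_sel(3))
    obtain x u w where x: "x : Pts P" "u : gp A" "w : gp B" "Act A u (Fn p x) = s" "Act B w (Fn q x) = t"
      "Tw b (Fn q x) w *[R] e x = c' *[R] Tw a (Fn p x) u"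
      using E(4)[OF y(2-5)] by (elim bexE conjE) (rule that)
    then have "Act ?F (PPair u w) (Fn h x) = y" unfolding ac[OF x(1)] using conj[OF x(1-3) y(4)] y(1) by simp
    then show "EX x:Pts P. EX k:gp ?F. Act ?F k (Fn h x) = y" using x by (auto simp: bp_sel(1))
  qed
  ultimately have "eqv P ?F h" using one by (simp add: eqv_def)
  then show ?thesis by (rule that) (auto intro!: oc_eqI simp: hs)
qed

text \<open>The reflected square carries the inverse 2-cell.\<close>

lemma bpb_sym:
  assumes "bpb P A B R a b p q"
  shows "bpb P B A R b a q p"
proof -
  note z = bpbD[OF assms]
  obtain e where e: "bpb_on P A B R a b p q e" using bpbE[OF assms] .
  note E = bpb_onD[OF e]
  interpret P: zcell P + A: zcell A + B: zcell B + R: zcell R by (simp_all add: z(1,2,3,4))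
  note c = ocD[OF z(5)] and d = ocD[OF z(6)] and P = ocD[OF z(7)] and Q = ocD[OF z(8)]
  have sw: "u *[R] inv[R] s = inv[R] t *[R] v \<longleftrightarrow> v *[R] s = t *[R] u"
    if "u : gp R" "v : gp R" "s : gp R" "t : gp R" for u v s t
    using that by (metis R.cancel_simps R.inv_closed R.m_assoc R.m_closed)
  show ?thesis
  proof (rule bpbI[OF z(1,3,2,4,6,5,8,7), of "%z. inv[R] (e z)"])
    fix x g assume x: "x : Pts P" "g : gp P"
    then show "inv[R] (e (Act P g x)) *[R] Tw b (Fn q x) (Tw q x g) = Tw a (Fn p x) (Tw p x g) *[R] inv[R] (e x)"
      using sw[of "Tw a (Fn p x) (Tw p x g)" "Tw b (Fn q x) (Tw q x g)" "e x" "e (Act P g x)"] E(1) E(3)[OF x] c(2) d(2) P Q by simp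
  next
    fix x y k assume h: "x : Pts B" "y : Pts A" "k : gp R" "Act R k (Fn b x) = Fn a y"
    then have "Act R (inv[R] k) (Fn a y) = Fn b x" using R.act_eqD d by simp
    then obtain t u w where t: "t : Pts P" "u : gp A" "w : gp B" "Act A u (Fn p t) = y" "Act B w (Fn q t) = x"
      "Tw b (Fn q t) w *[R] e t = inv[R] k *[R] Tw a (Fn p t) u" using E(4)[of y x "inv[R] k"] h by auto
    have "Tw a (Fn p t) u *[R] inv[R] (e t) = k *[R] Tw b (Fn q t) w"
      using sw[of "Tw a (Fn p t) u" "Tw b (Fn q t) w" "e t" "inv[R] k"] t h E(1) c(2) d(2) P Q by simp
    then show "EX z:Pts P. EX u: gp B. EX w: gp A. Act B u (Fn q z) = x & Act A w (Fn p z) = y &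
       Tw a (Fn p z) w *[R] inv[R] (e z) = k *[R] Tw b (Fn q z) u" using t by blast
  next
    fix t t' u w assume h: "t : Pts P" "t' : Pts P" "u : gp B" "w : gp A" "Act B u (Fn q t) = Fn q t'" "Act A w (Fn p t) = Fn p t'"
      "Tw a (Fn p t) w *[R] inv[R] (e t) = inv[R] (e t') *[R] Tw b (Fn q t) u"
    have "Tw b (Fn q t) u *[R] e t = e t' *[R] Tw a (Fn p t) w"
      using sw[of "Tw a (Fn p t) w" "Tw b (Fn q t) u" "e t" "e t'"] h E(1) c(2) d(2) P Q by simp
    from E(5)[OF h(1,2,4,3,6,5) this] show "EX g: gp P. Act P g t = t' & Tw q t g = u & Tw p t g = w" by blast
  next
    fix x assume x: "x : Pts P"
    show "Act R (inv[R] (e x)) (Fn b (Fn q x)) = Fn a (Fn p x)" using R.act_eqD E(1,2)[OF x] c(1) P(1) x by simp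
  qed (use E(1,6) in auto)
qed

text \<open>Functoriality of \<open>a\<close> with the intermediate object named \<open>y\<close>,
  so that composites can be formed without rewriting inside \<open>Tw\<close>.\<close>

lemma tw_comp:
  assumes "oc P Q a" "x : Pts P" "g : gp P" "g' : gp P" "Act P g' x = y"
  shows "Tw a y g *[Q] Tw a x g' = Tw a x (g *[P] g')"
  using ocD(4)[OF assms(1-4)] assms(5) by simp

text \<open>The 2-cell of the square is precomposed with the inverse of the 2-cell \<open>d\<close>
  from \<open>a\<close> to \<open>a'\<close>.\<close>

lemma bpb_change:
  assumes "bpb P A B R a b p q" and i: "iso2 A R a a'"
  shows "bpb P A B R a' b p q"
proof -
  note z = bpbD[OF assms(1)]
  obtain e where e: "bpb_on P A B R a b p q e" using bpbE[OF assms(1)] .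
  note E = bpb_onD[OF e]
  interpret P: zcell P + A: zcell A + B: zcell B + R: zcell R by (simp_all add: z(1,2,3,4))
  obtain d where "cell2 A R a a' d" using iso2E[OF i z(2,4)] .
  note a' = cell2D(2)[OF this] and d = cell2D(3-5)[OF this]
  note a = ocD(1-3)[OF z(5)] and a'' = ocD(1-3)[OF a'] and b = ocD(1-3)[OF z(6)]
    and p = ocD(1-3)[OF z(7)] and q = ocD(1-3)[OF z(8)]
  have sw: "inv[R] (d (Act A g x)) *[R] Tw a' x g = Tw a x g *[R] inv[R] (d x)" if "x : Pts A" "g : gp A" for x g
  proof -
    have "inv[R] (d (Act A g x)) *[R] (Tw a' x g *[R] d x) *[R] inv[R] (d x) = Tw a x g *[R] inv[R] (d x)"
      unfolding d(3)[OF that, symmetric] using that d(1) a by simp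
    then show ?thesis using that d(1) a'' by (simp add: R.m_assoc)
  qed
  show ?thesis
  proof (rule bpbI[OF z(1-4) a' z(6-8), of "%z. e z *[R] inv[R] (d (Fn p z))"])
    fix x assume x: "x : Pts P"
    show "Act R (e x *[R] inv[R] (d (Fn p x))) (Fn a' (Fn p x)) = Fn b (Fn q x)"
      using x E(1,2) d(1) R.act_eqD[OF d(1) a(1) d(2)] p a'' by (simp add: R.act_mult)
  next
    fix x g assume x: "x : Pts P" "g : gp P"
    have "e (Act P g x) *[R] inv[R] (d (Fn p (Act P g x))) *[R] Tw a' (Fn p x) (Tw p x g) =
        e (Act P g x) *[R] (Tw a (Fn p x) (Tw p x g) *[R] inv[R] (d (Fn p x)))"
      using sw[of "Fn p x" "Tw p x g"] x E(1) d(1) a a'' p by (simp add: R.m_assoc)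
    also have "... = Tw b (Fn q x) (Tw q x g) *[R] (e x *[R] inv[R] (d (Fn p x)))"
      using E(3)[OF x] x E(1) d(1) a b p q by (simp add: R.m_assoc[symmetric])
    finally show "e (Act P g x) *[R] inv[R] (d (Fn p (Act P g x))) *[R] Tw a' (Fn p x) (Tw p x g) =
        Tw b (Fn q x) (Tw q x g) *[R] (e x *[R] inv[R] (d (Fn p x)))" .
  next
    fix x y c assume h: "x : Pts A" "y : Pts B" "c : gp R" "Act R c (Fn a' x) = Fn b y"
    have "Act R (c *[R] d x) (Fn a x) = Fn b y" using h d a by (simp add: R.act_mult)
    then obtain t u w where t: "t : Pts P" "u : gp A" "w : gp B" "Act A u (Fn p t) = x" "Act B w (Fn q t) = y"
      "Tw b (Fn q t) w *[R] e t = c *[R] d x *[R] Tw a (Fn p t) u"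
      using E(4)[OF h(1,2), of "c *[R] d x"] h d by (elim meta_impE) (auto intro: that)
    have "Tw b (Fn q t) w *[R] (e t *[R] inv[R] (d (Fn p t))) = c *[R] (d x *[R] Tw a (Fn p t) u) *[R] inv[R] (d (Fn p t))"
      using t h d(1) E(1) a b p q by (simp add: R.m_assoc[symmetric])
    also have "... = c *[R] Tw a' (Fn p t) u"
      using d(3)[of "Fn p t" u] t h d(1) a'' p by (simp add: R.m_assoc)
    finally show "EX z:Pts P. EX u: gp A. EX w: gp B. Act A u (Fn p z) = x & Act B w (Fn q z) = y &
       Tw b (Fn q z) w *[R] (e z *[R] inv[R] (d (Fn p z))) = c *[R] Tw a' (Fn p z) u" using t by blast
  next
    fix t t' u w assume h: "t : Pts P" "t' : Pts P" "u : gp A" "w : gp B" "Act A u (Fn p t) = Fn p t'" "Act B w (Fn q t) = Fn q t'"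
      "Tw b (Fn q t) w *[R] (e t *[R] inv[R] (d (Fn p t))) = e t' *[R] inv[R] (d (Fn p t')) *[R] Tw a' (Fn p t) u"
    have c: "Tw b (Fn q t) w : gp R" "e t : gp R" "e t' : gp R" "d (Fn p t) : gp R" "d (Fn p t') : gp R" "Tw a' (Fn p t) u : gp R" "Tw a (Fn p t) u : gp R"
      using h d(1) E(1) a a'' b p q by simp_all
    have "Tw b (Fn q t) w *[R] e t *[R] inv[R] (d (Fn p t)) = e t' *[R] (Tw a (Fn p t) u *[R] inv[R] (d (Fn p t)))"
      using h(7) sw[of "Fn p t" u] h(5) c p h by (simp add: R.m_assoc)
    then have "Tw b (Fn q t) w *[R] e t = e t' *[R] Tw a (Fn p t) u"
      using c R.right_cancel by (simp flip: R.m_assoc)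
    from E(5)[OF h(1-6) this] show "EX g: gp P. Act P g t = t' & Tw p t g = u & Tw q t g = w" .
  qed (use E(1,6) d(1) p in auto)
qed

text \<open>Objects of \<open>A\<close> are reached from \<open>A'\<close> because \<open>k\<close>
  is essentially surjective, and morphisms lift uniquely because it is full and faithful. With
  \<open>bpb_change\<close> this makes composites of spans independent of the representative within
  an isomorphism class.\<close>

lemma bpb_equiv:
  assumes A': "zc A" and k: "eqv A' A k" and a: "oc A R a"
    and h: "bpb P A' B R (a oo k) b p q"
  shows "bpb P A B R a b (k oo p) q"
proof -
  note z = bpbD[OF h]
  obtain e where e: "bpb_on P A' B R (a oo k) b p q e" using bpbE[OF h] .
  note E = bpb_onD[OF e, simplified]
  have kk: "oc A' A k" and fu: "full A' A k" and fa: "faithful A' A k" and es: "eso A' A k"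
    using k by (auto simp: eqv_def)
  interpret P: zcell P + A': zcell A' + A: zcell A + R: zcell R by (simp_all add: z(1) z(2) A' z(4))
  note K = ocD(1-3)[OF kk] and ac = ocD(1-3)[OF a] and p = ocD(1-3)[OF z(7)] and q = ocD(1-3)[OF z(8)]
  show ?thesis
  proof (rule bpbI[OF z(1) A' z(3,4) a z(6) oc_comp[OF z(1,7) kk] z(8), of e]; (unfold oo_simps)?)
    fix x y c assume x: "x : Pts A" "y : Pts B" "c : gp R" "Act R c (Fn a x) = Fn b y"
    obtain x' h where x': "x' : Pts A'" "h : gp A" "Act A h (Fn k x') = x" using eso_cellD[OF es x(1)] by blast
    \<comment> \<open>The given morphism \<open>c\<close>, preceded by the image of
      \<open>h\<close>, so that it starts at the image of \<open>x'\<close>.\<close>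
    let ?c = "c *[R] Tw a (Fn k x') h"
    have "?c : gp R" "Act R ?c (Fn a (Fn k x')) = Fn b y"
      using x x' K ac by (simp_all add: R.act_mult flip: ac(3))
    then obtain t u w where t: "t : Pts P" "u : gp A'" "w : gp B" "Act A' u (Fn p t) = x'" "Act B w (Fn q t) = y"
      "Tw b (Fn q t) w *[R] e t = ?c *[R] Tw a (Fn k (Fn p t)) (Tw k (Fn p t) u)"
      using E(4)[OF x'(1) x(2)] by blast
    have "Tw a (Fn k x') h *[R] Tw a (Fn k (Fn p t)) (Tw k (Fn p t) u) = Tw a (Fn k (Fn p t)) (h *[A] Tw k (Fn p t) u)"
      by (rule tw_comp[OF a]) (use t x' K p in "auto simp flip: K(3)")
    then have "Tw b (Fn q t) w *[R] e t = c *[R] Tw a (Fn k (Fn p t)) (h *[A] Tw k (Fn p t) u)"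
      using t x x' K ac p by (simp add: R.m_assoc)
    moreover have "Act A (h *[A] Tw k (Fn p t) u) (Fn k (Fn p t)) = x"
      using t x' K p by (simp add: A.act_mult flip: K(3))
    ultimately show "EX z:Pts P. EX u: gp A. EX w: gp B. Act A u (Fn k (Fn p z)) = x & Act B w (Fn q z) = y &
       Tw b (Fn q z) w *[R] e z = c *[R] Tw a (Fn k (Fn p z)) u"
      using t x' K p by (intro bexI[of _ t] bexI[of _ "h *[A] Tw k (Fn p t) u"] bexI[of _ w]) auto
  next
    fix t t' u w assume t: "t : Pts P" "t' : Pts P" "u : gp A" "w : gp B" "Act A u (Fn k (Fn p t)) = Fn k (Fn p t')"
      "Act B w (Fn q t) = Fn q t'" "Tw b (Fn q t) w *[R] e t = e t' *[R] Tw a (Fn k (Fn p t)) u"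
    obtain v where v: "v : gp A'" "Act A' v (Fn p t) = Fn p t'" "Tw k (Fn p t) v = u"
      using fullD[OF fu p(1)[OF t(1)] p(1)[OF t(2)] t(3,5)] by blast
    show "EX g: gp P. Act P g t = t' & Tw k (Fn p t) (Tw p t g) = u & Tw q t g = w"
      using E(5)[OF t(1,2) v(1) t(4) v(2) t(6)] t(7) v(3) by auto
  next
    fix t g g' assume g: "t : Pts P" "g : gp P" "g' : gp P" "Act P g t = Act P g' t"
      "Tw k (Fn p t) (Tw p t g) = Tw k (Fn p t) (Tw p t g')" "Tw q t g = Tw q t g'"
    have "Tw p t g = Tw p t g'"
      by (rule faithfulD[OF fa p(1)[OF g(1)]]) (use g p in "simp_all flip: p(3)")
    then show "g = g'" using E(6) g by blast
  qed (use E(1-3) in auto)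
qed

text \<open>The pasting law. The 2-cell of the outer square at \<open>v\<close> is \<open>a\<close>
  applied to \<open>f v\<close>, followed by the component of \<open>e\<close> at
  \<open>Fn t v\<close>.\<close>

lemma bpb_paste:
  assumes h1: "bpb P A B R a b p q" and h2: "bpb Q D P A d p s t"
  shows "bpb Q D B R (a oo d) b s (q oo t)"
proof -
  note z = bpbD[OF h1] and y = bpbD[OF h2]
  obtain e where e: "bpb_on P A B R a b p q e" using bpbE[OF h1] .
  obtain f where f: "bpb_on Q D P A d p s t f" using bpbE[OF h2] .
  note E = bpb_onD[OF e] and F = bpb_onD[OF f]
  interpret P: zcell P + A: zcell A + B: zcell B + R: zcell R + Q: zcell Q + D: zcell D by (simp_all add: z(1) z(2) z(3) z(4) y(1) y(2))
  note ac = ocD(1,2)[OF z(5)] and bc = ocD(1,2)[OF z(6)] and pc = ocD(1,2)[OF z(7)] and qc = ocD(1,2)[OF z(8)]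
    and dc = ocD(1,2)[OF y(5)] and sc = ocD(1,2)[OF y(7)] and tc = ocD(1,2)[OF y(8)]
  note cl = ac bc pc qc dc sc tc E(1) F(1)
  note a3 = ocD(3)[OF z(5)] and b3 = ocD(3)[OF z(6)] and p3 = ocD(3)[OF z(7)] and q3 = ocD(3)[OF z(8)]
    and d3 = ocD(3)[OF y(5)] and s3 = ocD(3)[OF y(7)] and t3 = ocD(3)[OF y(8)]
  let ?A = "%v. Tw a (Fn d (Fn s v))" and ?B = "%v. Tw b (Fn q (Fn t v))" and ?C = "%v. Tw a (Fn p (Fn t v))" and ?D = "%v. Tw d (Fn s v)" and ?P = "%v. Tw p (Fn t v)" and ?Q = "%v. Tw q (Fn t v)" and ?e = "%v. e (Fn t v)" and ?d = "%v. Fn d (Fn s v)" and ?q = "%v. Fn q (Fn t v)" and ?p = "%v. Fn p (Fn t v)"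
  show ?thesis
  proof (rule bpbI[OF y(1,2) z(3,4) oc_comp[OF y(2,5) z(5)] z(6) y(7) oc_comp[OF y(1,8) z(8)],
        of "%v. ?e v *[R] ?A v (f v)"]; (unfold oo_simps)?)
    fix v assume v: "v : Pts Q"
    show "?e v *[R] ?A v (f v) : gp R" using v cl by simp
    show "Act R (?e v *[R] ?A v (f v)) (Fn a (?d v)) = Fn b (?q v)"
      using v cl E(2)[of "Fn t v"] F(2)[of v] by (simp add: R.act_mult flip: a3)
  next
    fix v g assume v: "v : Pts Q" "g : gp Q"
    have 1: "?A (Act Q g v) (f (Act Q g v)) *[R] ?A v (?D v (Tw s v g)) =
        ?A v (f (Act Q g v) *[A] ?D v (Tw s v g))"
      by (rule tw_comp[OF z(5)]) (use v cl in "auto simp: s3 d3")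
    have 2: "?C v (?P v (Tw t v g)) *[R] ?A v (f v) =
        ?A v (?P v (Tw t v g) *[A] f v)"
      by (rule tw_comp[OF z(5)]) (use v cl F(2)[of v] in auto)
    have 3: "?e (Act Q g v) *[R] ?C v (?P v (Tw t v g)) =
        ?B v (?Q v (Tw t v g)) *[R] ?e v"
      using E(3)[of "Fn t v" "Tw t v g"] v cl by (simp add: t3)
    have "?e (Act Q g v) *[R] ?A (Act Q g v) (f (Act Q g v)) *[R] ?A v (?D v (Tw s v g))
        = ?e (Act Q g v) *[R] ?A v (f (Act Q g v) *[A] ?D v (Tw s v g))"
      using 1 v cl by (simp add: R.m_assoc)
    also have "... = ?e (Act Q g v) *[R] (?C v (?P v (Tw t v g)) *[R] ?A v (f v))"
      by (simp add: F(3)[OF v] 2)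
    also have "... = ?B v (?Q v (Tw t v g)) *[R] (?e v *[R] ?A v (f v))"
      using 3 v cl by (simp add: R.m_assoc[symmetric])
    finally show "?e (Act Q g v) *[R] ?A (Act Q g v) (f (Act Q g v)) *[R] ?A v (?D v (Tw s v g)) =
      ?B v (?Q v (Tw t v g)) *[R] (?e v *[R] ?A v (f v))" .
  next
    fix x x' c assume x: "x : Pts D" "x' : Pts B" "c : gp R" "Act R c (Fn a (Fn d x)) = Fn b x'"
    obtain i u w where i: "i : Pts P" "u : gp A" "w : gp B" "Act A u (Fn p i) = Fn d x" "Act B w (Fn q i) = x'"
      "Tw b (Fn q i) w *[R] e i = c *[R] Tw a (Fn p i) u"
      using E(4)[OF dc(1)[OF x(1)] x(2-4)] by blast
    \<comment> \<open>The first square has produced \<open>i\<close> over the given data;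
      \<open>inv[A] u\<close> now runs from \<open>Fn d x\<close> to \<open>Fn p i\<close> and is
      the input for essential surjectivity of the second square.\<close>
    have "Act A (inv[A] u) (Fn d x) = Fn p i" using i cl A.act_eqD by simp
    then obtain v u2 w2 where v: "v : Pts Q" "u2 : gp D" "w2 : gp P" "Act D u2 (Fn s v) = x" "Act P w2 (Fn t v) = i"
      "?P v w2 *[A] f v = inv[A] u *[A] ?D v u2"
      using F(4)[OF x(1) i(1) A.inv_closed[OF i(2)]] by blast
    have 1: "Tw b (Fn q i) w *[R] ?B v (?Q v w2) = ?B v (w *[B] ?Q v w2)"
      by (rule tw_comp[OF z(6)]) (use v i cl in "auto simp flip: q3")
    have 2: "e i *[R] ?C v (?P v w2) = ?B v (?Q v w2) *[R] ?e v"
      using E(3)[of "Fn t v" w2] v cl by simp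
    have 3: "?C v (?P v w2) *[R] ?A v (f v) = ?A v (?P v w2 *[A] f v)"
      by (rule tw_comp[OF z(5)]) (use v cl F(2)[of v] in auto)
    have 4: "Tw a (Fn p i) u *[R] ?A v (inv[A] u *[A] ?D v u2) = ?A v (u *[A] (inv[A] u *[A] ?D v u2))"
      by (rule tw_comp[OF z(5)]) (use v i cl A.act_eqD[OF i(2) _ i(4)] in "auto simp: A.act_mult simp flip: d3")
    have "?B v (w *[B] ?Q v w2) *[R] (?e v *[R] ?A v (f v)) =
      Tw b (Fn q i) w *[R] (?B v (?Q v w2) *[R] ?e v) *[R] ?A v (f v)"
      using 1[symmetric] v i cl by (simp add: R.m_assoc)
    also have "... = Tw b (Fn q i) w *[R] e i *[R] (?C v (?P v w2) *[R] ?A v (f v))"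
      unfolding 2[symmetric] using v(1-5) i(1-5) cl by (simp add: R.m_assoc)
    also have "... = c *[R] Tw a (Fn p i) u *[R] ?A v (inv[A] u *[A] ?D v u2)"
      unfolding 3 v(6) i(6) ..
    also have "... = c *[R] ?A v (?D v u2)"
      using 4 v i x cl by (simp add: R.m_assoc)
    finally have "?B v (w *[B] ?Q v w2) *[R] (?e v *[R] ?A v (f v)) =
      c *[R] ?A v (?D v u2)" .
    moreover have "Act B (w *[B] ?Q v w2) (?q v) = x'" using v i cl by (simp add: B.act_mult flip: q3)
    moreover have "w *[B] ?Q v w2 : gp B" using v i cl by simp
    ultimately show "EX v:Pts Q. EX u: gp D. EX w: gp B. Act D u (Fn s v) = x & Act B w (?q v) = x' &
       ?B v w *[R] (?e v *[R] ?A v (f v)) = c *[R] ?A v (?D v u)"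
      using v(1,2,4) by blast
  next
    fix v v' u w assume h: "v : Pts Q" "v' : Pts Q" "u : gp D" "w : gp B" "Act D u (Fn s v) = Fn s v'"
      "Act B w (?q v) = ?q v'"
      "?B v w *[R] (?e v *[R] ?A v (f v)) =
       ?e v' *[R] ?A v' (f v') *[R] ?A v (?D v u)"
    \<comment> \<open>The morphism between the images of \<open>v\<close> and \<open>v'\<close> in
      \<open>A\<close> under \<open>p oo t\<close> that \<open>u\<close> and the 2-cell
      \<open>f\<close> force. The pair of \<open>U\<close> and \<open>w\<close> lifts to a morphism
      of \<open>P\<close>, and \<open>u\<close> together with that lift then lifts to
      \<open>Q\<close>.\<close>
    define U where "U = f v' *[A] ?D v u *[A] inv[A] (f v)"
    have Uc: "U : gp A" unfolding U_def using h cl by simp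
    have Uf: "U *[A] f v = f v' *[A] ?D v u" unfolding U_def using h cl by simp
    have du: "Act A (?D v u) (?d v) = ?d v'" using d3[of "Fn s v" u] h cl by simp
    have Ua: "Act A U (?p v) = ?p v'"
    proof -
      have "Act A U (?p v) = Act A (U *[A] f v) (?d v)" using h cl Uc F(2)[OF h(1)] by (simp add: A.act_mult)
      also have "... = ?p v'" unfolding Uf using h cl du F(2)[OF h(2)] by (simp add: A.act_mult)
      finally show ?thesis .
    qed
    have 1: "?A v' (f v') *[R] ?A v (?D v u) = ?A v (f v' *[A] ?D v u)"
      by (rule tw_comp[OF z(5)]) (use h cl du in auto)
    have 2: "?C v U *[R] ?A v (f v) = ?A v (U *[A] f v)"
      by (rule tw_comp[OF z(5)]) (use h cl Uc F(2)[OF h(1)] in auto)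
    have "?B v w *[R] ?e v *[R] ?A v (f v) =
        ?e v' *[R] ?C v U *[R] ?A v (f v)"
      using h cl Uc 1 2 Uf by (simp add: R.m_assoc)
    then have "?B v w *[R] ?e v = ?e v' *[R] ?C v U"
      using h cl Uc by simp
    from E(5)[OF tc(1)[OF h(1)] tc(1)[OF h(2)] Uc h(4) Ua h(6) this]
    obtain g where g: "g : gp P" "Act P g (Fn t v) = Fn t v'" "?P v g = U" "?Q v g = w" by blast
    have "?P v g *[A] f v = f v' *[A] ?D v u" using g Uf by simp
    from F(5)[OF h(1-3) g(1) h(5) g(2) this] g(4)
    show "EX k: gp Q. Act Q k v = v' & Tw s v k = u & ?Q v (Tw t v k) = w" by auto
  next
    fix v g g' assume h: "v : Pts Q" "g : gp Q" "g' : gp Q" "Act Q g v = Act Q g' v" "Tw s v g = Tw s v g'"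
      "?Q v (Tw t v g) = ?Q v (Tw t v g')"
    have "?P v (Tw t v g) *[A] f v = ?P v (Tw t v g') *[A] f v"
      using F(3)[OF h(1,2)] F(3)[OF h(1,3)] h by simp
    then have p: "?P v (Tw t v g) = ?P v (Tw t v g')" using h cl by simp
    have "Tw t v g = Tw t v g'"
      by (rule E(6)[of "Fn t v"]) (use h cl p t3[OF h(1,2)] t3[OF h(1,3)] in auto)
    then show "g = g'" using F(6)[OF h(1-5)] by blast
  qed
qed

lemma bpb_id:
  assumes A: "zc A" and B: "zc B" and b: "oc B A b"
  shows "bpb B A B A id_cell b b id_cell"
proof -
  interpret A: zcell A + B: zcell B by (simp_all add: A B)
  note c = ocD[OF b] one_cell_one[OF B A b]
  show ?thesis
  proof (rule bpbI[OF B A B A oc_id b b oc_id, of "%z. 1[A]"]; (unfold id_cell_simps)?)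
    fix x y d assume h: "x : Pts A" "y : Pts B" "d : gp A" "Act A d x = Fn b y"
    \<comment> \<open>The point over \<open>y\<close> is \<open>y\<close> itself, and
      \<open>inv[A] d\<close> moves its image back to \<open>x\<close>.\<close>
    then show "EX z:Pts B. EX u: gp A. EX w: gp B. Act A u (Fn b z) = x & Act B w z = y & Tw b z w *[A] 1[A] = d *[A] u"
      using A.act_eqD[OF h(3,1,4)] c by (intro bexI[of _ y] bexI[of _ "inv[A] d"] bexI[of _ "1[B]"]) auto
  qed (use c in auto)
qed

lemma bpb_times:
  assumes h1: "bpb P A B R a b p q" and h2: "bpb P' A' B' R' a' b' p' q'"
  shows "bpb (P ** P') (A ** A') (B ** B') (R ** R')
    (times a a') (times b b') (times p p') (times q q')"
proof -
  note z = bpbD[OF h1] and y = bpbD[OF h2]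
  obtain e where e: "bpb_on P A B R a b p q e" using bpbE[OF h1] .
  obtain f where f: "bpb_on P' A' B' R' a' b' p' q' f" using bpbE[OF h2] .
  note E = bpb_onD[OF e] and F = bpb_onD[OF f]
  note ac = ocD(1,2)[OF z(5)] and bc = ocD(1,2)[OF z(6)] and pc = ocD(1,2)[OF z(7)] and qc = ocD(1,2)[OF z(8)]
  note ac' = ocD(1,2)[OF y(5)] and bc' = ocD(1,2)[OF y(6)] and pc' = ocD(1,2)[OF y(7)] and qc' = ocD(1,2)[OF y(8)]
  note cl = ac bc pc qc ac' bc' pc' qc'
  note S = prod_sel
  show ?thesis
  proof (rule bpbI[of _ _ _ _ _ _ _ _ "%z. PPair (e (pfst z)) (f (psnd z))"]; (unfold times_cell_simps pt.sel)?)
    fix x x' c assume "x : Pts (A ** A')" "x' : Pts (B ** B')" "c : gp (R ** R')"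
      and ca: "Act (R ** R') c (PPair (Fn a (pfst x)) (Fn a' (psnd x))) = PPair (Fn b (pfst x')) (Fn b' (psnd x'))"
    then obtain x1 x2 y1 y2 c1 c2 where h: "x = PPair x1 x2" "x' = PPair y1 y2" "c = PPair c1 c2" "x1 : Pts A" "x2 : Pts A'"
      "y1 : Pts B" "y2 : Pts B'" "c1 : gp R" "c2 : gp R'" by (auto simp: S)
    have c12: "Act R c1 (Fn a x1) = Fn b y1" "Act R' c2 (Fn a' x2) = Fn b' y2"
      using ca h cl by (simp_all add: S)
    obtain s1 u1 w1 where 1: "s1 : Pts P" "u1 : gp A" "w1 : gp B" "Act A u1 (Fn p s1) = x1" "Act B w1 (Fn q s1) = y1"
      "Tw b (Fn q s1) w1 *[R] e s1 = c1 *[R] Tw a (Fn p s1) u1" using E(4)[OF h(4,6,8) c12(1)] by blast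
    obtain s2 u2 w2 where 2: "s2 : Pts P'" "u2 : gp A'" "w2 : gp B'" "Act A' u2 (Fn p' s2) = x2" "Act B' w2 (Fn q' s2) = y2"
      "Tw b' (Fn q' s2) w2 *[R'] f s2 = c2 *[R'] Tw a' (Fn p' s2) u2" using F(4)[OF h(5,7,9) c12(2)] by blast
    show "EX z:Pts (P ** P'). EX u:gp (A ** A'). EX w:gp (B ** B').
       Act (A ** A') u (PPair (Fn p (pfst z)) (Fn p' (psnd z))) = x &
       Act (B ** B') w (PPair (Fn q (pfst z)) (Fn q' (psnd z))) = x' &
       PPair (Tw b (Fn q (pfst z)) (pfst w))
         (Tw b' (Fn q' (psnd z)) (psnd w)) *[R ** R'] PPair (e (pfst z)) (f (psnd z)) =
       c *[R ** R'] PPair (Tw a (Fn p (pfst z)) (pfst u))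
         (Tw a' (Fn p' (psnd z)) (psnd u))"
      using 1 2 h cl
      by (intro bexI[of _ "PPair s1 s2"] bexI[of _ "PPair u1 u2"] bexI[of _ "PPair w1 w2"]) (auto simp: S)
  next
    fix t t' u w assume tt: "t : Pts (P ** P')" "t' : Pts (P ** P')" "u : gp (A ** A')" "w : gp (B ** B')"
      and uw: "Act (A ** A') u (PPair (Fn p (pfst t)) (Fn p' (psnd t))) = PPair (Fn p (pfst t')) (Fn p' (psnd t'))"
       "Act (B ** B') w (PPair (Fn q (pfst t)) (Fn q' (psnd t))) = PPair (Fn q (pfst t')) (Fn q' (psnd t'))"
       "PPair (Tw b (Fn q (pfst t)) (pfst w))
         (Tw b' (Fn q' (psnd t)) (psnd w)) *[R ** R'] PPair (e (pfst t)) (f (psnd t)) =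
       PPair (e (pfst t')) (f (psnd t')) *[R ** R'] PPair (Tw a (Fn p (pfst t)) (pfst u))
         (Tw a' (Fn p' (psnd t)) (psnd u))"
    obtain t1 t2 v1 v2 u1 u2 w1 w2 where t: "t = PPair t1 t2" "t1 : Pts P" "t2 : Pts P'" and v: "t' = PPair v1 v2" "v1 : Pts P" "v2 : Pts P'"
      and u: "u = PPair u1 u2" "u1 : gp A" "u2 : gp A'" and w: "w = PPair w1 w2" "w1 : gp B" "w2 : gp B'"
      using tt by (auto simp: S(1,2))
    have 1: "Act A u1 (Fn p t1) = Fn p v1" "Act B w1 (Fn q t1) = Fn q v1" "Tw b (Fn q t1) w1 *[R] e t1 = e v1 *[R] Tw a (Fn p t1) u1"
      and 2: "Act A' u2 (Fn p' t2) = Fn p' v2" "Act B' w2 (Fn q' t2) = Fn q' v2" "Tw b' (Fn q' t2) w2 *[R'] f t2 = f v2 *[R'] Tw a' (Fn p' t2) u2"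
      using uw t v u w cl by (simp_all add: S)
    obtain g1 where g1: "g1 : gp P" "Act P g1 t1 = v1" "Tw p t1 g1 = u1" "Tw q t1 g1 = w1" using E(5)[OF t(2) v(2) u(2) w(2) 1] by blast
    obtain g2 where g2: "g2 : gp P'" "Act P' g2 t2 = v2" "Tw p' t2 g2 = u2" "Tw q' t2 g2 = w2" using F(5)[OF t(3) v(3) u(3) w(3) 2] by blast
    show "EX g:gp (P ** P'). Act (P ** P') g t = t' &
        PPair (Tw p (pfst t) (pfst g)) (Tw p' (psnd t) (psnd g)) = u & PPair (Tw q (pfst t) (pfst g)) (Tw q' (psnd t) (psnd g)) = w"
      using g1 g2 t v u w by (intro bexI[of _ "PPair g1 g2"]) (auto simp: S)
  next
    fix t g g' assume tt: "t : Pts (P ** P')" "g : gp (P ** P')" "g' : gp (P ** P')"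
     and gg: "Act (P ** P') g t = Act (P ** P') g' t"
       "PPair (Tw p (pfst t) (pfst g)) (Tw p' (psnd t) (psnd g)) = PPair (Tw p (pfst t) (pfst g')) (Tw p' (psnd t) (psnd g'))"
       "PPair (Tw q (pfst t) (pfst g)) (Tw q' (psnd t) (psnd g)) = PPair (Tw q (pfst t) (pfst g')) (Tw q' (psnd t) (psnd g'))"
    obtain t1 t2 u1 u2 w1 w2 where t: "t = PPair t1 t2" "t1 : Pts P" "t2 : Pts P'" and u: "g = PPair u1 u2" "u1 : gp P" "u2 : gp P'"
      and w: "g' = PPair w1 w2" "w1 : gp P" "w2 : gp P'" using tt by (auto simp: S(1,2))
    have "u1 = w1" by (rule E(6)[OF t(2) u(2) w(2)]) (use gg t u w in "simp_all add: S")
    moreover have "u2 = w2" by (rule F(6)[OF t(3) u(3) w(3)]) (use gg t u w in "simp_all add: S")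
    ultimately show "g = g'" using u w by simp
  qed (use z y E(1-3) F(1-3) cl in "auto simp: S")
qed

lemma bpb_iso2:
  assumes "bpb P A B R a b p q"
  shows "iso2 P R (a oo p) (b oo q)"
proof -
  note z = bpbD[OF assms]
  obtain e where e: "bpb_on P A B R a b p q e" using bpbE[OF assms] .
  note E = bpb_onD(1-3)[OF e]
  show ?thesis
    by (rule iso2I[OF z(1,4) oc_comp[OF z(1,7,5)] oc_comp[OF z(1,8,6)], of e]) (use E in "simp_all only: oo_simps")
qed

subsection \<open>Coproducts in slice categories\<close>

lemma coprodD:
  assumes "is_coproduct C A B S i j"
  shows "A : ob C" "B : ob C" "S : ob C" "i : arrows C A S" "j : arrows C B S"
    and "f : arrows C A T ==> g : arrows C B T ==> T : ob C ==> EX h:arrows C S T. h o[C] i = f & h o[C] j = g"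
    and "h : arrows C S T ==> h' : arrows C S T ==> T : ob C ==> h o[C] i : arrows C A T ==> h o[C] j : arrows C B T ==>
      h o[C] i = h' o[C] i ==> h o[C] j = h' o[C] j ==> h = h'"
  using assms unfolding is_coproduct_def by (blast, blast, blast, blast, blast, meson, metis)

lemma coproduct_ext:
  assumes C: "is_category C" and S: "is_coproduct C A B S i j"
    and h: "h : arrows C S T" "h' : arrows C S T" "h o[C] i = h' o[C] i" "h o[C] j = h' o[C] j"
  shows "h = h'"
  using coprodD(7)[OF S h(1,2) arrows_ob(2)[OF C h(1)]] catD(4)[OF C coprodD(4)[OF S] h(1)]
    catD(4)[OF C coprodD(5)[OF S] h(1)] h(3,4) by blast

lemma coproduct_iso:
  assumes C: "is_category C" and S: "is_coproduct C A B S i j" and S': "is_coproduct C A B S' i' j'"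
  obtains f g where "f : arrows C S S'" "g : arrows C S' S" "g o[C] f = idn C S" "f o[C] g = idn C S'"
    "f o[C] i = i'" "f o[C] j = j'"
proof -
  note c = catD[OF C] and s = coprodD[OF S] and s' = coprodD[OF S']
  obtain f where f: "f : arrows C S S'" "f o[C] i = i'" "f o[C] j = j'" using s(6)[OF s'(4,5,3)] by blast
  obtain g where g: "g : arrows C S' S" "g o[C] i' = i" "g o[C] j' = j" using s'(6)[OF s(4,5,3)] by blast
  have "g o[C] f = idn C S"
    by (rule coproduct_ext[OF C S c(4)[OF f(1) g(1)] c(3)[OF s(3)]])
      (use c(7)[OF s(4) f(1) g(1)] c(7)[OF s(5) f(1) g(1)] f g c(6)[OF s(4)] c(6)[OF s(5)] in simp_all)
  moreover have "f o[C] g = idn C S'"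
    by (rule coproduct_ext[OF C S' c(4)[OF g(1) f(1)] c(3)[OF s'(3)]])
      (use c(7)[OF s'(4) g(1) f(1)] c(7)[OF s'(5) g(1) f(1)] f g c(6)[OF s'(4)] c(6)[OF s'(5)] in simp_all)
  ultimately show ?thesis using that f g by blast
qed

lemma coproduct_transfer:
  assumes C: "is_category C" and S: "is_coproduct C A B S i j"
    and f: "f : arrows C S S'" "g : arrows C S' S" "g o[C] f = idn C S" "f o[C] g = idn C S'"
  shows "is_coproduct C A B S' (f o[C] i) (f o[C] j)"
proof -
  note c = catD[OF C] and s = coprodD[OF S]
  have "EX! h. h : arrows C S' T & h o[C] (f o[C] i) = u & h o[C] (f o[C] j) = v"
    if T: "T : ob C" and uv: "u : arrows C A T" "v : arrows C B T" for T u v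
  proof -
    obtain h where h: "h : arrows C S T" "h o[C] i = u" "h o[C] j = v" using s(6)[OF uv T] by blast
    have hg: "h o[C] g : arrows C S' T" by (rule c(4)[OF f(2) h(1)])
    have "(h o[C] g) o[C] (f o[C] x) = h o[C] x" if "x : arrows C D S" for x D
      using c(7)[OF c(4)[OF that f(1)] f(2) h(1)] c(7)[OF that f(1,2)] f(3) c(6)[OF that] by simp
    then have ex: "h o[C] g : arrows C S' T & (h o[C] g) o[C] (f o[C] i) = u & (h o[C] g) o[C] (f o[C] j) = v"
      using hg s(4,5) h by metis
    show ?thesis
    proof (rule ex1I)
      show "h o[C] g : arrows C S' T & (h o[C] g) o[C] (f o[C] i) = u & (h o[C] g) o[C] (f o[C] j) = v" by (rule ex)
      fix l assume l: "l : arrows C S' T & l o[C] (f o[C] i) = u & l o[C] (f o[C] j) = v"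
      then have "l o[C] f = h"
        by (intro coproduct_ext[OF C S c(4)[OF f(1)] h(1)])
          (use h c(7)[OF s(4) f(1)] c(7)[OF s(5) f(1)] in auto)
      then show "l = h o[C] g" using c(7)[OF f(2,1), of l T] l f(4) c(5)[of l S' T] by metis
    qed
  qed
  then show ?thesis
    using s c(4)[OF s(4) f(1)] c(4)[OF s(5) f(1)] arrows_ob[OF C f(1)] by (simp add: is_coproduct_def)
qed

lemma slice_simps [simp]:
  "ob (slice C X) = {f : ar C. tgt C f = X}"
  "src (slice C X) (f, g, h) = f" "tgt (slice C X) (f, g, h) = g"
  "idn (slice C X) f = (f, f, idn C (src C f))"
  "cmp (slice C X) (f', g', h') (f, g, h) = (f, g', cmp C h' h)"
  by (simp_all add: slice_def)

lemma arr_slice: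
  "t : arrows (slice C X) f g \<longleftrightarrow> f : arrows C (src C f) X & g : arrows C (src C g) X &
     (EX h:arrows C (src C f) (src C g). g o[C] h = f & t = (f, g, h))"
  by (auto simp: arrows_def slice_def)

lemma is_isoI:
  assumes "f : arrows C X Y" "g : arrows C Y X" "g o[C] f = idn C X" "f o[C] g = idn C Y"
  shows "is_iso C f"
  using assms by (auto simp: is_iso_def arrows_def)

lemma is_isoE:
  assumes "is_iso C f" "f : arrows C X Y"
  obtains g where "g : arrows C Y X" "g o[C] f = idn C X" "f o[C] g = idn C Y"
  using assms by (auto simp: is_iso_def arrows_def)

lemma ar_sliceE:
  assumes "t : ar (slice C X)"
  obtains f g h where "t = (f, g, h)" "f : arrows C (src C f) X" "g : arrows C (src C g) X"
    "h : arrows C (src C f) (src C g)" "g o[C] h = f"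
  using assms by (auto simp: slice_def arrows_def)

lemma slice_category:
  assumes C: "is_category C"
  shows "is_category (slice C X)"
proof -
  note c = catD[OF C]
  show ?thesis
    unfolding is_category_def
  proof (intro conjI ballI impI)
    fix t u assume t: "t : ar (slice C X)" "u : ar (slice C X)" "tgt (slice C X) t = src (slice C X) u"
    obtain f g h where 1: "t = (f, g, h)" "f : arrows C (src C f) X" "g : arrows C (src C g) X"
      "h : arrows C (src C f) (src C g)" "g o[C] h = f" using ar_sliceE[OF t(1)] .
    obtain g1 g' h' where 2: "u = (g1, g', h')" "g' : arrows C (src C g') X"
      "h' : arrows C (src C g1) (src C g')" "g' o[C] h' = g1" using ar_sliceE[OF t(2)] .
    have g1: "g1 = g" using t(3) 1(1) 2(1) by simp
    note 2 = 2[unfolded g1]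
    have "g' o[C] (h' o[C] h) = f" using c(7)[OF 1(4) 2(3,2)] 1(5) 2(4) by simp
    then have "(f, g', h' o[C] h) : arrows (slice C X) f g'"
      using 1(2) 2(2) c(4)[OF 1(4) 2(3)] by (simp add: arr_slice)
    then show "u o[slice C X] t : arrows (slice C X) (src (slice C X) t) (tgt (slice C X) u)"
      by (simp add: 1(1) 2(1))
    fix v assume v: "v : ar (slice C X)" "tgt (slice C X) u = src (slice C X) v"
    obtain g2 g'' h'' where 3: "v = (g2, g'', h'')" "h'' : arrows C (src C g2) (src C g'')" using ar_sliceE[OF v(1)] .
    have g2: "g2 = g'" using v(2) 2(1) 3(1) by simp
    note 3 = 3[unfolded g2]
    show "v o[slice C X] (u o[slice C X] t) = (v o[slice C X] u) o[slice C X] t"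
      using 1(1) 2(1) 3(1) c(7)[OF 1(4) 2(3) 3(2)] by simp
  next
    fix t assume t: "t : ar (slice C X)"
    obtain f g h where 1: "t = (f, g, h)" "f : arrows C (src C f) X" "g : arrows C (src C g) X"
      "h : arrows C (src C f) (src C g)" "g o[C] h = f" using ar_sliceE[OF t] .
    show "t o[slice C X] idn (slice C X) (src (slice C X) t) = t"
      and "idn (slice C X) (tgt (slice C X) t) o[slice C X] t = t"
      and "src (slice C X) t : ob (slice C X)" and "tgt (slice C X) t : ob (slice C X)"
      using 1(1) c(5,6)[OF 1(4)] arrowsD[OF 1(2)] arrowsD[OF 1(3)] by simp_all
  next
    fix f assume "f : ob (slice C X)"
    then have f: "f : arrows C (src C f) X" by (simp add: arrows_def)
    show "idn (slice C X) f : arrows (slice C X) f f"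
      using f c(3)[OF arrows_ob(1)[OF C f]] c(5)[OF f] by (simp add: arr_slice)
  qed
qed

lemma slice_isomorphic_iff:
  assumes C: "is_category C"
  shows "isomorphic (slice C X) f g \<longleftrightarrow> f : ar C & tgt C f = X & g : ar C & tgt C g = X &
    (EX h:arrows C (src C f) (src C g). is_iso C h & g o[C] h = f)"
proof
  assume "isomorphic (slice C X) f g"
  then obtain t u where t: "t : arrows (slice C X) f g" "u : arrows (slice C X) g f"
    "u o[slice C X] t = idn (slice C X) f" "t o[slice C X] u = idn (slice C X) g"
    by (auto simp: isomorphic_iff)
  then obtain h l where h: "f : arrows C (src C f) X" "g : arrows C (src C g) X" "h : arrows C (src C f) (src C g)"
    "l : arrows C (src C g) (src C f)" "g o[C] h = f" "l o[C] h = idn C (src C f)" "h o[C] l = idn C (src C g)"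
    by (auto simp: arr_slice)
  then show "f : ar C & tgt C f = X & g : ar C & tgt C g = X &
    (EX h:arrows C (src C f) (src C g). is_iso C h & g o[C] h = f)"
    using is_isoI[OF h(3,4,6,7)] arrowsD[OF h(1)] arrowsD[OF h(2)] by blast
next
  assume "f : ar C & tgt C f = X & g : ar C & tgt C g = X &
    (EX h:arrows C (src C f) (src C g). is_iso C h & g o[C] h = f)"
  then obtain h where h: "f : arrows C (src C f) X" "g : arrows C (src C g) X" "h : arrows C (src C f) (src C g)" "is_iso C h" "g o[C] h = f"
    by (auto simp: arrows_def)
  obtain l where l: "l : arrows C (src C g) (src C f)" "l o[C] h = idn C (src C f)" "h o[C] l = idn C (src C g)"
    using is_isoE[OF h(4,3)] .
  have "f o[C] l = g" using catD(7)[OF C l(1) h(3,2)] l(3) h(5) catD(5)[OF C h(2)] by simp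
  then have "(f, g, h) : arrows (slice C X) f g" "(g, f, l) : arrows (slice C X) g f"
    using h l by (simp_all add: arr_slice)
  then show "isomorphic (slice C X) f g"
    unfolding isomorphic_iff using l by (intro bexI[of _ "(f, g, h)"] bexI[of _ "(g, f, l)"]) auto
qed

text \<open>The copairing in \<open>C\<close> is also the copairing in the slice: it lies over
  \<open>X\<close> because the two maps to \<open>X\<close> agree on both summands.\<close>

lemma coproduct_slice:
  assumes C: "is_category C" and S: "is_coproduct C A B S i j" and s: "s : arrows C S X"
  shows "is_coproduct (slice C X) (s o[C] i) (s o[C] j) s (s o[C] i, s, i) (s o[C] j, s, j)"
proof -
  note c = catD[OF C] and d = coprodD[OF S]
  note si = c(4)[OF d(4) s] and sj = c(4)[OF d(5) s]
  have "EX! h. h : arrows (slice C X) s t & h o[slice C X] (s o[C] i, s, i) = u & h o[slice C X] (s o[C] j, s, j) = v"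
    if uv: "u : arrows (slice C X) (s o[C] i) t" "v : arrows (slice C X) (s o[C] j) t" for t u v
  proof -
    have t: "t : arrows C (src C t) X" using uv(1) by (auto simp: arr_slice)
    obtain u0 where u0: "u = (s o[C] i, t, u0)" "u0 : arrows C A (src C t)" "t o[C] u0 = s o[C] i"
      using uv(1) arrowsD(2)[OF si] by (auto simp: arr_slice)
    obtain v0 where v0: "v = (s o[C] j, t, v0)" "v0 : arrows C B (src C t)" "t o[C] v0 = s o[C] j"
      using uv(2) arrowsD(2)[OF sj] by (auto simp: arr_slice)
    obtain h where h: "h : arrows C S (src C t)" "h o[C] i = u0" "h o[C] j = v0"
      using d(6)[OF u0(2) v0(2) arrows_ob(1)[OF C t]] by blast
    have th: "t o[C] h = s"
      by (rule coproduct_ext[OF C S c(4)[OF h(1) t] s])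
        (use c(7)[OF d(4) h(1) t] c(7)[OF d(5) h(1) t] h u0 v0 in simp_all)
    show ?thesis
    proof (rule ex1I[of _ "(s, t, h)"])
      show "(s, t, h) : arrows (slice C X) s t & (s, t, h) o[slice C X] (s o[C] i, s, i) = u &
        (s, t, h) o[slice C X] (s o[C] j, s, j) = v"
        using h th t s u0 v0 arrowsD(2)[OF s] by (simp add: arr_slice)
      fix l assume l: "l : arrows (slice C X) s t & l o[slice C X] (s o[C] i, s, i) = u & l o[slice C X] (s o[C] j, s, j) = v"
      then obtain l0 where l0: "l = (s, t, l0)" "l0 : arrows C S (src C t)"
        using arrowsD(2)[OF s] by (auto simp: arr_slice)
      have "l0 = h" by (rule coproduct_ext[OF C S l0(2) h(1)]) (use l l0 h u0 v0 in auto)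
      then show "l = (s, t, h)" using l0 by simp
    qed
  qed
  then show ?thesis
    using si sj s d arrowsD[OF si] arrowsD[OF sj] arrowsD[OF s]
    by (simp add: is_coproduct_def arr_slice)
qed

text \<open>The coproduct of the sources, formed in \<open>C\<close> with its induced map to
  \<open>X\<close>, is another coproduct in the slice. The comparison isomorphism carries its
  universal property over to the source of \<open>s\<close>.\<close>

lemma slice_coproductD:
  assumes C: "is_category C" and E: "!!A B. A : ob C ==> B : ob C ==> EX E i j. is_coproduct C A B E i j"
    and S: "is_coproduct (slice C X) a b s i j"
  shows "EX i0 j0. is_coproduct C (src C a) (src C b) (src C s) i0 j0 & s o[C] i0 = a & s o[C] j0 = b"
proof -
  note c = catD[OF C] and d = coprodD[OF S]
  have a: "a : arrows C (src C a) X" and b: "b : arrows C (src C b) X" using d(1,2) by (auto simp: arrows_def)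
  obtain E i' j' where E: "is_coproduct C (src C a) (src C b) E i' j'"
    using E[OF arrows_ob(1)[OF C a] arrows_ob(1)[OF C b]] by blast
  obtain e where e: "e : arrows C E X" "e o[C] i' = a" "e o[C] j' = b"
    using coprodD(6)[OF E a b arrows_ob(2)[OF C a]] by blast
  have "is_coproduct (slice C X) a b e (a, e, i') (b, e, j')"
    using coproduct_slice[OF C E e(1)] e by simp
  from coproduct_iso[OF slice_category[OF C] this S]
  obtain f g where f: "f : arrows (slice C X) e s" "g : arrows (slice C X) s e"
    "g o[slice C X] f = idn (slice C X) e" "f o[slice C X] g = idn (slice C X) s" by metis
  then obtain f0 g0 where f0: "f0 : arrows C E (src C s)" "g0 : arrows C (src C s) E" "g0 o[C] f0 = idn C E" "f0 o[C] g0 = idn C (src C s)" "s o[C] f0 = e"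
    "s : arrows C (src C s) X"
    using arrowsD(2)[OF e(1)] by (auto simp: arr_slice)
  have "is_coproduct C (src C a) (src C b) (src C s) (f0 o[C] i') (f0 o[C] j')"
    by (rule coproduct_transfer[OF C E f0(1-4)])
  moreover have "s o[C] (f0 o[C] i') = a" "s o[C] (f0 o[C] j') = b"
    using c(7)[OF coprodD(4)[OF E] f0(1,6)] c(7)[OF coprodD(5)[OF E] f0(1,6)] f0(5) e by simp_all
  ultimately show ?thesis by blast
qed

subsection \<open>Spans\<close>

lemma span_iso_sym:
  assumes "is_span \<beta> \<alpha>" "is_span \<beta>' \<alpha>'" "span_iso (\<beta>, \<alpha>) (\<beta>', \<alpha>')"
  shows "span_iso (\<beta>', \<alpha>') (\<beta>, \<alpha>)"
proof -
  note c = catD[OF cat_CC]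
  obtain \<gamma> where g: "is_iso CC \<gamma>" "cdom \<gamma> = cdom \<beta>" "ccod \<gamma> = cdom \<beta>'" "\<beta>' o[CC] \<gamma> = \<beta>" "\<alpha>' o[CC] \<gamma> = \<alpha>"
    using assms(3) by (auto simp: span_iso_def)
  then obtain \<delta> where d: "\<gamma> : arrows CC (cdom \<beta>) (cdom \<beta>')" "\<delta> : arrows CC (cdom \<beta>') (cdom \<beta>)"
    "\<delta> o[CC] \<gamma> = idn CC (cdom \<beta>)" "\<gamma> o[CC] \<delta> = idn CC (cdom \<beta>')"
    by (auto simp: is_iso_def arrows_def)
  have "\<beta>' : arrows CC (cdom \<beta>') (ccod \<beta>')" "\<alpha>' : arrows CC (cdom \<beta>') (ccod \<alpha>')"
    using assms(2) by (auto simp: is_span_def arrows_def)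
  note e = c(7)[OF d(2,1) this(1)] c(7)[OF d(2,1) this(2)] c(5)[OF this(1)] c(5)[OF this(2)]
  have "is_iso CC \<delta>" using d by (auto simp: is_iso_def arrows_def)
  moreover have "\<beta> o[CC] \<delta> = \<beta>'" "\<alpha> o[CC] \<delta> = \<alpha>'" using e d(4) g(4,5) by simp_all
  ultimately show ?thesis using d(2) by (auto simp: span_iso_def arrows_def)
qed

lemma span_iso_trans:
  assumes "is_span \<beta> \<alpha>" "is_span \<beta>' \<alpha>'" "is_span \<beta>'' \<alpha>''" "span_iso (\<beta>, \<alpha>) (\<beta>', \<alpha>')" "span_iso (\<beta>', \<alpha>') (\<beta>'', \<alpha>'')"
  shows "span_iso (\<beta>, \<alpha>) (\<beta>'', \<alpha>'')"
proof -
  note c = catD[OF cat_CC]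
  obtain \<gamma> where g: "is_iso CC \<gamma>" "cdom \<gamma> = cdom \<beta>" "ccod \<gamma> = cdom \<beta>'" "\<beta>' o[CC] \<gamma> = \<beta>" "\<alpha>' o[CC] \<gamma> = \<alpha>"
    using assms(4) by (auto simp: span_iso_def)
  obtain \<delta> where d: "is_iso CC \<delta>" "cdom \<delta> = cdom \<beta>'" "ccod \<delta> = cdom \<beta>''" "\<beta>'' o[CC] \<delta> = \<beta>'" "\<alpha>'' o[CC] \<delta> = \<alpha>'"
    using assms(5) by (auto simp: span_iso_def)
  have gd: "\<gamma> : arrows CC (cdom \<beta>) (cdom \<beta>')" "\<delta> : arrows CC (cdom \<beta>') (cdom \<beta>'')"
    using g d by (auto simp: is_iso_def arrows_def)
  have s: "\<beta>'' : arrows CC (cdom \<beta>'') (ccod \<beta>'')" "\<alpha>'' : arrows CC (cdom \<beta>'') (ccod \<alpha>'')"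
    using assms(3) by (auto simp: is_span_def arrows_def)
  obtain W W' W'' u v where u: "zc W" "zc W'" "zc W''" "\<gamma> = c_arr W W' u" "\<delta> = c_arr W' W'' v"
    "oc W W' u" "oc W' W'' v" using gd by (auto simp: arr_CC)
  have "is_iso CC (\<delta> o[CC] \<gamma>)"
  proof -
    obtain \<gamma>' where g': "\<gamma>' : arrows CC W' W" "\<gamma>' o[CC] \<gamma> = idn CC W" "\<gamma> o[CC] \<gamma>' = idn CC W'"
      using g(1) u by (auto simp: is_iso_def)
    obtain \<delta>' where d': "\<delta>' : arrows CC W'' W'" "\<delta>' o[CC] \<delta> = idn CC W'" "\<delta> o[CC] \<delta>' = idn CC W''"
      using d(1) u by (auto simp: is_iso_def)
    have m: "\<gamma> : arrows CC W W'" "\<delta> : arrows CC W' W''" using u by auto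
    have "(\<gamma>' o[CC] \<delta>') o[CC] (\<delta> o[CC] \<gamma>) = idn CC W"
      using c(7)[OF c(4)[OF m] d'(1) g'(1)] c(7)[OF m d'(1)] d' g' c(6)[OF m(1)] by simp
    moreover have "(\<delta> o[CC] \<gamma>) o[CC] (\<gamma>' o[CC] \<delta>') = idn CC W''"
      using c(7)[OF c(4)[OF d'(1) g'(1)] m] c(7)[OF d'(1) g'(1) m(1)] d' g' c(6)[OF d'(1)] by simp
    ultimately show ?thesis
      using c(4)[OF m] c(4)[OF d'(1) g'(1)] by (auto simp: is_iso_def arrows_def)
  qed
  moreover have "\<delta> o[CC] \<gamma> : arrows CC (cdom \<beta>) (cdom \<beta>'')" by (rule c(4)[OF gd])
  moreover have "\<beta>'' o[CC] (\<delta> o[CC] \<gamma>) = \<beta>" "\<alpha>'' o[CC] (\<delta> o[CC] \<gamma>) = \<alpha>"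
    using c(7)[OF gd s(1)] c(7)[OF gd s(2)] g d by simp_all
  ultimately show ?thesis by (auto simp: span_iso_def arrows_def)
qed

lemma span_iso_refl:
  assumes "is_span \<beta> \<alpha>"
  shows "span_iso (\<beta>, \<alpha>) (\<beta>, \<alpha>)"
proof -
  have s: "\<beta> : arrows CC (cdom \<beta>) (ccod \<beta>)" "\<alpha> : arrows CC (cdom \<beta>) (ccod \<alpha>)"
    using assms by (auto simp: is_span_def arrows_def)
  have i: "idn CC (cdom \<beta>) : arrows CC (cdom \<beta>) (cdom \<beta>)"
    by (rule catD(3)[OF cat_CC arrows_ob(1)[OF cat_CC s(1)]])
  then have "is_iso CC (idn CC (cdom \<beta>))"
    using catD(5)[OF cat_CC i] unfolding is_iso_def by (auto simp: arrows_def)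
  then show ?thesis
    using i catD(5)[OF cat_CC s(1)] catD(5)[OF cat_CC s(2)]
    unfolding span_iso_def by (auto simp: arrows_def)
qed

lemma s_arr_eq_iff:
  assumes s: "is_span \<beta> \<alpha>" and s': "is_span \<beta>' \<alpha>'"
  shows "s_arr \<beta> \<alpha> = s_arr \<beta>' \<alpha>' \<longleftrightarrow> span_iso (\<beta>, \<alpha>) (\<beta>', \<alpha>')"
proof
  assume "s_arr \<beta> \<alpha> = s_arr \<beta>' \<alpha>'"
  then have "(\<beta>', \<alpha>') : scls (s_arr \<beta> \<alpha>)" using span_iso_refl[OF s'] s' by (simp add: s_arr_def)
  then show "span_iso (\<beta>, \<alpha>) (\<beta>', \<alpha>')" by (simp add: s_arr_def)
next
  assume i: "span_iso (\<beta>, \<alpha>) (\<beta>', \<alpha>')"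
  have "span_iso (\<beta>, \<alpha>) (b, a) \<longleftrightarrow> span_iso (\<beta>', \<alpha>') (b, a)" if "is_span b a" for b a
    using span_iso_trans[OF s s' that i] span_iso_trans[OF s' s that span_iso_sym[OF s s' i]] by blast
  moreover have "ccod \<beta> = ccod \<beta>'" "ccod \<alpha> = ccod \<alpha>'"
  proof -
    obtain \<gamma> where g: "is_iso CC \<gamma>" "cdom \<gamma> = cdom \<beta>" "ccod \<gamma> = cdom \<beta>'" "\<beta>' o[CC] \<gamma> = \<beta>" "\<alpha>' o[CC] \<gamma> = \<alpha>"
      using i by (auto simp: span_iso_def)
    have "\<gamma> : arrows CC (cdom \<beta>) (cdom \<beta>')" using g by (auto simp: is_iso_def arrows_def)
    moreover have "\<beta>' : arrows CC (cdom \<beta>') (ccod \<beta>')" "\<alpha>' : arrows CC (cdom \<beta>') (ccod \<alpha>')"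
      using s' by (auto simp: is_span_def arrows_def)
    ultimately have "\<beta>' o[CC] \<gamma> : arrows CC (cdom \<beta>) (ccod \<beta>')" "\<alpha>' o[CC] \<gamma> : arrows CC (cdom \<beta>) (ccod \<alpha>')"
      using catD(4)[OF cat_CC] by blast+
    then show "ccod \<beta> = ccod \<beta>'" "ccod \<alpha> = ccod \<alpha>'" using g by (auto simp: arrows_def)
  qed
  ultimately show "s_arr \<beta> \<alpha> = s_arr \<beta>' \<alpha>'" by (auto simp: s_arr_def)
qed

text \<open>The arguments are apex, source, target, then the leg to the target and the leg to the
  source; the span is a morphism from \<open>X\<close> to \<open>Y\<close>.\<close>

definition is_sp :: "zero_cell => zero_cell => zero_cell => one_cell => one_cell => bool" where
  "is_sp W X Y b a \<longleftrightarrow> zc W & zc X & zc Y & oc W Y b & oc W X a"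

definition sp :: "zero_cell => zero_cell => zero_cell => one_cell => one_cell => s_arrow" where
  "sp W X Y b a = s_arr (c_arr W Y b) (c_arr W X a)"

lemma sp_sel [simp]: "sdom (sp W X Y b a) = X" "scod (sp W X Y b a) = Y"
  by (simp_all add: sp_def s_arr_def)

lemma is_sp_span: "is_sp W X Y b a ==> is_span (c_arr W Y b) (c_arr W X a)"
  by (auto simp: is_sp_def is_span_def)

text \<open>The morphisms of \<open>CC\<close> are mere classes, so an isomorphism of spans unfolds
  into an equivalence of apexes that commutes with each leg up to some 2-cell, the two 2-cells being
  unrelated.\<close>

lemma sp_eq_iff:
  assumes s: "is_sp W X Y b a" and s': "is_sp W' X Y b' a'"
  shows "sp W X Y b a = sp W' X Y b' a' \<longleftrightarrow>
    (EX k. eqv W W' k & iso2 W Y (b' oo k) b & iso2 W X (a' oo k) a)"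
proof -
  note z = s[unfolded is_sp_def] s'[unfolded is_sp_def]
  have W: "zc W" "zc X" "zc Y" "zc W'" and b: "oc W' Y b'" "oc W' X a'"
    and b0: "oc W Y b" "oc W X a" using z by auto
  have "span_iso (c_arr W Y b, c_arr W X a) (c_arr W' Y b', c_arr W' X a') \<longleftrightarrow>
      (EX k. oc W W' k & is_iso CC (c_arr W W' k) & c_arr W' Y b' o[CC] c_arr W W' k = c_arr W Y b &
        c_arr W' X a' o[CC] c_arr W W' k = c_arr W X a)"
  proof
    assume "span_iso (c_arr W Y b, c_arr W X a) (c_arr W' Y b', c_arr W' X a')"
    then obtain \<gamma> where g: "is_iso CC \<gamma>" "cdom \<gamma> = W" "ccod \<gamma> = W'" "c_arr W' Y b' o[CC] \<gamma> = c_arr W Y b"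
      "c_arr W' X a' o[CC] \<gamma> = c_arr W X a" by (auto simp: span_iso_def)
    then have "\<gamma> : arrows CC W W'" by (auto simp: is_iso_def arrows_def)
    then show "EX k. oc W W' k & is_iso CC (c_arr W W' k) & c_arr W' Y b' o[CC] c_arr W W' k = c_arr W Y b &
        c_arr W' X a' o[CC] c_arr W W' k = c_arr W X a" using g by (auto simp: arr_CC)
  next
    assume "EX k. oc W W' k & is_iso CC (c_arr W W' k) & c_arr W' Y b' o[CC] c_arr W W' k = c_arr W Y b &
        c_arr W' X a' o[CC] c_arr W W' k = c_arr W X a"
    then show "span_iso (c_arr W Y b, c_arr W X a) (c_arr W' Y b', c_arr W' X a')"
      unfolding span_iso_def by auto
  qed
  also have "... \<longleftrightarrow> (EX k. eqv W W' k & iso2 W Y (b' oo k) b & iso2 W X (a' oo k) a)"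
  proof (rule ex_cong1)
    fix k
    show "oc W W' k & is_iso CC (c_arr W W' k) & c_arr W' Y b' o[CC] c_arr W W' k = c_arr W Y b &
        c_arr W' X a' o[CC] c_arr W W' k = c_arr W X a \<longleftrightarrow>
      eqv W W' k & iso2 W Y (b' oo k) b & iso2 W X (a' oo k) a"
    proof (cases "oc W W' k")
      case True
      note c = oc_comp[OF W(1) True b(1)] oc_comp[OF W(1) True b(2)]
      show ?thesis
        using is_iso_CC_iff[OF W(1,4) True] c_comp[OF W(1,4,3) True b(1)] c_comp[OF W(1,4,2) True b(2)] True
          c_arr_eq_iff[OF W(1,3) c(1), of b] c_arr_eq_iff[OF W(1,2) c(2), of a] b0 by auto
    next
      case False then show ?thesis by (simp add: eqv_def)
    qed
  qed
  finally show ?thesis using s_arr_eq_iff[OF is_sp_span[OF s] is_sp_span[OF s']] by (simp add: sp_def)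
qed

text \<open>All that is known of the span picked by \<open>s_rep\<close>: an equivalence of apexes
  compatible with the legs.\<close>

lemma s_rep_sp:
  assumes s: "is_sp W X Y b a"
  obtains W' b' a' k where "s_rep (sp W X Y b a) = (c_arr W' Y b', c_arr W' X a')" "is_sp W' X Y b' a'"
    "eqv W W' k" "iso2 W Y (b' oo k) b" "iso2 W X (a' oo k) a"
    "sp W' X Y b' a' = sp W X Y b a"
proof -
  have "(c_arr W Y b, c_arr W X a) : scls (sp W X Y b a)"
    using span_iso_refl is_sp_span[OF s] by (simp add: sp_def s_arr_def)
  then have "s_rep (sp W X Y b a) : scls (sp W X Y b a)" unfolding s_rep_def by (rule someI)
  then obtain \<beta> \<alpha> where r: "s_rep (sp W X Y b a) = (\<beta>, \<alpha>)" "is_span \<beta> \<alpha>" "span_iso (c_arr W Y b, c_arr W X a) (\<beta>, \<alpha>)"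
    by (auto simp: sp_def s_arr_def)
  have eq: "s_arr (c_arr W Y b) (c_arr W X a) = s_arr \<beta> \<alpha>" using s_arr_eq_iff[OF is_sp_span[OF s] r(2)] r(3) by simp
  then have "ccod \<beta> = Y" "ccod \<alpha> = X" by (simp_all add: s_arr_def)
  then have "\<beta> : arrows CC (cdom \<beta>) Y" "\<alpha> : arrows CC (cdom \<beta>) X" using r(2) by (auto simp: is_span_def arrows_def)
  then obtain b' a' where ba: "\<beta> = c_arr (cdom \<beta>) Y b'" "\<alpha> = c_arr (cdom \<beta>) X a'" "is_sp (cdom \<beta>) X Y b' a'"
    unfolding arr_CC is_sp_def by metis
  have e: "sp W X Y b a = sp (cdom \<beta>) X Y b' a'" using eq ba(1,2) by (metis sp_def)
  then obtain k where "eqv W (cdom \<beta>) k" "iso2 W Y (b' oo k) b" "iso2 W X (a' oo k) a"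
    using sp_eq_iff[OF s ba(3)] by blast
  then show ?thesis using that[OF _ ba(3)] r(1) ba(1,2) e by metis
qed

lemma SpC_simps [simp]: "src SpC = sdom" "tgt SpC = scod" "ob SpC = {P. zc P}"
  by (simp_all add: SpC_def)

lemma idn_SpC: "idn SpC P = sp P P P id_cell id_cell"
  by (simp add: SpC_def sp_def)

lemma ar_SpC_iff: "s : ar SpC \<longleftrightarrow> (EX W X Y b a. is_sp W X Y b a & s = sp W X Y b a)"
proof
  assume "s : ar SpC"
  then obtain \<beta> \<alpha> where s: "s = s_arr \<beta> \<alpha>" "is_span \<beta> \<alpha>" by (auto simp: SpC_def)
  then have "\<beta> : arrows CC (cdom \<beta>) (ccod \<beta>)" "\<alpha> : arrows CC (cdom \<beta>) (ccod \<alpha>)" by (auto simp: is_span_def arrows_def)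
  then show "EX W X Y b a. is_sp W X Y b a & s = sp W X Y b a"
    unfolding s(1) sp_def is_sp_def arr_CC by metis
next
  assume "EX W X Y b a. is_sp W X Y b a & s = sp W X Y b a"
  then obtain W X Y b a where "is_sp W X Y b a" "s = sp W X Y b a" by blast
  then show "s : ar SpC" using is_sp_span[of W X Y b a] by (auto simp: SpC_def sp_def)
qed

lemma sp_in [simp]: "is_sp W X Y b a ==> sp W X Y b a : ar SpC"
  using ar_SpC_iff by blast

lemma ar_SpCE:
  assumes "s : ar SpC" "sdom s = X" "scod s = Y"
  obtains W b a where "is_sp W X Y b a" "s = sp W X Y b a"
  using assms unfolding ar_SpC_iff by auto

lemma ar_SpC_ob: "s : ar SpC ==> zc (sdom s)" "s : ar SpC ==> zc (scod s)"
  by (auto simp: ar_SpC_iff is_sp_def)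

lemma eqvD:
  assumes "eqv P Q k"
  shows "oc P Q k" "full P Q k" "faithful P Q k" "eso P Q k"
  using assms by (auto simp: eqv_def)

text \<open>Independence of all choices. The composite is defined by chosen spans, chosen 1-cells
  and the standard bipullback. The given square is moved onto those representatives by
  \<open>bpb_change\<close> and \<open>bpb_equiv\<close>, once for each leg with
  \<open>bpb_sym\<close> in between, and \<open>bpb_unique\<close> then compares the apexes.\<close>

lemma sp_comp:
  assumes s: "is_sp W X Y b a" and t: "is_sp V Y Z d c" and h: "bpb P W V Y b c p q"
  shows "sp V Y Z d c o[SpC] sp W X Y b a = sp P X Z (d oo q) (a oo p)"
proof -
  obtain W' b' a' k where s': "s_rep (sp W X Y b a) = (c_arr W' Y b', c_arr W' X a')" "is_sp W' X Y b' a'"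
    "eqv W W' k" "iso2 W Y (b' oo k) b" "iso2 W X (a' oo k) a" using s_rep_sp[OF s] .
  obtain V' d' c' l where t': "s_rep (sp V Y Z d c) = (c_arr V' Z d', c_arr V' Y c')" "is_sp V' Y Z d' c'"
    "eqv V V' l" "iso2 V Z (d' oo l) d" "iso2 V Y (c' oo l) c" using s_rep_sp[OF t] .
  have z: "zc W" "zc X" "zc Y" "zc Z" "zc V" "zc W'" "zc V'"
    "oc W' Y b'" "oc W' X a'" "oc V' Z d'" "oc V' Y c'" "oc V Z d" "oc W X a"
    using s t s'(2) t'(2) by (auto simp: is_sp_def)
  define b'' where "b'' = c_rep (c_arr W' Y b')"
  define c'' where "c'' = c_rep (c_arr V' Y c')"
  have b'': "iso2 W' Y b' b''" and c'': "iso2 V' Y c' c''"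
    unfolding b''_def c''_def using c_rep_iso2 z by blast+
  note k = eqvD[OF s'(3)] and l = eqvD[OF t'(3)] and P = bpbD(1)[OF h]
  have "bpb P W V Y (b'' oo k) c p q"
    by (rule bpb_change[OF h iso2_trans[OF z(1,3) iso2_sym[OF z(1,3) s'(4)] iso2_comp[OF z(1,6,3) iso2_refl[OF z(1,6) k(1)] b'']]])
  then have "bpb P W' V Y b'' c (k oo p) q" by (rule bpb_equiv[OF z(6) s'(3) iso2_cells(2)[OF b'']])
  then have "bpb P V W' Y c b'' q (k oo p)" by (rule bpb_sym)
  then have "bpb P V W' Y (c'' oo l) b'' q (k oo p)"
    by (rule bpb_change[OF _ iso2_trans[OF z(5,3) iso2_sym[OF z(5,3) t'(5)] iso2_comp[OF z(5,7,3) iso2_refl[OF z(5,7) l(1)] c'']]])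
  then have "bpb P V' W' Y c'' b'' (l oo q) (k oo p)" by (rule bpb_equiv[OF z(7) t'(3) iso2_cells(2)[OF c'']])
  then have "bpb P W' V' Y b'' c'' (k oo p) (l oo q)" by (rule bpb_sym)
  from bpb_unique[OF this] obtain h' where h': "eqv P (bipullback W' V' Y b'' c'') h'"
    "bipullback_fst oo h' = k oo p" "bipullback_snd oo h' = l oo q" .
  let ?B = "bipullback W' V' Y b'' c''"
  note bb = bpbD[OF bp_bpb[OF z(6,7,3) iso2_cells(2)[OF b''] iso2_cells(2)[OF c'']]]
  have B: "zc ?B" by (rule bb(1))
  have wp: "c_wpb (c_arr W' Y b') (c_arr V' Y c') = ?B" by (simp add: c_wpb_def b''_def c''_def)
  have 1: "sp V Y Z d c o[SpC] sp W X Y b a = s_arr (c_arr V' Z d' o[CC] c_arr ?B V' bipullback_snd) (c_arr W' X a' o[CC] c_arr ?B W' bipullback_fst)"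
    using s'(1) t'(1) wp by (simp add: SpC_def s_comp_def c_wpb_fst_def c_wpb_snd_def)
  also have "... = sp ?B X Z (d' oo bipullback_snd) (a' oo bipullback_fst)"
    using c_comp[OF B z(7,4) bb(8) z(10)] c_comp[OF B z(6,2) bb(7) z(9)] by (simp add: sp_def)
  also have "... = sp P X Z (d oo q) (a oo p)"
  proof (rule sp_eq_iff[THEN iffD2, symmetric])
    note pq = bpbD(7,8)[OF h]
    show "is_sp P X Z (d oo q) (a oo p)"
      using z P oc_comp[OF P pq(1) z(13)] oc_comp[OF P pq(2) z(12)] by (simp add: is_sp_def)
    show "is_sp ?B X Z (d' oo bipullback_snd) (a' oo bipullback_fst)"
      using z B oc_comp[OF B bb(8) z(10)] oc_comp[OF B bb(7) z(9)] by (simp add: is_sp_def)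
    have "d' oo bipullback_snd oo h' = (d' oo l) oo q"
      by (simp add: oo_assoc[symmetric] h'(3))
    moreover have "a' oo bipullback_fst oo h' = (a' oo k) oo p"
      by (simp add: oo_assoc[symmetric] h'(2))
    ultimately show "EX k. eqv P ?B k & iso2 P Z (d' oo bipullback_snd oo k) (d oo q) &
      iso2 P X (a' oo bipullback_fst oo k) (a oo p)"
      using h'(1) iso2_comp[OF P z(5,4) iso2_refl[OF P z(5) pq(2)] t'(4)] iso2_comp[OF P z(1,2) iso2_refl[OF P z(1) pq(1)] s'(5)]
      by (intro exI[of _ h']) simp
  qed
  finally show ?thesis .
qed

lemma s_op_sp:
  assumes s: "is_sp W X Y b a"
  shows "s_op (sp W X Y b a) = sp W Y X a b"
proof -
  obtain W' b' a' k where s': "s_rep (sp W X Y b a) = (c_arr W' Y b', c_arr W' X a')" "is_sp W' X Y b' a'"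
    "eqv W W' k" "iso2 W Y (b' oo k) b" "iso2 W X (a' oo k) a" using s_rep_sp[OF s] .
  have "is_sp W Y X a b" "is_sp W' Y X a' b'" using s s'(2) by (auto simp: is_sp_def)
  then have "sp W Y X a b = sp W' Y X a' b'" using s'(3-5) sp_eq_iff by blast
  then show ?thesis using s'(1) by (simp add: s_op_def sp_def)
qed

lemma times_iso2:
  assumes P: "zc P" and Q: "zc Q" and P': "zc P'" and Q': "zc Q'"
    and i: "iso2 P Q a a'" and j: "iso2 P' Q' b b'"
  shows "iso2 (P ** P') (Q ** Q') (times a b) (times a' b')"
  unfolding times_def
  by (intro pair_iso2 iso2_comp[OF _ P Q _ i] iso2_comp[OF _ P' Q' _ j] iso2_refl) (use P Q P' Q' in auto)

lemma times_equiv: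
  assumes k: "eqv P Q k" and l: "eqv P' Q' l" and P: "zc P" "zc P'"
  shows "eqv (P ** P') (Q ** Q') (times k l)"
proof -
  note k = eqvD[OF k] and l = eqvD[OF l]
  note c = ocD(1,2)[OF k(1)] ocD(1,2)[OF l(1)] and S = prod_sel
  have "full (P ** P') (Q ** Q') (times k l)"
    unfolding full_def
  proof (intro ballI impI)
    fix x x' h assume xh: "x : Pts (P ** P')" "x' : Pts (P ** P')" "h : gp (Q ** Q')"
      and e: "Act (Q ** Q') h (Fn (times k l) x) = Fn (times k l) x'"
    obtain x1 x2 y1 y2 h1 h2 where x: "x = PPair x1 x2" "x' = PPair y1 y2" "h = PPair h1 h2" "x1 : Pts P" "x2 : Pts P'"
      "y1 : Pts P" "y2 : Pts P'" "h1 : gp Q" "h2 : gp Q'" using xh by (auto simp: S(1,2))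
    have "Act Q h1 (Fn k x1) = Fn k y1" "Act Q' h2 (Fn l x2) = Fn l y2" using e x c by (simp_all add: S)
    then obtain g1 g2 where "g1 : gp P" "Act P g1 x1 = y1" "Tw k x1 g1 = h1" "g2 : gp P'" "Act P' g2 x2 = y2" "Tw l x2 g2 = h2"
      using fullD[OF k(2) x(4,6,8)] fullD[OF l(2) x(5,7,9)] by blast
    then show "EX g:gp (P ** P'). Act (P ** P') g x = x' & Tw (times k l) x g = h"
      using x by (intro bexI[of _ "PPair g1 g2"]) (auto simp: S)
  qed
  moreover have "faithful (P ** P') (Q ** Q') (times k l)"
    unfolding faithful_def
  proof (intro ballI impI)
    fix x g g' assume xg: "x : Pts (P ** P')" "g : gp (P ** P')" "g' : gp (P ** P')"
      and e: "Act (P ** P') g x = Act (P ** P') g' x" "Tw (times k l) x g = Tw (times k l) x g'"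
    obtain x1 x2 g1 g2 h1 h2 where x: "x = PPair x1 x2" "g = PPair g1 g2" "g' = PPair h1 h2" "x1 : Pts P" "x2 : Pts P'"
      "g1 : gp P" "g2 : gp P'" "h1 : gp P" "h2 : gp P'" using xg by (auto simp: S(1,2))
    then show "g = g'" using e faithfulD[OF k(3) x(4,6,8)] faithfulD[OF l(3) x(5,7,9)] by (simp add: S)
  qed
  moreover have "eso (P ** P') (Q ** Q') (times k l)"
    unfolding eso_def
  proof
    fix y assume "y : Pts (Q ** Q')"
    then obtain y1 y2 where y: "y = PPair y1 y2" "y1 : Pts Q" "y2 : Pts Q'" by (auto simp: S)
    obtain x1 h1 where "x1 : Pts P" "h1 : gp Q" "Act Q h1 (Fn k x1) = y1" using eso_cellD[OF k(4) y(2)] by blast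
    moreover obtain x2 h2 where "x2 : Pts P'" "h2 : gp Q'" "Act Q' h2 (Fn l x2) = y2" using eso_cellD[OF l(4) y(3)] by blast
    ultimately show "EX x:Pts (P ** P'). EX h:gp (Q ** Q'). Act (Q ** Q') h (Fn (times k l) x) = y"
      using y c by (intro bexI[of _ "PPair x1 x2"] bexI[of _ "PPair h1 h2"]) (auto simp: S)
  qed
  ultimately show ?thesis using times_one_cell[OF P k(1) l(1)] by (simp add: eqv_def)
qed

lemma times_comp: "(times a b) oo (times c d) = times (a oo c) (b oo d)"
  by (rule oc_eqI) simp_all

lemma is_sp_times:
  assumes "is_sp W X Y b a" "is_sp W' X' Y' b' a'"
  shows "is_sp (W ** W') (X ** X') (Y ** Y') (times b b') (times a a')"
  using assms by (simp add: is_sp_def)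

lemma s_times_sp:
  assumes s: "is_sp W X Y b a" and t: "is_sp V X' Y' d c"
  shows "s_times (sp W X Y b a) (sp V X' Y' d c) =
    sp (W ** V) (X ** X') (Y ** Y') (times b d) (times a c)"
proof -
  obtain W' b' a' k where s': "s_rep (sp W X Y b a) = (c_arr W' Y b', c_arr W' X a')" "is_sp W' X Y b' a'"
    "eqv W W' k" "iso2 W Y (b' oo k) b" "iso2 W X (a' oo k) a" using s_rep_sp[OF s] .
  obtain V' d' c' l where t': "s_rep (sp V X' Y' d c) = (c_arr V' Y' d', c_arr V' X' c')" "is_sp V' X' Y' d' c'"
    "eqv V V' l" "iso2 V Y' (d' oo l) d" "iso2 V X' (c' oo l) c" using s_rep_sp[OF t] .
  have z: "zc W" "zc X" "zc Y" "zc V" "zc X'" "zc Y'" "zc W'" "zc V'"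
    "oc W' Y b'" "oc W' X a'" "oc V' Y' d'" "oc V' X' c'"
    using s t s'(2) t'(2) by (auto simp: is_sp_def)
  have "s_times (sp W X Y b a) (sp V X' Y' d c) =
      sp (W' ** V') (X ** X') (Y ** Y') (times b' d') (times a' c')"
    using s'(1) t'(1) z by (simp add: s_times_def c_times_eq sp_def)
  also have "... = sp (W ** V) (X ** X') (Y ** Y') (times b d) (times a c)"
    by (rule sp_eq_iff[OF is_sp_times[OF s t] is_sp_times[OF s'(2) t'(2)], THEN iffD2, symmetric])
      (rule exI[of _ "times k l"], use times_equiv[OF s'(3) t'(3) z(1,4)] times_iso2[OF z(1,3,4,6) s'(4) t'(4)]
        times_iso2[OF z(1,2,4,5) s'(5) t'(5)] in "simp add: times_comp")
  finally show ?thesis .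
qed

lemma is_sp_id [simp]: "zc P ==> is_sp P P P id_cell id_cell"
  by (simp add: is_sp_def oc_id)

lemma s_times_in [simp]:
  assumes s: "s : ar SpC" and t: "t : ar SpC"
  shows "s_times s t : ar SpC" "sdom (s_times s t) = (sdom s) ** (sdom t)"
    "scod (s_times s t) = (scod s) ** (scod t)"
proof -
  obtain W b a where s: "is_sp W (sdom s) (scod s) b a" "s = sp W (sdom s) (scod s) b a" using ar_SpCE[OF s refl refl] .
  obtain V d c where t: "is_sp V (sdom t) (scod t) d c" "t = sp V (sdom t) (scod t) d c" using ar_SpCE[OF t refl refl] .
  have "s_times s t = sp (W ** V) (sdom s ** sdom t) (scod s ** scod t) (times b d) (times a c)"
    using s_times_sp[OF s(1) t(1)] s(2) t(2) by simp
  then show "s_times s t : ar SpC" "sdom (s_times s t) = (sdom s) ** (sdom t)"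
    "scod (s_times s t) = (scod s) ** (scod t)"
    using is_sp_times[OF s(1) t(1)] by simp_all
qed

lemma s_op_in [simp]:
  assumes "s : ar SpC"
  shows "s_op s : ar SpC" "sdom (s_op s) = scod s" "scod (s_op s) = sdom s"
proof -
  obtain W X Y b a where s: "is_sp W X Y b a" "s = sp W X Y b a" using assms by (auto simp: ar_SpC_iff)
  then have "is_sp W Y X a b" by (auto simp: is_sp_def)
  then show "s_op s : ar SpC" "sdom (s_op s) = scod s" "scod (s_op s) = sdom s"
    using s s_op_sp[OF s(1)] by auto
qed

lemma idn_SpC_in [simp]: "zc P ==> idn SpC P : ar SpC" "sdom (idn SpC P) = P" "scod (idn SpC P) = P"
  by (auto simp: idn_SpC)

lemma SpC_comp_ex:
  assumes s: "is_sp W X Y b a" and t: "is_sp V Y Z d c"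
  obtains P p q where "bpb P W V Y b c p q" "is_sp P X Z (d oo q) (a oo p)"
    "sp V Y Z d c o[SpC] sp W X Y b a = sp P X Z (d oo q) (a oo p)"
proof -
  have z: "zc W" "zc V" "zc Y" "oc W Y b" "oc V Y c" "zc X" "zc Z"
    "oc W X a" "oc V Z d"
    using s t by (auto simp: is_sp_def)
  note h = bp_bpb[OF z(1-5)]
  note B = bpbD[OF h]
  show ?thesis
    by (rule that[OF h _ sp_comp[OF s t h]])
      (use oc_comp[OF B(1,8) z(9)] oc_comp[OF B(1,7) z(8)] B(1) z in "simp add: is_sp_def")
qed

lemma SpC_comp_in [simp]:
  assumes "s : ar SpC" "t : ar SpC" "scod s = sdom t"
  shows "t o[SpC] s : ar SpC" "sdom (t o[SpC] s) = sdom s" "scod (t o[SpC] s) = scod t"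
proof -
  define X Y Z where "X = sdom s" and "Y = scod s" and "Z = scod t"
  obtain W b a where s: "is_sp W X Y b a" "s = sp W X Y b a" using ar_SpCE[OF assms(1)] X_def Y_def by metis
  obtain V d c where t: "is_sp V Y Z d c" "t = sp V Y Z d c" using ar_SpCE[OF assms(2)] assms(3) Y_def Z_def by metis
  obtain P p q where "is_sp P X Z (d oo q) (a oo p)" "t o[SpC] s = sp P X Z (d oo q) (a oo p)"
    using SpC_comp_ex[OF s(1) t(1)] s t by metis
  then show "t o[SpC] s : ar SpC" "sdom (t o[SpC] s) = sdom s" "scod (t o[SpC] s) = scod t" by (simp_all add: X_def Z_def)
qed

lemma SpC_id_right:
  assumes "s : ar SpC"
  shows "s o[SpC] idn SpC (sdom s) = s"
proof -
  obtain W X Y b a where s: "is_sp W X Y b a" "s = sp W X Y b a" using assms by (auto simp: ar_SpC_iff)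
  then have z: "zc X" "zc W" "oc W X a" by (auto simp: is_sp_def)
  show ?thesis
    using sp_comp[OF is_sp_id[OF z(1)] s(1) bpb_id[OF z]] s by (simp add: idn_SpC)
qed

lemma SpC_id_left:
  assumes "s : ar SpC"
  shows "idn SpC (scod s) o[SpC] s = s"
proof -
  obtain W X Y b a where s: "is_sp W X Y b a" "s = sp W X Y b a" using assms by (auto simp: ar_SpC_iff)
  then have z: "zc Y" "zc W" "oc W Y b" by (auto simp: is_sp_def)
  show ?thesis
    using sp_comp[OF s(1) is_sp_id[OF z(1)] bpb_sym[OF bpb_id[OF z]]] s by (simp add: idn_SpC)
qed

text \<open>By \<open>bpb_times\<close> the product of the two squares that compute the composites
  is a homotopy pullback computing the composite of the products.\<close>

lemma s_times_comp:
  assumes "s : ar SpC" "t : ar SpC" "scod s = sdom t" "s' : ar SpC" "t' : ar SpC" "scod s' = sdom t'"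
  shows "s_times (t o[SpC] s) (t' o[SpC] s') = s_times t t' o[SpC] s_times s s'"
proof -
  define X Y Z where "X = sdom s" and "Y = scod s" and "Z = scod t"
  obtain W b a where s: "is_sp W X Y b a" "s = sp W X Y b a" using ar_SpCE[OF assms(1)] X_def Y_def by metis
  obtain V d c where t: "is_sp V Y Z d c" "t = sp V Y Z d c" using ar_SpCE[OF assms(2)] assms(3) Y_def Z_def by metis
  define X' Y' Z' where "X' = sdom s'" and "Y' = scod s'" and "Z' = scod t'"
  obtain W' b' a' where s': "is_sp W' X' Y' b' a'" "s' = sp W' X' Y' b' a'" using ar_SpCE[OF assms(4)] X'_def Y'_def by metis
  obtain V' d' c' where t': "is_sp V' Y' Z' d' c'" "t' = sp V' Y' Z' d' c'" using ar_SpCE[OF assms(5)] assms(6) Y'_def Z'_def by metis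
  obtain P p q where P: "bpb P W V Y b c p q" "is_sp P X Z (d oo q) (a oo p)"
    "t o[SpC] s = sp P X Z (d oo q) (a oo p)" using SpC_comp_ex[OF s(1) t(1)] s t by metis
  obtain P' p' q' where P': "bpb P' W' V' Y' b' c' p' q'" "is_sp P' X' Z' (d' oo q') (a' oo p')"
    "t' o[SpC] s' = sp P' X' Z' (d' oo q') (a' oo p')" using SpC_comp_ex[OF s'(1) t'(1)] s' t' by metis
  show ?thesis
    unfolding P(3) P'(3) s_times_sp[OF P(2) P'(2)]
    using sp_comp[OF is_sp_times[OF s(1) s'(1)] is_sp_times[OF t(1) t'(1)] bpb_times[OF P(1) P'(1)]] s t s' t'
    by (simp add: s_times_sp times_comp)
qed

subsection \<open>Coproducts in \<open>CC\<close>\<close>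

text \<open>Coproducts of \<open>CC\<close> in elementary terms: both 1-cells are full and faithful,
  no morphism connects their images, and together they are essentially surjective.
  \<open>gsum_coproduct\<close> and \<open>coproduct_gsum\<close> relate this to the universal
  property.\<close>

definition gsum :: "zero_cell => zero_cell => zero_cell => one_cell => one_cell => bool" where
  "gsum A B S i j \<longleftrightarrow> zc A & zc B & zc S & oc A S i & oc B S j &
     full A S i & faithful A S i & full B S j & faithful B S j &
     (ALL x:Pts A. ALL y:Pts B. ALL h:gp S. Act S h (Fn i x) ~= Fn j y) &
     (ALL s:Pts S. (EX x:Pts A. EX h:gp S. Act S h (Fn i x) = s) | (EX y:Pts B. EX h:gp S. Act S h (Fn j y) = s))"

lemma gsumD:
  assumes "gsum A B S i j"
  shows "zc A" "zc B" "zc S" "oc A S i" "oc B S j"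
    "full A S i" "faithful A S i" "full B S j" "faithful B S j"
    and "x : Pts A ==> y : Pts B ==> h : gp S ==> Act S h (Fn i x) ~= Fn j y"
    and "s : Pts S ==> (EX x:Pts A. EX h:gp S. Act S h (Fn i x) = s) | (EX y:Pts B. EX h:gp S. Act S h (Fn j y) = s)"
  using assms by (simp_all add: gsum_def)

lemma gsum_sym:
  assumes "gsum A B S i j"
  shows "gsum B A S j i"
proof -
  note g = gsumD[OF assms]
  interpret S: zcell S by (rule zcellI[OF g(3)])
  have "Act S h (Fn j y) ~= Fn i x" if "x : Pts A" "y : Pts B" "h : gp S" for x y h
    using g(10)[OF that(1,2) S.inv_closed[OF that(3)]] S.act_eqD[OF that(3) ocD(1)[OF g(5) that(2)]] by blast
  then show ?thesis using g unfolding gsum_def by blast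
qed

text \<open>
  The coproduct of \<open>X/G\<close> and \<open>Y/H\<close> is realized over the group \<open>G \<times> H\<close>: \<open>X\<close> is replaced by \<open>X \<times> H\<close> and
  \<open>Y\<close> by \<open>G \<times> Y\<close>, where the factors \<open>H\<close> and \<open>G\<close> are acted on by translation.
\<close>

definition sumc :: "zero_cell => zero_cell => zero_cell" where
  "sumc P Q =
     (let X = {PPair (Atom 0) (PPair x h) | x h. x : Pts P & h : gp Q} \<union>
              {PPair (Atom (Suc 0)) (PPair g y) | g y. g : gp P & y : Pts Q} in
      \<lparr> Grp = Grp (P ** Q),
        Pts = X,
        Act = (%u. \<lambda>z \<in> X. let g = pfst u; h = psnd u; x = pfst (psnd z); y = psnd (psnd z) in
          if pfst z = Atom 0 then PPair (Atom 0) (PPair (Act P g x) (h *[Q] y))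
          else PPair (Atom (Suc 0)) (PPair (g *[P] x) (Act Q h y))) \<rparr>)"

definition inl :: "zero_cell => one_cell" where
  "inl Q = \<lparr> Fn = (%x. PPair (Atom 0) (PPair x 1[Q])), Tw = (%x g. PPair g 1[Q]) \<rparr>"

definition inr :: "zero_cell => one_cell" where
  "inr P = \<lparr> Fn = (%y. PPair (Atom (Suc 0)) (PPair 1[P] y)), Tw = (%y h. PPair 1[P] h) \<rparr>"

definition copair :: "one_cell => one_cell => one_cell" where
  "copair a b =
     \<lparr> Fn = (%z. if pfst z = Atom 0 then Fn a (pfst (psnd z)) else Fn b (psnd (psnd z))),
       Tw = (%z u. if pfst z = Atom 0 then Tw a (pfst (psnd z)) (pfst u) else Tw b (psnd (psnd z)) (psnd u)) \<rparr>"

lemma sum_sel: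
  "Grp (sumc P Q) = Grp (P ** Q)"
  "Pts (sumc P Q) = {PPair (Atom 0) (PPair x h) | x h. x : Pts P & h : gp Q} \<union>
      {PPair (Atom (Suc 0)) (PPair g y) | g y. g : gp P & y : Pts Q}"
  "x : Pts P ==> h : gp Q ==> Act (sumc P Q) (PPair g' h') (PPair (Atom 0) (PPair x h)) = PPair (Atom 0) (PPair (Act P g' x) (h' *[Q] h))"
  "g : gp P ==> y : Pts Q ==> Act (sumc P Q) (PPair g' h') (PPair (Atom (Suc 0)) (PPair g y)) = PPair (Atom (Suc 0)) (PPair (g' *[P] g) (Act Q h' y))"
  "Act (sumc P Q) u : extensional (Pts (sumc P Q))"
  by (simp_all add: sumc_def Let_def)

lemma sum_ptE:
  assumes "z : Pts (sumc P Q)"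
  obtains x h where "z = PPair (Atom 0) (PPair x h)" "x : Pts P" "h : gp Q"
    | g y where "z = PPair (Atom (Suc 0)) (PPair g y)" "g : gp P" "y : Pts Q"
  using assms by (auto simp: sum_sel(2))

lemma sum_zero_cell:
  assumes P: "zc P" and Q: "zc Q"
  shows "zc (sumc P Q)"
proof -
  interpret P: zcell P + Q: zcell Q by (simp_all add: P Q)
  show ?thesis
  proof (rule zcI)
    show "group (Grp (sumc P Q))" unfolding sum_sel(1) by (rule prod_group) unfold_locales
    show "finite (gp (sumc P Q))"
      using finite_PPair[OF P.finite_grp Q.finite_grp] by (simp add: sum_sel(1) prod_sel(1))
    have "Pts (sumc P Q) \<subseteq> {PPair x z | x z. x : {Atom 0} & z : {PPair y c | y c. y : Pts P & c : gp Q}} \<union>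
       {PPair x z | x z. x : {Atom (Suc 0)} & z : {PPair y c | y c. y : gp P & c : Pts Q}}"
      by (auto simp: sum_sel(2))
    then show "finite (Pts (sumc P Q))"
      by (rule finite_subset)
        (intro finite_UnI finite_PPair P.finite_pts Q.finite_pts P.finite_grp Q.finite_grp; simp)
    fix g z assume g: "g : gp (sumc P Q)" and z: "z : Pts (sumc P Q)"
    obtain g1 g2 where g: "g = PPair g1 g2" "g1 : gp P" "g2 : gp Q" using g by (auto simp: sum_sel(1) prod_sel(1))
    show "Act (sumc P Q) g z : Pts (sumc P Q)"
      using z by (rule sum_ptE) (use g in "simp_all add: sum_sel(2-4)")
    fix h assume h: "h : gp (sumc P Q)"
    obtain h1 h2 where h: "h = PPair h1 h2" "h1 : gp P" "h2 : gp Q" using h by (auto simp: sum_sel(1) prod_sel(1))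
    show "Act (sumc P Q) (g *[sumc P Q] h) z = Act (sumc P Q) g (Act (sumc P Q) h z)"
      using z by (rule sum_ptE)
        (use g h in "simp_all add: sum_sel(1,3,4) prod_sel(3) P.act_mult Q.act_mult P.m_assoc Q.m_assoc")
  next
    fix z assume z: "z : Pts (sumc P Q)"
    show "Act (sumc P Q) 1[sumc P Q] z = z"
      using z by (rule sum_ptE) (simp_all add: sum_sel(1,3,4) prod_sel(4))
  qed (rule sum_sel(5))
qed

lemma inl_simps [simp]: "Fn (inl Q) x = PPair (Atom 0) (PPair x 1[Q])" "Tw (inl Q) x g = PPair g 1[Q]"
  and inr_simps [simp]: "Fn (inr P) y = PPair (Atom (Suc 0)) (PPair 1[P] y)" "Tw (inr P) y h = PPair 1[P] h"
  by (simp_all add: inl_def inr_def)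

lemma copair_simps:
  "Fn (copair a b) (PPair (Atom 0) (PPair x h)) = Fn a x"
  "Fn (copair a b) (PPair (Atom (Suc 0)) (PPair g y)) = Fn b y"
  "Tw (copair a b) (PPair (Atom 0) (PPair x h)) (PPair g' h') = Tw a x g'"
  "Tw (copair a b) (PPair (Atom (Suc 0)) (PPair g y)) (PPair g' h') = Tw b y h'"
  by (simp_all add: copair_def)

lemma inl_one_cell:
  assumes P: "zc P" and Q: "zc Q"
  shows "oc P (sumc P Q) (inl Q)"
proof -
  interpret Q: zcell Q by (rule zcellI[OF Q])
  show ?thesis by (rule ocI) (auto simp: sum_sel(1-3) prod_sel(1,3))
qed

lemma inr_one_cell:
  assumes P: "zc P" and Q: "zc Q"
  shows "oc Q (sumc P Q) (inr P)"
proof -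
  interpret P: zcell P by (rule zcellI[OF P])
  show ?thesis by (rule ocI) (auto simp: sum_sel(1,2,4) prod_sel(1,3))
qed

lemma copair_one_cell:
  assumes P: "zc P" and Q: "zc Q" and a: "oc P T a" and b: "oc Q T b"
  shows "oc (sumc P Q) T (copair a b)"
proof -
  interpret P: zcell P + Q: zcell Q by (simp_all add: P Q)
  note c = ocD[OF a] ocD[OF b]
  have el: "EX g1 g2. g = PPair g1 g2 & g1 : gp P & g2 : gp Q" if "g : gp (sumc P Q)" for g
    using that by (auto simp: sum_sel(1) prod_sel(1))
  show ?thesis
  proof (rule ocI)
    fix z assume "z : Pts (sumc P Q)"
    then show "Fn (copair a b) z : Pts T" by (rule sum_ptE) (simp_all add: copair_simps c)
  next
    fix z g assume z: "z : Pts (sumc P Q)" "g : gp (sumc P Q)"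
    obtain g1 g2 where g: "g = PPair g1 g2" "g1 : gp P" "g2 : gp Q" using el[OF z(2)] by blast
    show "Tw (copair a b) z g : gp T" using z(1) by (rule sum_ptE) (simp_all add: copair_simps c g)
    show "Fn (copair a b) (Act (sumc P Q) g z) = Act T (Tw (copair a b) z g) (Fn (copair a b) z)"
      using z(1) by (rule sum_ptE) (simp_all add: copair_simps c g sum_sel(3,4))
    fix g' assume z': "g' : gp (sumc P Q)"
    obtain h1 h2 where h: "g' = PPair h1 h2" "h1 : gp P" "h2 : gp Q" using el[OF z'] by blast
    show "Tw (copair a b) z (g *[sumc P Q] g') =
       Tw (copair a b) (Act (sumc P Q) g' z) g *[T] Tw (copair a b) z g'"
      using z(1) by (rule sum_ptE) (simp_all add: copair_simps c g h sum_sel(1,3,4) prod_sel(3))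
  qed
qed

lemma sum_gsum:
  assumes P: "zc P" and Q: "zc Q"
  shows "gsum P Q (sumc P Q) (inl Q) (inr P)"
proof -
  interpret P: zcell P + Q: zcell Q by (simp_all add: P Q)
  have el: "g : gp (sumc P Q) \<longleftrightarrow> (EX g1 g2. g = PPair g1 g2 & g1 : gp P & g2 : gp Q)" for g
    by (auto simp: sum_sel(1) prod_sel(1))
  have 1: "full P (sumc P Q) (inl Q)" "faithful P (sumc P Q) (inl Q)"
    "full Q (sumc P Q) (inr P)" "faithful Q (sumc P Q) (inr P)"
    by (auto simp: full_def faithful_def el sum_sel(3,4))
  have 2: "Act (sumc P Q) h (Fn (inl Q) x) ~= Fn (inr P) y"
    if "x : Pts P" "y : Pts Q" "h : gp (sumc P Q)" for x y h
    using that by (auto simp: el sum_sel(3,4))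
  have "(EX x:Pts P. EX h:gp (sumc P Q). Act (sumc P Q) h (Fn (inl Q) x) = s) |
    (EX y:Pts Q. EX h:gp (sumc P Q). Act (sumc P Q) h (Fn (inr P) y) = s)"
    if "s : Pts (sumc P Q)" for s
    using that
  proof (rule sum_ptE)
    fix x h assume s: "s = PPair (Atom 0) (PPair x h)" "x : Pts P" "h : gp Q"
    then have "PPair 1[P] h : gp (sumc P Q)" "Act (sumc P Q) (PPair 1[P] h) (Fn (inl Q) x) = s"
      by (auto simp: el sum_sel(3))
    then show ?thesis using s by blast
  next
    fix g y assume s: "s = PPair (Atom (Suc 0)) (PPair g y)" "g : gp P" "y : Pts Q"
    then have "PPair g 1[Q] : gp (sumc P Q)" "Act (sumc P Q) (PPair g 1[Q]) (Fn (inr P) y) = s"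
      by (auto simp: el sum_sel(4))
    then show ?thesis using s by blast
  qed
  then show ?thesis
    unfolding gsum_def using 1 2 P Q sum_zero_cell[OF P Q] inl_one_cell[OF P Q] inr_one_cell[OF P Q] by blast
qed

text \<open>Every point of \<open>sumc P Q\<close> is joined by a canonical translation to the image
  of a point of \<open>P\<close> or \<open>Q\<close>. The component of the desired 2-cell there is
  transported from \<open>e\<close> or \<open>f\<close>, and naturality reduces to that on the
  summand.\<close>

lemma sum_ext:
  assumes P: "zc P" and Q: "zc Q" and T: "zc T"
    and w: "oc (sumc P Q) T w" and w': "oc (sumc P Q) T w'"
    and i: "iso2 P T (w oo inl Q) (w' oo inl Q)"
    and j: "iso2 Q T (w oo inr P) (w' oo inr P)"
  shows "iso2 (sumc P Q) T w w'"
proof -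
  interpret P: zcell P + Q: zcell Q + T: zcell T by (simp_all add: P Q T)
  let ?S = "sumc P Q"
  interpret S: zcell ?S by (rule zcellI[OF sum_zero_cell[OF P Q]])
  note c = ocD(1,2)[OF w] ocD(1,2)[OF w'] and c3 = ocD(3)[OF w] ocD(3)[OF w']
  have el: "g : gp ?S \<longleftrightarrow> (EX g1 g2. g = PPair g1 g2 & g1 : gp P & g2 : gp Q)" for g
    by (auto simp: sum_sel(1) prod_sel(1))
  obtain e where "cell2 P T (w oo inl Q) (w' oo inl Q) e" using iso2E[OF i P T] .
  note e = cell2D(3-5)[OF this, unfolded oo_simps]
  obtain f where "cell2 Q T (w oo inr P) (w' oo inr P) f" using iso2E[OF j Q T] .
  note f = cell2D(3-5)[OF this, unfolded oo_simps]
  text \<open>Transport along the morphism \<open>h : s \<rightarrow> t\<close> turns a component at \<open>s\<close> into the component at \<open>t\<close>.\<close>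
  define tr where "tr s h k = Tw w' s h *[T] k *[T] inv[T] (Tw w s h)" for s h k
  have tr_in: "tr s h k : gp T" if "s : Pts ?S" "h : gp ?S" "k : gp T" for s h k
    using that c by (simp add: tr_def)
  have tr_act: "Act T (tr s h k) (Fn w t) = Fn w' t"
    if "s : Pts ?S" "h : gp ?S" "k : gp T" "Act ?S h s = t" "Act T k (Fn w s) = Fn w' s" for s h k t
    using that c c3 by (auto simp: tr_def T.act_mult)
  \<comment> \<open>The morphism \<open>g\<close> closes a square with \<open>h\<close>,
    \<open>h'\<close> and \<open>m\<close>, where \<open>m\<close> comes from a summand; so
    naturality along \<open>g\<close> is naturality along \<open>m\<close>, which is the last
    hypothesis.\<close>
  have tr_nat: "tr s' h' k' *[T] Tw w t g = Tw w' t g *[T] tr s h k"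
    if h: "s : Pts ?S" "h : gp ?S" "k : gp T" "Act ?S h s = t" "s' : Pts ?S" "h' : gp ?S" "k' : gp T"
      "g : gp ?S" "m : gp ?S" "Act ?S m s = s'" "g *[?S] h = h' *[?S] m" "k' *[T] Tw w s m = Tw w' s m *[T] k"
    for s h k s' h' k' t g m
  proof -
    have t: "t : Pts ?S" using h by auto
    have a: "Tw w t g *[T] Tw w s h = Tw w s' h' *[T] Tw w s m" "Tw w' t g *[T] Tw w' s h = Tw w' s' h' *[T] Tw w' s m"
      using tw_comp[OF w h(1,8,2,4)] tw_comp[OF w h(1,6,9,10)] tw_comp[OF w' h(1,8,2,4)] tw_comp[OF w' h(1,6,9,10)] h(11) by simp_all
    have 1: "inv[T] (Tw w s' h') *[T] Tw w t g = Tw w s m *[T] inv[T] (Tw w s h)"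
    proof -
      have "inv[T] (Tw w s' h') *[T] (Tw w t g *[T] Tw w s h) *[T] inv[T] (Tw w s h) = inv[T] (Tw w s' h') *[T] (Tw w s' h' *[T] Tw w s m) *[T] inv[T] (Tw w s h)"
        by (simp only: a(1))
      then show ?thesis using h t c by (simp add: T.m_assoc)
    qed
    have "tr s' h' k' *[T] Tw w t g = Tw w' s' h' *[T] (k' *[T] Tw w s m) *[T] inv[T] (Tw w s h)"
      unfolding tr_def using 1 h(1-11) t c by (simp add: T.m_assoc)
    also have "... = (Tw w' t g *[T] Tw w' s h) *[T] k *[T] inv[T] (Tw w s h)"
      unfolding h(12) a(2) using h t c by (simp add: T.m_assoc)
    finally show ?thesis unfolding tr_def using h t c by (simp add: T.m_assoc)
  qed
  define d where "d z = (if pfst z = Atom 0 then tr (Fn (inl Q) (pfst (psnd z))) (PPair 1[P] (psnd (psnd z))) (e (pfst (psnd z)))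
     else tr (Fn (inr P) (psnd (psnd z))) (PPair (pfst (psnd z)) 1[Q]) (f (psnd (psnd z))))" for z
  have dl: "d (PPair (Atom 0) (PPair x h)) = tr (Fn (inl Q) x) (PPair 1[P] h) (e x)"
    and dr: "d (PPair (Atom (Suc 0)) (PPair g y)) = tr (Fn (inr P) y) (PPair g 1[Q]) (f y)" for x h g y
    by (simp_all add: d_def)
  have il: "x : Pts P ==> Fn (inl Q) x : Pts ?S" and ir: "y : Pts Q ==> Fn (inr P) y : Pts ?S" for x y
    by (auto simp: sum_sel(2))
  show ?thesis
  proof (rule iso2I[OF sum_zero_cell[OF P Q] T w w', of d])
    fix z assume z: "z : Pts ?S"
    show "d z : gp T" using z
      by (rule sum_ptE) (simp_all only: dl dr, use tr_in il ir e f el in auto)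
    show "Act T (d z) (Fn w z) = Fn w' z" using z
    proof (rule sum_ptE)
      fix x h assume z: "z = PPair (Atom 0) (PPair x h)" "x : Pts P" "h : gp Q"
      show ?thesis unfolding z(1) dl
        by (rule tr_act[OF il[OF z(2)] _ e(1)[OF z(2)] _ e(2)[OF z(2)]]) (use z in "auto simp: el sum_sel(3)")
    next
      fix g y assume z: "z = PPair (Atom (Suc 0)) (PPair g y)" "g : gp P" "y : Pts Q"
      show ?thesis unfolding z(1) dr
        by (rule tr_act[OF ir[OF z(3)] _ f(1)[OF z(3)] _ f(2)[OF z(3)]]) (use z in "auto simp: el sum_sel(4)")
    qed
    fix u assume u: "u : gp ?S"
    obtain u1 u2 where u: "u = PPair u1 u2" "u1 : gp P" "u2 : gp Q" using el u by blast
    show "d (Act ?S u z) *[T] Tw w z u = Tw w' z u *[T] d z" using z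
    proof (rule sum_ptE)
      fix x h assume z: "z = PPair (Atom 0) (PPair x h)" "x : Pts P" "h : gp Q"
      have e3: "e (Act P u1 x) *[T] Tw w (Fn (inl Q) x) (PPair u1 1[Q]) = Tw w' (Fn (inl Q) x) (PPair u1 1[Q]) *[T] e x"
        using e(3)[OF z(2) u(2)] by simp
      show ?thesis unfolding z(1) u(1) sum_sel(3)[OF z(2,3)] dl
        by (rule tr_nat[OF il[OF z(2)] _ e(1)[OF z(2)] _ il _ e(1) _ _ _ _ e3])
          (use z u in "auto simp: el sum_sel(1,3) prod_sel(1,3)")
    next
      fix g y assume z: "z = PPair (Atom (Suc 0)) (PPair g y)" "g : gp P" "y : Pts Q"
      have f3: "f (Act Q u2 y) *[T] Tw w (Fn (inr P) y) (PPair 1[P] u2) = Tw w' (Fn (inr P) y) (PPair 1[P] u2) *[T] f y"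
        using f(3)[OF z(3) u(3)] by simp
      show ?thesis unfolding z(1) u(1) sum_sel(4)[OF z(2,3)] dr
        by (rule tr_nat[OF ir[OF z(3)] _ f(1)[OF z(3)] _ ir _ f(1) _ _ _ _ f3])
          (use z u in "auto simp: el sum_sel(1,4) prod_sel(1,3)")
    qed
  qed
qed

lemma copair_inl:
  assumes P: "zc P" and Q: "zc Q" and a: "oc P T a" and b: "oc Q T b"
  shows "copair a b oo inl Q = a" "copair a b oo inr P = b"
  by (rule oc_eqI; simp add: copair_simps)+

lemma sum_coproduct:
  assumes P: "zc P" and Q: "zc Q"
  shows "is_coproduct CC P Q (sumc P Q) (c_arr P (sumc P Q) (inl Q)) (c_arr Q (sumc P Q) (inr P))"
proof -
  note S = sum_zero_cell[OF P Q] and il = inl_one_cell[OF P Q] and ir = inr_one_cell[OF P Q]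
  have "EX! h. h : arrows CC (sumc P Q) T & h o[CC] c_arr P (sumc P Q) (inl Q) = f & h o[CC] c_arr Q (sumc P Q) (inr P) = g"
    if fg: "f : arrows CC P T" "g : arrows CC Q T" for T f g
  proof -
    obtain a b where ab: "oc P T a" "f = c_arr P T a" "oc Q T b" "g = c_arr Q T b" and T: "zc T"
      using fg by (auto simp: arr_CC)
    note w = copair_one_cell[OF P Q ab(1,3)]
    have h: "c_arr (sumc P Q) T (copair a b) o[CC] c_arr P (sumc P Q) (inl Q) = f"
      "c_arr (sumc P Q) T (copair a b) o[CC] c_arr Q (sumc P Q) (inr P) = g"
      using c_comp[OF P S T il w] c_comp[OF Q S T ir w] copair_inl[OF P Q ab(1,3)] ab by simp_all
    show ?thesis
    proof (rule ex1I)
      show "c_arr (sumc P Q) T (copair a b) : arrows CC (sumc P Q) T &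
        c_arr (sumc P Q) T (copair a b) o[CC] c_arr P (sumc P Q) (inl Q) = f &
        c_arr (sumc P Q) T (copair a b) o[CC] c_arr Q (sumc P Q) (inr P) = g"
        using h S T w by simp
      fix l assume l: "l : arrows CC (sumc P Q) T & l o[CC] c_arr P (sumc P Q) (inl Q) = f & l o[CC] c_arr Q (sumc P Q) (inr P) = g"
      then obtain v where v: "oc (sumc P Q) T v" "l = c_arr (sumc P Q) T v" by (auto simp: arr_CC)
      have "c_arr P T (v oo inl Q) = c_arr P T (copair a b oo inl Q)"
        using l h(1) v c_comp[OF P S T il v(1)] c_comp[OF P S T il w] by simp
      then have 1: "iso2 P T (v oo inl Q) (copair a b oo inl Q)"
        by (rule c_arr_eqD[OF P T oc_comp[OF P il v(1)] oc_comp[OF P il w]])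
      have "c_arr Q T (v oo inr P) = c_arr Q T (copair a b oo inr P)"
        using l h(2) v c_comp[OF Q S T ir v(1)] c_comp[OF Q S T ir w] by simp
      then have 2: "iso2 Q T (v oo inr P) (copair a b oo inr P)"
        by (rule c_arr_eqD[OF Q T oc_comp[OF Q ir v(1)] oc_comp[OF Q ir w]])
      show "l = c_arr (sumc P Q) T (copair a b)"
        unfolding v(2) by (rule c_arr_eqI[OF S T sum_ext[OF P Q T v(1) w 1 2]])
    qed
  qed
  then show ?thesis using P Q S il ir by (simp add: is_coproduct_def)
qed

lemma gsum_equiv_sum:
  assumes g: "gsum A B S i j"
  shows "eqv (sumc A B) S (copair i j)"
proof -
  note d = gsumD[OF g] and d' = gsumD(10)[OF gsum_sym[OF g]]
  interpret A: zcell A + B: zcell B + S: zcell S by (simp_all add: d(1,2,3))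
  have el: "g : gp (sumc A B) \<longleftrightarrow> (EX g1 g2. g = PPair g1 g2 & g1 : gp A & g2 : gp B)" for g
    by (auto simp: sum_sel(1) prod_sel(1))
  have "full (sumc A B) S (copair i j)"
    unfolding full_def
  proof (intro ballI impI)
    fix z z' h assume z: "z : Pts (sumc A B)" "z' : Pts (sumc A B)" and h: "h : gp S" "Act S h (Fn (copair i j) z) = Fn (copair i j) z'"
    from z(1) show "EX g:gp (sumc A B). Act (sumc A B) g z = z' & Tw (copair i j) z g = h"
    proof (rule sum_ptE)
      fix x k assume 1: "z = PPair (Atom 0) (PPair x k)" "x : Pts A" "k : gp B"
      from z(2) show ?thesis
      proof (rule sum_ptE)
        fix x' k' assume 2: "z' = PPair (Atom 0) (PPair x' k')" "x' : Pts A" "k' : gp B"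
        obtain g where "g : gp A" "Act A g x = x'" "Tw i x g = h"
          using fullD[OF d(6) 1(2) 2(2) h(1)] h(2) 1 2 by (auto simp: copair_simps)
        \<comment> \<open>The second component of the witness matches the translation coordinates;
          \<open>copair i j\<close> ignores it on this summand.\<close>
        then show ?thesis using 1 2
          by (intro bexI[of _ "PPair g (k' *[B] inv[B] k)"]) (auto simp: el sum_sel(3) copair_simps B.m_assoc)
      next
        fix k' y assume "z' = PPair (Atom (Suc 0)) (PPair k' y)" "y : Pts B"
        then show ?thesis using d(10)[OF 1(2) _ h(1)] h(2) 1 by (auto simp: copair_simps)
      qed
    next
      fix k y assume 1: "z = PPair (Atom (Suc 0)) (PPair k y)" "k : gp A" "y : Pts B"
      from z(2) show ?thesis
      proof (rule sum_ptE)
        fix k' y' assume 2: "z' = PPair (Atom (Suc 0)) (PPair k' y')" "k' : gp A" "y' : Pts B"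
        obtain g where "g : gp B" "Act B g y = y'" "Tw j y g = h"
          using fullD[OF d(8) 1(3) 2(3) h(1)] h(2) 1 2 by (auto simp: copair_simps)
        then show ?thesis using 1 2
          by (intro bexI[of _ "PPair (k' *[A] inv[A] k) g"]) (auto simp: el sum_sel(4) copair_simps A.m_assoc)
      next
        fix x k' assume "z' = PPair (Atom 0) (PPair x k')" "x : Pts A"
        then show ?thesis using d'[OF 1(3) _ h(1)] h(2) 1 by (auto simp: copair_simps)
      qed
    qed
  qed
  moreover have "faithful (sumc A B) S (copair i j)"
    unfolding faithful_def
  proof (intro ballI impI)
    fix z g g' assume z: "z : Pts (sumc A B)" and g: "g : gp (sumc A B)" "g' : gp (sumc A B)"
      and eq: "Act (sumc A B) g z = Act (sumc A B) g' z" "Tw (copair i j) z g = Tw (copair i j) z g'"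
    obtain g1 g2 where g1: "g = PPair g1 g2" "g1 : gp A" "g2 : gp B" using g(1) el by blast
    obtain h1 h2 where h1: "g' = PPair h1 h2" "h1 : gp A" "h2 : gp B" using g(2) el by blast
    from z show "g = g'"
    proof (rule sum_ptE)
      fix x k assume 1: "z = PPair (Atom 0) (PPair x k)" "x : Pts A" "k : gp B"
      show ?thesis using eq faithfulD[OF d(7) 1(2) g1(2) h1(2)] g1 h1 1 by (simp add: copair_simps sum_sel(3))
    next
      fix k y assume 1: "z = PPair (Atom (Suc 0)) (PPair k y)" "k : gp A" "y : Pts B"
      show ?thesis using eq faithfulD[OF d(9) 1(3) g1(3) h1(3)] g1 h1 1 by (simp add: copair_simps sum_sel(4))
    qed
  qed
  moreover have "eso (sumc A B) S (copair i j)"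
    unfolding eso_def
  proof
    fix s assume "s : Pts S"
    then consider x h where "x : Pts A" "h : gp S" "Act S h (Fn i x) = s" | y h where "y : Pts B" "h : gp S" "Act S h (Fn j y) = s"
      using d(11) by blast
    then show "EX z:Pts (sumc A B). EX h: gp S. Act S h (Fn (copair i j) z) = s"
    proof cases
      case 1
      have "PPair (Atom 0) (PPair x 1[B]) : Pts (sumc A B)" using 1 by (auto simp: sum_sel(2))
      then show ?thesis using 1 by (metis copair_simps(1))
    next
      case 2
      have "PPair (Atom (Suc 0)) (PPair 1[A] y) : Pts (sumc A B)" using 2 by (auto simp: sum_sel(2))
      then show ?thesis using 2 by (metis copair_simps(2))
    qed
  qed
  ultimately show ?thesis using copair_one_cell[OF d(1,2,4,5)] by (simp add: eqv_def)
qed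

lemma gsum_coproduct:
  assumes g: "gsum A B S i j"
  shows "is_coproduct CC A B S (c_arr A S i) (c_arr B S j)"
proof -
  note d = gsumD[OF g] and eq = gsum_equiv_sum[OF g]
  note E = sum_zero_cell[OF d(1,2)] and k = eqvD(1)[OF eq]
  have "is_iso CC (c_arr (sumc A B) S (copair i j))" using is_iso_CC_iff[OF E d(3) k] eq by simp
  moreover have m: "c_arr (sumc A B) S (copair i j) : arrows CC (sumc A B) S" using E d(3) k by simp
  ultimately obtain h where h: "h : arrows CC S (sumc A B)" "h o[CC] c_arr (sumc A B) S (copair i j) = idn CC (sumc A B)"
    "c_arr (sumc A B) S (copair i j) o[CC] h = idn CC S" by (rule is_isoE)
  from coproduct_transfer[OF cat_CC sum_coproduct[OF d(1,2)] m h]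
  show ?thesis
    using c_comp[OF d(1) E d(3) inl_one_cell[OF d(1,2)] k] c_comp[OF d(2) E d(3) inr_one_cell[OF d(1,2)] k]
      copair_inl[OF d(1,2,4,5)] by simp
qed

section \<open>Stability of full, faithful and essentially surjective 1-cells, and sums versus
  coproducts\<close>

lemma full_faithful_comp:
  assumes P: "zc P" and a: "oc P Q a" and b: "oc Q R b"
  shows "full P Q a ==> full Q R b ==> full P R (b oo a)"
    and "faithful P Q a ==> faithful Q R b ==> faithful P R (b oo a)"
proof -
  interpret P: zcell P by (rule zcellI[OF P])
  note c = ocD[OF a]
  show "full P R (b oo a)" if f: "full P Q a" "full Q R b"
    unfolding full_def
  proof (intro ballI impI)
    fix x x' h assume h: "x : Pts P" "x' : Pts P" "h : gp R" "Act R h (Fn (b oo a) x) = Fn (b oo a) x'"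
    obtain u where u: "u : gp Q" "Act Q u (Fn a x) = Fn a x'" "Tw b (Fn a x) u = h"
      using fullD[OF f(2) c(1)[OF h(1)] c(1)[OF h(2)] h(3)] h(4) by auto
    then show "EX g: gp P. Act P g x = x' & Tw (b oo a) x g = h"
      using fullD[OF f(1) h(1,2) u(1,2)] by auto
  qed
  show "faithful P R (b oo a)" if "faithful P Q a" "faithful Q R b"
    unfolding faithful_def
  proof (intro ballI impI)
    fix x g g' assume h: "x : Pts P" "g : gp P" "g' : gp P" "Act P g x = Act P g' x" "Tw (b oo a) x g = Tw (b oo a) x g'"
    have "Tw a x g = Tw a x g'"
      by (rule faithfulD[OF that(2) c(1)[OF h(1)]]) (use h c c(3)[OF h(1,2)] c(3)[OF h(1,3)] in auto)
    then show "g = g'" by (rule faithfulD[OF that(1) h(1-4)])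
  qed
qed

lemma full_faithful_iso2:
  assumes P: "zc P" and Q: "zc Q" and i: "iso2 P Q a a'"
  shows "full P Q a ==> full P Q a'" and "faithful P Q a ==> faithful P Q a'"
    and "eso P Q a ==> eso P Q a'"
proof -
  interpret P: zcell P + Q: zcell Q by (simp_all add: P Q)
  obtain e where "cell2 P Q a a' e" using iso2E[OF i P Q] .
  note e = cell2D[OF this]
  note c = ocD(1,2)[OF e(1)] ocD(1,2)[OF e(2)]
  show "full P Q a'" if f: "full P Q a"
    unfolding full_def
  proof (intro ballI impI)
    fix x x' h assume h: "x : Pts P" "x' : Pts P" "h : gp Q" "Act Q h (Fn a' x) = Fn a' x'"
    let ?k = "inv[Q] (e x') *[Q] h *[Q] e x"
    have "Act Q ?k (Fn a x) = Fn a x'"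
      using h e c Q.act_eqD[OF e(3) _ e(4)] by (simp add: Q.act_mult)
    then obtain g where g: "g : gp P" "Act P g x = x'" "Tw a x g = ?k"
      using fullD[OF f h(1,2), of ?k] h e by auto
    have "Tw a' x g *[Q] e x = h *[Q] e x" using e(5)[OF h(1) g(1)] g h e(3) by (simp add: Q.m_assoc)
    then have "Tw a' x g = h" using c g(1) h e(3) by simp
    then show "EX g: gp P. Act P g x = x' & Tw a' x g = h" using g by blast
  qed
  show "faithful P Q a'" if f: "faithful P Q a"
    unfolding faithful_def
  proof (intro ballI impI)
    fix x g g' assume h: "x : Pts P" "g : gp P" "g' : gp P" "Act P g x = Act P g' x" "Tw a' x g = Tw a' x g'"
    have "e (Act P g x) *[Q] Tw a x g = e (Act P g x) *[Q] Tw a x g'"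
      using e(5)[OF h(1,2)] e(5)[OF h(1,3)] h by simp
    then have "Tw a x g = Tw a x g'" using c h e(3)[of "Act P g x"] by simp
    then show "g = g'" by (rule faithfulD[OF f h(1-4)])
  qed
  show "eso P Q a'" if f: "eso P Q a"
    unfolding eso_def
  proof
    fix y assume "y : Pts Q"
    then obtain x h where x: "x : Pts P" "h : gp Q" "Act Q h (Fn a x) = y" using eso_cellD[OF f] by blast
    then have "Act Q (h *[Q] inv[Q] (e x)) (Fn a' x) = y"
      using e c Q.act_eqD[OF e(3) _ e(4)] by (simp add: Q.act_mult)
    then show "EX x:Pts P. EX h: gp Q. Act Q h (Fn a' x) = y" using x e(3)
      by (intro bexI[of _ x] bexI[of _ "h *[Q] inv[Q] (e x)"]) auto
  qed
qed

text \<open>The comparison \<open>k\<close> with the explicit sum is an equivalence, so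
  \<open>i\<close> and \<open>j\<close> are, up to 2-cells, composites of the full and faithful
  \<open>inl\<close> and \<open>inr\<close> with it. Disjointness and covering are transported
  through the 2-cells \<open>e\<close> and \<open>e'\<close>.\<close>

lemma coproduct_gsum:
  assumes c: "is_coproduct CC A B S (c_arr A S i) (c_arr B S j)" and i: "oc A S i" and j: "oc B S j"
  shows "gsum A B S i j"
proof -
  have A: "zc A" and B: "zc B" and S: "zc S" using coprodD(1-3)[OF c] by simp_all
  interpret A: zcell A + B: zcell B + S: zcell S by (simp_all add: A B S)
  let ?E = "sumc A B"
  note E = sum_zero_cell[OF A B] and il = inl_one_cell[OF A B] and ir = inr_one_cell[OF A B]
  interpret E: zcell ?E by (rule zcellI[OF E])
  obtain f g where f: "f : arrows CC ?E S" "g : arrows CC S ?E" "g o[CC] f = idn CC ?E" "f o[CC] g = idn CC S"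
    "f o[CC] c_arr A ?E (inl B) = c_arr A S i" "f o[CC] c_arr B ?E (inr A) = c_arr B S j"
    using coproduct_iso[OF cat_CC sum_coproduct[OF A B] c] by metis
  obtain k where k: "oc ?E S k" "f = c_arr ?E S k" using f(1) by (auto simp: arr_CC)
  have eq: "eqv ?E S k" using is_isoI[OF f(1-4)] is_iso_CC_iff[OF E S k(1)] k(2) by simp
  note kk = eqvD[OF eq] and ki = oc_comp[OF A il k(1)] and kj = oc_comp[OF B ir k(1)]
  have i': "iso2 A S (k oo inl B) i"
    by (rule c_arr_eqD[OF A S ki i]) (use f(5) c_comp[OF A E S il k(1)] k(2) in simp)
  have j': "iso2 B S (k oo inr A) j"
    by (rule c_arr_eqD[OF B S kj j]) (use f(6) c_comp[OF B E S ir k(1)] k(2) in simp)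
  note d = gsumD[OF sum_gsum[OF A B]]
  have ff: "full A S i" "faithful A S i" "full B S j" "faithful B S j"
    using full_faithful_iso2[OF A S i'] full_faithful_iso2[OF B S j'] full_faithful_comp[OF A il k(1)] full_faithful_comp[OF B ir k(1)]
      d(6-9) kk by blast+
  obtain e where "cell2 A S (k oo inl B) i e" using iso2E[OF i' A S] .
  note e = cell2D(3,4)[OF this, unfolded oo_simps]
  obtain e' where "cell2 B S (k oo inr A) j e'" using iso2E[OF j' B S] .
  note e' = cell2D(3,4)[OF this, unfolded oo_simps]
  note il1 = ocD(1)[OF il] and ir1 = ocD(1)[OF ir] and k1 = ocD[OF k(1)]
  have "Act S h (Fn i x) ~= Fn j y" if h: "x : Pts A" "y : Pts B" "h : gp S" for x y h
  proof
    assume "Act S h (Fn i x) = Fn j y"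
    moreover have "Act S (inv[S] (e' y)) (Fn j y) = Fn k (Fn (inr A) y)"
      by (rule S.act_eqD[OF e'(1)[OF h(2)] k1(1)[OF ir1[OF h(2)]] e'(2)[OF h(2)]])
    ultimately have "Act S (inv[S] (e' y) *[S] h *[S] e x) (Fn k (Fn (inl B) x)) = Fn k (Fn (inr A) y)"
      using h e e' k1(1) il1 ir1 ocD(1)[OF i] by (simp add: S.act_mult del: inl_simps inr_simps)
    then obtain u where "u : gp ?E" "Act ?E u (Fn (inl B) x) = Fn (inr A) y"
      using fullD[OF kk(2) il1[OF h(1)] ir1[OF h(2)], of "inv[S] (e' y) *[S] h *[S] e x"] h e(1) e'(1) by auto
    then show False using d(10)[OF h(1,2)] by blast
  qed
  moreover have "(EX x:Pts A. EX h:gp S. Act S h (Fn i x) = s) | (EX y:Pts B. EX h:gp S. Act S h (Fn j y) = s)" if s: "s : Pts S" for s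
  proof -
    obtain z h where z: "z : Pts ?E" "h : gp S" "Act S h (Fn k z) = s" using eso_cellD[OF kk(4) s] by blast
    from d(11)[OF z(1)] show ?thesis
    proof (elim disjE bexE)
      fix x u assume x: "x : Pts A" "u : gp ?E" "Act ?E u (Fn (inl B) x) = z"
      let ?m = "h *[S] Tw k (Fn (inl B) x) u *[S] inv[S] (e x)"
      have "Act S ?m (Fn i x) = s"
        using x z e k1(1,2) k1(3)[OF il1[OF x(1)] x(2)] il1 S.act_eqD[OF e(1)[OF x(1)] k1(1)[OF il1[OF x(1)]] e(2)[OF x(1)]] ocD(1)[OF i]
        by (simp add: S.act_mult del: inl_simps)
      moreover have "?m : gp S" using x z e k1(2) il1 by (simp del: inl_simps)
      ultimately show ?thesis using x(1) by blast
    next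
      fix x u assume x: "x : Pts B" "u : gp ?E" "Act ?E u (Fn (inr A) x) = z"
      let ?m = "h *[S] Tw k (Fn (inr A) x) u *[S] inv[S] (e' x)"
      have "Act S ?m (Fn j x) = s"
        using x z e' k1(1,2) k1(3)[OF ir1[OF x(1)] x(2)] ir1 S.act_eqD[OF e'(1)[OF x(1)] k1(1)[OF ir1[OF x(1)]] e'(2)[OF x(1)]] ocD(1)[OF j]
        by (simp add: S.act_mult del: inr_simps)
      moreover have "?m : gp S" using x z e' k1(2) ir1 by (simp del: inr_simps)
      ultimately show ?thesis using x(1) by blast
    qed
  qed
  ultimately show ?thesis using A B S i j ff unfolding gsum_def by blast
qed

lemma CC_coproducts: "A : ob CC ==> B : ob CC ==> EX E i j. is_coproduct CC A B E i j"
  using sum_coproduct[of A B] by (intro exI) simp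

text \<open>Brings a coproduct over \<open>X\<close> into the form of a sum of 0-cells with a 1-cell
  to \<open>X\<close>, the form in which additivity of the Burnside classes can be computed.\<close>

lemma slice_CC_coproductE:
  assumes "is_coproduct (slice CC X) a b s i j"
  obtains A B S i0 j0 s0 where "gsum A B S i0 j0" "oc S X s0" "zc X" "s = c_arr S X s0"
    "a = c_arr A X (s0 oo i0)" "b = c_arr B X (s0 oo j0)"
proof -
  obtain i' j' where ij: "is_coproduct CC (cdom a) (cdom b) (cdom s) i' j'" "s o[CC] i' = a" "s o[CC] j' = b"
    using slice_coproductD[OF cat_CC CC_coproducts assms] by auto
  have "s : arrows CC (cdom s) X" using coprodD(3)[OF assms] by (auto simp: arrows_def)
  then obtain s0 where s: "oc (cdom s) X s0" "s = c_arr (cdom s) X s0" and X: "zc X"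
    by (auto simp: arr_CC)
  obtain i0 where i0: "oc (cdom a) (cdom s) i0" "i' = c_arr (cdom a) (cdom s) i0"
    using coprodD(4)[OF ij(1)] by (auto simp: arr_CC)
  obtain j0 where j0: "oc (cdom b) (cdom s) j0" "j' = c_arr (cdom b) (cdom s) j0"
    using coprodD(5)[OF ij(1)] by (auto simp: arr_CC)
  have z: "zc (cdom a)" "zc (cdom b)" "zc (cdom s)" using coprodD(1-3)[OF ij(1)] by simp_all
  have "a = c_arr (cdom a) X (s0 oo i0)" "b = c_arr (cdom b) X (s0 oo j0)"
    using ij(2,3) c_comp[OF z(1,3) X i0(1) s(1)] c_comp[OF z(2,3) X j0(1) s(1)] s(2) i0(2) j0(2) by simp_all
  moreover have "gsum (cdom a) (cdom b) (cdom s) i0 j0"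
    by (rule coproduct_gsum[OF _ i0(1) j0(1)]) (use ij(1) i0 j0 in simp)
  ultimately show ?thesis using that s X by blast
qed

lemma gsum_slice_coproduct:
  assumes g: "gsum A B S i j" and X: "zc X" and s: "oc S X s"
  shows "EX u v. is_coproduct (slice CC X) (c_arr A X (s oo i)) (c_arr B X (s oo j)) (c_arr S X s) u v"
proof -
  note d = gsumD[OF g]
  have "c_arr S X s : arrows CC S X" using d(3) X s by simp
  from coproduct_slice[OF cat_CC gsum_coproduct[OF g] this]
  show ?thesis using c_comp[OF d(1,3) X d(4) s] c_comp[OF d(2,3) X d(5) s] by (intro exI) simp
qed

text \<open>Each property is read off the matching clause of \<open>bpb_on\<close>. For fullness,
  \<open>?c\<close> is the morphism of \<open>R\<close> that \<open>u\<close> induces between the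
  images of \<open>Fn q x\<close> and \<open>Fn q x'\<close>; it lifts to \<open>B\<close> because
  \<open>b\<close> is full. For stab-surjective 1-cells this is what makes \<open>Omega\<close> a
  deflative quotient of the big Burnside functor.\<close>

lemma bpb_base_change:
  assumes h: "bpb P A B R a b p q"
  shows "full B R b ==> full P A p" and "faithful B R b ==> faithful P A p"
    and "eso B R b ==> eso P A p"
proof -
  note z = bpbD[OF h]
  obtain e where e: "bpb_on P A B R a b p q e" using bpbE[OF h] .
  note E = bpb_onD[OF e]
  interpret P: zcell P + A: zcell A + B: zcell B + R: zcell R by (simp_all add: z(1,2,3,4))
  note cl = ocD(1,2)[OF z(5)] ocD(1,2)[OF z(6)] ocD(1,2)[OF z(7)] ocD(1,2)[OF z(8)] E(1)
  note a3 = ocD(3)[OF z(5)] and b3 = ocD(3)[OF z(6)] and p3 = ocD(3)[OF z(7)] and q3 = ocD(3)[OF z(8)]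
  show "full P A p" if f: "full B R b"
    unfolding full_def
  proof (intro ballI impI)
    fix x x' u assume h: "x : Pts P" "x' : Pts P" "u : gp A" "Act A u (Fn p x) = Fn p x'"
    let ?c = "e x' *[R] Tw a (Fn p x) u *[R] inv[R] (e x)"
    have ux: "Act R (Tw a (Fn p x) u) (Fn a (Fn p x)) = Fn a (Fn p x')" using a3[of "Fn p x" u] h cl by simp
    have "Act R ?c (Fn b (Fn q x)) = Fn b (Fn q x')"
      using h cl ux E(2) R.act_eqD[OF E(1) _ E(2)] by (simp add: R.act_mult)
    then obtain w where w: "w : gp B" "Act B w (Fn q x) = Fn q x'" "Tw b (Fn q x) w = ?c"
      using fullD[OF f, of "Fn q x" "Fn q x'" ?c] h cl by auto
    have "Tw b (Fn q x) w *[R] e x = e x' *[R] Tw a (Fn p x) u" using w(3) h cl by simp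
    from E(5)[OF h(1-3) w(1) h(4) w(2) this]
    show "EX g: gp P. Act P g x = x' & Tw p x g = u" by blast
  qed
  show "faithful P A p" if f: "faithful B R b"
    unfolding faithful_def
  proof (intro ballI impI)
    fix x g g' assume h: "x : Pts P" "g : gp P" "g' : gp P" "Act P g x = Act P g' x" "Tw p x g = Tw p x g'"
    have "Tw b (Fn q x) (Tw q x g) *[R] e x = Tw b (Fn q x) (Tw q x g') *[R] e x"
      using E(3)[OF h(1,2)] E(3)[OF h(1,3)] h by simp
    then have "Tw b (Fn q x) (Tw q x g) = Tw b (Fn q x) (Tw q x g')" using h cl by simp
    note tw = this
    have "Act B (Tw q x g) (Fn q x) = Act B (Tw q x g') (Fn q x)"
      using q3[OF h(1,2)] q3[OF h(1,3)] h(4) by simp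
    then have "Tw q x g = Tw q x g'"
      by (rule faithfulD[OF f cl(7)[OF h(1)] cl(8)[OF h(1,2)] cl(8)[OF h(1,3)] _ tw])
    then show "g = g'" using E(6)[OF h(1-5)] by blast
  qed
  show "eso P A p" if f: "eso B R b"
    unfolding eso_def
  proof
    fix x assume x: "x : Pts A"
    obtain y h where y: "y : Pts B" "h : gp R" "Act R h (Fn b y) = Fn a x" using eso_cellD[OF f cl(1)[OF x]] by blast
    have "Act R (inv[R] h) (Fn a x) = Fn b y" using R.act_eqD[OF y(2) cl(3)[OF y(1)] y(3)] .
    then show "EX z:Pts P. EX u: gp A. Act A u (Fn p z) = x" using E(4)[OF x y(1) R.inv_closed[OF y(2)]] by blast
  qed
qed

text \<open>A full and faithful 1-cell is a monomorphism in the homotopy sense, so its self-pullback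
  is trivial. For spans this says that going along \<open>i\<close> and back is the
  identity.\<close>

lemma bpb_self:
  assumes A: "zc A" and S: "zc S" and i: "oc A S i"
    and f: "full A S i" "faithful A S i"
  shows "bpb A A A S i i id_cell id_cell"
proof -
  interpret A: zcell A + S: zcell S by (simp_all add: A S)
  note c = ocD[OF i] one_cell_one[OF A S i]
  show ?thesis
  proof (rule bpbI[OF A A A S i i oc_id oc_id, of "%z. 1[S]"]; (unfold id_cell_simps)?)
    fix x y k assume h: "x : Pts A" "y : Pts A" "k : gp S" "Act S k (Fn i x) = Fn i y"
    obtain g where "g : gp A" "Act A g x = y" "Tw i x g = k" using fullD[OF f(1) h] by blast
    then show "EX z:Pts A. EX u: gp A. EX w: gp A. Act A u z = x & Act A w z = y & Tw i z w *[S] 1[S] = k *[S] Tw i z u"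
      using h c by (intro bexI[of _ x] bexI[of _ "1[A]"] bexI[of _ g]) auto
  next
    fix z z' u w assume h: "z : Pts A" "z' : Pts A" "u : gp A" "w : gp A" "Act A u z = z'" "Act A w z = z'"
      "Tw i z w *[S] 1[S] = 1[S] *[S] Tw i z u"
    then have "u = w" using faithfulD[OF f(2) h(1,3,4)] c by simp
    then show "EX g: gp A. Act A g z = z' & g = u & g = w" using h by blast
  qed (use c in auto)
qed

lemma gsum_disjoint_pullback:
  assumes g: "gsum A B S i j"
  obtains F p q where "bpb F A B S i j p q" "Pts F = {}"
proof -
  note d = gsumD[OF g]
  have "Pts (bipullback A B S i j) = {}"
    using d(10) by (force simp: bp_sel(3))
  then show ?thesis using that[OF bp_bpb[OF d(1-5)]] by blast
qed

text \<open>Sums are stable under pullback. Full faithfulness is base change; every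
  \<open>Fn f v\<close> lies in the image of one summand up to a morphism, which gives covering; and
  a morphism joining the two parts would, after conjugation by the 2-cells, join the images of
  \<open>i\<close> and \<open>j\<close>.\<close>

lemma gsum_pullback:
  assumes g: "gsum A B S i j" and h: "bpb P V A S f i p s" and k: "bpb Q V B S f j q t"
  shows "gsum P Q V p q"
proof -
  note d = gsumD[OF g] and z = bpbD[OF h] and y = bpbD[OF k]
  obtain e where e: "bpb_on P V A S f i p s e" using bpbE[OF h] .
  obtain l where l: "bpb_on Q V B S f j q t l" using bpbE[OF k] .
  note E = bpb_onD[OF e] and L = bpb_onD[OF l]
  interpret V: zcell V + S: zcell S by (simp_all add: z(2,4))
  note f = ocD[OF z(5)] and p = ocD(1)[OF z(7)] and q = ocD(1)[OF y(7)] and s = ocD(1)[OF z(8)] and t = ocD(1)[OF y(8)]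
    and ic = ocD(1)[OF d(4)] and jc = ocD(1)[OF d(5)]
  have "Act V h (Fn p x) ~= Fn q w" if h: "x : Pts P" "w : Pts Q" "h : gp V" for x w h
  proof
    assume eq: "Act V h (Fn p x) = Fn q w"
    have "Act S (Tw f (Fn p x) h) (Fn f (Fn p x)) = Fn f (Fn q w)" using f(3)[OF p[OF h(1)] h(3)] eq by simp
    then have "Act S (l w *[S] Tw f (Fn p x) h *[S] inv[S] (e x)) (Fn i (Fn s x)) = Fn j (Fn t w)"
      using h E(1,2) L(1,2) f(1,2) p q s t ic S.act_eqD[OF E(1)[OF h(1)] f(1)[OF p[OF h(1)]] E(2)[OF h(1)]]
      by (simp add: S.act_mult)
    then show False using d(10)[OF s[OF h(1)] t[OF h(2)], of "l w *[S] Tw f (Fn p x) h *[S] inv[S] (e x)"] h E(1) L(1) f(2) p by simp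
  qed
  moreover have "(EX x:Pts P. EX h: gp V. Act V h (Fn p x) = v) | (EX w:Pts Q. EX h: gp V. Act V h (Fn q w) = v)" if v: "v : Pts V" for v
    using d(11)[OF f(1)[OF v]]
  proof (elim disjE bexE)
    fix x h assume x: "x : Pts A" "h : gp S" "Act S h (Fn i x) = Fn f v"
    then show ?thesis using E(4)[OF v x(1), of "inv[S] h"] S.act_eqD[OF x(2) ic[OF x(1)] x(3)] by auto
  next
    fix x h assume x: "x : Pts B" "h : gp S" "Act S h (Fn j x) = Fn f v"
    then show ?thesis using L(4)[OF v x(1), of "inv[S] h"] S.act_eqD[OF x(2) jc[OF x(1)] x(3)] by auto
  qed
  ultimately show ?thesis
    unfolding gsum_def using z(1,2,7) y(1,7) bpb_base_change[OF h] bpb_base_change[OF k] d(6-9) by blast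
qed

text \<open>A converse to stability: a 1-cell between sums that respects the summands is a pullback
  over each of them. Points of \<open>E\<close> coming from the other summand cannot map to the
  image of \<open>i\<close>, by disjointness in \<open>S\<close>.\<close>

lemma gsum_component_pullback:
  assumes g: "gsum A B S i j" and g': "gsum W W' E \<iota> \<iota>'" and \<beta>: "oc E S \<beta>"
    and b: "oc W A b" and b': "oc W' B b'"
    and e: "iso2 W S (\<beta> oo \<iota>) (i oo b)" and e': "iso2 W' S (\<beta> oo \<iota>') (j oo b')"
  shows "bpb W E A S \<beta> i \<iota> b"
proof -
  note d = gsumD[OF g] and k = gsumD[OF g']
  obtain f where "cell2 W S (\<beta> oo \<iota>) (i oo b) f" using iso2E[OF e k(1) d(3)] .
  note f = cell2D(3-5)[OF this, unfolded oo_simps]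
  obtain f' where "cell2 W' S (\<beta> oo \<iota>') (j oo b') f'" using iso2E[OF e' k(2) d(3)] .
  note f' = cell2D(3,4)[OF this, unfolded oo_simps]
  interpret S: zcell S + E: zcell E by (simp_all add: d(3) k(3))
  note cl = ocD(1,2)[OF d(4)] ocD(1,2)[OF d(5)] ocD(1,2)[OF k(4)] ocD(1,2)[OF k(5)] ocD(1,2)[OF \<beta>]
    ocD(1,2)[OF b] ocD(1,2)[OF b'] f(1) f'(1)
  note \<beta>3 = ocD(3)[OF \<beta>] and b3 = ocD(3)[OF b]
  show ?thesis
  proof (rule bpbI[OF k(1,3) d(1,3) \<beta> d(4) k(4) b, of f])
    fix x y c assume h: "x : Pts E" "y : Pts A" "c : gp S" "Act S c (Fn \<beta> x) = Fn i y"
    from k(11)[OF h(1)] show "EX z:Pts W. EX u: gp E. EX w: gp A. Act E u (Fn \<iota> z) = x & Act A w (Fn b z) = y &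
       Tw i (Fn b z) w *[S] f z = c *[S] Tw \<beta> (Fn \<iota> z) u"
    proof (elim disjE bexE)
      fix w u assume w: "w : Pts W" "u : gp E" "Act E u (Fn \<iota> w) = x"
      have "Act S (Tw \<beta> (Fn \<iota> w) u) (Fn \<beta> (Fn \<iota> w)) = Fn \<beta> x" using \<beta>3[of "Fn \<iota> w" u] w cl by simp
      then have "Act S (c *[S] Tw \<beta> (Fn \<iota> w) u *[S] inv[S] (f w)) (Fn i (Fn b w)) = Fn i y"
        using w h cl S.act_eqD[OF f(1)[OF w(1)] _ f(2)[OF w(1)]] by (simp add: S.act_mult)
      then obtain g where g: "g : gp A" "Act A g (Fn b w) = y" "Tw i (Fn b w) g = c *[S] Tw \<beta> (Fn \<iota> w) u *[S] inv[S] (f w)"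
        using fullD[OF d(6), of "Fn b w" y "c *[S] Tw \<beta> (Fn \<iota> w) u *[S] inv[S] (f w)"] w h cl by auto
      then have "Tw i (Fn b w) g *[S] f w = c *[S] Tw \<beta> (Fn \<iota> w) u" using w h cl by simp
      then show ?thesis using w g by blast
    next
      fix w u assume w: "w : Pts W'" "u : gp E" "Act E u (Fn \<iota>' w) = x"
      have "Act S (Tw \<beta> (Fn \<iota>' w) u) (Fn \<beta> (Fn \<iota>' w)) = Fn \<beta> x" using \<beta>3[of "Fn \<iota>' w" u] w cl by simp
      then have "Act S (c *[S] Tw \<beta> (Fn \<iota>' w) u *[S] inv[S] (f' w)) (Fn j (Fn b' w)) = Fn i y"
        using w h cl S.act_eqD[OF f'(1)[OF w(1)] _ f'(2)[OF w(1)]] by (simp add: S.act_mult)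
      then show ?thesis
        using gsumD(10)[OF gsum_sym[OF g], of "Fn b' w" y "c *[S] Tw \<beta> (Fn \<iota>' w) u *[S] inv[S] (f' w)"] w h cl by simp
    qed
  next
    fix w w' u v assume h: "w : Pts W" "w' : Pts W" "u : gp E" "v : gp A" "Act E u (Fn \<iota> w) = Fn \<iota> w'" "Act A v (Fn b w) = Fn b w'"
      "Tw i (Fn b w) v *[S] f w = f w' *[S] Tw \<beta> (Fn \<iota> w) u"
    obtain t where t: "t : gp W" "Act W t w = w'" "Tw \<iota> w t = u" using fullD[OF k(6) h(1-3,5)] by blast
    have "Tw i (Fn b w) (Tw b w t) *[S] f w = Tw i (Fn b w) v *[S] f w" using f(3)[OF h(1) t(1)] t h(7) by simp
    then have tw: "Tw i (Fn b w) (Tw b w t) = Tw i (Fn b w) v"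
      by (subst (asm) S.right_cancel) (use h(1-6) t(1) cl in auto)
    have "Act A (Tw b w t) (Fn b w) = Act A v (Fn b w)" using b3[OF h(1) t(1)] t(2) h(6) by simp
    then have "Tw b w t = v"
      by (rule faithfulD[OF d(7) cl(11)[OF h(1)] cl(12)[OF h(1) t(1)] h(4) _ tw])
    then show "EX g: gp W. Act W g w = w' & Tw \<iota> w g = u & Tw b w g = v" using t by blast
  next
    fix w g g' assume h: "w : Pts W" "g : gp W" "g' : gp W" "Act W g w = Act W g' w" "Tw \<iota> w g = Tw \<iota> w g'"
    show "g = g'" by (rule faithfulD[OF k(7) h])
  qed (use f in auto)
qed

subsection \<open>Products in the category of spans\<close>

text \<open>The equivalences of the two parts are glued to an isomorphism of the apexes, and its
  compatibility with the legs is tested on the parts. This is the uniqueness half of the product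
  property in \<open>SpC\<close>.\<close>

lemma span_ext:
  assumes h: "is_sp V T S \<beta> \<alpha>" and h': "is_sp V' T S \<beta>' \<alpha>'" and g: "gsum P Q V p q" and g': "gsum P' Q' V' p' q'"
    and l: "sp P T S (\<beta> oo p) (\<alpha> oo p) = sp P' T S (\<beta>' oo p') (\<alpha>' oo p')"
    and r: "sp Q T S (\<beta> oo q) (\<alpha> oo q) = sp Q' T S (\<beta>' oo q') (\<alpha>' oo q')"
  shows "sp V T S \<beta> \<alpha> = sp V' T S \<beta>' \<alpha>'"
proof -
  note d = gsumD[OF g] and d' = gsumD[OF g'] and c = catD[OF cat_CC]
  note G = gsum_coproduct[OF g] and G' = gsum_coproduct[OF g']
  have z: "zc T" "zc S" and b: "oc V S \<beta>" "oc V T \<alpha>" "oc V' S \<beta>'" "oc V' T \<alpha>'"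
    using h h' by (auto simp: is_sp_def)
  have 1: "is_sp P T S (\<beta> oo p) (\<alpha> oo p)" "is_sp Q T S (\<beta> oo q) (\<alpha> oo q)"
    "is_sp P' T S (\<beta>' oo p') (\<alpha>' oo p')" "is_sp Q' T S (\<beta>' oo q') (\<alpha>' oo q')"
    using d d' z b oc_comp by (auto simp: is_sp_def)
  obtain k where k: "eqv P P' k" "iso2 P S (\<beta>' oo p' oo k) (\<beta> oo p)" "iso2 P T (\<alpha>' oo p' oo k) (\<alpha> oo p)"
    using sp_eq_iff[OF 1(1,3)] l by blast
  obtain m where m: "eqv Q Q' m" "iso2 Q S (\<beta>' oo q' oo m) (\<beta> oo q)" "iso2 Q T (\<alpha>' oo q' oo m) (\<alpha> oo q)"
    using sp_eq_iff[OF 1(2,4)] r by blast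
  note k1 = eqvD(1)[OF k(1)] and m1 = eqvD(1)[OF m(1)]
  have K: "c_arr P P' k : arrows CC P P'" "is_iso CC (c_arr P P' k)" using is_iso_CC_iff[OF d(1) d'(1) k1] k(1) k1 d d' by simp_all
  have M: "c_arr Q Q' m : arrows CC Q Q'" "is_iso CC (c_arr Q Q' m)" using is_iso_CC_iff[OF d(2) d'(2) m1] m(1) m1 d d' by simp_all
  obtain K' where K': "K' : arrows CC P' P" "K' o[CC] c_arr P P' k = idn CC P" "c_arr P P' k o[CC] K' = idn CC P'" using is_isoE[OF K(2,1)] .
  obtain M' where M': "M' : arrows CC Q' Q" "M' o[CC] c_arr Q Q' m = idn CC Q" "c_arr Q Q' m o[CC] M' = idn CC Q'" using is_isoE[OF M(2,1)] .
  note s = coprodD[OF G] and s' = coprodD[OF G']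
  obtain u where u: "u : arrows CC V V'" "u o[CC] c_arr P V p = c_arr P' V' p' o[CC] c_arr P P' k" "u o[CC] c_arr Q V q = c_arr Q' V' q' o[CC] c_arr Q Q' m"
    using s(6)[OF c(4)[OF K(1) s'(4)] c(4)[OF M(1) s'(5)] s'(3)] by blast
  obtain v where v: "v : arrows CC V' V" "v o[CC] c_arr P' V' p' = c_arr P V p o[CC] K'" "v o[CC] c_arr Q' V' q' = c_arr Q V q o[CC] M'"
    using s'(6)[OF c(4)[OF K'(1) s(4)] c(4)[OF M'(1) s(5)] s(3)] by blast
  have vu: "v o[CC] u = idn CC V"
    by (rule coproduct_ext[OF cat_CC G c(4)[OF u(1) v(1)] c(3)[OF s(3)]])
      (use c(7)[OF s(4) u(1) v(1)] c(7)[OF s(5) u(1) v(1)] c(7)[OF K(1) s'(4) v(1)] c(7)[OF M(1) s'(5) v(1)]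
        c(7)[OF K(1) K'(1) s(4)] c(7)[OF M(1) M'(1) s(5)] u v K' M' c(5)[OF s(4)] c(5)[OF s(5)] c(6)[OF s(4)] c(6)[OF s(5)] in simp_all)
  have uv: "u o[CC] v = idn CC V'"
    by (rule coproduct_ext[OF cat_CC G' c(4)[OF v(1) u(1)] c(3)[OF s'(3)]])
      (use c(7)[OF s'(4) v(1) u(1)] c(7)[OF s'(5) v(1) u(1)] c(7)[OF K'(1) s(4) u(1)] c(7)[OF M'(1) s(5) u(1)]
        c(7)[OF K'(1) K(1) s'(4)] c(7)[OF M'(1) M(1) s'(5)] u v K' M' c(5)[OF s'(4)] c(5)[OF s'(5)] c(6)[OF s'(4)] c(6)[OF s'(5)] in simp_all)
  have comp: "c_arr V' X b' o[CC] u = c_arr V X b"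
    if X: "zc X" and b: "oc V X b" "oc V' X b'"
      and i: "iso2 P X (b' oo p' oo k) (b oo p)" "iso2 Q X (b' oo q' oo m) (b oo q)" for X b b'
  proof -
    have B: "c_arr V' X b' : arrows CC V' X" "c_arr V X b : arrows CC V X" using X b d d' by simp_all
    have 1: "c_arr V' X b' o[CC] (c_arr P' V' p' o[CC] c_arr P P' k) = c_arr V X b o[CC] c_arr P V p"
      using c_arr_eqI[OF d(1) X i(1)] c_comp[OF d(1) d'(1,3) k1 d'(4)] c_comp[OF d(1) d'(3) X oc_comp[OF d(1) k1 d'(4)] b(2)]
        c_comp[OF d(1,3) X d(4) b(1)] by (simp add: oo_assoc)
    have 2: "c_arr V' X b' o[CC] (c_arr Q' V' q' o[CC] c_arr Q Q' m) = c_arr V X b o[CC] c_arr Q V q"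
      using c_arr_eqI[OF d(2) X i(2)] c_comp[OF d(2) d'(2,3) m1 d'(5)] c_comp[OF d(2) d'(3) X oc_comp[OF d(2) m1 d'(5)] b(2)]
        c_comp[OF d(2,3) X d(5) b(1)] by (simp add: oo_assoc)
    show ?thesis
      by (rule coproduct_ext[OF cat_CC G c(4)[OF u(1) B(1)] B(2)])
        (use c(7)[OF s(4) u(1) B(1)] c(7)[OF s(5) u(1) B(1)] u 1 2 in simp_all)
  qed
  have "span_iso (c_arr V S \<beta>, c_arr V T \<alpha>) (c_arr V' S \<beta>', c_arr V' T \<alpha>')"
    using is_isoI[OF u(1) v(1) vu uv] u(1) comp[OF z(2) b(1,3) k(2) m(2)] comp[OF z(1) b(2,4) k(3) m(3)]
    by (auto simp: span_iso_def arrows_def)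
  then show ?thesis using s_arr_eq_iff[OF is_sp_span[OF h] is_sp_span[OF h']] by (simp add: sp_def)
qed

lemma arrows_SpC_iff: "s : arrows SpC X Y \<longleftrightarrow> (EX W b a. is_sp W X Y b a & s = sp W X Y b a)"
proof
  assume "s : arrows SpC X Y"
  then have s: "s : ar SpC" "sdom s = X" "scod s = Y" by (simp_all add: arrows_def)
  show "EX W b a. is_sp W X Y b a & s = sp W X Y b a" using ar_SpCE[OF s] by metis
qed (auto simp: arrows_def)

lemma gsum_is_sp:
  assumes g: "gsum A B S i j"
  shows "is_sp A S A id_cell i" "is_sp B S B id_cell j" "is_sp A A S i id_cell" "is_sp B B S j id_cell"
    "is_sp A S S i i" "is_sp B S S j j"
  using gsumD[OF g] by (auto simp: is_sp_def oc_id)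

text \<open>For existence, the apexes of the two components are added up over \<open>S\<close>;
  pulling back along \<open>i\<close> and \<open>j\<close> returns them. For uniqueness, the apex of
  any candidate is the sum of its pullbacks along \<open>i\<close> and \<open>j\<close>, and each
  part is determined by the corresponding component.\<close>

lemma gsum_product:
  assumes g: "gsum A B S i j"
  shows "is_product SpC A B S (sp A S A id_cell i) (sp B S B id_cell j)"
proof -
  note d = gsumD[OF g] and I = gsum_is_sp[OF g]
  have "EX! h. h : arrows SpC T S & sp A S A id_cell i o[SpC] h = f & sp B S B id_cell j o[SpC] h = f'"
    if ff: "f : arrows SpC T A" "f' : arrows SpC T B" for T f f'
  proof -
    obtain W b a where f: "is_sp W T A b a" "f = sp W T A b a" using ff(1) by (auto simp: arrows_SpC_iff)
    obtain W' b' a' where f': "is_sp W' T B b' a'" "f' = sp W' T B b' a'" using ff(2) by (auto simp: arrows_SpC_iff)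
    note z = f(1)[unfolded is_sp_def] f'(1)[unfolded is_sp_def]
    have z: "zc W" "zc W'" "zc T" "oc W A b" "oc W T a" "oc W' B b'" "oc W' T a'"
      using z by auto
    let ?E = "sumc W W'"
    define \<beta> where "\<beta> = copair (i oo b) (j oo b')"
    define \<alpha> where "\<alpha> = copair a a'"
    note ib = oc_comp[OF z(1,4) d(4)] and jb = oc_comp[OF z(2,6) d(5)]
    note E = sum_zero_cell[OF z(1,2)]
    have \<beta>: "oc ?E S \<beta>" "\<beta> oo inl W' = i oo b" "\<beta> oo inr W = j oo b'"
      unfolding \<beta>_def using copair_one_cell[OF z(1,2) ib jb] copair_inl[OF z(1,2) ib jb] by auto
    have \<alpha>: "oc ?E T \<alpha>" "\<alpha> oo inl W' = a" "\<alpha> oo inr W = a'"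
      unfolding \<alpha>_def using copair_one_cell[OF z(1,2,5,7)] copair_inl[OF z(1,2,5,7)] by auto
    have h: "is_sp ?E T S \<beta> \<alpha>" using E z(3) d(3) \<alpha> \<beta> by (simp add: is_sp_def)
    have bl: "bpb W ?E A S \<beta> i (inl W') b"
      by (rule gsum_component_pullback[OF g sum_gsum[OF z(1,2)] \<beta>(1) z(4,6)])
        (simp_all add: \<beta> iso2_refl[OF z(1) d(3) ib] iso2_refl[OF z(2) d(3) jb])
    have br: "bpb W' ?E B S \<beta> j (inr W) b'"
      by (rule gsum_component_pullback[OF gsum_sym[OF g] gsum_sym[OF sum_gsum[OF z(1,2)]] \<beta>(1) z(6,4)])
        (simp_all add: \<beta> iso2_refl[OF z(1) d(3) ib] iso2_refl[OF z(2) d(3) jb])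
    have ex: "sp ?E T S \<beta> \<alpha> : arrows SpC T S & sp A S A id_cell i o[SpC] sp ?E T S \<beta> \<alpha> = f & sp B S B id_cell j o[SpC] sp ?E T S \<beta> \<alpha> = f'"
      using sp_comp[OF h I(1) bl] sp_comp[OF h I(2) br] f(2) f'(2) h \<alpha> by (auto simp: arrows_SpC_iff)
    show ?thesis
    proof (rule ex1I)
      show "sp ?E T S \<beta> \<alpha> : arrows SpC T S & sp A S A id_cell i o[SpC] sp ?E T S \<beta> \<alpha> = f & sp B S B id_cell j o[SpC] sp ?E T S \<beta> \<alpha> = f'"
        by (rule ex)
      fix l assume l: "l : arrows SpC T S & sp A S A id_cell i o[SpC] l = f & sp B S B id_cell j o[SpC] l = f'"
      then obtain V \<beta>' \<alpha>' where V: "is_sp V T S \<beta>' \<alpha>'" "l = sp V T S \<beta>' \<alpha>'" by (auto simp: arrows_SpC_iff)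
      have v: "zc V" "oc V S \<beta>'" "oc V T \<alpha>'" using V by (auto simp: is_sp_def)
      note P = bp_bpb[OF v(1) d(1,3) v(2) d(4)] and Q = bp_bpb[OF v(1) d(2,3) v(2) d(5)]
      note G = gsum_pullback[OF g P Q]
      have to: "sp X T S (m oo w) (n oo y) = sp Y Y' S m id_cell o[SpC] sp X T Y' w (n oo y)"
        if "is_sp X T Y' w (n oo y)" "oc Y' S m" "Y = Y'" for X m w n y Y Y'
      proof -
        have w: "zc X" "zc Y'" "oc X Y' w" using that(1) by (auto simp: is_sp_def)
        have "is_sp Y' Y' S m id_cell" using w that d(3) by (simp add: is_sp_def oc_id)
        from sp_comp[OF that(1) this bpb_sym[OF bpb_id[OF w(2,1,3)]]] show ?thesis using that(3) by simp
      qed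
      \<comment> \<open>The part of the candidate over the summand \<open>D\<close>. Its square
        commutes up to a 2-cell, so the leg \<open>\<beta>' oo p\<close> may be exchanged for
        \<open>m oo q\<close>; what remains is the component \<open>w\<close> followed by pushing
        forward along \<open>m\<close>.\<close>
      have leg: "sp Z T S (\<beta>' oo p) (\<alpha>' oo p) = sp D D S m id_cell o[SpC] w"
        if B: "bpb Z V D S \<beta>' m p q" and e: "sp D S D id_cell m o[SpC] l = w" for Z D m p q w
      proof -
        note b = bpbD[OF B]
        have 1: "is_sp Z T D q (\<alpha>' oo p)" "is_sp D S D id_cell m"
          using b z(3) oc_comp[OF b(1,7) v(3)] by (simp_all add: is_sp_def oc_id)
        have "w = sp Z T D q (\<alpha>' oo p)" using sp_comp[OF V(1) 1(2) B] e V(2) by simp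
        moreover have "sp Z T S (\<beta>' oo p) (\<alpha>' oo p) = sp Z T S (m oo q) (\<alpha>' oo p)"
          using c_arr_eqI[OF b(1,4) bpb_iso2[OF B]] by (simp add: sp_def)
        ultimately show ?thesis using to[OF 1(1) b(6) refl] by simp
      qed
      note bp = leg[OF P l[THEN conjunct2, THEN conjunct1]] and bq = leg[OF Q l[THEN conjunct2, THEN conjunct2]]
      have cp: "sp W T S (\<beta> oo inl W') (\<alpha> oo inl W') = sp A A S i id_cell o[SpC] f"
        using to[of W A b a id_cell i A] f \<beta>(2) \<alpha>(2) d(4) by simp
      have cq: "sp W' T S (\<beta> oo inr W) (\<alpha> oo inr W) = sp B B S j id_cell o[SpC] f'"
        using to[of W' B b' a' id_cell j B] f' \<beta>(3) \<alpha>(3) d(5) by simp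
      show "l = sp ?E T S \<beta> \<alpha>"
        unfolding V(2)
        by (rule span_ext[OF V(1) h G sum_gsum[OF z(1,2)]]) (simp_all only: bp bq cp cq)
    qed
  qed
  then show ?thesis
    using d I by (auto simp: is_product_def arrows_SpC_iff)
qed

text \<open>The apex of a span into an empty 0-cell is itself empty, and between empty 0-cells all
  conditions hold vacuously, whatever the groups are.\<close>

lemma empty_terminal:
  assumes F: "zc F" and e: "Pts F = {}"
  shows "is_terminal SpC F"
proof -
  have ex: "is_sp F X F id_cell id_cell" if "zc X" for X
    using F that e by (auto simp: is_sp_def is_one_cell_def)
  have "f = sp F X F id_cell id_cell" if f: "f : arrows SpC X F" for X f
  proof -
    obtain W b a where W: "is_sp W X F b a" "f = sp W X F b a" using f by (auto simp: arrows_SpC_iff)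
    have 0: "Pts W = {}" using W(1) ocD(1)[of W F b] e by (auto simp: is_sp_def)
    have X: "zc X" using W by (simp add: is_sp_def)
    have eq: "eqv W F id_cell"
      using 0 e by (auto simp: eqv_def is_one_cell_def full_def faithful_def eso_def)
    have "iso2 W F id_cell b" "iso2 W X id_cell a"
      using 0 W(1) by (auto simp: iso2_def is_one_cell_def is_two_cell_def is_sp_def)
    then show ?thesis unfolding W(2) using sp_eq_iff[OF W(1) ex[OF X]] eq by (intro iffD2[OF sp_eq_iff[OF W(1) ex[OF X]]]) auto
  qed
  then have "EX! f. f : arrows SpC X F" if "zc X" for X
    using sp_in[OF ex[OF that]] by (intro ex1I[of _ "sp F X F id_cell id_cell"]) (auto simp: arrows_def)
  then show ?thesis using F by (simp add: is_terminal_def)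
qed

text \<open>Back along \<open>a\<close>, then forward along \<open>b\<close>; the two halves meet in
  an identity square.\<close>

lemma sp_factor:
  assumes "is_sp W X Y b a"
  shows "sp W X Y b a = sp W W Y b id_cell o[SpC] sp W X W id_cell a"
    and "is_sp W W Y b id_cell" "is_sp W X W id_cell a"
proof -
  have z: "zc W" "zc X" "zc Y" "oc W Y b" "oc W X a"
    using assms by (auto simp: is_sp_def)
  show 1: "is_sp W W Y b id_cell" "is_sp W X W id_cell a" using z by (simp_all add: is_sp_def oc_id)
  from sp_comp[OF 1(2,1) bpb_id[OF z(1,1) oc_id]]
  show "sp W X Y b a = sp W W Y b id_cell o[SpC] sp W X W id_cell a" by simp
qed

subsection \<open>Additivity of Mackey functors\<close>

lemma kfD:
  assumes "is_kfunctor k M"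
  shows "zc X ==> module k (fob M X)"
    and "s : ar SpC ==> far M s : lin k (fob M (sdom s)) (fob M (scod s))"
    and "zc X ==> v : el M X ==> far M (idn SpC X) v = v"
    and "s : ar SpC ==> t : ar SpC ==> scod s = sdom t ==> v : el M (sdom s) ==>
      far M (t o[SpC] s) v = far M t (far M s v)"
  using assms by (auto simp: is_kfunctor_def compose_def)

text \<open>The form in which product preservation enters: an element is the sum of its parts on two
  summands. For \<open>Omega k\<close> it can be computed directly, so that one treatment of the
  actions serves both Mackey functors and \<open>Omega k\<close>.\<close>

definition is_additive :: "('k, 'm) kfctr => bool" where
  "is_additive M \<longleftrightarrow> (ALL A B S i j. gsum A B S i j --> (ALL v:el M S.
     far M (sp A S S i i) v +[fob M S] far M (sp B S S j j) v = v))"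

text \<open>Elements over \<open>S\<close> are determined by their images under the product
  projections \<open>?p\<close> and \<open>?q\<close>, so the identity is tested there. Going along
  a summand and back is the identity by \<open>bpb_self\<close>; crossing from one summand to the
  other factors through an empty 0-cell, whose module is zero.\<close>

lemma (in base_ring) mackey_additive:
  assumes M: "is_mackey k M"
  shows "is_additive M"
  unfolding is_additive_def
proof (intro allI impI ballI)
  fix A B S i j v assume g: "gsum A B S i j" and v: "v : el M S"
  have F: "is_kfunctor k M" and pp: "preserves_finite_products M" using M by (auto simp: is_mackey_def)
  note d = gsumD[OF g] and I = gsum_is_sp[OF g] and K = kfD[OF F]
  interpret A: module k "fob M A" by (rule K(1)[OF d(1)])
  interpret B: module k "fob M B" by (rule K(1)[OF d(2)])
  interpret S: module k "fob M S" by (rule K(1)[OF d(3)])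
  have zero: "far M (sp C X Y b a) w = 0[fob M Y]" if C: "Pts C = {}" and s: "is_sp C X Y b a" and w: "w : el M X" for C X Y a b w
  proof -
    note f = sp_factor[OF s]
    have C': "zc C" "zc Y" using s by (auto simp: is_sp_def)
    have t: "el M C = {0[fob M C]}" using pp empty_terminal[OF C'(1) C] by (auto simp: preserves_finite_products_def)
    have "far M (sp C X C id_cell a) w : el M C" using linD(1)[OF K(2)[OF sp_in[OF f(3)]], of w] w by simp
    then have "far M (sp C X C id_cell a) w = 0[fob M C]" using t by simp
    moreover have "far M (sp C C Y b id_cell) 0[fob M C] = 0[fob M Y]"
      using linear_map_zero[OF K(1)[OF C'(1)] K(1)[OF C'(2)]] K(2)[OF sp_in[OF f(2)]] by simp
    moreover have "far M (sp C X Y b a) w = far M (sp C C Y b id_cell) (far M (sp C X C id_cell a) w)"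
      unfolding f(1) by (rule K(4)) (use f w in simp_all)
    ultimately show ?thesis by simp
  qed
  let ?p = "far M (sp A S A id_cell i)" and ?q = "far M (sp B S B id_cell j)"
  let ?i = "far M (sp A A S i id_cell)" and ?j = "far M (sp B B S j id_cell)"
  have P: "?p : lin k (fob M S) (fob M A)" and Q: "?q : lin k (fob M S) (fob M B)"
    and Il: "?i : lin k (fob M A) (fob M S)" and Jl: "?j : lin k (fob M B) (fob M S)"
    using K(2)[OF sp_in[OF I(1)]] K(2)[OF sp_in[OF I(2)]] K(2)[OF sp_in[OF I(3)]] K(2)[OF sp_in[OF I(4)]] by simp_all
  have ii: "far M (sp A S S i i) v = ?i (?p v)" "far M (sp B S S j j) v = ?j (?q v)"
    using sp_factor[OF I(5)] sp_factor[OF I(6)] K(4)[OF sp_in[OF I(1)] sp_in[OF I(3)]] K(4)[OF sp_in[OF I(2)] sp_in[OF I(4)]] v by simp_all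
  have pi: "?p (?i w) = w" if "w : el M A" for w
    using K(4)[OF sp_in[OF I(3)] sp_in[OF I(1)], of w] sp_comp[OF I(3,1) bpb_self[OF d(1,3,4,6,7)]] K(3)[OF d(1) that] that
    by (simp add: idn_SpC)
  have qj: "?q (?j w) = w" if "w : el M B" for w
    using K(4)[OF sp_in[OF I(4)] sp_in[OF I(2)], of w] sp_comp[OF I(4,2) bpb_self[OF d(2,3,5,8,9)]] K(3)[OF d(2) that] that
    by (simp add: idn_SpC)
  obtain C p q where C: "bpb C A B S i j p q" "Pts C = {}" using gsum_disjoint_pullback[OF g] .
  note c = bpbD[OF C(1)]
  have qi: "?q (?i w) = 0[fob M B]" if "w : el M A" for w
    using K(4)[OF sp_in[OF I(3)] sp_in[OF I(2)], of w] sp_comp[OF I(3,2) C(1)] zero[OF C(2), of A B q p w] c that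
    by (simp add: is_sp_def)
  have pj: "?p (?j w) = 0[fob M A]" if "w : el M B" for w
    using K(4)[OF sp_in[OF I(4)] sp_in[OF I(1)], of w] sp_comp[OF I(4,1) bpb_sym[OF C(1)]] zero[OF C(2), of B A p q w] c that
    by (simp add: is_sp_def)
  have bij: "bij_betw (%z. (?p z, ?q z)) (el M S) (el M A \<times> el M B)"
    using pp gsum_product[OF g] unfolding preserves_finite_products_def by blast
  note pv = linD(1)[OF P v] and qv = linD(1)[OF Q v]
  note iv = linD(1)[OF Il pv] and jv = linD(1)[OF Jl qv]
  let ?w = "?i (?p v) +[fob M S] ?j (?q v)"
  have "?p ?w = ?p v" using linD(3)[OF P iv jv] pi[OF pv] pj[OF qv] pv by simp
  moreover have "?q ?w = ?q v" using linD(3)[OF Q iv jv] qi[OF pv] qj[OF qv] qv by simp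
  ultimately have "?w = v"
    using bij_betw_imp_inj_on[OF bij] iv jv v by (auto simp: inj_on_def)
  then show "far M (sp A S S i i) v +[fob M S] far M (sp B S S j j) v = v" using ii by simp
qed

section \<open>The big Burnside functor\<close>

context base_ring
begin

abbreviation OB where "OB \<equiv> Omega_big k"
abbreviation OM where "OM \<equiv> Omega k"
abbreviation big_el where "big_el X \<equiv> carrier (Omega_big_ob k X)"
abbreviation burn_el where "burn_el X \<equiv> carrier (Omega_ob k X)"

section \<open>Classes of 1-cells in the big Burnside modules\<close>

definition big_cls :: "zero_cell => zero_cell => one_cell => 'k big_elt" where
  "big_cls X A a = k0_class k (slice CC X) (c_arr A X a)"

lemma slice_CC_ob: "f : ob (slice CC X) \<longleftrightarrow> (EX A a. zc A & zc X & oc A X a & f = c_arr A X a)"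
proof -
  have "f : ob (slice CC X) \<longleftrightarrow> (EX A. f : arrows CC A X)" by (auto simp: arrows_def)
  then show ?thesis by (simp add: arr_CC del: slice_simps)
qed

lemma Obig_mod: "module k (Omega_big_ob k X)"
  unfolding Omega_big_ob_def by (rule k0_module_module)

lemma big_cls_in:
  assumes "zc A" "zc X" "oc A X a"
  shows "big_cls X A a : big_el X"
  unfolding Omega_big_ob_def big_cls_def by (rule k0_class_closed) (use assms in simp)

lemma big_cls_cong:
  assumes X: "zc X" "zc A" "zc A'" and h: "eqv A A' h" and i: "iso2 A X (a' oo h) a"
    and a': "oc A' X a'"
  shows "big_cls X A a = big_cls X A' a'"
  unfolding big_cls_def
proof (rule k0_class_cong[OF slice_category[OF cat_CC]])
  note h1 = eqvD(1)[OF h]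
  show "isomorphic (slice CC X) (c_arr A X a) (c_arr A' X a')"
    unfolding slice_isomorphic_iff[OF cat_CC]
    using X h1 iso2_cells(2)[OF i] a' is_iso_CC_iff[OF X(2,3) h1] h c_comp[OF X(2,3,1) h1 a'] c_arr_eqI[OF X(2,1) i]
    by (auto intro!: bexI[of _ "c_arr A A' h"])
qed

lemma big_cls_iso2:
  assumes X: "zc X" "zc A" and i: "iso2 A X a a'"
  shows "big_cls X A a = big_cls X A a'"
  using c_arr_eqI[OF X(2,1) i] by (simp add: big_cls_def)

lemma big_cls_gsum:
  assumes g: "gsum A B S i j" and X: "zc X" and s: "oc S X s"
  shows "big_cls X S s = big_cls X A (s oo i) +[Omega_big_ob k X] big_cls X B (s oo j)"
proof -
  obtain u v where "is_coproduct (slice CC X) (c_arr A X (s oo i)) (c_arr B X (s oo j)) (c_arr S X s) u v"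
    using gsum_slice_coproduct[OF g X s] by blast
  then show ?thesis unfolding big_cls_def Omega_big_ob_def by (rule k0_class_coproduct)
qed

text \<open>\<open>k0_lift_linear\<close> in the language of 1-cells: isomorphisms over
  \<open>X\<close> become precomposition with equivalences, and coproducts over \<open>X\<close>
  become sums \<open>gsum\<close>.\<close>

lemma big_lift:
  assumes N: "module k N" and X: "zc X"
    and c: "!!A a. zc A ==> oc A X a ==> h (c_arr A X a) : carrier N"
    and e: "!!A A' a t. zc A ==> zc A' ==> oc A' X a ==> eqv A A' t ==>
      h (c_arr A X (a oo t)) = h (c_arr A' X a)"
    and s: "!!A B S i j s. gsum A B S i j ==> oc S X s ==>
      h (c_arr S X s) = h (c_arr A X (s oo i)) +[N] h (c_arr B X (s oo j))"
  shows "k0_lift k (slice CC X) N h : lin k (Omega_big_ob k X) N"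
    and "zc A ==> oc A X a ==> k0_lift k (slice CC X) N h (big_cls X A a) = h (c_arr A X a)"
proof -
  have 1: "h f : carrier N" if "f : ob (slice CC X)" for f using that c unfolding slice_CC_ob by blast
  have 2: "h f = h g" if fg: "isomorphic (slice CC X) f g" for f g
  proof -
    obtain l where l: "g : ob (slice CC X)" "l : arrows CC (cdom f) (cdom g)" "is_iso CC l" "g o[CC] l = f"
      using fg unfolding slice_isomorphic_iff[OF cat_CC] by auto
    obtain A' a where a: "zc A'" "oc A' X a" "g = c_arr A' X a" using l(1) unfolding slice_CC_ob by blast
    obtain A t where t: "zc A" "oc A A' t" "l = c_arr A A' t"
      using l(2) a(3) unfolding arr_CC by auto
    have "eqv A A' t" using is_iso_CC_iff[OF t(1) a(1) t(2)] l(3) t(3) by simp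
    from e[OF t(1) a(1,2) this] show ?thesis using l(4) c_comp[OF t(1) a(1) X t(2) a(2)] a(3) t(3) by simp
  qed
  have 3: "h f = h a +[N] h b" if "is_coproduct (slice CC X) a b f i j" for a b f i j
    using slice_CC_coproductE[OF that] s by metis
  note L = k0_lift_linear[OF slice_category[OF cat_CC] N 1 2 3]
  show "k0_lift k (slice CC X) N h : lin k (Omega_big_ob k X) N"
    unfolding Omega_big_ob_def using L(1) .
  show "zc A ==> oc A X a ==> k0_lift k (slice CC X) N h (big_cls X A a) = h (c_arr A X a)"
    unfolding big_cls_def by (rule L(2)) (use X in simp_all)
qed

lemma big_ext:
  assumes N: "module k N" and f: "f : lin k (Omega_big_ob k X) N" and g: "g : lin k (Omega_big_ob k X) N"
    and e: "!!A a. zc A ==> oc A X a ==> f (big_cls X A a) = g (big_cls X A a)"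
  shows "f = g"
  by (rule k0_ext[OF N f[unfolded Omega_big_ob_def] g[unfolded Omega_big_ob_def]])
    (use e in "auto simp: slice_CC_ob big_cls_def simp del: slice_simps")

lemma big_lower:
  assumes X: "zc X" and Y: "zc Y" and b: "oc X Y b"
  shows "Omega_big_lower k (c_arr X Y b) : lin k (Omega_big_ob k X) (Omega_big_ob k Y)"
    and "zc A ==> oc A X a ==> Omega_big_lower k (c_arr X Y b) (big_cls X A a) = big_cls Y A (b oo a)"
proof -
  let ?h = "%a. k0_class k (slice CC Y) (c_arr X Y b o[CC] a)"
  have h: "?h (c_arr A X a) = big_cls Y A (b oo a)" if "zc A" "oc A X a" for A a
    using c_comp[OF that(1) X Y that(2) b] by (simp add: big_cls_def)
  have 1: "?h (c_arr A X a) : big_el Y" if "zc A" "oc A X a" for A a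
    unfolding h[OF that] by (rule big_cls_in[OF that(1) Y oc_comp[OF that b]])
  have 2: "?h (c_arr A X (a oo t)) = ?h (c_arr A' X a)"
    if "zc A" "zc A'" "oc A' X a" "eqv A A' t" for A A' a t
  proof -
    note t = eqvD(1)[OF that(4)]
    note ba = oc_comp[OF that(2,3) b]
    show ?thesis
      unfolding h[OF that(1) oc_comp[OF that(1) t that(3)]] h[OF that(2,3)] oo_assoc
      by (rule big_cls_cong[OF Y that(1,2,4) iso2_refl[OF that(1) Y oc_comp[OF that(1) t ba]] ba])
  qed
  have 3: "?h (c_arr S X s) = ?h (c_arr A X (s oo i)) +[Omega_big_ob k Y] ?h (c_arr B X (s oo j))"
    if g: "gsum A B S i j" and s: "oc S X s" for A B S i j s
  proof -
    note d = gsumD[OF g]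
    show ?thesis
      unfolding h[OF d(1) oc_comp[OF d(1,4) s]] h[OF d(2) oc_comp[OF d(2,5) s]] h[OF d(3) s] oo_assoc
      by (rule big_cls_gsum[OF g Y oc_comp[OF d(3) s b]])
  qed
  note L = big_lift[OF Obig_mod X 1 2 3]
  show "Omega_big_lower k (c_arr X Y b) : lin k (Omega_big_ob k X) (Omega_big_ob k Y)"
    unfolding Omega_big_lower_def c_arr_sel using L(1) by simp
  show "zc A ==> oc A X a ==> Omega_big_lower k (c_arr X Y b) (big_cls X A a) = big_cls Y A (b oo a)"
    unfolding Omega_big_lower_def c_arr_sel using L(2)[of A a] h[of A a] by simp
qed

text \<open>The pasting law along the other leg, by reflection.\<close>

lemma bpb_paste_right:
  assumes "bpb V W S X \<alpha> s v t" "bpb P V A S t i p q"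
  shows "bpb P W A X \<alpha> (s oo i) (v oo p) q"
  by (rule bpb_sym[OF bpb_paste[OF bpb_sym[OF assms(1)] bpb_sym[OF assms(2)]]])

text \<open>Any homotopy pullback gives the same class as the standard one of chosen
  representatives, by \<open>bpb_unique\<close>. Invariance under equivalences and additivity are
  then \<open>bpb_equiv\<close> and stability of sums.\<close>

lemma big_upper:
  assumes W: "zc W" and X: "zc X" and \<alpha>: "oc W X \<alpha>"
  shows "Omega_big_upper k (c_arr W X \<alpha>) : lin k (Omega_big_ob k X) (Omega_big_ob k W)"
    and "bpb P W A X \<alpha> a p q ==> Omega_big_upper k (c_arr W X \<alpha>) (big_cls X A a) = big_cls W P p"
proof -
  let ?f = "c_arr W X \<alpha>"
  let ?h = "%a. k0_class k (slice CC W) (c_wpb_fst ?f a)"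
  have h: "?h (c_arr A X a) = big_cls W P p" if b: "bpb P W A X \<alpha> a p q" for A a P p q
  proof -
    note z = bpbD[OF b]
    define \<alpha>' where "\<alpha>' = c_rep ?f"
    define a' where "a' = c_rep (c_arr A X a)"
    have \<alpha>': "iso2 W X \<alpha> \<alpha>'" unfolding \<alpha>'_def by (rule c_rep_iso2[OF W X \<alpha>])
    have a': "iso2 A X a a'" unfolding a'_def by (rule c_rep_iso2[OF z(3) X z(6)])
    have b': "bpb P W A X \<alpha>' a' p q" by (rule bpb_sym[OF bpb_change[OF bpb_sym[OF bpb_change[OF b \<alpha>']] a']])
    obtain h where h: "eqv P (bipullback W A X \<alpha>' a') h" "bipullback_fst oo h = p" using bpb_unique[OF b'] by metis
    note B = bpbD[OF bp_bpb[OF W z(3) X bpbD(5,6)[OF b']]]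
    have "big_cls W P p = big_cls W (bipullback W A X \<alpha>' a') bipullback_fst"
      by (rule big_cls_cong[OF W z(1) B(1) h(1) _ B(7)]) (simp add: h(2) iso2_refl z W)
    then show ?thesis by (simp add: big_cls_def c_wpb_fst_def c_wpb_def \<alpha>'_def a'_def)
  qed
  note bip = bp_bpb[OF W _ X \<alpha>]
  have 1: "?h (c_arr A X a) : big_el W" if "zc A" "oc A X a" for A a
    unfolding h[OF bip[OF that]] using big_cls_in[OF _ W] bpbD[OF bip[OF that]] by blast
  have 2: "?h (c_arr A X (a oo t)) = ?h (c_arr A' X a)"
    if "zc A" "zc A'" "oc A' X a" "eqv A A' t" for A A' a t
  proof -
    note B = bip[OF that(1) oc_comp[OF that(1) eqvD(1)[OF that(4)] that(3)]]
    show ?thesis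
      using h[OF B] h[OF bpb_sym[OF bpb_equiv[OF that(2,4,3) bpb_sym[OF B]]]] by simp
  qed
  have 3: "?h (c_arr S X s) = ?h (c_arr A X (s oo i)) +[Omega_big_ob k W] ?h (c_arr B X (s oo j))"
    if g: "gsum A B S i j" and s: "oc S X s" for A B S i j s
  proof -
    note d = gsumD[OF g]
    note V = bip[OF d(3) s]
    note v = bpbD[OF V]
    note P = bp_bpb[OF v(1) d(1,3) v(8) d(4)] and Q = bp_bpb[OF v(1) d(2,3) v(8) d(5)]
    show ?thesis
      unfolding h[OF V] h[OF bpb_paste_right[OF V P]] h[OF bpb_paste_right[OF V Q]]
      by (rule big_cls_gsum[OF gsum_pullback[OF g P Q] W v(7)])
  qed
  note L = big_lift[OF Obig_mod X 1 2 3]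
  show "Omega_big_upper k (c_arr W X \<alpha>) : lin k (Omega_big_ob k X) (Omega_big_ob k W)"
    unfolding Omega_big_upper_def c_arr_sel using L(1) by simp
  show "Omega_big_upper k (c_arr W X \<alpha>) (big_cls X A a) = big_cls W P p" if "bpb P W A X \<alpha> a p q"
    unfolding Omega_big_upper_def c_arr_sel using L(2)[of A a] h[OF that] bpbD[OF that] by simp
qed

lemma Omega_big_fob: "fob OB X = Omega_big_ob k X"
  by (simp add: Omega_big_def kfctr_of_def)

text \<open>Pull back along the source leg, push forward along the target leg; the representative
  chosen by \<open>s_rep\<close> is traded for the given span by moving the square along
  \<open>t\<close>.\<close>

lemma big_far:
  assumes s: "is_sp W X Y b \<alpha>"
  shows "far OB (sp W X Y b \<alpha>) : lin k (Omega_big_ob k X) (Omega_big_ob k Y)"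
    and "bpb P W A X \<alpha> a p q ==> far OB (sp W X Y b \<alpha>) (big_cls X A a) = big_cls Y P (b oo p)"
proof -
  obtain W' b' \<alpha>' t where s': "s_rep (sp W X Y b \<alpha>) = (c_arr W' Y b', c_arr W' X \<alpha>')" "is_sp W' X Y b' \<alpha>'"
    "eqv W W' t" "iso2 W Y (b' oo t) b" "iso2 W X (\<alpha>' oo t) \<alpha>" using s_rep_sp[OF s] .
  have z: "zc W" "zc X" "zc Y" "zc W'" "oc W' Y b'" "oc W' X \<alpha>'"
    using s s'(2) by (auto simp: is_sp_def)
  have f: "far OB (sp W X Y b \<alpha>) = compose (big_el X) (Omega_big_lower k (c_arr W' Y b')) (Omega_big_upper k (c_arr W' X \<alpha>'))"
    using s'(1) by (simp add: Omega_big_def kfctr_of_def)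
  note lo = big_lower[OF z(4,3,5)] and up = big_upper[OF z(4,2,6)]
  show "far OB (sp W X Y b \<alpha>) : lin k (Omega_big_ob k X) (Omega_big_ob k Y)"
    unfolding f by (rule lin_comp[OF Obig_mod up(1) lo(1)])
  show "far OB (sp W X Y b \<alpha>) (big_cls X A a) = big_cls Y P (b oo p)" if B: "bpb P W A X \<alpha> a p q"
  proof -
    note y = bpbD[OF B]
    have "bpb P W' A X \<alpha>' a (t oo p) q"
      by (rule bpb_equiv[OF z(4) s'(3) z(6) bpb_change[OF B iso2_sym[OF z(1,2) s'(5)]]])
    then have "Omega_big_upper k (c_arr W' X \<alpha>') (big_cls X A a) = big_cls W' P (t oo p)" by (rule up(2))
    then have "far OB (sp W X Y b \<alpha>) (big_cls X A a) = big_cls Y P (b' oo (t oo p))"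
      unfolding f using lo(2)[OF y(1) oc_comp[OF y(1,7) eqvD(1)[OF s'(3)]]] big_cls_in[OF y(3,4,6)]
      by (simp add: compose_def)
    also have "... = big_cls Y P (b oo p)"
      unfolding oo_assoc
      by (rule big_cls_iso2[OF z(3) y(1) iso2_comp[OF y(1) z(1,3) iso2_refl[OF y(1) z(1) y(7)] s'(4)]])
    finally show ?thesis .
  qed
qed

lemma kf_Obig: "is_kfunctor k OB"
proof -
  have lin: "far OB s : lin k (Omega_big_ob k (sdom s)) (Omega_big_ob k (scod s))" if "s : ar SpC" for s
    using ar_SpCE[OF that refl refl] big_far(1) by metis
  have id: "far OB (idn SpC X) = (\<lambda>x \<in> big_el X. x)" if X: "zc X" for X
  proof (rule big_ext[OF Obig_mod])
    show "far OB (idn SpC X) : lin k (Omega_big_ob k X) (Omega_big_ob k X)"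
      using lin[OF idn_SpC_in(1)[OF X]] X by simp
    show "(\<lambda>x \<in> big_el X. x) : lin k (Omega_big_ob k X) (Omega_big_ob k X)"
      by (rule lin_id[OF Obig_mod])
    fix A a assume a: "zc A" "oc A X a"
    show "far OB (idn SpC X) (big_cls X A a) = (\<lambda>x \<in> big_el X. x) (big_cls X A a)"
      using big_far(2)[OF is_sp_id[OF X] bpb_id[OF X a]] big_cls_in[OF a(1) X a(2)] by (simp add: idn_SpC)
  qed
  have comp: "far OB (t o[SpC] s) = compose (big_el (sdom s)) (far OB t) (far OB s)"
    if st: "s : ar SpC" "t : ar SpC" "scod s = sdom t" for s t
  proof (rule big_ext[OF Obig_mod])
    define X Y Z where "X = sdom s" and "Y = scod s" and "Z = scod t"
    show "far OB (t o[SpC] s) : lin k (Omega_big_ob k (sdom s)) (Omega_big_ob k (scod t))"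
      using lin[OF SpC_comp_in(1)[OF st]] st by simp
    show "compose (big_el (sdom s)) (far OB t) (far OB s) : lin k (Omega_big_ob k (sdom s)) (Omega_big_ob k (scod t))"
      by (rule lin_comp[OF Obig_mod lin[OF st(1)]]) (use lin[OF st(2)] st in simp)
    fix A a assume a: "zc A" "oc A (sdom s) a"
    obtain W b \<alpha> where s: "is_sp W X Y b \<alpha>" "s = sp W X Y b \<alpha>" using ar_SpCE[OF st(1)] X_def Y_def by metis
    obtain V d \<gamma> where t: "is_sp V Y Z d \<gamma>" "t = sp V Y Z d \<gamma>" using ar_SpCE[OF st(2)] st(3) Y_def Z_def by metis
    have z: "zc W" "zc X" "oc W X \<alpha>" using s by (auto simp: is_sp_def)
    obtain R p q where R: "bpb R W V Y b \<gamma> p q" "is_sp R X Z (d oo q) (\<alpha> oo p)" "t o[SpC] s = sp R X Z (d oo q) (\<alpha> oo p)"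
      using SpC_comp_ex[OF s(1) t(1)] s(2) t(2) by metis
    have ax: "oc A X a" using a X_def by simp
    note P = bp_bpb[OF z(1) a(1) z(2,3) ax]
    let ?P = "bipullback W A X \<alpha> a"
    note p = bpbD[OF P] and r = bpbD[OF R(1)]
    \<comment> \<open>The common pullback of the composite apex \<open>R\<close> and of
      \<open>?P\<close> over \<open>W\<close>. Pasted one way it pulls \<open>a\<close> back to the
      composite span, pasted the other way it evaluates the second span on the result of the
      first.\<close>
    note Q = bp_bpb[OF r(1) p(1) z(1) r(7) p(7)]
    let ?Q = "bipullback R ?P W p bipullback_fst"
    have Q1: "bpb ?Q R A X (\<alpha> oo p) a bipullback_fst (bipullback_snd oo bipullback_snd)"
      by (rule bpb_paste[OF P Q])
    have "bpb ?Q ?P V Y (b oo bipullback_fst) \<gamma> bipullback_snd (q oo bipullback_fst)"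
      by (rule bpb_paste[OF R(1) bpb_sym[OF Q]])
    then have Q2: "bpb ?Q V ?P Y \<gamma> (b oo bipullback_fst) (q oo bipullback_fst) bipullback_snd" by (rule bpb_sym)
    show "far OB (t o[SpC] s) (big_cls (sdom s) A a) = compose (big_el (sdom s)) (far OB t) (far OB s) (big_cls (sdom s) A a)"
      using big_far(2)[OF R(2) Q1] big_far(2)[OF s(1) P] big_far(2)[OF t(1) Q2] R(3) s(2) t(2) big_cls_in[OF a(1) z(2) ax]
      by (simp add: compose_def X_def[symmetric] oo_assoc)
  qed
  show ?thesis
    unfolding is_kfunctor_def Omega_big_fob
    using Obig_mod lin id comp by simp
qed

subsection \<open>Elements of \<open>\<Omega>(Y \<times> X)\<close> as spans\<close>

text \<open>The span from \<open>Y\<close> to \<open>X\<close> given by \<open>a : A \<rightarrow> Y \<times> X\<close>, written \<open>\<langle>a\<rangle>\<close> above.\<close>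

definition unc :: "zero_cell => zero_cell => zero_cell => one_cell => s_arrow" where
  "unc Y X A a = sp A Y X (snd_cell oo a) (fst_cell oo a)"

lemma is_sp_unc:
  assumes "zc Y" "zc X" "zc A" "oc A (Y ** X) a"
  shows "is_sp A Y X (snd_cell oo a) (fst_cell oo a)"
  using assms oc_comp[OF assms(3,4) oc_fst] oc_comp[OF assms(3,4) oc_snd]
  by (simp add: is_sp_def)

text \<open>A 1-cell into a product is recovered up to a 2-cell from its components, and 2-cells for
  the components, even unrelated ones, pair to a 2-cell for the whole.\<close>

lemma uncurry_inj:
  assumes z: "zc Y" "zc X" "zc A" "zc A'"
    and a: "oc A (Y ** X) a" and a': "oc A' (Y ** X) a'"
    and e: "unc Y X A a = unc Y X A' a'"
  shows "big_cls (Y ** X) A a = big_cls (Y ** X) A' a'"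
proof -
  obtain t where t: "eqv A A' t" "iso2 A X (snd_cell oo a' oo t) (snd_cell oo a)"
    "iso2 A Y (fst_cell oo a' oo t) (fst_cell oo a)"
    using sp_eq_iff[OF is_sp_unc[OF z(1-3) a] is_sp_unc[OF z(1,2,4) a']] e unfolding unc_def by blast
  note YX = zc_prod[OF z(1,2)]
  have t1: "oc A (Y ** X) (a' oo t)" by (rule oc_comp[OF z(3) eqvD(1)[OF t(1)] a'])
  have "iso2 A (Y ** X) (pair_cell (fst_cell oo (a' oo t)) (snd_cell oo (a' oo t)))
     (pair_cell (fst_cell oo a) (snd_cell oo a))"
    using pair_iso2[OF z(3,1,2) t(3,2)] by (simp add: oo_assoc)
  from iso2_trans[OF z(3) YX iso2_trans[OF z(3) YX iso2_sym[OF z(3) YX pair_eta[OF z(3,1,2) t1]] this] pair_eta[OF z(3,1,2) a]]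
  show ?thesis by (intro big_cls_cong[OF YX z(3,4) t(1) _ a'])
qed

text \<open>Pulling a projection back along \<open>\<alpha>\<close> gives the product with
  \<open>\<alpha>\<close>; the square commutes strictly, whence the trivial 2-cell. A morphism
  \<open>d\<close> over \<open>X\<close> is absorbed by moving the second coordinate back with its
  inverse.\<close>

lemma bpb_snd_square:
  assumes Y: "zc Y" and W: "zc W" and X: "zc X" and \<alpha>: "oc W X \<alpha>"
  shows "bpb (Y ** W) (Y ** X) W X snd_cell \<alpha> (times id_cell \<alpha>) snd_cell"
proof -
  interpret Y: zcell Y + W: zcell W + X: zcell X by (simp_all add: Y W X)
  note S = prod_sel and c = ocD[OF \<alpha>] one_cell_one[OF W X \<alpha>]
  show ?thesis
  proof (rule bpbI[of _ _ _ _ _ _ _ _ "%z. 1[X]"]; (unfold times_cell_simps snd_cell_simps id_cell_simps)?)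
    fix x w d assume "x : Pts (Y ** X)" "w : Pts W" "d : gp X" "Act X d (psnd x) = Fn \<alpha> w"
    then show "EX z:Pts (Y ** W). EX u:gp (Y ** X). EX v:gp W.
       Act (Y ** X) u (PPair (pfst z) (Fn \<alpha> (psnd z))) = x & Act W v (psnd z) = w & Tw \<alpha> (psnd z) v *[X] 1[X] = d *[X] psnd u"
      using X.act_eqD[of d "psnd x" "Fn \<alpha> w"] c
      by (intro bexI[of _ "PPair (pfst x) w"] bexI[of _ "PPair 1[Y] (inv[X] d)"] bexI[of _ "1[W]"]) (auto simp: S)
  next
    fix z z' u v assume "z : Pts (Y ** W)" "z' : Pts (Y ** W)" "u : gp (Y ** X)" "v : gp W"
      "Act (Y ** X) u (PPair (pfst z) (Fn \<alpha> (psnd z))) = PPair (pfst z') (Fn \<alpha> (psnd z'))" "Act W v (psnd z) = psnd z'"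
      "Tw \<alpha> (psnd z) v *[X] 1[X] = 1[X] *[X] psnd u"
    then show "EX g:gp (Y ** W). Act (Y ** W) g z = z' & PPair (pfst g) (Tw \<alpha> (psnd z) (psnd g)) = u & psnd g = v"
      using c by (intro bexI[of _ "PPair (pfst u) v"]) (auto simp: S)
  qed (use Y W X \<alpha> c in "auto simp: S oc_id")
qed

lemma bpb_fst_square:
  assumes Y: "zc Y" and W: "zc W" and X: "zc X" and \<alpha>: "oc W Y \<alpha>"
  shows "bpb (W ** X) (Y ** X) W Y fst_cell \<alpha> (times \<alpha> id_cell) fst_cell"
proof -
  interpret Y: zcell Y + W: zcell W + X: zcell X by (simp_all add: Y W X)
  note S = prod_sel and c = ocD[OF \<alpha>] one_cell_one[OF W Y \<alpha>]
  show ?thesis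
  proof (rule bpbI[of _ _ _ _ _ _ _ _ "%z. 1[Y]"]; (unfold times_cell_simps fst_cell_simps id_cell_simps)?)
    fix x w d assume "x : Pts (Y ** X)" "w : Pts W" "d : gp Y" "Act Y d (pfst x) = Fn \<alpha> w"
    then show "EX z:Pts (W ** X). EX u:gp (Y ** X). EX v:gp W.
       Act (Y ** X) u (PPair (Fn \<alpha> (pfst z)) (psnd z)) = x & Act W v (pfst z) = w & Tw \<alpha> (pfst z) v *[Y] 1[Y] = d *[Y] pfst u"
      using Y.act_eqD[of d "pfst x" "Fn \<alpha> w"] c
      by (intro bexI[of _ "PPair w (psnd x)"] bexI[of _ "PPair (inv[Y] d) 1[X]"] bexI[of _ "1[W]"]) (auto simp: S)
  next
    fix z z' u v assume "z : Pts (W ** X)" "z' : Pts (W ** X)" "u : gp (Y ** X)" "v : gp W"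
      "Act (Y ** X) u (PPair (Fn \<alpha> (pfst z)) (psnd z)) = PPair (Fn \<alpha> (pfst z')) (psnd z')" "Act W v (pfst z) = pfst z'"
      "Tw \<alpha> (pfst z) v *[Y] 1[Y] = 1[Y] *[Y] pfst u"
    then show "EX g:gp (W ** X). Act (W ** X) g z = z' & PPair (Tw \<alpha> (pfst z) (pfst g)) (psnd g) = u & pfst g = v"
      using c by (intro bexI[of _ "PPair v (psnd u)"]) (auto simp: S)
  qed (use Y W X \<alpha> c in "auto simp: S oc_id")
qed

text \<open>Under \<open>unc\<close>, the Mackey structure in the second factor becomes composition
  of spans on the left. The square computing the composite is the pullback \<open>Q\<close> pasted
  with \<open>bpb_snd_square\<close>.\<close>

lemma big_post:
  assumes Y: "zc Y" and A: "zc A" and a: "oc A (Y ** X) a"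
    and s: "s : ar SpC" "sdom s = X" "scod s = X'"
  obtains B b where "zc B" "oc B (Y ** X') b" "unc Y X' B b = s o[SpC] unc Y X A a"
    "far OB (s_times (idn SpC Y) s) (big_cls (Y ** X) A a) = big_cls (Y ** X') B b"
proof -
  obtain W b \<alpha> where S: "is_sp W X X' b \<alpha>" "s = sp W X X' b \<alpha>" using ar_SpCE[OF s] .
  have z: "zc W" "zc X" "zc X'" "oc W X' b" "oc W X \<alpha>" using S(1) by (auto simp: is_sp_def)
  note YW = zc_prod[OF Y z(1)] and YX = zc_prod[OF Y z(2)]
  obtain Q r t where h: "bpb Q A (Y ** W) (Y ** X) a (times id_cell \<alpha>) r t"
    using bp_bpb[OF A YW YX a times_one_cell[OF Y z(1) oc_id z(5)]] by blast
  note B = bpb_paste[OF bpb_snd_square[OF Y z(1,2,5)] h] and q = bpbD[OF h]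
  let ?c = "(times id_cell b) oo t"
  have 1: "far OB (s_times (idn SpC Y) s) (big_cls (Y ** X) A a) = big_cls (Y ** X') Q ?c"
    unfolding idn_SpC S(2) s_times_sp[OF is_sp_id[OF Y] S(1)]
    by (rule big_far(2)[OF is_sp_times[OF is_sp_id[OF Y] S(1)] bpb_sym[OF h]])
  have 2: "oc Q (Y ** X') ?c" by (rule oc_comp[OF q(1,8) times_one_cell[OF Y z(1) oc_id z(4)]])
  have e: "snd_cell oo ?c = b oo (snd_cell oo t)" "fst_cell oo ?c = fst_cell oo ((times id_cell \<alpha>) oo t)"
    "fst_cell oo a oo r = fst_cell oo (a oo r)" by (rule oc_eqI; simp)+
  have "c_arr Q Y (fst_cell oo ?c) = c_arr Q Y (fst_cell oo a oo r)"
    unfolding e by (rule c_arr_eqI[OF q(1) Y iso2_sym[OF q(1) Y iso2_comp[OF q(1) YX Y bpb_iso2[OF h]]]]) (simp add: iso2_refl Y YX)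
  then have "unc Y X' Q ?c = s o[SpC] unc Y X A a"
    using sp_comp[OF is_sp_unc[OF Y z(2) A a] S(1) B] by (simp add: unc_def S(2) sp_def e(1))
  then show ?thesis using that q(1) 1 2 by blast
qed

text \<open>The counterpart for the first factor. Since \<open>Y\<close> is the source of the span,
  \<open>f\<close> enters reversed on the product and becomes composition on the right.\<close>

lemma big_pre:
  assumes X: "zc X" and A: "zc A" and a: "oc A (Y ** X) a"
    and f: "f : ar SpC" "sdom f = Y'" "scod f = Y"
  obtains B b where "zc B" "oc B (Y' ** X) b" "unc Y' X B b = unc Y X A a o[SpC] f"
    "far OB (s_times (s_op f) (idn SpC X)) (big_cls (Y ** X) A a) = big_cls (Y' ** X) B b"
proof -
  obtain W b \<alpha> where S: "is_sp W Y' Y b \<alpha>" "f = sp W Y' Y b \<alpha>" using ar_SpCE[OF f] .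
  have z: "zc W" "zc Y'" "zc Y" "oc W Y b" "oc W Y' \<alpha>" using S(1) by (auto simp: is_sp_def)
  have S': "is_sp W Y Y' \<alpha> b" using z by (simp add: is_sp_def)
  note WX = zc_prod[OF z(1) X] and YX = zc_prod[OF z(3) X]
  obtain Q r t where h: "bpb Q A (W ** X) (Y ** X) a (times b id_cell) r t"
    using bp_bpb[OF A WX YX a times_one_cell[OF z(1) X z(4) oc_id]] by blast
  note B = bpb_paste[OF bpb_fst_square[OF z(3,1) X z(4)] h] and q = bpbD[OF h]
  let ?c = "(times \<alpha> id_cell) oo t"
  have 1: "far OB (s_times (s_op f) (idn SpC X)) (big_cls (Y ** X) A a) = big_cls (Y' ** X) Q ?c"
    unfolding idn_SpC S(2) s_op_sp[OF S(1)] s_times_sp[OF S' is_sp_id[OF X]]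
    by (rule big_far(2)[OF is_sp_times[OF S' is_sp_id[OF X]] bpb_sym[OF h]])
  have 2: "oc Q (Y' ** X) ?c" by (rule oc_comp[OF q(1,8) times_one_cell[OF z(1) X z(5) oc_id]])
  have e: "fst_cell oo ?c = \<alpha> oo (fst_cell oo t)" "snd_cell oo ?c = snd_cell oo ((times b id_cell) oo t)"
    "snd_cell oo a oo r = snd_cell oo (a oo r)" by (rule oc_eqI; simp)+
  have "c_arr Q X (snd_cell oo ?c) = c_arr Q X (snd_cell oo a oo r)"
    unfolding e by (rule c_arr_eqI[OF q(1) X iso2_sym[OF q(1) X iso2_comp[OF q(1) YX X bpb_iso2[OF h]]]]) (simp add: iso2_refl X YX)
  then have "unc Y' X Q ?c = unc Y X A a o[SpC] f"
    using sp_comp[OF S(1) is_sp_unc[OF z(3) X A a] bpb_sym[OF B]] by (simp add: unc_def S(2) sp_def e(1))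
  then show ?thesis using that q(1) 1 2 by blast
qed

end

section \<open>The Burnside functor\<close>

subsection \<open>Sets with a group action\<close>

definition gmap :: "zero_cell => zero_cell => (pt => pt) => bool" where
  "gmap P Q f \<longleftrightarrow> zc P & zc Q & Grp P = Grp Q & f : Pts P \<rightarrow>\<^sub>E Pts Q &
     (ALL g:gp Q. ALL x:Pts P. f (Act P g x) = Act Q g (f x))"

lemma gmapD:
  assumes "gmap P Q f"
  shows "zc P" "zc Q" "Grp P = Grp Q" "f : extensional (Pts P)"
    and "x : Pts P ==> f x : Pts Q" and "g : gp Q ==> x : Pts P ==> f (Act P g x) = Act Q g (f x)"
  using assms by (auto simp: gmap_def PiE_iff)

lemma arr_gset:
  "t : arrows (gset_cat G) P Q \<longleftrightarrow> Grp Q = G & (EX f. t = (P, Q, f) & gmap P Q f)"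
  by (auto simp: arrows_def gset_cat_def gmap_def)

lemma gset_cat_simps [simp]: "ob (gset_cat G) = {P. zc P & Grp P = G}"
  "src (gset_cat G) (P, Q, f) = P" "tgt (gset_cat G) (P, Q, f) = Q"
  "idn (gset_cat G) P = (P, P, \<lambda>x \<in> Pts P. x)"
  "cmp (gset_cat G) (P', Q', f') (P, Q, f) = (P, Q', compose (Pts P) f' f)"
  by (simp_all add: gset_cat_def)

lemma ar_gset_iff: "t : ar (gset_cat G) \<longleftrightarrow> (EX P Q f. t = (P, Q, f) & Grp Q = G & gmap P Q f)"
  by (auto simp: gset_cat_def gmap_def)

lemma gmap_compose:
  assumes f: "gmap P Q f" and g: "gmap Q R g"
  shows "gmap P R (compose (Pts P) g f)"
proof -
  interpret P: zcell P by (rule zcellI[OF gmapD(1)[OF f]])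
  show ?thesis
    using gmapD[OF f] gmapD[OF g] P.act_closed by (auto simp: gmap_def compose_def)
qed

lemma gmap_id: "zc P ==> gmap P P (\<lambda>x \<in> Pts P. x)"
  using zcell.act_closed[OF zcellI] by (auto simp: gmap_def)

lemma gset_category: "is_category (gset_cat G)"
  unfolding is_category_def
proof (intro conjI ballI impI)
  fix t u assume t: "t : ar (gset_cat G)" and u: "u : ar (gset_cat G)" and tu: "tgt (gset_cat G) t = src (gset_cat G) u"
  obtain P Q f where 1: "t = (P, Q, f)" "gmap P Q f" "Grp Q = G" using t unfolding ar_gset_iff by blast
  obtain Q' R g where "u = (Q', R, g)" "gmap Q' R g" "Grp R = G" using u unfolding ar_gset_iff by blast
  then have 2: "u = (Q, R, g)" "gmap Q R g" "Grp R = G" using tu 1(1) by simp_all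
  show "cmp (gset_cat G) u t : arrows (gset_cat G) (src (gset_cat G) t) (tgt (gset_cat G) u)"
    using 1 2 gmap_compose[OF 1(2) 2(2)] by (simp add: arr_gset)
  fix v assume v: "v : ar (gset_cat G)" and uv: "tgt (gset_cat G) u = src (gset_cat G) v"
  obtain R' S h where "v = (R', S, h)" using v unfolding ar_gset_iff by blast
  then have 3: "v = (R, S, h)" using uv 2(1) by simp
  show "cmp (gset_cat G) v (cmp (gset_cat G) u t) = cmp (gset_cat G) (cmp (gset_cat G) v u) t"
    using 1 2 3 gmapD(5)[OF 1(2)] by (auto simp: compose_def fun_eq_iff)
next
  fix t assume t: "t : ar (gset_cat G)"
  obtain P Q f where 1: "t = (P, Q, f)" "gmap P Q f" "Grp Q = G" using t unfolding ar_gset_iff by blast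
  show "src (gset_cat G) t : ob (gset_cat G)" "tgt (gset_cat G) t : ob (gset_cat G)"
    using 1 gmapD(1-3)[OF 1(2)] by simp_all
  have "compose (Pts P) f (\<lambda>x \<in> Pts P. x) = f" "compose (Pts P) (\<lambda>x \<in> Pts Q. x) f = f"
    using gmapD(4,5)[OF 1(2)] by (auto simp: compose_def extensional_def fun_eq_iff)
  then show "cmp (gset_cat G) t (idn (gset_cat G) (src (gset_cat G) t)) = t"
    "cmp (gset_cat G) (idn (gset_cat G) (tgt (gset_cat G) t)) t = t" using 1(1) by simp_all
next
  fix P assume "P : ob (gset_cat G)"
  then show "idn (gset_cat G) P : arrows (gset_cat G) P P" using gmap_id by (simp add: arr_gset)
qed

lemma gsets_over_ob: "t : ob (gsets_over X) \<longleftrightarrow> (EX A f. t = (A, X, f) & gmap A X f)"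
  by (auto simp: ar_gset_iff)

text \<open>Both sets are parametrized by one index set, and the map is defined through a chosen
  index of each point. Stabilizer images are quotients of sets of pairs, so such parametrizations
  are at hand for them.\<close>

lemma gset_transport:
  assumes f: "gmap A X f" and f': "gmap B X f'"
    and z: "z ` I = Pts A" and w: "w ` I = Pts B"
    and eq: "!!i i'. i : I ==> i' : I ==> z i = z i' ==> w i = w i'"
    and act: "!!i g. i : I ==> g : gp X ==> EX i':I. z i' = Act A g (z i) & w i' = Act B g (w i)"
    and m: "!!i. i : I ==> f (z i) = f' (w i)"
  obtains \<phi> where "gmap A B \<phi>" "!!i. i : I ==> \<phi> (z i) = w i" "compose (Pts A) f' \<phi> = f"
proof -
  define \<phi> where "\<phi> = (\<lambda>x \<in> Pts A. w (SOME i. i : I & z i = x))"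
  have \<phi>: "\<phi> (z i) = w i" if i: "i : I" for i
  proof -
    have j: "(SOME j. j : I & z j = z i) : I & z (SOME j. j : I & z j = z i) = z i" by (rule someI[of _ i]) (use i in simp)
    have "z i : Pts A" using i z by blast
    then show ?thesis using eq[OF j[THEN conjunct1] i j[THEN conjunct2]] by (simp add: \<phi>_def)
  qed
  note F = gmapD[OF f] and F' = gmapD[OF f']
  have zE: "EX i:I. x = z i" if "x : Pts A" for x using that z by blast
  have wB: "w i : Pts B" if "i : I" for i using that w by blast
  have "gmap A B \<phi>"
    unfolding gmap_def
  proof (intro conjI ballI)
    show "Grp A = Grp B" using F(3) F'(3) by simp
    have "\<phi> x : Pts B" if x: "x : Pts A" for x using zE[OF x] \<phi> wB by auto
    moreover have "\<phi> : extensional (Pts A)" by (simp add: \<phi>_def)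
    ultimately show "\<phi> : Pts A \<rightarrow>\<^sub>E Pts B" by (simp add: PiE_iff)
    fix g x assume g: "g : gp B" and x: "x : Pts A"
    obtain i where i: "i : I" "x = z i" using zE[OF x] by blast
    have "g : gp X" using g F'(3) by simp
    then obtain i' where i': "i' : I" "z i' = Act A g (z i)" "w i' = Act B g (w i)" using act[OF i(1)] by blast
    show "\<phi> (Act A g x) = Act B g (\<phi> x)" using \<phi>[OF i'(1)] \<phi>[OF i(1)] i'(2,3) i(2) by simp
  qed (rule F(1) F'(1))+
  moreover have "compose (Pts A) f' \<phi> = f"
  proof (rule extensionalityI)
    fix x assume "x : Pts A"
    then obtain i where i: "i : I" "x = z i" using z by blast
    then show "compose (Pts A) f' \<phi> x = f x" using \<phi>[OF i(1)] m[OF i(1)] \<open>x : Pts A\<close> by (simp add: compose_def)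
  qed (use F(4) in auto)
  ultimately show ?thesis using that \<phi> by blast
qed

lemma gset_isoI:
  assumes f: "gmap A X f" and f': "gmap B X f'"
    and z: "z ` I = Pts A" and w: "w ` I = Pts B"
    and eq: "!!i i'. i : I ==> i' : I ==> z i = z i' \<longleftrightarrow> w i = w i'"
    and act: "!!i g. i : I ==> g : gp X ==> EX i':I. z i' = Act A g (z i) & w i' = Act B g (w i)"
    and m: "!!i. i : I ==> f (z i) = f' (w i)"
  shows "isomorphic (gsets_over X) (A, X, f) (B, X, f')"
proof -
  obtain \<phi> where \<phi>: "gmap A B \<phi>" "!!i. i : I ==> \<phi> (z i) = w i" "compose (Pts A) f' \<phi> = f"
    by (rule gset_transport[OF f f' z w _ act m]) (use eq in auto)
  have act': "EX i':I. w i' = Act B g (w i) & z i' = Act A g (z i)" if "i : I" "g : gp X" for i g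
    using act[OF that] by blast
  obtain \<psi> where \<psi>: "gmap B A \<psi>" "!!i. i : I ==> \<psi> (w i) = z i"
    by (rule gset_transport[OF f' f w z _ act' m[symmetric]]) (use eq in auto)
  have zE: "EX i:I. x = z i" if "x : Pts A" for x using that z by blast
  have wE: "EX i:I. x = w i" if "x : Pts B" for x using that w by blast
  have "\<psi> (\<phi> x) = x" if "x : Pts A" for x using zE[OF that] \<phi>(2) \<psi>(2) by auto
  moreover have "\<phi> (\<psi> x) = x" if "x : Pts B" for x using wE[OF that] \<phi>(2) \<psi>(2) by auto
  ultimately have "compose (Pts A) \<psi> \<phi> = (\<lambda>x \<in> Pts A. x)" "compose (Pts B) \<phi> \<psi> = (\<lambda>x \<in> Pts B. x)"
    by (auto simp: compose_def fun_eq_iff)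
  then have "is_iso (gset_cat (Grp X)) (A, B, \<phi>)"
    using \<phi>(1) \<psi>(1) gmapD(3)[OF f] gmapD(3)[OF f']
    by (intro is_isoI[of _ _ A B "(B, A, \<psi>)"]) (auto simp: arr_gset)
  then show ?thesis
    unfolding slice_isomorphic_iff[OF gset_category]
    using f f' \<phi> gmapD(3)[OF f] gmapD(3)[OF f'] by (auto simp: ar_gset_iff arr_gset intro!: bexI[of _ "(A, B, \<phi>)"])
qed

section \<open>Coproducts of sets with a group action\<close>

definition gset_sum :: "zero_cell => zero_cell => zero_cell" where
  "gset_sum A B =
     (let S = PPair (Atom 0) ` Pts A \<union> PPair (Atom (Suc 0)) ` Pts B in
      \<lparr> Grp = Grp A, Pts = S,
        Act = (%g. \<lambda>z \<in> S. PPair (pfst z) (Act (if pfst z = Atom 0 then A else B) g (psnd z))) \<rparr>)"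

lemma gset_sum_sel:
  "Grp (gset_sum A B) = Grp A" "Pts (gset_sum A B) = PPair (Atom 0) ` Pts A \<union> PPair (Atom (Suc 0)) ` Pts B"
  "x : Pts A ==> Act (gset_sum A B) g (PPair (Atom 0) x) = PPair (Atom 0) (Act A g x)"
  "y : Pts B ==> Act (gset_sum A B) g (PPair (Atom (Suc 0)) y) = PPair (Atom (Suc 0)) (Act B g y)"
  "Act (gset_sum A B) g : extensional (Pts (gset_sum A B))"
  by (auto simp: gset_sum_def Let_def)

lemma gset_sum_zero_cell:
  assumes A: "zc A" and B: "zc B" and G: "Grp B = Grp A"
  shows "zc (gset_sum A B)"
proof -
  interpret A: zcell A + B: zcell B by (simp_all add: A B)
  show ?thesis
    by (rule zcI)
      (use A.act_mult B.act_mult A.act_closed B.act_closed A.act_one B.act_one A.finite_grp A.finite_pts B.finite_pts A.group_axioms gset_sum_sel(5)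
        in "auto simp: gset_sum_sel(1-4) G")
qed

lemma gset_sum_coproduct:
  assumes A: "zc A" "Grp A = G" and B: "zc B" "Grp B = G"
  shows "is_coproduct (gset_cat G) A B (gset_sum A B)
    (A, gset_sum A B, \<lambda>x \<in> Pts A. PPair (Atom 0) x) (B, gset_sum A B, \<lambda>x \<in> Pts B. PPair (Atom (Suc 0)) x)"
proof -
  let ?S = "gset_sum A B" and ?i = "\<lambda>x \<in> Pts A. PPair (Atom 0) x" and ?j = "\<lambda>x \<in> Pts B. PPair (Atom (Suc 0)) x"
  have S: "zc ?S" by (rule gset_sum_zero_cell) (use A B in simp_all)
  interpret A: zcell A + B: zcell B by (simp_all add: A(1) B(1))
  have i: "gmap A ?S ?i" and j: "gmap B ?S ?j"
    using A B S A.act_closed B.act_closed by (auto simp: gmap_def gset_sum_sel)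
  have "EX! h. h : arrows (gset_cat G) ?S T & cmp (gset_cat G) h (A, ?S, ?i) = u & cmp (gset_cat G) h (B, ?S, ?j) = v"
    if uv: "u : arrows (gset_cat G) A T" "v : arrows (gset_cat G) B T" for T u v
  proof -
    obtain f where f: "u = (A, T, f)" "gmap A T f" and T: "Grp T = G" using uv(1) by (auto simp: arr_gset)
    obtain g where g: "v = (B, T, g)" "gmap B T g" using uv(2) by (auto simp: arr_gset)
    note F = gmapD[OF f(2)] and F' = gmapD[OF g(2)]
    define h where "h = (\<lambda>z \<in> Pts ?S. if pfst z = Atom 0 then f (psnd z) else g (psnd z))"
    have hv: "h (PPair (Atom 0) x) = f x" if "x : Pts A" for x using that by (auto simp: h_def gset_sum_sel)
    have hw: "h (PPair (Atom (Suc 0)) x) = g x" if "x : Pts B" for x using that by (auto simp: h_def gset_sum_sel)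
    have hm: "gmap ?S T h"
      using S F F' A B T hv hw A.act_closed B.act_closed by (auto simp: gmap_def gset_sum_sel h_def)
    show ?thesis
    proof (rule ex1I)
      show "(?S, T, h) : arrows (gset_cat G) ?S T & cmp (gset_cat G) (?S, T, h) (A, ?S, ?i) = u & cmp (gset_cat G) (?S, T, h) (B, ?S, ?j) = v"
        using hm T f(1) g(1) hv hw F(4) F'(4) by (auto simp: arr_gset compose_def extensional_def fun_eq_iff)
      fix l assume l: "l : arrows (gset_cat G) ?S T & cmp (gset_cat G) l (A, ?S, ?i) = u & cmp (gset_cat G) l (B, ?S, ?j) = v"
      then obtain m where m: "l = (?S, T, m)" "gmap ?S T m" by (auto simp: arr_gset)
      have c: "compose (Pts A) m ?i = f" "compose (Pts B) m ?j = g" using l m(1) f(1) g(1) by simp_all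
      have "m = h"
      proof (rule extensionalityI[OF gmapD(4)[OF m(2)] gmapD(4)[OF hm]])
        fix z assume "z : Pts ?S"
        then consider x where "x : Pts A" "z = PPair (Atom 0) x" | x where "x : Pts B" "z = PPair (Atom (Suc 0)) x"
          by (auto simp: gset_sum_sel)
        then show "m z = h z"
          using fun_cong[OF c(1)] fun_cong[OF c(2)] hv hw by cases (auto simp: compose_def split: if_splits, metis+)
      qed
      then show "l = (?S, T, h)" using m(1) by simp
    qed
  qed
  then show ?thesis using A B S i j by (auto simp: is_coproduct_def arr_gset gset_sum_sel(1))
qed

text \<open>An equivariant map regarded as a 1-cell over the identity of the group, the passage that
  underlies \<open>Omega_i\<close>.\<close>

definition gcell :: "(pt => pt) => one_cell" where
  "gcell f = \<lparr> Fn = f, Tw = (%x g. g) \<rparr>"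

lemma gset_cell_simps [simp]: "Fn (gcell f) = f" "Tw (gcell f) x g = g"
  by (simp_all add: gcell_def)

lemma oc_gset: "gmap P Q f ==> oc P Q (gcell f)"
  by (auto simp: gmap_def is_one_cell_def)

text \<open>Comparison with the disjoint union makes the injections injective, disjoint and jointly
  surjective. For 1-cells over the identity of the group, injectivity is fullness, while
  faithfulness is automatic because the twist is the identity.\<close>

lemma gset_coproduct_gsum:
  assumes c: "is_coproduct (gset_cat G) A B S i j"
  obtains i0 j0 where "i = (A, S, i0)" "j = (B, S, j0)" "gmap A S i0" "gmap B S j0" "gsum A B S (gcell i0) (gcell j0)"
proof -
  note d = coprodD[OF c]
  obtain i0 where i: "i = (A, S, i0)" "gmap A S i0" using d(4) by (auto simp: arr_gset)
  obtain j0 where j: "j = (B, S, j0)" "gmap B S j0" using d(5) by (auto simp: arr_gset)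
  note I = gmapD[OF i(2)] and J = gmapD[OF j(2)]
  let ?E = "gset_sum A B" and ?i = "\<lambda>x \<in> Pts A. PPair (Atom 0) x" and ?j = "\<lambda>x \<in> Pts B. PPair (Atom (Suc 0)) x"
  have "is_coproduct (gset_cat G) A B ?E (A, ?E, ?i) (B, ?E, ?j)" by (rule gset_sum_coproduct) (use d in auto)
  from coproduct_iso[OF gset_category this c]
  obtain u v where uv: "u : arrows (gset_cat G) ?E S" "v : arrows (gset_cat G) S ?E" "cmp (gset_cat G) v u = idn (gset_cat G) ?E"
    "cmp (gset_cat G) u v = idn (gset_cat G) S" "cmp (gset_cat G) u (A, ?E, ?i) = i" "cmp (gset_cat G) u (B, ?E, ?j) = j" by metis
  obtain f where f: "u = (?E, S, f)" "gmap ?E S f" using uv(1) by (auto simp: arr_gset)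
  obtain g where g: "v = (S, ?E, g)" "gmap S ?E g" using uv(2) by (auto simp: arr_gset)
  have "compose (Pts ?E) g f = (\<lambda>x \<in> Pts ?E. x)" "compose (Pts S) f g = (\<lambda>x \<in> Pts S. x)" using uv(3,4) f g by simp_all
  note gf0 = fun_cong[OF this(1)] and fg0 = fun_cong[OF this(2)]
  have gf: "g (f z) = z" if "z : Pts ?E" for z using gf0[of z] that by (simp add: compose_def)
  have fg: "f (g s) = s" if "s : Pts S" for s using fg0[of s] that by (simp add: compose_def)
  have "compose (Pts A) f ?i = i0" "compose (Pts B) f ?j = j0" using uv(5,6) f(1) i(1) j(1) by simp_all
  note fi0 = fun_cong[OF this(1)] and fj0 = fun_cong[OF this(2)]
  have fi: "i0 x = f (PPair (Atom 0) x)" if "x : Pts A" for x using fi0[of x] that by (simp add: compose_def)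
  have fj: "j0 x = f (PPair (Atom (Suc 0)) x)" if "x : Pts B" for x using fj0[of x] that by (simp add: compose_def)
  interpret A: zcell A + B: zcell B + S: zcell S by (simp_all add: I(1) J(1) I(2))
  have E: "PPair (Atom 0) x : Pts ?E" if "x : Pts A" for x using that by (simp add: gset_sum_sel(2))
  have E': "PPair (Atom (Suc 0)) x : Pts ?E" if "x : Pts B" for x using that by (simp add: gset_sum_sel(2))
  have gi: "g (i0 x) = PPair (Atom 0) x" if "x : Pts A" for x unfolding fi[OF that] by (rule gf[OF E[OF that]])
  have gj: "g (j0 x) = PPair (Atom (Suc 0)) x" if "x : Pts B" for x unfolding fj[OF that] by (rule gf[OF E'[OF that]])
  have ii: "x = y" if "x : Pts A" "y : Pts A" "i0 x = i0 y" for x y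
    using gi[OF that(1)] gi[OF that(2)] that(3) by (metis pt.inject(2))
  have jj: "x = y" if "x : Pts B" "y : Pts B" "j0 x = j0 y" for x y
    using gj[OF that(1)] gj[OF that(2)] that(3) by (metis pt.inject(2))
  have ij: "i0 x ~= j0 y" if "x : Pts A" "y : Pts B" for x y
    using gi[OF that(1)] gj[OF that(2)] by (metis pt.inject(1,2) nat.simps(3))
  have cov: "(EX x:Pts A. i0 x = s) | (EX y:Pts B. j0 y = s)" if s: "s : Pts S" for s
  proof -
    have "g s : Pts ?E" using gmapD(5)[OF g(2) s] .
    then consider x where "x : Pts A" "g s = PPair (Atom 0) x" | x where "x : Pts B" "g s = PPair (Atom (Suc 0)) x"
      unfolding gset_sum_sel(2) by blast
    then show ?thesis
    proof cases
      case 1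
      then have "i0 x = s" using fg[OF s] fi[OF 1(1)] by metis
      then show ?thesis using 1 by blast
    next
      case 2
      then have "j0 x = s" using fg[OF s] fj[OF 2(1)] by metis
      then show ?thesis using 2 by blast
    qed
  qed
  have full: "full D S (gcell m)" if m: "gmap D S m" and inj: "!!x y. x : Pts D ==> y : Pts D ==> m x = m y ==> x = y" for D m
    unfolding full_def gset_cell_simps
  proof (intro ballI impI)
    note M = gmapD[OF m]
    interpret D: zcell D by (simp add: M(1))
    fix x x' h assume h: "x : Pts D" "x' : Pts D" "h : gp S" "Act S h (m x) = m x'"
    then have hD: "h : gp D" using M(3) by simp
    have "Act D h x = x'" by (rule inj[OF D.act_closed[OF hD h(1)] h(2)]) (use M(6)[OF h(3,1)] h(4) in simp)
    then show "EX g: gp D. Act D g x = x' & g = h" using hD by blast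
  qed
  have "full A S (gcell i0)" "full B S (gcell j0)" by (rule full[OF i(2) ii] full[OF j(2) jj]; assumption)+
  moreover have "faithful A S (gcell i0)" "faithful B S (gcell j0)"
    by (simp_all add: faithful_def)
  moreover have "Act S h (i0 x) ~= j0 y" if "x : Pts A" "y : Pts B" "h : gp S" for x y h
    using ij[OF A.act_closed[OF _ that(1)] that(2), of h] I(3) I(6)[OF that(3,1)] that(3) by simp
  moreover have "(EX x:Pts A. EX h:gp S. Act S h (i0 x) = s) | (EX y:Pts B. EX h:gp S. Act S h (j0 y) = s)" if s: "s : Pts S" for s
    using cov[OF s] S.act_one[OF s] S.one_closed by (elim disjE bexE) blast+
  ultimately have "gsum A B S (gcell i0) (gcell j0)"
    unfolding gsum_def using I(1,2) J(1) oc_gset[OF i(2)] oc_gset[OF j(2)] by simp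
  then show ?thesis using that i j by blast
qed

lemma gset_slice_coproductE:
  assumes "is_coproduct (gsets_over X) a b s i j"
  obtains A B S i0 j0 s0 where "gsum A B S (gcell i0) (gcell j0)" "gmap S X s0" "s = (S, X, s0)"
    "a = (A, X, compose (Pts A) s0 i0)" "b = (B, X, compose (Pts B) s0 j0)" "gmap A S i0" "gmap B S j0"
proof -
  have cop: "EX E i j. is_coproduct (gset_cat (Grp X)) A B E i j" if "A : ob (gset_cat (Grp X))" "B : ob (gset_cat (Grp X))" for A B
    using gset_sum_coproduct[of A "Grp X" B] that by (intro exI) simp
  obtain i' j' where ij: "is_coproduct (gset_cat (Grp X)) (src (gset_cat (Grp X)) a) (src (gset_cat (Grp X)) b) (src (gset_cat (Grp X)) s) i' j'"
    "cmp (gset_cat (Grp X)) s i' = a" "cmp (gset_cat (Grp X)) s j' = b"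
    using slice_coproductD[OF gset_category cop assms] by blast
  obtain S s0 where s: "s = (S, X, s0)" "gmap S X s0" using coprodD(3)[OF assms] unfolding gsets_over_ob by blast
  obtain A a0 where a: "a = (A, X, a0)" using coprodD(1)[OF assms] unfolding gsets_over_ob by blast
  obtain B b0 where b: "b = (B, X, b0)" using coprodD(2)[OF assms] unfolding gsets_over_ob by blast
  have "is_coproduct (gset_cat (Grp X)) A B S i' j'" using ij(1) s a b by simp
  then obtain i0 j0 where "i' = (A, S, i0)" "j' = (B, S, j0)" "gmap A S i0" "gmap B S j0" "gsum A B S (gcell i0) (gcell j0)"
    by (rule gset_coproduct_gsum)
  then show ?thesis using that s ij(2,3) by simp
qed

subsection \<open>Stabilizer images\<close>

definition sim_set :: "zero_cell => zero_cell => one_cell => pt => pt => pt set" where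
  "sim_set P Q a \<eta> x = {PPair \<eta>' x' | \<eta>' x'. \<eta>' : gp Q & x' : Pts P & (EX g:gp P. x' = Act P g x & \<eta> = \<eta>' *[Q] Tw a x g)}"

context
  fixes P Q a
  assumes P: "zc P" and Q: "zc Q" and a: "oc P Q a"
begin

interpretation P: zcell P by (rule zcellI[OF P])
interpretation Q: zcell Q by (rule zcellI[OF Q])

lemma sim_set_finite: "finite (sim_set P Q a \<eta> x)"
  by (rule finite_subset[OF _ finite_PPair[OF Q.finite_grp P.finite_pts]]) (auto simp: sim_set_def)

lemma sim_class_eq: "sim_class P Q a \<eta> x = Cls (Abs_fset (sim_set P Q a \<eta> x))"
  by (simp add: sim_class_def sim_set_def)

lemma fset_sim: "fset (Abs_fset (sim_set P Q a \<eta> x)) = sim_set P Q a \<eta> x"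
  by (rule Abs_fset_inverse) (simp add: sim_set_finite)

text \<open>Classes coincide as soon as one representative lies in the other class: the relation is
  an equivalence, with reflexivity from \<open>one_cell_one\<close> and the exchange of
  representatives from the cocycle condition for \<open>Tw a\<close>.\<close>

lemma sim_class_eq_iff:
  assumes h: "\<eta> : gp Q" "x : Pts P" "\<eta>' : gp Q" "x' : Pts P"
  shows "sim_class P Q a \<eta> x = sim_class P Q a \<eta>' x' \<longleftrightarrow> (EX g:gp P. x' = Act P g x & \<eta> = \<eta>' *[Q] Tw a x g)"
proof -
  note c = ocD[OF a]
  have "sim_class P Q a \<eta> x = sim_class P Q a \<eta>' x' \<longleftrightarrow> sim_set P Q a \<eta> x = sim_set P Q a \<eta>' x'"
    unfolding sim_class_eq using fset_sim by (metis pt.inject(3))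
  also have "... \<longleftrightarrow> PPair \<eta>' x' : sim_set P Q a \<eta> x"
  proof
    assume "sim_set P Q a \<eta> x = sim_set P Q a \<eta>' x'"
    moreover have "PPair \<eta>' x' : sim_set P Q a \<eta>' x'"
      using h one_cell_one[OF P Q a h(4)] by (auto simp: sim_set_def intro!: bexI[of _ "1[P]"])
    ultimately show "PPair \<eta>' x' : sim_set P Q a \<eta> x" by simp
  next
    assume "PPair \<eta>' x' : sim_set P Q a \<eta> x"
    then obtain g where g: "g : gp P" "x' = Act P g x" "\<eta> = \<eta>' *[Q] Tw a x g" by (auto simp: sim_set_def)
    show "sim_set P Q a \<eta> x = sim_set P Q a \<eta>' x'"
    proof (intro equalityI subsetI)
      fix z assume "z : sim_set P Q a \<eta> x"
      then obtain \<zeta> y k where z: "z = PPair \<zeta> y" "\<zeta> : gp Q" "y : Pts P" "k : gp P" "y = Act P k x" "\<eta> = \<zeta> *[Q] Tw a x k"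
        by (auto simp: sim_set_def)
      have y: "y = Act P (k *[P] inv[P] g) x'" using z g h by (simp add: P.act_mult)
      have "Tw a x' (k *[P] inv[P] g) *[Q] Tw a x g = Tw a x k"
        using tw_comp[OF a h(2), of "k *[P] inv[P] g" g x'] z g by simp
      then have "\<eta>' *[Q] Tw a x g = \<zeta> *[Q] Tw a x' (k *[P] inv[P] g) *[Q] Tw a x g"
        using z g h c by (simp add: Q.m_assoc)
      then have "\<eta>' = \<zeta> *[Q] Tw a x' (k *[P] inv[P] g)" using z g h c by (subst (asm) Q.right_cancel) auto
      then show "z : sim_set P Q a \<eta>' x'" unfolding sim_set_def
        using z(1-4) g(1) y by (intro CollectI exI[of _ \<zeta>] exI[of _ y] conjI bexI[of _ "k *[P] inv[P] g"]) auto
    next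
      fix z assume "z : sim_set P Q a \<eta>' x'"
      then obtain \<zeta> y k where z: "z = PPair \<zeta> y" "\<zeta> : gp Q" "y : Pts P" "k : gp P" "y = Act P k x'" "\<eta>' = \<zeta> *[Q] Tw a x' k"
        by (auto simp: sim_set_def)
      have "y = Act P (k *[P] g) x" using z g h by (simp add: P.act_mult)
      moreover have "\<eta> = \<zeta> *[Q] Tw a x (k *[P] g)"
        using tw_comp[OF a h(2), of k g x'] z g h c by (simp add: Q.m_assoc)
      ultimately show "z : sim_set P Q a \<eta> x" using z g by (auto simp: sim_set_def)
    qed
  qed
  also have "... \<longleftrightarrow> (EX g:gp P. x' = Act P g x & \<eta> = \<eta>' *[Q] Tw a x g)" using h by (auto simp: sim_set_def)
  finally show ?thesis .
qed

lemma SIm_sel: "Grp (SIm P Q a) = Grp Q" "Pts (SIm P Q a) = {sim_class P Q a \<eta> x | \<eta> x. \<eta> : gp Q & x : Pts P}"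
  "Act (SIm P Q a) h : extensional (Pts (SIm P Q a))"
  by (simp_all add: SIm_def Let_def)

lemma SIm_act:
  assumes h: "h : gp Q" "\<eta> : gp Q" "x : Pts P"
  shows "Act (SIm P Q a) h (sim_class P Q a \<eta> x) = sim_class P Q a (h *[Q] \<eta>) x"
proof -
  note c = ocD[OF a]
  have z: "sim_class P Q a \<eta> x : Pts (SIm P Q a)" using h by (auto simp: SIm_sel(2))
  have "(%p. PPair (h *[Q] pfst p) (psnd p)) ` sim_set P Q a \<eta> x = sim_set P Q a (h *[Q] \<eta>) x"
  proof (intro equalityI subsetI)
    fix z assume "z : (%p. PPair (h *[Q] pfst p) (psnd p)) ` sim_set P Q a \<eta> x"
    then show "z : sim_set P Q a (h *[Q] \<eta>) x" using h c by (auto simp: sim_set_def Q.m_assoc)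
  next
    fix z assume "z : sim_set P Q a (h *[Q] \<eta>) x"
    then obtain \<zeta> y g where z: "z = PPair \<zeta> y" "\<zeta> : gp Q" "y : Pts P" "g : gp P" "y = Act P g x" "h *[Q] \<eta> = \<zeta> *[Q] Tw a x g"
      by (auto simp: sim_set_def)
    have "\<eta> = inv[Q] h *[Q] (h *[Q] \<eta>)" using h by simp
    also have "... = inv[Q] h *[Q] \<zeta> *[Q] Tw a x g" using z h c by (simp add: Q.m_assoc)
    finally have "PPair (inv[Q] h *[Q] \<zeta>) y : sim_set P Q a \<eta> x" using z h by (auto simp: sim_set_def)
    then show "z : (%p. PPair (h *[Q] pfst p) (psnd p)) ` sim_set P Q a \<eta> x"
      using z h by (intro image_eqI[of _ _ "PPair (inv[Q] h *[Q] \<zeta>) y"]) simp_all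
  qed
  then have "fset ((%p. PPair (h *[Q] pfst p) (psnd p)) |`| Abs_fset (sim_set P Q a \<eta> x)) = fset (Abs_fset (sim_set P Q a (h *[Q] \<eta>) x))"
    by (simp add: fset_sim)
  then have "(%p. PPair (h *[Q] pfst p) (psnd p)) |`| Abs_fset (sim_set P Q a \<eta> x) = Abs_fset (sim_set P Q a (h *[Q] \<eta>) x)"
    by (simp only: fset_inject)
  then show ?thesis using z by (simp add: SIm_def Let_def sim_class_eq)
qed

lemma SIm_zero_cell: "zc (SIm P Q a)"
proof (rule zcI)
  have "Pts (SIm P Q a) \<subseteq> (%(\<eta>, x). sim_class P Q a \<eta> x) ` ((gp Q) \<times> Pts P)" by (auto simp: SIm_sel(2))
  then show "finite (Pts (SIm P Q a))" by (rule finite_subset) (simp add: Q.finite_grp P.finite_pts)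
  show "finite (gp (SIm P Q a))" by (simp add: SIm_sel(1) Q.finite_grp)
  show "group (Grp (SIm P Q a))" unfolding SIm_sel(1) by unfold_locales
next
  fix g z assume "g : gp (SIm P Q a)" "z : Pts (SIm P Q a)"
  then show "Act (SIm P Q a) g z : Pts (SIm P Q a)"
    by (auto simp: SIm_sel(1,2) SIm_act) blast
next
  fix z assume "z : Pts (SIm P Q a)"
  then show "Act (SIm P Q a) 1[SIm P Q a] z = z" by (auto simp: SIm_sel(1,2) SIm_act)
next
  fix g h z assume "g : gp (SIm P Q a)" "h : gp (SIm P Q a)" "z : Pts (SIm P Q a)"
  then show "Act (SIm P Q a) (g *[SIm P Q a] h) z = Act (SIm P Q a) g (Act (SIm P Q a) h z)"
    by (auto simp: SIm_sel(1,2) SIm_act Q.m_assoc)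
qed (rule SIm_sel(3))

lemma SIm_map_class:
  assumes h: "\<eta> : gp Q" "x : Pts P"
  shows "SIm_map P Q a (sim_class P Q a \<eta> x) = Act Q \<eta> (Fn a x)"
proof -
  note c = ocD[OF a]
  have z: "sim_class P Q a \<eta> x : Pts (SIm P Q a)" using h by (auto simp: SIm_sel(2))
  have fm: "p |\<in>| elems (sim_class P Q a \<eta> x) \<longleftrightarrow> p : sim_set P Q a \<eta> x" for p
    by (simp add: sim_class_eq fset_sim)
  let ?p = "SOME p. p |\<in>| elems (sim_class P Q a \<eta> x)"
  have "PPair \<eta> x : sim_set P Q a \<eta> x"
    using h one_cell_one[OF P Q a h(2)] by (auto simp: sim_set_def intro!: bexI[of _ "1[P]"])
  then have "?p |\<in>| elems (sim_class P Q a \<eta> x)" using fm by (intro someI[of "%p. p |\<in>| elems (sim_class P Q a \<eta> x)"]) blast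
  then have "?p : sim_set P Q a \<eta> x" using fm by blast
  then obtain \<zeta> y g where p: "?p = PPair \<zeta> y" "\<zeta> : gp Q" "g : gp P" "y = Act P g x" "\<eta> = \<zeta> *[Q] Tw a x g"
    by (auto simp: sim_set_def)
  then have "Act Q (pfst ?p) (Fn a (psnd ?p)) = Act Q \<eta> (Fn a x)" using h c by (simp add: Q.act_mult)
  then show ?thesis using z by (simp add: SIm_map_def Let_def)
qed

lemma SIm_gmap: "gmap (SIm P Q a) Q (SIm_map P Q a)"
  unfolding gmap_def
proof (intro conjI ballI)
  show "SIm_map P Q a : Pts (SIm P Q a) \<rightarrow>\<^sub>E Pts Q"
  proof (rule PiE_I)
    fix z assume "z : Pts (SIm P Q a)"
    then obtain \<eta> x where "z = sim_class P Q a \<eta> x" "\<eta> : gp Q" "x : Pts P" by (auto simp: SIm_sel(2))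
    then show "SIm_map P Q a z : Pts Q" using ocD(1)[OF a] by (simp add: SIm_map_class)
  qed (simp add: SIm_map_def)
  fix g z assume g: "g : gp Q" and z: "z : Pts (SIm P Q a)"
  then obtain \<eta> x where z: "z = sim_class P Q a \<eta> x" "\<eta> : gp Q" "x : Pts P" by (auto simp: SIm_sel(2))
  show "SIm_map P Q a (Act (SIm P Q a) g z) = Act Q g (SIm_map P Q a z)"
    using g z ocD(1)[OF a] by (simp add: SIm_act SIm_map_class Q.act_mult)
qed (simp_all add: SIm_zero_cell Q SIm_sel(1))

end

text \<open>The stab-surjective half of the factorization of \<open>a\<close> through its stabilizer
  image: a point goes to its class with the unit as group coordinate, and the twist is that of
  \<open>a\<close>. The other half is \<open>SIm_map\<close>.\<close>

definition sim_cell :: "zero_cell => zero_cell => one_cell => one_cell" where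
  "sim_cell P Q a = \<lparr> Fn = sim_class P Q a 1[Q], Tw = Tw a \<rparr>"

lemma sim_cell_props:
  assumes P: "zc P" and Q: "zc Q" and a: "oc P Q a"
  shows "oc P (SIm P Q a) (sim_cell P Q a)"
    and "full P (SIm P Q a) (sim_cell P Q a)" and "eso P (SIm P Q a) (sim_cell P Q a)"
    and "iso2 P Q ((gcell (SIm_map P Q a)) oo (sim_cell P Q a)) a"
proof -
  interpret P: zcell P + Q: zcell Q by (simp_all add: P Q)
  note c = ocD[OF a] and S = SIm_sel[OF P Q a] and act = SIm_act[OF P Q a] and eq = sim_class_eq_iff[OF P Q a]
  have s: "Fn (sim_cell P Q a) x = sim_class P Q a 1[Q] x" "Tw (sim_cell P Q a) = Tw a" for x
    by (simp_all add: sim_cell_def)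
  show 1: "oc P (SIm P Q a) (sim_cell P Q a)"
  proof (rule ocI)
    fix x g assume h: "x : Pts P" "g : gp P"
    have "sim_class P Q a (Tw a x g) x = sim_class P Q a 1[Q] (Act P g x)"
      using eq[of "Tw a x g" x "1[Q]" "Act P g x"] h c by auto
    then show "Fn (sim_cell P Q a) (Act P g x) = Act (SIm P Q a) (Tw (sim_cell P Q a) x g) (Fn (sim_cell P Q a) x)"
      using h c by (simp add: s act)
  qed (use c in "auto simp: s S(1,2)")
  show "full P (SIm P Q a) (sim_cell P Q a)"
    unfolding full_def
  proof (intro ballI impI)
    fix x x' u assume h: "x : Pts P" "x' : Pts P" "u : gp (SIm P Q a)"
      "Act (SIm P Q a) u (Fn (sim_cell P Q a) x) = Fn (sim_cell P Q a) x'"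
    have u: "u : gp Q" using h(3) S(1) by simp
    then have "sim_class P Q a u x = sim_class P Q a 1[Q] x'" using h by (simp add: s act)
    then obtain g where "g : gp P" "x' = Act P g x" "u = 1[Q] *[Q] Tw a x g" using eq[of u x "1[Q]" x'] u h by auto
    then show "EX g: gp P. Act P g x = x' & Tw (sim_cell P Q a) x g = u" using c h(1) by (auto simp: s(2))
  qed
  show "eso P (SIm P Q a) (sim_cell P Q a)"
    unfolding eso_def
  proof
    fix z assume "z : Pts (SIm P Q a)"
    then obtain \<eta> x where z: "z = sim_class P Q a \<eta> x" "\<eta> : gp Q" "x : Pts P" by (auto simp: S(2))
    then show "EX x:Pts P. EX h:gp (SIm P Q a). Act (SIm P Q a) h (Fn (sim_cell P Q a) x) = z"
      by (intro bexI[of _ x] bexI[of _ \<eta>]) (simp_all add: s act S(1))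
  qed
  show "iso2 P Q ((gcell (SIm_map P Q a)) oo (sim_cell P Q a)) a"
  proof (rule iso2_eq_on[OF P Q oc_comp[OF P 1 oc_gset[OF SIm_gmap[OF P Q a]]] a])
    fix x assume x: "x : Pts P"
    show "Fn ((gcell (SIm_map P Q a)) oo (sim_cell P Q a)) x = Fn a x"
      using SIm_map_class[OF P Q a Q.one_closed x] c x by (simp add: s)
  qed (simp add: s)
qed

text \<open>Two pairs over images of \<open>s\<close> are equivalent for \<open>a\<close> by means
  of a morphism of \<open>A\<close>, and fullness of \<open>s\<close> lifts that morphism to
  \<open>A'\<close>. The family \<open>e\<close> accounts for \<open>a'\<close> being only
  isomorphic to \<open>a oo s\<close>.\<close>

lemma sim_class_full:
  assumes A': "zc A'" and A: "zc A" and X: "zc X" and s: "oc A' A s" and a: "oc A X a"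
    and full: "full A' A s" and a': "oc A' X a'"
    and e: "!!x. x : Pts A' ==> e x : gp X"
      "!!x g. x : Pts A' ==> g : gp A' ==> e (Act A' g x) *[X] Tw a (Fn s x) (Tw s x g) = Tw a' x g *[X] e x"
    and h: "\<eta> : gp X" "x : Pts A'" "\<eta>' : gp X" "x' : Pts A'"
  shows "sim_class A' X a' \<eta> x = sim_class A' X a' \<eta>' x' \<longleftrightarrow>
    sim_class A X a (\<eta> *[X] e x) (Fn s x) = sim_class A X a (\<eta>' *[X] e x') (Fn s x')"
proof -
  interpret A': zcell A' + X: zcell X by (simp_all add: A' X)
  note c = ocD[OF s] and ca = ocD(2)[OF a] and ca' = ocD(2)[OF a']
  have key: "\<eta> *[X] e x = \<eta>' *[X] e (Act A' g x) *[X] Tw a (Fn s x) (Tw s x g) \<longleftrightarrow> \<eta> = \<eta>' *[X] Tw a' x g" if g: "g : gp A'" for g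
  proof -
    have "\<eta>' *[X] e (Act A' g x) *[X] Tw a (Fn s x) (Tw s x g) = \<eta>' *[X] Tw a' x g *[X] e x"
      using e(2)[OF h(2) g] e(1) c ca ca' h g by (simp add: X.m_assoc)
    then show ?thesis using e(1) ca' h g by simp
  qed
  have "sim_class A X a (\<eta> *[X] e x) (Fn s x) = sim_class A X a (\<eta>' *[X] e x') (Fn s x') \<longleftrightarrow>
    (EX g:gp A. Fn s x' = Act A g (Fn s x) & \<eta> *[X] e x = \<eta>' *[X] e x' *[X] Tw a (Fn s x) g)"
    by (rule sim_class_eq_iff[OF A X a]) (use h e c in simp_all)
  also have "... \<longleftrightarrow> (EX g:gp A'. x' = Act A' g x & \<eta> = \<eta>' *[X] Tw a' x g)"
  proof
    assume "EX g:gp A. Fn s x' = Act A g (Fn s x) & \<eta> *[X] e x = \<eta>' *[X] e x' *[X] Tw a (Fn s x) g"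
    then obtain u where u: "u : gp A" "Act A u (Fn s x) = Fn s x'" "\<eta> *[X] e x = \<eta>' *[X] e x' *[X] Tw a (Fn s x) u" by auto
    obtain g where "g : gp A'" "Act A' g x = x'" "Tw s x g = u" using fullD[OF full h(2,4) u(1,2)] by blast
    then show "EX g:gp A'. x' = Act A' g x & \<eta> = \<eta>' *[X] Tw a' x g" using key[of g] u(3) by blast
  next
    assume "EX g:gp A'. x' = Act A' g x & \<eta> = \<eta>' *[X] Tw a' x g"
    then obtain g where "g : gp A'" "x' = Act A' g x" "\<eta> = \<eta>' *[X] Tw a' x g" by blast
    then show "EX g:gp A. Fn s x' = Act A g (Fn s x) & \<eta> *[X] e x = \<eta>' *[X] e x' *[X] Tw a (Fn s x) g"
      using key[of g] c h by auto
  qed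
  also have "... \<longleftrightarrow> sim_class A' X a' \<eta> x = sim_class A' X a' \<eta>' x'"
    by (rule sim_class_eq_iff[OF A' X a' h, symmetric])
  finally show ?thesis by blast
qed

text \<open>The class of \<open>\<eta>\<close>, \<open>x\<close> corresponds to that of
  \<open>\<eta> *[X] e x\<close>, \<open>Fn s x\<close>. Fullness of \<open>s\<close> gives
  injectivity and essential surjectivity gives surjectivity. Thus the stabilizer image does not see
  precomposition with a stab-surjective 1-cell.\<close>

lemma sim_iso:
  assumes A': "zc A'" and A: "zc A" and X: "zc X" and s: "oc A' A s" and a: "oc A X a"
    and full: "full A' A s" and eso: "eso A' A s" and i: "iso2 A' X (a oo s) a'"
  shows "isomorphic (gsets_over X) (SIm A' X a', X, SIm_map A' X a') (SIm A X a, X, SIm_map A X a)"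
proof -
  obtain e where "cell2 A' X (a oo s) a' e" using iso2E[OF i A' X] .
  note a' = cell2D(2)[OF this] and e = cell2D(3-5)[OF this, unfolded oo_simps]
  interpret X: zcell X + A: zcell A by (simp_all add: X A)
  note c = ocD[OF s] and ca = ocD[OF a]
  note S = SIm_sel[OF A X a] and S' = SIm_sel[OF A' X a']
  show ?thesis
  proof (rule gset_isoI[OF SIm_gmap[OF A' X a'] SIm_gmap[OF A X a], where I = "(gp X) \<times> Pts A'"
        and z = "%(\<eta>, x). sim_class A' X a' \<eta> x" and w = "%(\<eta>, x). sim_class A X a (\<eta> *[X] e x) (Fn s x)"])
    show "(%(\<eta>, x). sim_class A' X a' \<eta> x) ` ((gp X) \<times> Pts A') = Pts (SIm A' X a')" by (auto simp: S'(2))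
    show "(%(\<eta>, x). sim_class A X a (\<eta> *[X] e x) (Fn s x)) ` ((gp X) \<times> Pts A') = Pts (SIm A X a)"
    proof (intro equalityI subsetI)
      fix v assume "v : Pts (SIm A X a)"
      then obtain \<eta> y where v: "v = sim_class A X a \<eta> y" "\<eta> : gp X" "y : Pts A" by (auto simp: S(2))
      obtain x h where x: "x : Pts A'" "h : gp A" "Act A h (Fn s x) = y" using eso_cellD[OF eso v(3)] by blast
      note t = ca(2)[OF c(1)[OF x(1)] x(2)]
      \<comment> \<open>The morphism \<open>h\<close> from \<open>Fn s x\<close> to \<open>y\<close>
        is absorbed into the group coordinate.\<close>
      have "sim_class A X a (\<eta> *[X] Tw a (Fn s x) h) (Fn s x) = v"
        unfolding v(1) by (rule iffD2[OF sim_class_eq_iff[OF A X a]]) (use v x c t in auto)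
      moreover have "\<eta> *[X] Tw a (Fn s x) h = \<eta> *[X] Tw a (Fn s x) h *[X] inv[X] (e x) *[X] e x"
        using v t e(1)[OF x(1)] by simp
      ultimately show "v : (%(\<eta>, x). sim_class A X a (\<eta> *[X] e x) (Fn s x)) ` ((gp X) \<times> Pts A')"
        using x v t e(1)[OF x(1)] by (intro image_eqI[of _ _ "(\<eta> *[X] Tw a (Fn s x) h *[X] inv[X] (e x), x)"]) auto
    next
      fix v assume "v : (%(\<eta>, x). sim_class A X a (\<eta> *[X] e x) (Fn s x)) ` ((gp X) \<times> Pts A')"
      then obtain \<eta> x where "v = sim_class A X a (\<eta> *[X] e x) (Fn s x)" "\<eta> : gp X" "x : Pts A'" by auto
      moreover from this have "\<eta> *[X] e x : gp X" "Fn s x : Pts A" using e(1) c(1) by simp_all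
      ultimately show "v : Pts (SIm A X a)" unfolding S(2) by blast
    qed
    fix i i' assume "i : gp X \<times> Pts A'" "i' : gp X \<times> Pts A'"
    then show "(case i of (\<eta>, x) => sim_class A' X a' \<eta> x) = (case i' of (\<eta>, x) => sim_class A' X a' \<eta> x) \<longleftrightarrow>
      (case i of (\<eta>, x) => sim_class A X a (\<eta> *[X] e x) (Fn s x)) = (case i' of (\<eta>, x) => sim_class A X a (\<eta> *[X] e x) (Fn s x))"
      using sim_class_full[OF A' A X s a full a' e(1,3)] by (auto simp: split_beta)
  next
    fix i assume "i : gp X \<times> Pts A'"
    then obtain \<eta> x where i: "i = (\<eta>, x)" "\<eta> : gp X" "x : Pts A'" by auto
    have "SIm_map A X a (sim_class A X a (\<eta> *[X] e x) (Fn s x)) = Act X (\<eta> *[X] e x) (Fn a (Fn s x))"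
      by (rule SIm_map_class[OF A X a]) (use i e(1) c in simp_all)
    also have "... = Act X \<eta> (Fn a' x)" using i c ca e(1,2) by (simp add: X.act_mult)
    finally show "SIm_map A' X a' (case i of (\<eta>, x) => sim_class A' X a' \<eta> x) =
      SIm_map A X a (case i of (\<eta>, x) => sim_class A X a (\<eta> *[X] e x) (Fn s x))"
      using i SIm_map_class[OF A' X a'] by simp
    fix g assume g: "g : gp X"
    have "Act (SIm A X a) g (sim_class A X a (\<eta> *[X] e x) (Fn s x)) = sim_class A X a (g *[X] \<eta> *[X] e x) (Fn s x)"
      using SIm_act[OF A X a g, of "\<eta> *[X] e x" "Fn s x"] i g e(1) c by (simp add: X.m_assoc)
    then show "EX i': gp X \<times> Pts A'. (case i' of (\<eta>, x) => sim_class A' X a' \<eta> x) = Act (SIm A' X a') g (case i of (\<eta>, x) => sim_class A' X a' \<eta> x) &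
       (case i' of (\<eta>, x) => sim_class A X a (\<eta> *[X] e x) (Fn s x)) = Act (SIm A X a) g (case i of (\<eta>, x) => sim_class A X a (\<eta> *[X] e x) (Fn s x))"
      using i g SIm_act[OF A' X a' g i(2,3)] by (intro bexI[of _ "(g *[X] \<eta>, x)"]) simp_all
  qed
qed

text \<open>The class of \<open>\<eta>\<close>, \<open>x\<close> corresponds to the point
  \<open>Act A \<eta> x\<close>. This is why \<open>Omega_p\<close> is a left inverse of
  \<open>Omega_i\<close>.\<close>

lemma sim_gset_iso:
  assumes f: "gmap A X f"
  shows "isomorphic (gsets_over X) (SIm A X (gcell f), X, SIm_map A X (gcell f)) (A, X, f)"
proof -
  note F = gmapD[OF f]
  note A = F(1) and X = F(2) and a = oc_gset[OF f]
  interpret X: zcell X + A: zcell A by (simp_all add: X A)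
  note S = SIm_sel[OF A X a]
  note ac = A.act_closed[unfolded F(3)] and am = A.act_mult[unfolded F(3)] and ao = A.act_one[unfolded F(3)] and ae = A.act_eqD[unfolded F(3)]
  show ?thesis
  proof (rule gset_isoI[OF SIm_gmap[OF A X a] f, where I = "(gp X) \<times> Pts A"
        and z = "%(\<eta>, x). sim_class A X (gcell f) \<eta> x" and w = "%(\<eta>, x). Act A \<eta> x"])
    show "(%(\<eta>, x). sim_class A X (gcell f) \<eta> x) ` ((gp X) \<times> Pts A) = Pts (SIm A X (gcell f))" by (auto simp: S(2))
    show "(%(\<eta>, x). Act A \<eta> x) ` ((gp X) \<times> Pts A) = Pts A"
      using ac ao by (auto intro!: image_eqI[of _ _ "(1[X], _)"])
    fix i i' assume "i : gp X \<times> Pts A" "i' : gp X \<times> Pts A"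
    then obtain \<eta> x \<eta>' x' where i: "i = (\<eta>, x)" "\<eta> : gp X" "x : Pts A" "i' = (\<eta>', x')" "\<eta>' : gp X" "x' : Pts A" by auto
    have "sim_class A X (gcell f) \<eta> x = sim_class A X (gcell f) \<eta>' x' \<longleftrightarrow> (EX g: gp X. x' = Act A g x & \<eta> = \<eta>' *[X] g)"
      using sim_class_eq_iff[OF A X a i(2,3,5,6)] F(3) by simp
    also have "... \<longleftrightarrow> Act A \<eta> x = Act A \<eta>' x'"
    proof
      assume "Act A \<eta> x = Act A \<eta>' x'"
      then have "x' = Act A (inv[X] \<eta>' *[X] \<eta>) x" using i ae[OF i(5,6) refl] by (simp add: am)
      then show "EX g: gp X. x' = Act A g x & \<eta> = \<eta>' *[X] g" using i by (intro bexI[of _ "inv[X] \<eta>' *[X] \<eta>"]) simp_all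
    qed (use i am in auto)
    finally show "(case i of (\<eta>, x) => sim_class A X (gcell f) \<eta> x) = (case i' of (\<eta>, x) => sim_class A X (gcell f) \<eta> x) \<longleftrightarrow>
      (case i of (\<eta>, x) => Act A \<eta> x) = (case i' of (\<eta>, x) => Act A \<eta> x)" using i by simp
  next
    fix i assume "i : gp X \<times> Pts A"
    then obtain \<eta> x where i: "i = (\<eta>, x)" "\<eta> : gp X" "x : Pts A" by auto
    show "SIm_map A X (gcell f) (case i of (\<eta>, x) => sim_class A X (gcell f) \<eta> x) = f (case i of (\<eta>, x) => Act A \<eta> x)"
      using i SIm_map_class[OF A X a i(2,3)] F(6) by simp
    fix g assume g: "g : gp X"
    show "EX i': gp X \<times> Pts A. (case i' of (\<eta>, x) => sim_class A X (gcell f) \<eta> x) =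
       Act (SIm A X (gcell f)) g (case i of (\<eta>, x) => sim_class A X (gcell f) \<eta> x) &
       (case i' of (\<eta>, x) => Act A \<eta> x) = Act A g (case i of (\<eta>, x) => Act A \<eta> x)"
      using i g SIm_act[OF A X a g i(2,3)] am by (intro bexI[of _ "(g *[X] \<eta>, x)"]) simp_all
  qed
qed

text \<open>The stabilizer image of a sum is the disjoint union of those of the summands. Both are
  parametrized by pairs from \<open>A\<close> or from \<open>B\<close>: within a summand
  \<open>sim_class_full\<close> matches the identifications, and across summands disjointness
  excludes any.\<close>

lemma sim_gsum_coproduct:
  assumes g: "gsum A B S i j" and X: "zc X" and s: "oc S X s"
  obtains E f u v where "is_coproduct (gsets_over X) (SIm A X (s oo i), X, SIm_map A X (s oo i))
    (SIm B X (s oo j), X, SIm_map B X (s oo j)) (E, X, f) u v"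
    "isomorphic (gsets_over X) (E, X, f) (SIm S X s, X, SIm_map S X s)"
proof -
  note d = gsumD[OF g] and d' = gsumD(10)[OF gsum_sym[OF g]]
  have si: "oc A X (s oo i)" and sj: "oc B X (s oo j)"
    using oc_comp[OF d(1,4) s] oc_comp[OF d(2,5) s] .
  let ?A = "SIm A X (s oo i)" and ?m = "SIm_map A X (s oo i)"
  let ?B = "SIm B X (s oo j)" and ?n = "SIm_map B X (s oo j)"
  let ?C = "SIm S X s" and ?E = "gset_sum ?A ?B" and ?G = "gset_cat (Grp X)"
  let ?i = "\<lambda>x \<in> Pts ?A. PPair (Atom 0) x" and ?j = "\<lambda>x \<in> Pts ?B. PPair (Atom (Suc 0)) x"
  interpret X: zcell X + S: zcell S by (simp_all add: X d(3))
  note SA = SIm_sel[OF d(1) X si] and SB = SIm_sel[OF d(2) X sj] and SC = SIm_sel[OF d(3) X s]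
  note zA = SIm_zero_cell[OF d(1) X si] and zB = SIm_zero_cell[OF d(2) X sj]
  note cop = gset_sum_coproduct[OF zA SA(1) zB SB(1)]
  have "(?A, X, ?m) : arrows ?G ?A X" "(?B, X, ?n) : arrows ?G ?B X"
    using SIm_gmap[OF d(1) X si] SIm_gmap[OF d(2) X sj] by (simp_all add: arr_gset)
  then obtain t where t: "t : arrows ?G ?E X" "cmp ?G t (?A, ?E, ?i) = (?A, X, ?m)" "cmp ?G t (?B, ?E, ?j) = (?B, X, ?n)"
    using coprodD(6)[OF cop, of "(?A, X, ?m)" X "(?B, X, ?n)"] X by auto
  obtain f where f: "t = (?E, X, f)" "gmap ?E X f" using t(1) by (auto simp: arr_gset)
  have "compose (Pts ?A) f ?i = ?m" "compose (Pts ?B) f ?j = ?n" using t f(1) by simp_all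
  note fi = fun_cong[OF this(1)] and fj = fun_cong[OF this(2)]
  have fi: "f (PPair (Atom 0) x) = ?m x" if "x : Pts ?A" for x using fi[of x] that by (simp add: compose_def)
  have fj: "f (PPair (Atom (Suc 0)) x) = ?n x" if "x : Pts ?B" for x using fj[of x] that by (simp add: compose_def)
  have 1: "is_coproduct (gsets_over X) (?A, X, ?m) (?B, X, ?n) (?E, X, f) (cmp ?G t (?A, ?E, ?i), t, (?A, ?E, ?i)) (cmp ?G t (?B, ?E, ?j), t, (?B, ?E, ?j))"
    using coproduct_slice[OF gset_category cop t(1)] t(2,3) f(1) by simp
  let ?I = "Inl ` ((gp X) \<times> Pts A) \<union> Inr ` ((gp X) \<times> Pts B)"
  define z where "z = case_sum (%(\<eta>, x). PPair (Atom 0) (sim_class A X (s oo i) \<eta> x)) (%(\<eta>, x). PPair (Atom (Suc 0)) (sim_class B X (s oo j) \<eta> x))"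
  define w where "w = case_sum (%(\<eta>, x). sim_class S X s \<eta> (Fn i x)) (%(\<eta>, x). sim_class S X s \<eta> (Fn j x))"
  have zw: "z (Inl (\<eta>, x)) = PPair (Atom 0) (sim_class A X (s oo i) \<eta> x)" "z (Inr (\<eta>, x)) = PPair (Atom (Suc 0)) (sim_class B X (s oo j) \<eta> x)"
    "w (Inl (\<eta>, x)) = sim_class S X s \<eta> (Fn i x)" "w (Inr (\<eta>, x)) = sim_class S X s \<eta> (Fn j x)" for \<eta> x
    by (simp_all add: z_def w_def)
  note ic = ocD[OF d(4)] and jc = ocD[OF d(5)] and sc = ocD[OF s]
  have memA: "sim_class A X (s oo i) \<eta> x : Pts ?A" if "\<eta> : gp X" "x : Pts A" for \<eta> x using that by (auto simp: SA(2))
  have memB: "sim_class B X (s oo j) \<eta> x : Pts ?B" if "\<eta> : gp X" "x : Pts B" for \<eta> x using that by (auto simp: SB(2))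
  have eqA: "sim_class A X (s oo i) \<eta> x = sim_class A X (s oo i) \<eta>' x' \<longleftrightarrow> sim_class S X s \<eta> (Fn i x) = sim_class S X s \<eta>' (Fn i x')"
    if h: "\<eta> : gp X" "x : Pts A" "\<eta>' : gp X" "x' : Pts A" for \<eta> x \<eta>' x'
    using sim_class_full[OF d(1,3) X d(4) s d(6) si _ _ h, of "%_. 1[X]"] h ic sc by simp
  have eqB: "sim_class B X (s oo j) \<eta> x = sim_class B X (s oo j) \<eta>' x' \<longleftrightarrow> sim_class S X s \<eta> (Fn j x) = sim_class S X s \<eta>' (Fn j x')"
    if h: "\<eta> : gp X" "x : Pts B" "\<eta>' : gp X" "x' : Pts B" for \<eta> x \<eta>' x'
    using sim_class_full[OF d(2,3) X d(5) s d(8) sj _ _ h, of "%_. 1[X]"] h jc sc by simp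
  have neq: "sim_class S X s \<eta> (Fn i x) ~= sim_class S X s \<eta>' (Fn j x')"
    if h: "\<eta> : gp X" "x : Pts A" "\<eta>' : gp X" "x' : Pts B" for \<eta> x \<eta>' x'
  proof
    assume "sim_class S X s \<eta> (Fn i x) = sim_class S X s \<eta>' (Fn j x')"
    then obtain g where "g : gp S" "Fn j x' = Act S g (Fn i x)"
      using sim_class_eq_iff[OF d(3) X s, of \<eta> "Fn i x" \<eta>' "Fn j x'"] h ic(1) jc(1) by auto
    then show False using d(10)[OF h(2,4)] by metis
  qed
  have "isomorphic (gsets_over X) (?E, X, f) (?C, X, SIm_map S X s)"
  proof (rule gset_isoI[OF f(2) SIm_gmap[OF d(3) X s], where I = ?I and z = z and w = w])
    show "z ` ?I = Pts ?E" by (auto simp: gset_sum_sel(2) SA(2) SB(2) image_Un image_image zw)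
        (force simp: zw image_iff)+
    show "w ` ?I = Pts ?C"
    proof (intro equalityI subsetI)
      have "sim_class S X s \<eta> y : Pts ?C" if "\<eta> : gp X" "y : Pts S" for \<eta> y using that by (auto simp: SC(2))
      then show "v : Pts ?C" if "v : w ` ?I" for v using that ic(1) jc(1) by (auto simp: zw)
    next
      fix v assume "v : Pts ?C"
      then obtain \<eta> y where v: "v = sim_class S X s \<eta> y" "\<eta> : gp X" "y : Pts S" by (auto simp: SC(2))
      have move: "sim_class S X s (\<eta> *[X] Tw s y' h) y' = v" "\<eta> *[X] Tw s y' h : gp X" if "y' : Pts S" "h : gp S" "Act S h y' = y" for y' h
        unfolding v(1) using sim_class_eq_iff[OF d(3) X s, of "\<eta> *[X] Tw s y' h" y' \<eta> y] that v sc by auto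
      from d(11)[OF v(3)] show "v : w ` ?I"
      proof (elim disjE bexE)
        fix x h assume x: "x : Pts A" "h : gp S" "Act S h (Fn i x) = y"
        note m = move[OF ic(1)[OF x(1)] x(2,3)]
        have "v = w (Inl (\<eta> *[X] Tw s (Fn i x) h, x))" using m by (simp add: zw)
        then show ?thesis using m(2) x(1) by (intro image_eqI) auto
      next
        fix x h assume x: "x : Pts B" "h : gp S" "Act S h (Fn j x) = y"
        note m = move[OF jc(1)[OF x(1)] x(2,3)]
        have "v = w (Inr (\<eta> *[X] Tw s (Fn j x) h, x))" using m by (simp add: zw)
        then show ?thesis using m(2) x(1) by (intro image_eqI) auto
      qed
    qed
    fix p q assume "p : ?I" "q : ?I"
    then show "z p = z q \<longleftrightarrow> w p = w q"
      using eqA eqB neq neq[symmetric] by (elim UnE imageE SigmaE) (simp_all add: zw)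
  next
    fix p assume p: "p : ?I"
    from p show "f (z p) = SIm_map S X s (w p)"
      using memA memB fi fj SIm_map_class[OF d(1) X si] SIm_map_class[OF d(2) X sj] SIm_map_class[OF d(3) X s] ic(1) jc(1)
      by (elim UnE imageE SigmaE) (simp_all add: zw)
    fix h assume h: "h : gp X"
    from p show "EX p':?I. z p' = Act ?E h (z p) & w p' = Act ?C h (w p)"
    proof (elim UnE imageE SigmaE)
      fix q \<eta> x assume q: "p = Inl q" "q = (\<eta>, x)" "\<eta> : gp X" "x : Pts A"
      then show ?thesis
        using h SIm_act[OF d(1) X si h q(3,4)] SIm_act[OF d(3) X s h q(3)] ic(1) memA gset_sum_sel(3)
        by (intro bexI[of _ "Inl (h *[X] \<eta>, x)"]) (simp_all add: zw)
    next
      fix q \<eta> x assume q: "p = Inr q" "q = (\<eta>, x)" "\<eta> : gp X" "x : Pts B"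
      then show ?thesis
        using h SIm_act[OF d(2) X sj h q(3,4)] SIm_act[OF d(3) X s h q(3)] jc(1) memB gset_sum_sel(4)
        by (intro bexI[of _ "Inr (h *[X] \<eta>, x)"]) (simp_all add: zw)
    qed
  qed
  with 1 show ?thesis by (rule that)
qed

lemma gset_equiv_cell:
  assumes f: "gmap A B f" and b: "bij_betw f (Pts A) (Pts B)"
  shows "eqv A B (gcell f)"
proof -
  note F = gmapD[OF f]
  interpret A: zcell A + B: zcell B by (simp_all add: F(1,2))
  note inj = bij_betw_imp_inj_on[OF b]
  have "full A B (gcell f)"
    unfolding full_def gset_cell_simps
  proof (intro ballI impI)
    fix x x' h assume h: "x : Pts A" "x' : Pts A" "h : gp B" "Act B h (f x) = f x'"
    then have hA: "h : gp A" using F(3) by simp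
    have "f (Act A h x) = f x'" using F(6)[OF h(3,1)] h(4) by simp
    then have "Act A h x = x'" using inj_onD[OF inj _ A.act_closed[OF hA h(1)] h(2)] by blast
    then show "EX g: gp A. Act A g x = x' & g = h" using hA by blast
  qed
  moreover have "eso A B (gcell f)"
    unfolding eso_def
  proof
    fix y assume y: "y : Pts B"
    then have "y : f ` Pts A" using bij_betw_imp_surj_on[OF b] by simp
    then obtain x where "x : Pts A" "y = f x" by (rule imageE)
    then show "EX x:Pts A. EX h: gp B. Act B h (Fn (gcell f) x) = y"
      using B.act_one[OF y] by (intro bexI[of _ x] bexI[of _ "1[B]"]) simp_all
  qed
  ultimately show ?thesis using oc_gset[OF f] by (simp add: eqv_def faithful_def)
qed

lemma gset_isoE:
  assumes "isomorphic (gsets_over X) (A, X, f) (B, X, f')"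
  obtains \<phi> where "gmap A B \<phi>" "bij_betw \<phi> (Pts A) (Pts B)" "compose (Pts A) f' \<phi> = f" "gmap A X f" "gmap B X f'"
proof -
  have h: "(A, X, f) : ar (gset_cat (Grp X))" "(B, X, f') : ar (gset_cat (Grp X))"
    "EX t:arrows (gset_cat (Grp X)) A B. is_iso (gset_cat (Grp X)) t & cmp (gset_cat (Grp X)) (B, X, f') t = (A, X, f)"
    using assms unfolding slice_isomorphic_iff[OF gset_category] by simp_all
  then obtain t where t: "t : arrows (gset_cat (Grp X)) A B" "is_iso (gset_cat (Grp X)) t" "cmp (gset_cat (Grp X)) (B, X, f') t = (A, X, f)" by blast
  obtain \<phi> where \<phi>: "t = (A, B, \<phi>)" "gmap A B \<phi>" using t(1) by (auto simp: arr_gset)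
  obtain u where u: "u : arrows (gset_cat (Grp X)) B A" "cmp (gset_cat (Grp X)) u t = idn (gset_cat (Grp X)) A" "cmp (gset_cat (Grp X)) t u = idn (gset_cat (Grp X)) B"
    using is_isoE[OF t(2,1)] by metis
  obtain \<psi> where \<psi>: "u = (B, A, \<psi>)" "gmap B A \<psi>" using u(1) by (auto simp: arr_gset)
  have "compose (Pts A) \<psi> \<phi> = (\<lambda>x \<in> Pts A. x)" "compose (Pts B) \<phi> \<psi> = (\<lambda>x \<in> Pts B. x)" using u(2,3) \<phi>(1) \<psi>(1) by simp_all
  note e0 = fun_cong[OF this(1)] and e1 = fun_cong[OF this(2)]
  have "\<psi> (\<phi> x) = x" if "x : Pts A" for x using e0[of x] that by (simp add: compose_def)
  moreover have "\<phi> (\<psi> y) = y" if "y : Pts B" for y using e1[of y] that by (simp add: compose_def)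
  ultimately have "bij_betw \<phi> (Pts A) (Pts B)"
    using gmapD(5)[OF \<phi>(2)] gmapD(5)[OF \<psi>(2)] by (intro bij_betw_byWitness[of _ \<psi>]) blast+
  moreover have "compose (Pts A) f' \<phi> = f" using t(3) \<phi>(1) by simp
  moreover have "gmap A X f" "gmap B X f'" using h(1,2) by (auto simp: ar_gset_iff)
  ultimately show ?thesis using that \<phi>(2) by blast
qed

section \<open>The classes p[a] and the transfer of the Mackey structure along p\<close>

context base_ring
begin

text \<open>This is p applied to \<open>big_cls X A a\<close>, see \<open>Omega_p_big\<close>; it
  names elements of the Burnside module by arbitrary 1-cells into \<open>X\<close>.\<close>

definition burn_cls :: "zero_cell => zero_cell => one_cell => 'k burn_elt" where
  "burn_cls X A a = k0_class k (gsets_over X) (SIm A X a, X, SIm_map A X a)"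

lemma Om_mod: "module k (Omega_ob k X)"
  unfolding Omega_ob_def by (rule k0_module_module)

lemma gset_class_in: "gmap A X f ==> k0_class k (gsets_over X) (A, X, f) : burn_el X"
  unfolding Omega_ob_def by (rule k0_class_closed) (unfold gsets_over_ob, blast)

lemma burn_cls_in:
  assumes "zc A" "zc X" "oc A X a"
  shows "burn_cls X A a : burn_el X"
  unfolding burn_cls_def by (rule gset_class_in[OF SIm_gmap[OF assms]])

lemma burn_cls_stab:
  assumes "zc A'" "zc A" "zc X" "oc A' A s" "oc A X a"
    "full A' A s" "eso A' A s" "iso2 A' X (a oo s) a'"
  shows "burn_cls X A' a' = burn_cls X A a"
  unfolding burn_cls_def by (rule k0_class_cong[OF slice_category[OF gset_category] sim_iso[OF assms]])

lemma burn_cls_iso2: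
  assumes A: "zc A" and X: "zc X" and i: "iso2 A X a a'"
  shows "burn_cls X A a' = burn_cls X A a"
proof -
  interpret A: zcell A by (rule zcellI[OF A])
  have "full A A id_cell" by (auto simp: full_def)
  moreover have "eso A A id_cell"
    unfolding eso_def
  proof
    fix y assume "y : Pts A"
    then show "EX x:Pts A. EX h: gp A. Act A h (Fn id_cell x) = y" by (intro bexI[of _ y] bexI[of _ "1[A]"]) simp_all
  qed
  ultimately show ?thesis
    by (intro burn_cls_stab[OF A A X oc_id iso2_cells(1)[OF i]]) (simp_all add: i)
qed

lemma burn_cls_gset: "gmap A X f ==> burn_cls X A (gcell f) = k0_class k (gsets_over X) (A, X, f)"
  unfolding burn_cls_def by (rule k0_class_cong[OF slice_category[OF gset_category] sim_gset_iso])

lemma burn_cls_gsum: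
  assumes g: "gsum A B S i j" and X: "zc X" and s: "oc S X s"
  shows "burn_cls X S s = burn_cls X A (s oo i) +[Omega_ob k X] burn_cls X B (s oo j)"
proof -
  obtain E f u v where c: "is_coproduct (gsets_over X) (SIm A X (s oo i), X, SIm_map A X (s oo i))
    (SIm B X (s oo j), X, SIm_map B X (s oo j)) (E, X, f) u v"
    and i: "isomorphic (gsets_over X) (E, X, f) (SIm S X s, X, SIm_map S X s)"
    using sim_gsum_coproduct[OF g X s] .
  show ?thesis
    unfolding burn_cls_def k0_class_cong[OF slice_category[OF gset_category] i, symmetric] Omega_ob_def
    by (rule k0_class_coproduct[OF c])
qed

text \<open>A set with a group action is its own stabilizer image up to isomorphism, so the elements
  \<open>burn_cls\<close> include all generators.\<close>

lemma Omega_ext: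
  assumes N: "module k N" and f: "f : lin k (Omega_ob k X) N" and g: "g : lin k (Omega_ob k X) N"
    and e: "!!A a. zc A ==> oc A X a ==> f (burn_cls X A a) = g (burn_cls X A a)"
  shows "f = g"
proof (rule k0_ext[OF N f[unfolded Omega_ob_def] g[unfolded Omega_ob_def]])
  fix t assume "t : ob (gsets_over X)"
  then obtain A p where t: "t = (A, X, p)" "gmap A X p" unfolding gsets_over_ob by blast
  show "f (k0_class k (gsets_over X) t) = g (k0_class k (gsets_over X) t)"
    unfolding t(1) burn_cls_gset[OF t(2), symmetric] by (rule e[OF gmapD(1)[OF t(2)] oc_gset[OF t(2)]])
qed

lemma Omega_p_big:
  assumes X: "zc X"
  shows "Omega_p k X : lin k (Omega_big_ob k X) (Omega_ob k X)"
    and "zc A ==> oc A X a ==> Omega_p k X (big_cls X A a) = burn_cls X A a"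
proof -
  let ?h = "%f. k0_class k (gsets_over X) (SIm (cdom f) X (c_rep f), X, SIm_map (cdom f) X (c_rep f))"
  have h: "?h (c_arr A X a) = burn_cls X A a" if a: "zc A" "oc A X a" for A a
    using burn_cls_iso2[OF a(1) X c_rep_iso2[OF a(1) X a(2)]] by (simp add: burn_cls_def)
  have 1: "?h (c_arr A X a) : burn_el X" if a: "zc A" "oc A X a" for A a
    unfolding h[OF a] by (rule burn_cls_in[OF a(1) X a(2)])
  have 2: "?h (c_arr A X (a oo t)) = ?h (c_arr A' X a)"
    if "zc A" "zc A'" "oc A' X a" "eqv A A' t" for A A' a t
  proof -
    note t = eqvD[OF that(4)]
    note c = oc_comp[OF that(1) t(1) that(3)]
    show ?thesis
      unfolding h[OF that(1) c] h[OF that(2,3)]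
      by (rule burn_cls_stab[OF that(1,2) X t(1) that(3) t(2,4) iso2_refl[OF that(1) X c]])
  qed
  have 3: "?h (c_arr S X s) = ?h (c_arr A X (s oo i)) +[Omega_ob k X] ?h (c_arr B X (s oo j))"
    if g: "gsum A B S i j" and s: "oc S X s" for A B S i j s
  proof -
    note d = gsumD[OF g]
    show ?thesis
      unfolding h[OF d(1) oc_comp[OF d(1,4) s]] h[OF d(2) oc_comp[OF d(2,5) s]] h[OF d(3) s]
      by (rule burn_cls_gsum[OF g X s])
  qed
  note L = big_lift[OF Om_mod X 1 2 3]
  have p: "Omega_p k X = k0_lift k (slice CC X) (Omega_ob k X) ?h" using X by (simp add: Omega_p_def)
  show "Omega_p k X : lin k (Omega_big_ob k X) (Omega_ob k X)" unfolding p by (rule L(1))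
  show "zc A ==> oc A X a ==> Omega_p k X (big_cls X A a) = burn_cls X A a"
    unfolding p using L(2)[of A a] h[of A a] by simp
qed

lemma Omega_i_class:
  assumes X: "zc X"
  shows "Omega_i k X : lin k (Omega_ob k X) (Omega_big_ob k X)"
    and "gmap A X f ==> Omega_i k X (k0_class k (gsets_over X) (A, X, f)) = big_cls X A (gcell f)"
proof -
  let ?h = "%(A, X' :: zero_cell, p). k0_class k (slice CC X) (c_arr A X \<lparr> Fn = p, Tw = (%x g. g) \<rparr>)"
  have h: "?h (A, X', p) = big_cls X A (gcell p)" for A X' p by (simp add: big_cls_def gcell_def)
  have 1: "?h t : big_el X" if o: "t : ob (gsets_over X)" for t
  proof -
    obtain A p where t: "t = (A, X, p)" "gmap A X p" using o unfolding gsets_over_ob by blast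
    show ?thesis unfolding t(1) h by (rule big_cls_in[OF gmapD(1)[OF t(2)] X oc_gset[OF t(2)]])
  qed
  have 2: "?h t = ?h u" if o: "t : ob (gsets_over X)" "u : ob (gsets_over X)" and i: "isomorphic (gsets_over X) t u" for t u
  proof -
    obtain A p where t: "t = (A, X, p)" using o(1) unfolding gsets_over_ob by blast
    obtain B q where u: "u = (B, X, q)" using o(2) unfolding gsets_over_ob by blast
    obtain \<phi> where \<phi>: "gmap A B \<phi>" "bij_betw \<phi> (Pts A) (Pts B)" "compose (Pts A) q \<phi> = p" "gmap A X p" "gmap B X q"
      using gset_isoE[OF i[unfolded t u]] .
    have "iso2 A X ((gcell q) oo (gcell \<phi>)) (gcell p)"
      by (rule iso2_eq_on[OF gmapD(1)[OF \<phi>(1)] X oc_comp[OF gmapD(1)[OF \<phi>(1)] oc_gset[OF \<phi>(1)] oc_gset[OF \<phi>(5)]] oc_gset[OF \<phi>(4)]])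
        (use \<phi>(3) in "auto simp: compose_def")
    then show ?thesis
      unfolding t u h by (rule big_cls_cong[OF X gmapD(1,2)[OF \<phi>(1)] gset_equiv_cell[OF \<phi>(1,2)] _ oc_gset[OF \<phi>(5)]])
  qed
  have 3: "?h s = ?h a +[Omega_big_ob k X] ?h b" if c: "is_coproduct (gsets_over X) a b s i j" for a b s i j
  proof -
    obtain A B S i0 j0 s0 where c: "gsum A B S (gcell i0) (gcell j0)" "gmap S X s0" "s = (S, X, s0)"
      "a = (A, X, compose (Pts A) s0 i0)" "b = (B, X, compose (Pts B) s0 j0)" "gmap A S i0" "gmap B S j0"
      using gset_slice_coproductE[OF c] .
    have r: "big_cls X C (gcell (compose (Pts C) s0 l)) = big_cls X C ((gcell s0) oo (gcell l))" if l: "gmap C S l" for C l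
      by (rule big_cls_iso2[OF X gmapD(1)[OF l] iso2_eq_on[OF gmapD(1)[OF l] X oc_gset[OF gmap_compose[OF l c(2)]]
        oc_comp[OF gmapD(1)[OF l] oc_gset[OF l] oc_gset[OF c(2)]]]]) (simp_all add: compose_def)
    show ?thesis
      unfolding c(3,4,5) h r[OF c(6)] r[OF c(7)] by (rule big_cls_gsum[OF c(1) X oc_gset[OF c(2)]])
  qed
  note L = k0_lift_linear[where C = "gsets_over X" and h = ?h, OF slice_category[OF gset_category] Obig_mod 1 2 3]
  have i: "Omega_i k X = k0_lift k (gsets_over X) (Omega_big_ob k X) ?h" using X by (simp add: Omega_i_def)
  show "Omega_i k X : lin k (Omega_ob k X) (Omega_big_ob k X)" unfolding i Omega_ob_def by (rule L(1))
  show "Omega_i k X (k0_class k (gsets_over X) (A, X, f)) = big_cls X A (gcell f)" if f: "gmap A X f"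
  proof -
    have "(A, X, f) : ob (gsets_over X)" unfolding gsets_over_ob using f by blast
    then have "k0_lift k (gsets_over X) (Omega_big_ob k X) ?h (k0_class k (gsets_over X) (A, X, f)) = ?h (A, X, f)"
      by (intro L(2))
    then show ?thesis unfolding i h .
  qed
qed

lemma Omega_i_burn:
  assumes "zc A" "zc X" "oc A X a"
  shows "Omega_i k X (burn_cls X A a) = big_cls X (SIm A X a) (gcell (SIm_map A X a))"
  unfolding burn_cls_def by (rule Omega_i_class(2)[OF assms(2) SIm_gmap[OF assms]])

lemma Omega_p_i:
  assumes X: "zc X" and w: "w : burn_el X"
  shows "Omega_p k X (Omega_i k X w) = w"
proof -
  note p = Omega_p_big[OF X] and i = Omega_i_class[OF X]
  have "compose (burn_el X) (Omega_p k X) (Omega_i k X) = (\<lambda>w \<in> burn_el X. w)"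
  proof (rule Omega_ext[OF Om_mod lin_comp[OF Om_mod i(1) p(1)] lin_id[OF Om_mod]])
    fix A a assume a: "zc A" "oc A X a"
    note g = SIm_gmap[OF a(1) X a(2)]
    show "compose (burn_el X) (Omega_p k X) (Omega_i k X) (burn_cls X A a) = (\<lambda>w \<in> burn_el X. w) (burn_cls X A a)"
      using burn_cls_in[OF a(1) X a(2)] Omega_i_burn[OF a(1) X a(2)] p(2)[OF gmapD(1)[OF g] oc_gset[OF g]] burn_cls_gset[OF g]
      by (simp add: compose_def burn_cls_def)
  qed
  from fun_cong[OF this, of w] show ?thesis using w by (simp add: compose_def)
qed

text \<open>The structure maps of \<open>Omega\<close> pass through i after p at every step. For
  pushforward this detour does no harm: a 1-cell \<open>a\<close> is its stabilizer map preceded by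
  the stab-surjective \<open>sim_cell\<close>, and it keeps this form after composition with
  \<open>b\<close>.\<close>

lemma Omega_p_lower:
  assumes X: "zc X" and Y: "zc Y" and b: "oc X Y b" and w: "w : big_el X"
  shows "Omega_p k Y (Omega_big_lower k (c_arr X Y b) (Omega_i k X (Omega_p k X w))) = Omega_p k Y (Omega_big_lower k (c_arr X Y b) w)"
proof -
  note lo = big_lower[OF X Y b] and pX = Omega_p_big[OF X] and pY = Omega_p_big[OF Y] and i = Omega_i_class[OF X]
  let ?B = "big_el X"
  have "compose ?B (Omega_p k Y) (compose ?B (Omega_big_lower k (c_arr X Y b)) (compose ?B (Omega_i k X) (Omega_p k X))) =
    compose ?B (Omega_p k Y) (Omega_big_lower k (c_arr X Y b))"
  proof (rule big_ext[OF Om_mod])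
    fix A a assume a: "zc A" "oc A X a"
    note g = SIm_gmap[OF a(1) X a(2)]
    note g' = gmapD(1)[OF g] oc_gset[OF g]
    note s = sim_cell_props[OF a(1) X a(2)]
    have "burn_cls Y A (b oo a) = burn_cls Y (SIm A X a) (b oo (gcell (SIm_map A X a)))"
      by (rule burn_cls_stab[OF a(1) g'(1) Y s(1) oc_comp[OF g' b] s(2,3)])
        (use iso2_comp[OF a(1) X Y s(4) iso2_refl[OF X Y b]] in "simp add: oo_assoc")
    then show "compose ?B (Omega_p k Y) (compose ?B (Omega_big_lower k (c_arr X Y b)) (compose ?B (Omega_i k X) (Omega_p k X))) (big_cls X A a) =
      compose ?B (Omega_p k Y) (Omega_big_lower k (c_arr X Y b)) (big_cls X A a)"
      using big_cls_in[OF a(1) X a(2)] pX(2)[OF a] Omega_i_burn[OF a(1) X a(2)] lo(2)[OF a] lo(2)[OF g']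
        pY(2)[OF a(1) oc_comp[OF a b]] pY(2)[OF g'(1) oc_comp[OF g' b]] by (simp add: compose_def)
  qed (rule lin_comp[OF Obig_mod lin_comp[OF Obig_mod lin_comp[OF Obig_mod pX(1) i(1)] lo(1)] pY(1)]
      lin_comp[OF Obig_mod lo(1) pY(1)])+
  from fun_cong[OF this, of w] show ?thesis using w by (simp add: compose_def)
qed

text \<open>For pullback the detour is harmless because the pullback of \<open>sim_cell\<close> is
  again full and essentially surjective, by \<open>bpb_base_change\<close>.\<close>

lemma Omega_p_upper:
  assumes W: "zc W" and X: "zc X" and \<alpha>: "oc W X \<alpha>" and w: "w : big_el X"
  shows "Omega_p k W (Omega_big_upper k (c_arr W X \<alpha>) (Omega_i k X (Omega_p k X w))) = Omega_p k W (Omega_big_upper k (c_arr W X \<alpha>) w)"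
proof -
  note up = big_upper[OF W X \<alpha>] and pX = Omega_p_big[OF X] and pW = Omega_p_big[OF W] and i = Omega_i_class[OF X]
  let ?B = "big_el X"
  have "compose ?B (Omega_p k W) (compose ?B (Omega_big_upper k (c_arr W X \<alpha>)) (compose ?B (Omega_i k X) (Omega_p k X))) =
    compose ?B (Omega_p k W) (Omega_big_upper k (c_arr W X \<alpha>))"
  proof (rule big_ext[OF Om_mod])
    fix A a assume a: "zc A" "oc A X a"
    note g = SIm_gmap[OF a(1) X a(2)]
    note g' = gmapD(1)[OF g] oc_gset[OF g]
    note s = sim_cell_props[OF a(1) X a(2)]
    obtain P p q where P: "bpb P W (SIm A X a) X \<alpha> (gcell (SIm_map A X a)) p q" using bp_bpb[OF W g'(1) X \<alpha> g'(2)] by blast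
    note z = bpbD[OF P]
    obtain P' t u where P': "bpb P' P A (SIm A X a) q (sim_cell A X a) t u" using bp_bpb[OF z(1) a(1) z(3,8) s(1)] by blast
    note z' = bpbD[OF P'] and bc = bpb_base_change[OF P']
    have c: "bpb P' W A X \<alpha> a (p oo t) u"
      by (rule bpb_sym[OF bpb_change[OF bpb_sym[OF bpb_paste_right[OF P P']] s(4)]])
    have "burn_cls W P' (p oo t) = burn_cls W P p"
      by (rule burn_cls_stab[OF z'(1) z(1) W z'(7) z(7) bc(1)[OF s(2)] bc(3)[OF s(3)] iso2_refl[OF z'(1) W bpbD(7)[OF c]]])
    then show "compose ?B (Omega_p k W) (compose ?B (Omega_big_upper k (c_arr W X \<alpha>)) (compose ?B (Omega_i k X) (Omega_p k X))) (big_cls X A a) =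
      compose ?B (Omega_p k W) (Omega_big_upper k (c_arr W X \<alpha>)) (big_cls X A a)"
      using big_cls_in[OF a(1) X a(2)] pX(2)[OF a] Omega_i_burn[OF a(1) X a(2)] up(2)[OF P] up(2)[OF c]
        pW(2)[OF z(1,7)] pW(2)[OF bpbD(1,7)[OF c]] by (simp add: compose_def)
  qed (rule lin_comp[OF Obig_mod lin_comp[OF Obig_mod lin_comp[OF Obig_mod pX(1) i(1)] up(1)] pW(1)]
      lin_comp[OF Obig_mod up(1) pW(1)])+
  from fun_cong[OF this, of w] show ?thesis using w by (simp add: compose_def)
qed

lemma Omega_fob: "fob OM X = Omega_ob k X"
  by (simp add: Omega_def kfctr_of_def)

lemma Omega_far_ext:
  assumes s: "s : ar SpC"
  shows "far OM s : extensional (burn_el (sdom s))"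
  by (auto simp: Omega_def kfctr_of_def Let_def split_beta)

text \<open>The detours in the two halves of a span are removed one after the other. As
  \<open>Omega_p\<close> is onto by \<open>Omega_p_i\<close>, linearity and the functor laws of
  \<open>OM\<close> follow from those of \<open>OB\<close>.\<close>

lemma Omega_p_natural:
  assumes s: "s : ar SpC" and w: "w : big_el (sdom s)"
  shows "far OM s (Omega_p k (sdom s) w) = Omega_p k (scod s) (far OB s w)"
proof -
  obtain W0 b0 \<alpha>0 where s0: "is_sp W0 (sdom s) (scod s) b0 \<alpha>0" "s = sp W0 (sdom s) (scod s) b0 \<alpha>0" using ar_SpCE[OF s] by metis
  obtain W b \<alpha> where s': "s_rep s = (c_arr W (scod s) b, c_arr W (sdom s) \<alpha>)" "is_sp W (sdom s) (scod s) b \<alpha>"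
    using s_rep_sp[OF s0(1)] s0(2) by metis
  let ?X = "sdom s" and ?Y = "scod s"
  have z: "zc W" "zc ?X" "zc ?Y" "oc W ?Y b" "oc W ?X \<alpha>" using s'(2) by (auto simp: is_sp_def)
  note lo = big_lower[OF z(1,3,4)] and up = big_upper[OF z(1,2,5)] and pX = Omega_p_big[OF z(2)] and pW = Omega_p_big[OF z(1)]
    and pY = Omega_p_big[OF z(3)] and iX = Omega_i_class[OF z(2)] and iW = Omega_i_class[OF z(1)]
  have in1: "Omega_p k ?X w : burn_el ?X" using linD(1)[OF pX(1) w] .
  let ?v = "Omega_i k ?X (Omega_p k ?X w)"
  have in2: "?v : big_el ?X" using linD(1)[OF iX(1) in1] .
  have in3: "Omega_big_upper k (c_arr W ?X \<alpha>) ?v : big_el W" "Omega_big_upper k (c_arr W ?X \<alpha>) w : big_el W"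
    using linD(1)[OF up(1)] in2 w by simp_all
  note in4 = linD(1)[OF pW(1) in3(1)]
  have "far OM s (Omega_p k ?X w) = Omega_p k ?Y (Omega_big_lower k (c_arr W ?Y b) (Omega_i k W (Omega_p k W (Omega_big_upper k (c_arr W ?X \<alpha>) ?v))))"
    using in1 in4 s'(1) by (simp add: Omega_def kfctr_of_def compose_def Omega_lower_def Omega_upper_def)
  also have "... = Omega_p k ?Y (Omega_big_lower k (c_arr W ?Y b) (Omega_i k W (Omega_p k W (Omega_big_upper k (c_arr W ?X \<alpha>) w))))"
    using Omega_p_upper[OF z(1,2,5) w] by simp
  also have "... = Omega_p k ?Y (Omega_big_lower k (c_arr W ?Y b) (Omega_big_upper k (c_arr W ?X \<alpha>) w))"
    by (rule Omega_p_lower[OF z(1,3,4) in3(2)])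
  also have "... = Omega_p k ?Y (far OB s w)"
    using w s'(1) by (simp add: Omega_big_def kfctr_of_def compose_def)
  finally show ?thesis .
qed

lemma Omega_far_linear:
  assumes s: "s : ar SpC"
  shows "far OM s : lin k (Omega_ob k (sdom s)) (Omega_ob k (scod s))"
proof -
  have z: "zc (sdom s)" "zc (scod s)" using ar_SpC_ob[OF s] by simp_all
  note iX = Omega_i_class(1)[OF z(1)]
  let ?C = "burn_el (sdom s)"
  have "far OM s = compose ?C (Omega_p k (scod s)) (compose ?C (far OB s) (Omega_i k (sdom s)))"
  proof (rule extensionalityI[OF Omega_far_ext[OF s]])
    fix w assume w: "w : ?C"
    show "far OM s w = compose ?C (Omega_p k (scod s)) (compose ?C (far OB s) (Omega_i k (sdom s))) w"
      using Omega_p_natural[OF s linD(1)[OF iX w]] Omega_p_i[OF z(1) w] w by (simp add: compose_def)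
  qed simp
  also have "... : lin k (Omega_ob k (sdom s)) (Omega_ob k (scod s))"
    by (rule lin_comp[OF Om_mod
        lin_comp[OF Om_mod iX kfD(2)[OF kf_Obig s, unfolded Omega_big_fob]] Omega_p_big(1)[OF z(2)]])
  finally show ?thesis .
qed

lemma kf_Om: "is_kfunctor k OM"
proof -
  note K = kfD[OF kf_Obig, unfolded Omega_big_fob]
  have id: "far OM (idn SpC X) = (\<lambda>x \<in> burn_el X. x)" if X: "zc X" for X
  proof (rule extensionalityI[of _ "burn_el X"])
    note I = idn_SpC_in(1)[OF X]
    show "far OM (idn SpC X) : extensional (burn_el X)" using Omega_far_ext[OF I] X by simp
    fix w assume w: "w : burn_el X"
    note iw = linD(1)[OF Omega_i_class(1)[OF X] w]
    show "far OM (idn SpC X) w = (\<lambda>x \<in> burn_el X. x) w"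
      using Omega_p_natural[OF I, of "Omega_i k X w"] K(3)[OF X iw] iw X Omega_p_i[OF X w] w by simp
  qed simp
  have comp: "far OM (t o[SpC] s) = compose (burn_el (sdom s)) (far OM t) (far OM s)"
    if st: "s : ar SpC" "t : ar SpC" "scod s = sdom t" for s t
  proof (rule extensionalityI[of _ "burn_el (sdom s)"])
    note C = SpC_comp_in[OF st]
    have X: "zc (sdom s)" using ar_SpC_ob[OF st(1)] by simp
    show "far OM (t o[SpC] s) : extensional (burn_el (sdom s))" using Omega_far_ext[OF C(1)] C st by simp
    fix w assume w: "w : burn_el (sdom s)"
    let ?v = "Omega_i k (sdom s) w"
    note iw = linD(1)[OF Omega_i_class(1)[OF X] w]
    have sv: "far OB s ?v : big_el (sdom t)" using linD(1)[OF K(2)[OF st(1)] iw] st(3) by simp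
    have "far OM (t o[SpC] s) w = Omega_p k (scod t) (far OB (t o[SpC] s) ?v)"
      using Omega_p_natural[OF C(1), of ?v] iw C st Omega_p_i[OF X w] by simp
    also have "... = far OM t (Omega_p k (sdom t) (far OB s ?v))"
      using K(4)[OF st iw] Omega_p_natural[OF st(2) sv] by simp
    also have "... = far OM t (far OM s w)"
      using Omega_p_natural[OF st(1) iw] Omega_p_i[OF X w] st(3) by simp
    finally show "far OM (t o[SpC] s) w = compose (burn_el (sdom s)) (far OM t) (far OM s) w"
      using w by (simp add: compose_def)
  qed simp
  show ?thesis
    unfolding is_kfunctor_def Omega_fob using Om_mod Omega_far_linear id comp by simp
qed

lemma Omega_p_nat: "Omega_p k : nat_trans k OB OM"
  unfolding nat_trans_def Omega_big_fob Omega_fob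
  using Omega_p_big(1) Omega_p_natural by (auto simp: Omega_p_def)

lemma burn_far:
  assumes s: "is_sp W X Y b \<alpha>" and B: "bpb P W A X \<alpha> a p q"
  shows "far OM (sp W X Y b \<alpha>) (burn_cls X A a) = burn_cls Y P (b oo p)"
proof -
  note y = bpbD[OF B] and z = s[unfolded is_sp_def]
  have z: "zc X" "zc Y" "oc W Y b" using s by (auto simp: is_sp_def)
  show ?thesis
    using Omega_p_natural[OF sp_in[OF s], of "big_cls X A a"] big_cls_in[OF y(3,4,6)] Omega_p_big(2)[OF z(1) y(3,6)]
      Omega_p_big(2)[OF z(2) y(1) oc_comp[OF y(1,7) z(3)]] big_far(2)[OF s B] by simp
qed

text \<open>The span formed by \<open>a\<close> twice sends the class of \<open>c\<close> to the
  pullback \<open>P\<close> with the 1-cell \<open>a oo p\<close>. Up to a 2-cell this is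
  \<open>c oo q\<close>, and \<open>q\<close> is stab-surjective as a pullback of \<open>a\<close>,
  so the class is that of \<open>c\<close>.\<close>

lemma Omega_deflative: "is_deflative OM"
  unfolding is_deflative_def
proof (intro allI impI)
  fix W X a assume W: "zc W" and X: "zc X" and a: "oc W X a" and ss: "stab_surjective W X a"
  have fe: "full W X a" "eso W X a" using stab_surjective_iff[OF W X a] ss by simp_all
  have S: "is_sp W X X a a" using W X a by (simp add: is_sp_def)
  have "far OM (sp W X X a a) = (\<lambda>x \<in> burn_el X. x)"
  proof (rule Omega_ext[OF Om_mod _ lin_id[OF Om_mod]])
    show "far OM (sp W X X a a) : lin k (Omega_ob k X) (Omega_ob k X)" using Omega_far_linear[OF sp_in[OF S]] by simp
    fix A c assume c: "zc A" "oc A X c"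
    obtain P p q where P: "bpb P W A X a c p q" using bp_bpb[OF W c(1) X a c(2)] by blast
    note z = bpbD[OF P] and bc = bpb_base_change[OF bpb_sym[OF P]]
    have "burn_cls X P (a oo p) = burn_cls X A c"
    proof (rule burn_cls_stab[OF z(1,3) X z(8,6) bc(1)[OF fe(1)] bc(3)[OF fe(2)]])
      show "iso2 P X (c oo q) (a oo p)" by (rule iso2_sym[OF z(1) X bpb_iso2[OF P]])
    qed
    then show "far OM (sp W X X a a) (burn_cls X A c) = (\<lambda>x \<in> burn_el X. x) (burn_cls X A c)"
      using burn_far[OF S P] burn_cls_in[OF c(1) X c(2)] by simp
  qed
  then show "far OM (s_arr (c_arr W X a) (c_arr W X a)) = (\<lambda>x \<in> el OM X. x)"
    by (simp add: sp_def Omega_fob)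
qed

text \<open>The two spans cut out of \<open>C\<close> its parts over \<open>A\<close> and over
  \<open>B\<close>, and \<open>gsum_pullback\<close> says that \<open>C\<close> is the sum of these
  parts.\<close>

lemma Omega_additive: "is_additive OM"
  unfolding is_additive_def Omega_fob
proof (intro allI impI ballI)
  fix A B S i j v assume g: "gsum A B S i j" and v: "v : burn_el S"
  note d = gsumD[OF g] and I = gsum_is_sp[OF g]
  interpret S: module k "Omega_ob k S" by (rule Om_mod)
  let ?i = "far OM (sp A S S i i)" and ?j = "far OM (sp B S S j j)"
  have lin: "?i : lin k (Omega_ob k S) (Omega_ob k S)" "?j : lin k (Omega_ob k S) (Omega_ob k S)"
    using Omega_far_linear[OF sp_in[OF I(5)]] Omega_far_linear[OF sp_in[OF I(6)]] by simp_all
  note L = linD[OF lin(1)] and R = linD[OF lin(2)]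
  have "(\<lambda>v \<in> burn_el S. ?i v +[Omega_ob k S] ?j v) = (\<lambda>v \<in> burn_el S. v)"
  proof (rule Omega_ext[OF Om_mod _ lin_id[OF Om_mod]])
    show "(\<lambda>v \<in> burn_el S. ?i v +[Omega_ob k S] ?j v) : lin k (Omega_ob k S) (Omega_ob k S)"
      by (rule linI) (use L R in "simp_all add: S.smult_r_distr S.a_ac")
    fix C c assume c: "zc C" "oc C S c"
    obtain P p q where P: "bpb P C A S c i q p" using bp_bpb[OF c(1) d(1,3) c(2) d(4)] by blast
    obtain Q p' q' where Q: "bpb Q C B S c j q' p'" using bp_bpb[OF c(1) d(2,3) c(2) d(5)] by blast
    note z = bpbD[OF P] and y = bpbD[OF Q]
    have 1: "?i (burn_cls S C c) = burn_cls S P (c oo q)"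
      using burn_far[OF I(5) bpb_sym[OF P]] burn_cls_iso2[OF z(1) d(3) bpb_iso2[OF P]] by simp
    have 2: "?j (burn_cls S C c) = burn_cls S Q (c oo q')"
      using burn_far[OF I(6) bpb_sym[OF Q]] burn_cls_iso2[OF y(1) d(3) bpb_iso2[OF Q]] by simp
    show "(\<lambda>v \<in> burn_el S. ?i v +[Omega_ob k S] ?j v) (burn_cls S C c) = (\<lambda>v \<in> burn_el S. v) (burn_cls S C c)"
      using 1 2 burn_cls_gsum[OF gsum_pullback[OF g P Q] d(3) c(2)] burn_cls_in[OF c(1) d(3) c(2)] by simp
  qed
  from fun_cong[OF this, of v] show "?i v +[Omega_ob k S] ?j v = v" using v by simp
qed

end

section \<open>The tensor product of Mackey functors\<close>

context base_ring
begin

text \<open>Linear data on which the coend construction can be carried out. It passes to tensor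
  products, see \<open>mtensor_kdiagram\<close>, so that these may serve as factors of further
  tensor products.\<close>

definition is_kdiagram :: "('k, 'm) kfctr => bool" where
  "is_kdiagram M \<longleftrightarrow> (ALL X. zc X --> module k (fob M X)) &
     (ALL s:ar SpC. far M s : lin k (fob M (sdom s)) (fob M (scod s)))"

lemma kdD:
  assumes "is_kdiagram M"
  shows "zc X ==> module k (fob M X)" "s : ar SpC ==> far M s : lin k (fob M (sdom s)) (fob M (scod s))"
  using assms by (auto simp: is_kdiagram_def)

lemma kf_kd: "is_kfunctor k M ==> is_kdiagram M"
  by (simp add: is_kdiagram_def is_kfunctor_def)

abbreviation TM where "TM M N X Y \<equiv> tensor_module k (fob M (Y ** X)) (fob N Y)"
abbreviation PT where "PT M N X Y \<equiv> pure_tensor k (fob M (Y ** X)) (fob N Y)"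

text \<open>The class of the elementary tensor of \<open>a\<close> and \<open>v\<close> in the
  summand of the coend indexed by \<open>Y\<close>.\<close>

definition mt :: "('k, 'm) kfctr => ('k, 'n) kfctr => zero_cell => zero_cell => 'm => 'n => ('k, 'm, 'n) mtensor" where
  "mt M N X Y a v = mtensor_in k M N X Y (PT M N X Y a v)"

lemma mtensor_fob [simp]: "fob (mtensor k M N) X = mtensor_ob k M N X"
  by (simp add: mtensor_def)

definition dinatural :: "('k, 'm) kfctr => ('k, 'n) kfctr => zero_cell => ('k, 'q) module => (zero_cell => 'm => 'n => 'q) => bool" where
  "dinatural M N X Q h \<longleftrightarrow>
     (ALL Y. zc Y --> bilinear_map (fob M (Y ** X)) (fob N Y) Q (h Y)) &
     (ALL f:ar SpC. ALL a:el M (scod f ** X). ALL v:el N (sdom f).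
        h (sdom f) (far M (s_times (s_op f) (idn SpC X)) a) v = h (scod f) a (far N f v))"

context
  fixes M :: "('k, 'm) kfctr" and N :: "('k, 'n) kfctr" and X
  assumes M: "is_kdiagram M" and N: "is_kdiagram N" and X: "zc X"
begin

lemma tensor_left_right:
  assumes f: "f : ar SpC"
  shows "bi_left (day_bifctr k M N X) f (sdom f) : lin k (tensor_module k (fob M (scod f ** X)) (fob N (sdom f)))
      (TM M N X (sdom f))" (is ?A)
    and "a : el M (scod f ** X) ==> v : el N (sdom f) ==>
      bi_left (day_bifctr k M N X) f (sdom f) (pure_tensor k (fob M (scod f ** X)) (fob N (sdom f)) a v) =
      PT M N X (sdom f) (far M (s_times (s_op f) (idn SpC X)) a) v" (is "PROP ?B")
    and "bi_right (day_bifctr k M N X) (scod f) f : lin k (tensor_module k (fob M (scod f ** X)) (fob N (sdom f)))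
      (TM M N X (scod f))" (is ?C)
    and "a : el M (scod f ** X) ==> v : el N (sdom f) ==>
      bi_right (day_bifctr k M N X) (scod f) f (pure_tensor k (fob M (scod f ** X)) (fob N (sdom f)) a v) =
      PT M N X (scod f) a (far N f v)" (is "PROP ?D")
proof -
  note z = ar_SpC_ob[OF f]
  note m = kdD(1)[OF M zc_prod[OF z(1) X]] kdD(1)[OF M zc_prod[OF z(2) X]]
    kdD(1)[OF N z(1)] kdD(1)[OF N z(2)]
  have l: "far M (s_times (s_op f) (idn SpC X)) : lin k (fob M (scod f ** X)) (fob M (sdom f ** X))"
    using kdD(2)[OF M, of "s_times (s_op f) (idn SpC X)"] f X by simp
  show ?A "PROP ?B" ?C "PROP ?D"
    using tensor_map_id_right[OF m(2,3,1) l] tensor_map_id_left[OF m(2,3,4) kdD(2)[OF N f]] by (simp_all add: day_bifctr_def)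
qed

lemma day_ob: "bi_ob (day_bifctr k M N X) Y Z = tensor_module k (fob M (Y ** X)) (fob N Z)"
  by (simp add: day_bifctr_def)

lemma day_is_bifctr: "is_bifctr SpC (day_bifctr k M N X)"
  unfolding is_bifctr_def day_ob SpC_simps
  using tensor_left_right(1,3) ar_SpC_ob tm_mod[OF kdD(1)[OF M] kdD(1)[OF N]] X by simp

lemma mt_mod: "module k (mtensor_ob k M N X)"
  unfolding mtensor_ob_def by (rule coend_module[OF day_is_bifctr])

lemma mtensor_in_linear:
  assumes Y: "zc Y"
  shows "restrict (mtensor_in k M N X Y) (carrier (TM M N X Y)) :
    lin k (TM M N X Y) (mtensor_ob k M N X)"
  using coend_in_linear[OF day_is_bifctr, of Y] Y unfolding mtensor_ob_def mtensor_in_def day_ob by simp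

lemma mt_bilinear:
  assumes Y: "zc Y"
  shows "bilinear_map (fob M (Y ** X)) (fob N Y) (mtensor_ob k M N X) (mt M N X Y)"
proof -
  note m = kdD(1)[OF M zc_prod[OF Y X]] kdD(1)[OF N Y]
  let ?T = "TM M N X Y"
  note l = linD[OF mtensor_in_linear[OF Y]]
  note pc = pure_tensor_closed[OF m] and pb = pure_tensor_bilinear[OF m]
  interpret M: module k "fob M (Y ** X)" by (rule m(1))
  interpret N: module k "fob N Y" by (rule m(2))
  interpret T: module k ?T by (rule tm_mod[OF m])
  have r: "mt M N X Y a v = restrict (mtensor_in k M N X Y) (carrier ?T) (PT M N X Y a v)"
    if "a : el M (Y ** X)" "v : el N Y" for a v
    using pc[OF that] by (simp add: mt_def)
  show ?thesis
    unfolding bilinear_map_def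
  proof (intro conjI ballI)
    fix u v assume h: "u : el M (Y ** X)" "v : el N Y"
    show "mt M N X Y u v : carrier (mtensor_ob k M N X)" unfolding r[OF h] by (rule l(1)[OF pc[OF h]])
    show "mt M N X Y (u +[fob M (Y ** X)] u') v = mt M N X Y u v +[mtensor_ob k M N X] mt M N X Y u' v"
      if h': "u' : el M (Y ** X)" for u'
      using r[OF M.a_closed[OF h(1) h'] h(2)] r[OF h] r[OF h' h(2)] pb(1)[OF k.one_closed h(1) h' h(2) h(2)] l(3)[OF pc[OF h] pc[OF h' h(2)]] by simp
    show "mt M N X Y u (v +[fob N Y] v') = mt M N X Y u v +[mtensor_ob k M N X] mt M N X Y u v'"
      if h': "v' : el N Y" for v'
      using r[OF h(1) N.a_closed[OF h(2) h']] r[OF h] r[OF h(1) h'] pb(2)[OF k.one_closed h(1) h(1) h(2) h'] l(3)[OF pc[OF h] pc[OF h(1) h']] by simp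
  next
    fix c u v assume c: "c : carrier k" and h: "u : el M (Y ** X)" "v : el N Y"
    show "mt M N X Y (c .[fob M (Y ** X)] u) v = c .[mtensor_ob k M N X] mt M N X Y u v"
      using r[OF M.smult_closed[OF c h(1)] h(2)] r[OF h] pb(3)[OF c h(1) h(1) h(2) h(2)] l(4)[OF c pc[OF h]] by simp
    show "mt M N X Y u (c .[fob N Y] v) = c .[mtensor_ob k M N X] mt M N X Y u v"
      using r[OF h(1) N.smult_closed[OF c h(2)]] r[OF h] pb(4)[OF c h(1) h(1) h(2) h(2)] l(4)[OF c pc[OF h]] by simp
  qed
qed

lemma mt_closed: "zc Y ==> a : el M (Y ** X) ==> v : el N Y ==> mt M N X Y a v : carrier (mtensor_ob k M N X)"
  using bilinD(1)[OF mt_bilinear] .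

lemma mt_wedge:
  assumes f: "f : ar SpC" and a: "a : el M (scod f ** X)" and v: "v : el N (sdom f)"
  shows "mt M N X (sdom f) (far M (s_times (s_op f) (idn SpC X)) a) v = mt M N X (scod f) a (far N f v)"
proof -
  note z = ar_SpC_ob[OF f]
  note m = kdD(1)[OF M zc_prod[OF z(2) X]] kdD(1)[OF N z(1)]
  from coend_in_wedge[OF day_is_bifctr f, unfolded day_ob SpC_simps, OF pure_tensor_closed[OF m a v]]
  show ?thesis unfolding tensor_left_right(2)[OF f a v] tensor_left_right(4)[OF f a v] by (simp add: mt_def mtensor_in_def)
qed

text \<open>The counterpart of \<open>presented_lift_eqI\<close>: compatibility with the coend
  relators is inherited from \<open>g\<close>.\<close>

lemma mtensor_lift_eqI:
  assumes Q: "module k Q" and g: "g : lin k (mtensor_ob k M N X) Q"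
    and H: "!!Y. zc Y ==> restrict (H Y) (carrier (TM M N X Y)) :
      lin k (TM M N X Y) Q"
    and e: "!!Y a v. zc Y ==> a : el M (Y ** X) ==> v : el N Y ==>
      H Y (PT M N X Y a v) = g (mt M N X Y a v)"
  shows "mtensor_lift k M N X Q H = g"
  unfolding mtensor_lift_def
proof (rule coend_lift_eqI[OF day_is_bifctr Q g[unfolded mtensor_ob_def]])
  fix Y t assume Y: "Y : ob SpC" and t: "t : carrier (bi_ob (day_bifctr k M N X) Y Y)"
  have Y: "zc Y" using Y by simp
  note m = kdD(1)[OF M zc_prod[OF Y X]] kdD(1)[OF N Y]
  let ?T = "TM M N X Y"
  have "restrict (H Y) (carrier ?T) = compose (carrier ?T) g (restrict (mtensor_in k M N X Y) (carrier ?T))"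
  proof (rule tensor_ext[OF m Q H[OF Y] lin_comp[OF tm_mod[OF m] mtensor_in_linear[OF Y] g]])
    fix u v assume h: "u : el M (Y ** X)" "v : el N Y"
    show "restrict (H Y) (carrier ?T) (PT M N X Y u v) =
       compose (carrier ?T) g (restrict (mtensor_in k M N X Y) (carrier ?T)) (PT M N X Y u v)"
      using e[OF Y h] pure_tensor_closed[OF m h] by (simp add: mt_def compose_def)
  qed
  from fun_cong[OF this, of t] show "H Y t = g (coend_in k SpC (day_bifctr k M N X) Y t)"
    using t unfolding day_ob by (simp add: compose_def mtensor_in_def)
qed

text \<open>Both maps are the lift of one formula, the values of \<open>g\<close> on elementary
  tensors.\<close>

lemma mt_ext:
  assumes Q: "module k Q" and f: "f : lin k (mtensor_ob k M N X) Q" and g: "g : lin k (mtensor_ob k M N X) Q"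
    and e: "!!Y a v. zc Y ==> a : el M (Y ** X) ==> v : el N Y ==> f (mt M N X Y a v) = g (mt M N X Y a v)"
  shows "f = g"
proof -
  let ?H = "%Y. tensor_lift k (fob M (Y ** X)) (fob N Y) Q (%a v. g (mt M N X Y a v))"
  have b: "bilinear_map (fob M (Y ** X)) (fob N Y) Q (%a v. g (mt M N X Y a v))" if Y: "zc Y" for Y
    using bilinD[OF mt_bilinear[OF Y]] linD[OF g] by (simp add: bilinear_map_def)
  have t: "?H Y : lin k (TM M N X Y) Q"
    and tv: "!!a v. a : el M (Y ** X) ==> v : el N Y ==> ?H Y (PT M N X Y a v) = g (mt M N X Y a v)"
    if Y: "zc Y" for Y
    using tensor_lift_linear[OF kdD(1)[OF M zc_prod[OF Y X]] kdD(1)[OF N Y] Q b[OF Y]] by auto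
  have r: "restrict (?H Y) (carrier (TM M N X Y)) : lin k (TM M N X Y) Q"
    if Y: "zc Y" for Y
    using t[OF Y] extensional_restrict[OF linD(2)[OF t[OF Y]]] by simp
  have "mtensor_lift k M N X Q ?H = f" by (rule mtensor_lift_eqI[OF Q f r]) (simp_all add: tv e)
  moreover have "mtensor_lift k M N X Q ?H = g" by (rule mtensor_lift_eqI[OF Q g r]) (simp_all add: tv)
  ultimately show ?thesis by simp
qed

lemma mt_lift:
  assumes Q: "module k Q" and h: "dinatural M N X Q h"
  shows "mtensor_lift k M N X Q (%Y. tensor_lift k (fob M (Y ** X)) (fob N Y) Q (h Y)) : lin k (mtensor_ob k M N X) Q"
    and "zc Y ==> a : el M (Y ** X) ==> v : el N Y ==>
      mtensor_lift k M N X Q (%Y. tensor_lift k (fob M (Y ** X)) (fob N Y) Q (h Y)) (mt M N X Y a v) = h Y a v"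
proof -
  let ?H = "%Y. tensor_lift k (fob M (Y ** X)) (fob N Y) Q (h Y)"
  have b: "bilinear_map (fob M (Y ** X)) (fob N Y) Q (h Y)" if "zc Y" for Y using h that by (simp add: dinatural_def)
  have t: "?H Y : lin k (TM M N X Y) Q"
    and tv: "!!a v. a : el M (Y ** X) ==> v : el N Y ==> ?H Y (PT M N X Y a v) = h Y a v"
    if Y: "zc Y" for Y
    using tensor_lift_linear[OF kdD(1)[OF M zc_prod[OF Y X]] kdD(1)[OF N Y] Q b[OF Y]] by auto
  have "is_cowedge SpC (day_bifctr k M N X) Q ?H"
    unfolding is_cowedge_def day_ob SpC_simps
  proof (intro conjI ballI)
    fix Y assume "Y : {P. zc P}" then show "?H Y : lin k (TM M N X Y) Q" using t by simp
  next
    fix f t' assume f: "f : ar SpC" and t': "t' : carrier (tensor_module k (fob M (scod f ** X)) (fob N (sdom f)))"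
    note z = ar_SpC_ob[OF f]
    note m = kdD(1)[OF M zc_prod[OF z(2) X]] kdD(1)[OF N z(1)]
    let ?T = "tensor_module k (fob M (scod f ** X)) (fob N (sdom f))"
    have l: "far M (s_times (s_op f) (idn SpC X)) : lin k (fob M (scod f ** X)) (fob M (sdom f ** X))"
      using kdD(2)[OF M, of "s_times (s_op f) (idn SpC X)"] f X by simp
    note T = tm_mod[OF m] and lr = tensor_left_right[OF f]
    have "compose (carrier ?T) (?H (sdom f)) (bi_left (day_bifctr k M N X) f (sdom f)) = compose (carrier ?T) (?H (scod f)) (bi_right (day_bifctr k M N X) (scod f) f)"
    proof (rule tensor_ext[OF m Q lin_comp[OF T lr(1) t[OF z(1)]] lin_comp[OF T lr(3) t[OF z(2)]]])
      fix a v assume av: "a : el M (scod f ** X)" "v : el N (sdom f)"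
      show "compose (carrier ?T) (?H (sdom f)) (bi_left (day_bifctr k M N X) f (sdom f)) (pure_tensor k (fob M (scod f ** X)) (fob N (sdom f)) a v) =
        compose (carrier ?T) (?H (scod f)) (bi_right (day_bifctr k M N X) (scod f) f) (pure_tensor k (fob M (scod f ** X)) (fob N (sdom f)) a v)"
        using pure_tensor_closed[OF m av] lr(2,4)[OF av] tv[OF z(1) linD(1)[OF l av(1)] av(2)]
          tv[OF z(2) av(1) linD(1)[OF kdD(2)[OF N f] av(2)]] h f av by (simp add: compose_def dinatural_def)
    qed
    from fun_cong[OF this, of t'] t' show "?H (sdom f) (bi_left (day_bifctr k M N X) f (sdom f) t') = ?H (scod f) (bi_right (day_bifctr k M N X) (scod f) f t')"
      by (simp add: compose_def)
  qed
  note L = coend_lift_linear[OF day_is_bifctr Q this]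
  show "mtensor_lift k M N X Q ?H : lin k (mtensor_ob k M N X) Q" unfolding mtensor_lift_def mtensor_ob_def by (rule L(1))
  show "mtensor_lift k M N X Q ?H (mt M N X Y a v) = h Y a v"
    if "zc Y" "a : el M (Y ** X)" "v : el N Y"
    using L(2)[of Y, unfolded day_ob, OF _ pure_tensor_closed[OF kdD(1)[OF M zc_prod[OF _ X]] kdD(1)[OF N]]] that tv
    unfolding mtensor_lift_def mt_def mtensor_in_def by simp
qed

lemma dinaturalI:
  assumes Q: "module k Q"
    and "!!Y. zc Y ==> bilinear_map (fob M (Y ** X)) (fob N Y) Q (h Y)"
    and "!!f a v. f : ar SpC ==> a : el M (scod f ** X) ==> v : el N (sdom f) ==>
        h (sdom f) (far M (s_times (s_op f) (idn SpC X)) a) v = h (scod f) a (far N f v)"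
  shows "dinatural M N X Q h"
  using assms by (simp add: dinatural_def)

text \<open>Both levels of lifting at once: bilinearity and dinaturality of \<open>h\<close> are
  read off the linear map \<open>g\<close>. The associativity constraint is treated with it.\<close>

lemma mt_lift_tensor_eqI:
  assumes Q: "module k Q" and g: "g : lin k (mtensor_ob k M N X) Q"
    and e: "!!Y a v. zc Y ==> a : el M (Y ** X) ==> v : el N Y ==> h Y a v = g (mt M N X Y a v)"
  shows "mtensor_lift k M N X Q (%Y. tensor_lift k (fob M (Y ** X)) (fob N Y) Q (h Y)) = g"
proof -
  have b: "bilinear_map (fob M (Y ** X)) (fob N Y) Q (h Y)" if Y: "zc Y" for Y
  proof -
    interpret M: module k "fob M (Y ** X)" by (rule kdD(1)[OF M zc_prod[OF Y X]])
    interpret N: module k "fob N Y" by (rule kdD(1)[OF N Y])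
    show ?thesis using bilinD[OF mt_bilinear[OF Y]] linD[OF g] e[OF Y] by (simp add: bilinear_map_def)
  qed
  note t = tensor_lift_linear[OF kdD(1)[OF M zc_prod[OF _ X]] kdD(1)[OF N] Q b]
  show ?thesis
    by (rule mtensor_lift_eqI[OF Q g]) (use t extensional_restrict[OF linD(2)[OF t(1)]] e in simp_all)
qed

end

text \<open>Spans in the two factors of a product act independently. It makes the structure maps of
  a tensor product, which act on \<open>X\<close>, respect the wedge relation, which acts on
  \<open>Y\<close>.\<close>

lemma interchange:
  assumes M: "is_kfunctor k M" and f: "f : ar SpC" and s: "s : ar SpC" and a: "a : el M (sdom f ** sdom s)"
  shows "far M (s_times f (idn SpC (scod s))) (far M (s_times (idn SpC (sdom f)) s) a) =
    far M (s_times (idn SpC (scod f)) s) (far M (s_times f (idn SpC (sdom s))) a)"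
proof -
  note z = ar_SpC_ob[OF f] ar_SpC_ob[OF s]
  have "s_times f (idn SpC (scod s)) o[SpC] s_times (idn SpC (sdom f)) s = s_times (f o[SpC] idn SpC (sdom f)) (idn SpC (scod s) o[SpC] s)"
    by (rule s_times_comp[symmetric]) (use f s z in simp_all)
  also have "... = s_times (idn SpC (scod f) o[SpC] f) (s o[SpC] idn SpC (sdom s))" by (simp add: SpC_id_left SpC_id_right f s)
  also have "... = s_times (idn SpC (scod f)) s o[SpC] s_times f (idn SpC (sdom s))"
    by (rule s_times_comp) (use f s z in simp_all)
  finally have e: "s_times f (idn SpC (scod s)) o[SpC] s_times (idn SpC (sdom f)) s = s_times (idn SpC (scod f)) s o[SpC] s_times f (idn SpC (sdom s))" .
  have "far M (s_times f (idn SpC (scod s))) (far M (s_times (idn SpC (sdom f)) s) a) = far M (s_times f (idn SpC (scod s)) o[SpC] s_times (idn SpC (sdom f)) s) a"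
    by (rule kfD(4)[OF M, symmetric]) (use f s z a in simp_all)
  also have "... = far M (s_times (idn SpC (scod f)) s) (far M (s_times f (idn SpC (sdom s))) a)"
    unfolding e by (rule kfD(4)[OF M]) (use f s z a in simp_all)
  finally show ?thesis .
qed

lemma mtensor_far:
  assumes M: "is_kfunctor k M" and N: "is_kdiagram N" and s: "s : ar SpC"
  shows "far (mtensor k M N) s : lin k (mtensor_ob k M N (sdom s)) (mtensor_ob k M N (scod s))"
    and "zc Y ==> a : el M (Y ** sdom s) ==> v : el N Y ==>
      far (mtensor k M N) s (mt M N (sdom s) Y a v) = mt M N (scod s) Y (far M (s_times (idn SpC Y) s) a) v"
proof -
  note M' = kf_kd[OF M] and z = ar_SpC_ob[OF s]
  let ?X = "sdom s" and ?X' = "scod s"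
  let ?Q = "mtensor_ob k M N ?X'"
  note Q = mt_mod[OF M' N z(2)] and B = mt_bilinear[OF M' N z(2)]
  have l: "far M (s_times (idn SpC Y) s) : lin k (fob M (Y ** ?X)) (fob M (Y ** ?X'))" if "zc Y" for Y
    using kdD(2)[OF M', of "s_times (idn SpC Y) s"] s that by simp
  define h where "h = (%Y a v. mt M N ?X' Y (far M (s_times (idn SpC Y) s) a) v)"
  have "dinatural M N ?X ?Q h"
  proof (rule dinaturalI[OF M' N z(1) Q])
    fix Y assume Y: "zc Y"
    show "bilinear_map (fob M (Y ** ?X)) (fob N Y) ?Q (h Y)"
      using bilinD[OF B[OF Y]] linD[OF l[OF Y]] by (simp add: bilinear_map_def h_def)
  next
    fix f a v assume f: "f : ar SpC" and a: "a : el M (scod f ** ?X)" and v: "v : el N (sdom f)"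
    note y = ar_SpC_ob[OF f]
    show "h (sdom f) (far M (s_times (s_op f) (idn SpC ?X)) a) v = h (scod f) a (far N f v)"
      using mt_wedge[OF M' N z(2) f linD(1)[OF l[OF y(2)] a] v] interchange[OF M s_op_in(1)[OF f] s] f a by (simp add: h_def)
  qed
  note L = mt_lift[OF M' N z(1) Q this]
  let ?g = "mtensor_lift k M N ?X ?Q (%Y. tensor_lift k (fob M (Y ** ?X)) (fob N Y) ?Q (h Y))"
  have "far (mtensor k M N) s = ?g"
    unfolding mtensor_def kfctr.simps
  proof (rule mtensor_lift_eqI[OF M' N z(1) Q L(1)])
    fix Y assume Y: "zc Y"
    note m = kdD(1)[OF M' zc_prod[OF Y z(1)]] kdD(1)[OF M' zc_prod[OF Y z(2)]] kdD(1)[OF N Y]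
    let ?T = "TM M N ?X Y" and ?T' = "TM M N ?X' Y"
    let ?t = "tensor_map k (fob M (Y ** ?X)) (fob N Y) (fob M (Y ** ?X')) (fob N Y) (far M (s_times (idn SpC Y) s)) (%v. v)"
    note t = tensor_map_id_right[OF m(1,3,2) l[OF Y]]
    have "restrict (%t. mtensor_in k M N ?X' Y (?t t)) (carrier ?T) = compose (carrier ?T) (restrict (mtensor_in k M N ?X' Y) (carrier ?T')) ?t"
      by (rule ext) (simp add: compose_def restrict_def linD(1)[OF t(1)])
    also have "... : lin k ?T ?Q"
      by (rule lin_comp[OF tm_mod[OF m(1,3)] t(1) mtensor_in_linear[OF M' N z(2) Y]])
    finally show "restrict (%t. mtensor_in k M N ?X' Y (?t t)) (carrier ?T) : lin k ?T ?Q" .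
    fix a v assume av: "a : el M (Y ** ?X)" "v : el N Y"
    show "mtensor_in k M N ?X' Y (?t (PT M N ?X Y a v)) = ?g (mt M N ?X Y a v)"
      using t(2)[OF av] L(2)[OF Y av] by (simp add: h_def mt_def)
  qed
  then show "far (mtensor k M N) s : lin k (mtensor_ob k M N ?X) ?Q"
    "zc Y ==> a : el M (Y ** ?X) ==> v : el N Y ==>
      far (mtensor k M N) s (mt M N ?X Y a v) = mt M N ?X' Y (far M (s_times (idn SpC Y) s) a) v"
    using L by (simp_all add: h_def)
qed

lemma mtensor_kdiagram:
  assumes M: "is_kfunctor k M" and N: "is_kdiagram N"
  shows "is_kdiagram (mtensor k M N)"
  by (simp add: is_kdiagram_def[of "mtensor k M N"] mt_mod[OF kf_kd[OF M] N] mtensor_far(1)[OF M N])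

section \<open>Natural transformations and their tensor products\<close>

lemma nat_transD:
  assumes "\<eta> : nat_trans k M N"
  shows "zc X ==> \<eta> X : lin k (fob M X) (fob N X)"
    and "s : ar SpC ==> x : el M (sdom s) ==> \<eta> (scod s) (far M s x) = far N s (\<eta> (sdom s) x)"
    and "\<eta> : extensional (ob SpC)"
  using assms by (auto simp: nat_trans_def PiE_iff)

lemma nat_transI:
  assumes "\<eta> : extensional (ob SpC)" "!!X. zc X ==> \<eta> X : lin k (fob M X) (fob N X)"
    "!!s x. s : ar SpC ==> x : el M (sdom s) ==> \<eta> (scod s) (far M s x) = far N s (\<eta> (sdom s) x)"
  shows "\<eta> : nat_trans k M N"
  using assms by (auto simp: nat_trans_def PiE_iff)

lemma nt_id_nat:
  assumes M: "is_kdiagram M"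
  shows "nt_id M : nat_trans k M M"
  by (rule nat_transI) (use lin_id kdD[OF M] linD(1)[OF kdD(2)[OF M]] ar_SpC_ob in "auto simp: nt_id_def")

lemma nt_comp_nat:
  assumes M: "is_kdiagram M" and \<eta>: "\<eta> : nat_trans k M N" and \<theta>: "\<theta> : nat_trans k N P"
  shows "nt_comp M \<theta> \<eta> : nat_trans k M P"
proof (rule nat_transI)
  fix X assume X: "zc X"
  show "nt_comp M \<theta> \<eta> X : lin k (fob M X) (fob P X)"
    using lin_comp[OF kdD(1)[OF M X] nat_transD(1)[OF \<eta> X] nat_transD(1)[OF \<theta> X]] X by (simp add: nt_comp_def)
next
  fix s x assume s: "s : ar SpC" and x: "x : el M (sdom s)"
  show "nt_comp M \<theta> \<eta> (scod s) (far M s x) = far P s (nt_comp M \<theta> \<eta> (sdom s) x)"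
    using nat_transD(2)[OF \<eta> s x] nat_transD(2)[OF \<theta> s linD(1)[OF nat_transD(1)[OF \<eta> ar_SpC_ob(1)[OF s]] x]]
      linD(1)[OF kdD(2)[OF M s] x] x ar_SpC_ob[OF s] by (simp add: nt_comp_def compose_def)
qed (simp add: nt_comp_def)

lemma mtensor_map_mt:
  fixes M :: "('k, 'm) kfctr" and N :: "('k, 'n) kfctr" and M' :: "('k, 'm2) kfctr" and N' :: "('k, 'n2) kfctr"
  assumes d: "is_kdiagram M" "is_kdiagram N" "is_kdiagram M'" "is_kdiagram N'"
    and \<eta>: "\<eta> : nat_trans k M M'" and \<theta>: "\<theta> : nat_trans k N N'" and X: "zc X"
  shows "mtensor_map k M N M' N' \<eta> \<theta> X : lin k (mtensor_ob k M N X) (mtensor_ob k M' N' X)"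
    and "zc Y ==> a : el M (Y ** X) ==> v : el N Y ==>
      mtensor_map k M N M' N' \<eta> \<theta> X (mt M N X Y a v) = mt M' N' X Y (\<eta> (Y ** X) a) (\<theta> Y v)"
proof -
  let ?Q = "mtensor_ob k M' N' X"
  note Q = mt_mod[OF d(3,4) X] and B = mt_bilinear[OF d(3,4) X]
  note le = nat_transD(1)[OF \<eta> zc_prod[OF _ X]] and lt = nat_transD(1)[OF \<theta>]
  define h where "h = (%Y a v. mt M' N' X Y (\<eta> (Y ** X) a) (\<theta> Y v))"
  have "dinatural M N X ?Q h"
  proof (rule dinaturalI[OF d(1,2) X Q])
    fix Y assume Y: "zc Y"
    show "bilinear_map (fob M (Y ** X)) (fob N Y) ?Q (h Y)"
      using bilinD[OF B[OF Y]] linD[OF le[OF Y]] linD[OF lt[OF Y]] by (simp add: bilinear_map_def h_def)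
  next
    fix f a v assume f: "f : ar SpC" and a: "a : el M (scod f ** X)" and v: "v : el N (sdom f)"
    note y = ar_SpC_ob[OF f]
    have "\<eta> (sdom f ** X) (far M (s_times (s_op f) (idn SpC X)) a) = far M' (s_times (s_op f) (idn SpC X)) (\<eta> (scod f ** X) a)"
      using nat_transD(2)[OF \<eta>, of "s_times (s_op f) (idn SpC X)" a] f X a by simp
    then show "h (sdom f) (far M (s_times (s_op f) (idn SpC X)) a) v = h (scod f) a (far N f v)"
      using mt_wedge[OF d(3,4) X f linD(1)[OF le[OF y(2)] a] linD(1)[OF lt[OF y(1)] v]] nat_transD(2)[OF \<theta> f v] by (simp add: h_def)
  qed
  note L = mt_lift[OF d(1,2) X Q this]
  let ?g = "mtensor_lift k M N X ?Q (%Y. tensor_lift k (fob M (Y ** X)) (fob N Y) ?Q (h Y))"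
  have "mtensor_lift k M N X ?Q (%Y t. mtensor_in k M' N' X Y (tensor_map k (fob M (Y ** X)) (fob N Y) (fob M' (Y ** X)) (fob N' Y) (\<eta> (Y ** X)) (\<theta> Y) t)) = ?g"
  proof (rule mtensor_lift_eqI[OF d(1,2) X Q L(1)])
    fix Y assume Y: "zc Y"
    note m = kdD(1)[OF d(1) zc_prod[OF Y X]] kdD(1)[OF d(2) Y] kdD(1)[OF d(3) zc_prod[OF Y X]] kdD(1)[OF d(4) Y]
    let ?T = "TM M N X Y" and ?T' = "TM M' N' X Y"
    let ?t = "tensor_map k (fob M (Y ** X)) (fob N Y) (fob M' (Y ** X)) (fob N' Y) (\<eta> (Y ** X)) (\<theta> Y)"
    note t = tensor_map_linear[OF m le[OF Y] lt[OF Y]]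
    have "restrict (%t. mtensor_in k M' N' X Y (?t t)) (carrier ?T) = compose (carrier ?T) (restrict (mtensor_in k M' N' X Y) (carrier ?T')) ?t"
      by (rule ext) (simp add: compose_def restrict_def linD(1)[OF t(1)])
    also have "... : lin k ?T ?Q"
      by (rule lin_comp[OF tm_mod[OF m(1,2)] t(1) mtensor_in_linear[OF d(3,4) X Y]])
    finally show "restrict (%t. mtensor_in k M' N' X Y (?t t)) (carrier ?T) : lin k ?T ?Q" .
    fix a v assume av: "a : el M (Y ** X)" "v : el N Y"
    show "mtensor_in k M' N' X Y (?t (PT M N X Y a v)) = ?g (mt M N X Y a v)"
      using t(2)[OF av] L(2)[OF Y av] by (simp add: h_def mt_def)
  qed
  then have "mtensor_map k M N M' N' \<eta> \<theta> X = ?g" using X by (simp add: mtensor_map_def)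
  then show "mtensor_map k M N M' N' \<eta> \<theta> X : lin k (mtensor_ob k M N X) ?Q"
    "zc Y ==> a : el M (Y ** X) ==> v : el N Y ==>
      mtensor_map k M N M' N' \<eta> \<theta> X (mt M N X Y a v) = mt M' N' X Y (\<eta> (Y ** X) a) (\<theta> Y v)"
    using L by (simp_all add: h_def)
qed

lemma mtensor_nat_transI:
  assumes M: "is_kfunctor k M" and N: "is_kdiagram N" and P: "is_kdiagram P" and e: "\<eta> : extensional (ob SpC)"
    and l: "!!X. zc X ==> \<eta> X : lin k (mtensor_ob k M N X) (fob P X)"
    and n: "!!s Y a v. s : ar SpC ==> zc Y ==> a : el M (Y ** sdom s) ==> v : el N Y ==>
      \<eta> (scod s) (mt M N (scod s) Y (far M (s_times (idn SpC Y) s) a) v) = far P s (\<eta> (sdom s) (mt M N (sdom s) Y a v))"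
  shows "\<eta> : nat_trans k (mtensor k M N) P"
proof (rule nat_transI[OF e])
  note M' = kf_kd[OF M]
  show "\<eta> X : lin k (fob (mtensor k M N) X) (fob P X)" if "zc X" for X using l[OF that] by simp
  fix s x assume s: "s : ar SpC" and x: "x : el (mtensor k M N) (sdom s)"
  note z = ar_SpC_ob[OF s] and F = mtensor_far[OF M N s]
  let ?C = "carrier (mtensor_ob k M N (sdom s))"
  note m = mt_mod[OF M' N z(1)]
  have "compose ?C (\<eta> (scod s)) (far (mtensor k M N) s) = compose ?C (far P s) (\<eta> (sdom s))"
    by (rule mt_ext[OF M' N z(1) kdD(1)[OF P z(2)] lin_comp[OF m F(1) l[OF z(2)]]
        lin_comp[OF m l[OF z(1)] kdD(2)[OF P s]]])
      (use F(2) n[OF s] mt_closed[OF M' N z(1)] in "simp add: compose_def")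
  from fun_cong[OF this, of x] x show "\<eta> (scod s) (far (mtensor k M N) s x) = far P s (\<eta> (sdom s) x)" by (simp add: compose_def)
qed

end

section \<open>The actions of the Burnside functors\<close>

text \<open>Refining the legs of a span along \<open>t\<close> and \<open>t'\<close> amounts to
  inserting an endomorphism of its apex between the backward and the forward half. Additivity and
  deflativity can then be applied at the apex.\<close>

lemma sp_sandwich:
  assumes s: "is_sp A X Y b a" and t: "oc A' A t" "oc A' A t'" "zc A'"
  shows "is_sp A' X Y (b oo t) (a oo t')"
    and "is_sp A' A A t t'" "is_sp A A Y b id_cell" "is_sp A X A id_cell a"
    and "sp A' X Y (b oo t) (a oo t') = sp A A Y b id_cell o[SpC] (sp A' A A t t' o[SpC] sp A X A id_cell a)"
proof -
  have z: "zc A" "zc X" "zc Y" "oc A Y b" "oc A X a" using s by (auto simp: is_sp_def)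
  note f = sp_factor(2,3)[OF s]
  show 1: "is_sp A' X Y (b oo t) (a oo t')"
    using z t oc_comp[OF t(3,1) z(4)] oc_comp[OF t(3,2) z(5)] by (simp add: is_sp_def)
  show 2: "is_sp A' A A t t'" using z t by (simp add: is_sp_def)
  show 3: "is_sp A A Y b id_cell" "is_sp A X A id_cell a" by (fact f)+
  have 4: "sp A' A A t t' o[SpC] sp A X A id_cell a = sp A' X A t (a oo t')"
    using sp_comp[OF 3(2) 2 bpb_id[OF z(1) t(3,2)]] by simp
  have 5: "is_sp A' X A t (a oo t')" using z t oc_comp[OF t(3,2) z(5)] by (simp add: is_sp_def)
  show "sp A' X Y (b oo t) (a oo t') = sp A A Y b id_cell o[SpC] (sp A' A A t t' o[SpC] sp A X A id_cell a)"
    unfolding 4 using sp_comp[OF 5 3(1) bpb_sym[OF bpb_id[OF z(1) t(3,1)]]] by simp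
qed

context base_ring
begin

lemma uncurry_iso2:
  assumes z: "zc Y" "zc X" "zc A" and i: "iso2 A (Y ** X) a a'"
  shows "unc Y X A a = unc Y X A a'"
proof -
  note YX = zc_prod[OF z(1,2)]
  have "c_arr A X (snd_cell oo a) = c_arr A X (snd_cell oo a')"
    by (rule c_arr_eqI[OF z(3,2) iso2_comp[OF z(3) YX z(2) i iso2_refl[OF YX z(2) oc_snd]]])
  moreover have "c_arr A Y (fst_cell oo a) = c_arr A Y (fst_cell oo a')"
    by (rule c_arr_eqI[OF z(3,1) iso2_comp[OF z(3) YX z(1) i iso2_refl[OF YX z(1) oc_fst]]])
  ultimately show ?thesis by (simp add: unc_def sp_def)
qed

lemma far_sandwich:
  assumes M: "is_kfunctor k M" and s: "is_sp A X Y b a" and t: "oc A' A t" "oc A' A t'" "zc A'"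
    and v: "v : el M X"
  shows "far M (sp A' X Y (b oo t) (a oo t')) v =
    far M (sp A A Y b id_cell) (far M (sp A' A A t t') (far M (sp A X A id_cell a) v))"
proof -
  note S = sp_sandwich[OF s t]
  show ?thesis
    unfolding S(5) using kfD(4)[OF M _ sp_in[OF S(3)]] kfD(4)[OF M sp_in[OF S(4)] sp_in[OF S(2)]] S v by simp
qed

text \<open>The element pulled back to the apex \<open>S\<close> is decomposed there and then pushed
  forward.\<close>

lemma far_gsum:
  assumes M: "is_kfunctor k M" "is_additive M" and s: "is_sp S X Y b a" and g: "gsum A B S i j" and v: "v : el M X"
  shows "far M (sp S X Y b a) v =
    far M (sp A X Y (b oo i) (a oo i)) v +[fob M Y] far M (sp B X Y (b oo j) (a oo j)) v"
proof -
  note d = gsumD[OF g] and K = kfD[OF M(1)] and f = sp_factor[OF s]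
  let ?w = "far M (sp S X S id_cell a) v"
  have w: "?w : el M S" using linD(1)[OF K(2)[OF sp_in[OF f(3)]]] v by simp
  note I = gsum_is_sp(5,6)[OF g]
  have b: "far M (sp S S Y b id_cell) : lin k (fob M S) (fob M Y)" using K(2)[OF sp_in[OF f(2)]] by simp
  have i: "far M (sp A S S i i) ?w : el M S" "far M (sp B S S j j) ?w : el M S"
    using linD(1)[OF K(2)[OF sp_in[OF I(1)]]] linD(1)[OF K(2)[OF sp_in[OF I(2)]]] w by simp_all
  have "far M (sp S X Y b a) v = far M (sp S S Y b id_cell) ?w"
    unfolding f(1) by (rule K(4)) (use f v in simp_all)
  also have "?w = far M (sp A S S i i) ?w +[fob M S] far M (sp B S S j j) ?w"
    using M(2) g w by (simp add: is_additive_def)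
  finally show ?thesis
    using linD(3)[OF b i] far_sandwich[OF M(1) s d(4,4,1) v] far_sandwich[OF M(1) s d(5,5,2) v] by simp
qed

text \<open>The endomorphism inserted at the apex is the span of the stab-surjective
  \<open>t\<close> with itself, which a deflative \<open>M\<close> sends to the identity.\<close>

lemma far_deflate:
  assumes M: "is_kfunctor k M" "is_deflative M" and s: "is_sp A X Y b a" and t: "oc A' A t" "zc A'"
    "full A' A t" "eso A' A t" and v: "v : el M X"
  shows "far M (sp A' X Y (b oo t) (a oo t)) v = far M (sp A X Y b a) v"
proof -
  note K = kfD[OF M(1)] and f = sp_factor[OF s]
  have A: "zc A" using s by (simp add: is_sp_def)
  have w: "far M (sp A X A id_cell a) v : el M A" using linD(1)[OF K(2)[OF sp_in[OF f(3)]]] v by simp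
  have "far M (sp A' A A t t) = (\<lambda>x \<in> el M A. x)"
    using M(2) t stab_surjective_iff[OF t(2) A t(1)] A by (simp add: is_deflative_def sp_def)
  then have "far M (sp A' X Y (b oo t) (a oo t)) v = far M (sp A A Y b id_cell) (far M (sp A X A id_cell a) v)"
    using far_sandwich[OF M(1) s t(1,1,2) v] w by simp
  also have "... = far M (sp A X Y b a) v"
    unfolding f(1) by (rule K(4)[symmetric]) (use f v in simp_all)
  finally show ?thesis .
qed

text \<open>The pairing from which \<open>ell\<close> is made: at the class of \<open>a\<close> it
  is M(<a>)(v).\<close>

definition big_pair :: "('k, 'm) kfctr => zero_cell => zero_cell => 'k big_elt => 'm => 'm" where
  "big_pair M Y X w v = k0_lift k (slice CC (Y ** X)) (fob M X)
     (%a. far M (s_arr (c_snd Y X o[CC] a) (c_fst Y X o[CC] a)) v) w"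

text \<open>Carries \<open>big_pair\<close> over to \<open>Omega\<close> through the section i of p.
  For deflative \<open>M\<close> it is also compatible with p itself, see
  \<open>burn_pair_p\<close>.\<close>

definition burn_pair :: "('k, 'm) kfctr => zero_cell => zero_cell => 'k burn_elt => 'm => 'm" where
  "burn_pair M Y X w v = big_pair M Y X (Omega_i k (Y ** X) w) v"

definition burn_act :: "('k, 'm) kfctr => zero_cell => ('k, 'k burn_elt, 'm) mtensor => 'm" where
  "burn_act M = (\<lambda>X \<in> ob SpC. mtensor_lift k OM M X (fob M X)
     (%Y. tensor_lift k (Omega_ob k (Y ** X)) (fob M Y) (fob M X) (burn_pair M Y X)))"

context
  fixes M :: "('k, 'm) kfctr"
  assumes M: "is_kfunctor k M" "is_additive M"
begin

lemma uncurry_far: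
  assumes "zc Y" "zc X" "zc A" "oc A (Y ** X) a"
  shows "far M (unc Y X A a) : lin k (fob M Y) (fob M X)"
  using kfD(2)[OF M(1) sp_in[OF is_sp_unc[OF assms]]] by (simp add: unc_def)

lemma big_pair_cls:
  assumes Y: "zc Y" and X: "zc X" and v: "v : el M Y"
  shows "w : big_el (Y ** X) ==> big_pair M Y X w v : el M X"
    and "(\<lambda>w \<in> big_el (Y ** X). big_pair M Y X w v) : lin k (Omega_big_ob k (Y ** X)) (fob M X)"
    and "zc A ==> oc A (Y ** X) a ==> big_pair M Y X (big_cls (Y ** X) A a) v = far M (unc Y X A a) v"
proof -
  note YX = zc_prod[OF Y X]
  let ?h = "%a. far M (s_arr (c_snd Y X o[CC] a) (c_fst Y X o[CC] a)) v"
  have h: "?h (c_arr A (Y ** X) a) = far M (unc Y X A a) v" if a: "zc A" "oc A (Y ** X) a" for A a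
    using c_comp[OF a(1) YX X a(2) oc_snd] c_comp[OF a(1) YX Y a(2) oc_fst] by (simp add: c_snd_def c_fst_def unc_def sp_def)
  have N: "module k (fob M X)" by (rule kfD(1)[OF M(1) X])
  have 1: "?h (c_arr A (Y ** X) a) : el M X" if a: "zc A" "oc A (Y ** X) a" for A a
    unfolding h[OF a] by (rule linD(1)[OF uncurry_far[OF Y X a] v])
  have 2: "?h (c_arr A (Y ** X) (a oo t)) = ?h (c_arr A' (Y ** X) a)"
    if a: "zc A" "zc A'" "oc A' (Y ** X) a" "eqv A A' t" for A A' a t
  proof -
    note at = oc_comp[OF a(1) eqvD(1)[OF a(4)] a(3)]
    note S = is_sp_unc[OF Y X a(1) at] and S' = is_sp_unc[OF Y X a(2,3)]
    have z: "oc A X (snd_cell oo a oo t)" "oc A Y (fst_cell oo a oo t)"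
      using S by (simp_all add: is_sp_def oo_assoc)
    have "unc Y X A (a oo t) = unc Y X A' a"
      unfolding unc_def
      by (rule iffD2[OF sp_eq_iff[OF S S']])
        (use a(4) iso2_refl[OF a(1) X z(1)] iso2_refl[OF a(1) Y z(2)] in "auto simp: oo_assoc intro!: exI[of _ t]")
    then show ?thesis unfolding h[OF a(1) at] h[OF a(2,3)] by simp
  qed
  have 3: "?h (c_arr S (Y ** X) s) = ?h (c_arr A (Y ** X) (s oo i)) +[fob M X] ?h (c_arr B (Y ** X) (s oo j))"
    if g: "gsum A B S i j" and s: "oc S (Y ** X) s" for A B S i j s
  proof -
    note d = gsumD[OF g]
    show ?thesis
      unfolding h[OF d(3) s] h[OF d(1) oc_comp[OF d(1,4) s]] h[OF d(2) oc_comp[OF d(2,5) s]]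
      using far_gsum[OF M is_sp_unc[OF Y X d(3) s] g v] by (simp add: unc_def oo_assoc)
  qed
  note L = big_lift[OF N YX 1 2 3]
  have e: "(\<lambda>w \<in> big_el (Y ** X). big_pair M Y X w v) = k0_lift k (slice CC (Y ** X)) (fob M X) ?h"
    unfolding big_pair_def by (rule extensional_restrict[OF linD(2)[OF L(1)]])
  show l: "(\<lambda>w \<in> big_el (Y ** X). big_pair M Y X w v) : lin k (Omega_big_ob k (Y ** X)) (fob M X)"
    unfolding e by (rule L(1))
  show "w : big_el (Y ** X) ==> big_pair M Y X w v : el M X"
    using linD(1)[OF l] by simp
  show "zc A ==> oc A (Y ** X) a ==> big_pair M Y X (big_cls (Y ** X) A a) v = far M (unc Y X A a) v"
    unfolding big_pair_def using L(2)[of A a] h[of A a] by simp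
qed

lemma big_pair_eqI:
  assumes Y: "zc Y" and X: "zc X" and v: "v : el M Y" and Q: "module k Q"
    and f: "f : lin k (fob M X) Q" and g: "(\<lambda>w \<in> big_el (Y ** X). g w) : lin k (Omega_big_ob k (Y ** X)) Q"
    and e: "!!A a. zc A ==> oc A (Y ** X) a ==> f (far M (unc Y X A a) v) = g (big_cls (Y ** X) A a)"
    and w: "w : big_el (Y ** X)"
  shows "f (big_pair M Y X w v) = g w"
proof -
  note YX = zc_prod[OF Y X] and B = big_pair_cls[OF Y X v]
  let ?C = "big_el (Y ** X)"
  have "compose ?C f (\<lambda>w \<in> ?C. big_pair M Y X w v) = (\<lambda>w \<in> ?C. g w)"
    by (rule big_ext[OF Q lin_comp[OF Obig_mod B(2) f] g])
      (use big_cls_in[OF _ YX] B(3) e in "simp add: compose_def")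
  from fun_cong[OF this, of w] show ?thesis using w by (simp add: compose_def)
qed

text \<open>Linearity in \<open>w\<close> is that of the lift. Linearity in \<open>v\<close> is
  tested on classes, where it is linearity of M(<a>).\<close>

lemma big_pair_bilinear:
  assumes Y: "zc Y" and X: "zc X"
  shows "bilinear_map (Omega_big_ob k (Y ** X)) (fob M Y) (fob M X) (big_pair M Y X)"
proof -
  note N = kfD(1)[OF M(1)] and B = big_pair_cls[OF Y X] and YX = zc_prod[OF Y X]
  interpret X: module k "fob M X" by (rule N[OF X])
  interpret Y: module k "fob M Y" by (rule N[OF Y])
  interpret W: module k "Omega_big_ob k (Y ** X)" by (rule Obig_mod)
  let ?C = "big_el (Y ** X)"
  note l = linD[OF B(2)]
  note id = lin_id[OF N[OF X]]
  have add: "big_pair M Y X w (v +[fob M Y] v') = big_pair M Y X w v +[fob M X] big_pair M Y X w v'"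
    if h: "w : ?C" "v : el M Y" "v' : el M Y" for w v v'
  proof -
    note vv = Y.a_closed[OF h(2,3)]
    have "(\<lambda>x \<in> el M X. x) (big_pair M Y X w (v +[fob M Y] v')) = big_pair M Y X w v +[fob M X] big_pair M Y X w v'"
    proof (rule big_pair_eqI[OF Y X vv N[OF X] id _ _ h(1)])
      show "(\<lambda>w \<in> ?C. big_pair M Y X w v +[fob M X] big_pair M Y X w v') : lin k (Omega_big_ob k (Y ** X)) (fob M X)"
        by (rule linI) (use l(3,4)[OF h(2)] l(3,4)[OF h(3)] B(1)[OF h(2)] B(1)[OF h(3)] in "simp_all add: X.smult_r_distr X.a_ac")
      fix A a assume a: "zc A" "oc A (Y ** X) a"
      note u = linD[OF uncurry_far[OF Y X a]]
      show "(\<lambda>x \<in> el M X. x) (far M (unc Y X A a) (v +[fob M Y] v')) =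
        big_pair M Y X (big_cls (Y ** X) A a) v +[fob M X] big_pair M Y X (big_cls (Y ** X) A a) v'"
        using u(1,3) h vv B(3)[OF _ a] by simp
    qed
    then show ?thesis using B(1)[OF vv h(1)] by simp
  qed
  have smult: "big_pair M Y X w (c .[fob M Y] v) = c .[fob M X] big_pair M Y X w v"
    if h: "c : carrier k" "w : ?C" "v : el M Y" for c w v
  proof -
    note vv = Y.smult_closed[OF h(1,3)]
    have "(\<lambda>x \<in> el M X. x) (big_pair M Y X w (c .[fob M Y] v)) = c .[fob M X] big_pair M Y X w v"
    proof (rule big_pair_eqI[OF Y X vv N[OF X] id _ _ h(2)])
      show "(\<lambda>w \<in> ?C. c .[fob M X] big_pair M Y X w v) : lin k (Omega_big_ob k (Y ** X)) (fob M X)"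
        by (rule linI)
          (use l(3,4)[OF h(3)] B(1)[OF h(3)] h(1) in "simp_all add: X.smult_r_distr X.smult_assoc1[symmetric] k.m_comm")
      fix A a assume a: "zc A" "oc A (Y ** X) a"
      note u = linD[OF uncurry_far[OF Y X a]]
      show "(\<lambda>x \<in> el M X. x) (far M (unc Y X A a) (c .[fob M Y] v)) =
        c .[fob M X] big_pair M Y X (big_cls (Y ** X) A a) v"
        using u(1,4) h vv B(3)[OF _ a] by simp
    qed
    then show ?thesis using B(1)[OF vv h(2)] by simp
  qed
  show ?thesis
    unfolding bilinear_map_def
    using B(1) l(3,4) add smult by simp
qed

text \<open>Dinaturality in \<open>Y\<close>: by \<open>big_pre\<close> both sides are M of the
  composite of <a> with \<open>f\<close>.\<close>

lemma big_pair_pre: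
  assumes X: "zc X" and f: "f : ar SpC" and v: "v : el M (sdom f)" and w: "w : big_el (scod f ** X)"
  shows "big_pair M (sdom f) X (far OB (s_times (s_op f) (idn SpC X)) w) v = big_pair M (scod f) X w (far M f v)"
proof -
  note z = ar_SpC_ob[OF f] and N = kfD[OF M(1)]
  let ?t = "s_times (s_op f) (idn SpC X)"
  have t: "far OB ?t : lin k (Omega_big_ob k (scod f ** X)) (Omega_big_ob k (sdom f ** X))"
    using kfD(2)[OF kf_Obig, of ?t] f X by (simp add: Omega_big_fob)
  have fv: "far M f v : el M (scod f)" by (rule linD(1)[OF N(2)[OF f] v])
  note B = big_pair_cls[OF z(1) X v] and B' = big_pair_cls[OF z(2) X fv]
  let ?C = "big_el (scod f ** X)"
  have "(\<lambda>x \<in> el M X. x) (big_pair M (scod f) X w (far M f v)) = big_pair M (sdom f) X (far OB ?t w) v"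
  proof (rule big_pair_eqI[OF z(2) X fv N(1)[OF X] lin_id[OF N(1)[OF X]] _ _ w])
    have "compose ?C (\<lambda>w \<in> big_el (sdom f ** X). big_pair M (sdom f) X w v) (far OB ?t) =
      (\<lambda>w \<in> ?C. big_pair M (sdom f) X (far OB ?t w) v)"
      by (rule ext) (simp add: compose_def restrict_def linD(1)[OF t])
    then show "(\<lambda>w \<in> ?C. big_pair M (sdom f) X (far OB ?t w) v) : lin k (Omega_big_ob k (scod f ** X)) (fob M X)"
      using lin_comp[OF Obig_mod t B(2)] by simp
    fix A a assume a: "zc A" "oc A (scod f ** X) a"
    obtain D b where b: "zc D" "oc D (sdom f ** X) b" "unc (sdom f) X D b = unc (scod f) X A a o[SpC] f"
      "far OB ?t (big_cls (scod f ** X) A a) = big_cls (sdom f ** X) D b"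
      using big_pre[OF X a f refl refl] .
    note u = is_sp_unc[OF z(2) X a]
    have "far M (unc (scod f) X A a o[SpC] f) v = far M (unc (scod f) X A a) (far M f v)"
      by (rule N(4)[OF f]) (use u v in "simp_all add: unc_def")
    then show "(\<lambda>x \<in> el M X. x) (far M (unc (scod f) X A a) (far M f v)) =
        big_pair M (sdom f) X (far OB ?t (big_cls (scod f ** X) A a)) v"
      using b B(3)[OF b(1,2)] linD(1)[OF uncurry_far[OF z(2) X a] fv] by simp
  qed
  then show ?thesis using B'(1)[OF w] by simp
qed

text \<open>Naturality in \<open>X\<close>: by \<open>big_post\<close> both sides are M of the
  composite of \<open>s\<close> with <a>.\<close>

lemma big_pair_post:
  assumes Y: "zc Y" and s: "s : ar SpC" and v: "v : el M Y" and w: "w : big_el (Y ** sdom s)"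
  shows "big_pair M Y (scod s) (far OB (s_times (idn SpC Y) s) w) v = far M s (big_pair M Y (sdom s) w v)"
proof -
  note z = ar_SpC_ob[OF s] and N = kfD[OF M(1)]
  let ?t = "s_times (idn SpC Y) s"
  have t: "far OB ?t : lin k (Omega_big_ob k (Y ** sdom s)) (Omega_big_ob k (Y ** scod s))"
    using kfD(2)[OF kf_Obig, of ?t] s Y by (simp add: Omega_big_fob)
  note B = big_pair_cls[OF Y z(1) v] and B' = big_pair_cls[OF Y z(2) v]
  let ?C = "big_el (Y ** sdom s)"
  show ?thesis
  proof (rule big_pair_eqI[OF Y z(1) v N(1)[OF z(2)] N(2)[OF s] _ _ w, symmetric])
    have "compose ?C (\<lambda>w \<in> big_el (Y ** scod s). big_pair M Y (scod s) w v) (far OB ?t) =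
      (\<lambda>w \<in> ?C. big_pair M Y (scod s) (far OB ?t w) v)"
      by (rule ext) (simp add: compose_def restrict_def linD(1)[OF t])
    then show "(\<lambda>w \<in> ?C. big_pair M Y (scod s) (far OB ?t w) v) : lin k (Omega_big_ob k (Y ** sdom s)) (fob M (scod s))"
      using lin_comp[OF Obig_mod t B'(2)] by simp
    fix A a assume a: "zc A" "oc A (Y ** sdom s) a"
    obtain D b where b: "zc D" "oc D (Y ** scod s) b" "unc Y (scod s) D b = s o[SpC] unc Y (sdom s) A a"
      "far OB ?t (big_cls (Y ** sdom s) A a) = big_cls (Y ** scod s) D b"
      using big_post[OF Y a s refl refl] .
    note u = is_sp_unc[OF Y z(1) a]
    have "far M (s o[SpC] unc Y (sdom s) A a) v = far M s (far M (unc Y (sdom s) A a) v)"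
      by (rule N(4)[OF _ s]) (use u v in "simp_all add: unc_def")
    then show "far M s (far M (unc Y (sdom s) A a) v) = big_pair M Y (scod s) (far OB ?t (big_cls (Y ** sdom s) A a)) v"
      using b B'(3)[OF b(1,2)] by simp
  qed
qed

lemma ell_mt:
  assumes X: "zc X"
  shows "ell k M X : lin k (mtensor_ob k OB M X) (fob M X)"
    and "zc Y ==> w : big_el (Y ** X) ==> v : el M Y ==>
      ell k M X (mt OB M X Y w v) = big_pair M Y X w v"
proof -
  note N = kfD(1)[OF M(1)] and O = kf_kd[OF kf_Obig] and D = kf_kd[OF M(1)]
  have d: "dinatural OB M X (fob M X) (%Y. big_pair M Y X)"
    by (rule dinaturalI[OF O D X N[OF X]]) (use big_pair_bilinear[OF _ X] big_pair_pre[OF X] in "simp_all add: Omega_big_fob")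
  note L = mt_lift[OF O D X N[OF X] d]
  have "ell k M X = mtensor_lift k OB M X (fob M X) (%Y. tensor_lift k (fob OB (Y ** X)) (fob M Y) (fob M X) (big_pair M Y X))"
    using X by (simp add: ell_def big_pair_def[abs_def] Omega_big_fob)
  then show "ell k M X : lin k (mtensor_ob k OB M X) (fob M X)"
    "zc Y ==> w : big_el (Y ** X) ==> v : el M Y ==>
      ell k M X (mt OB M X Y w v) = big_pair M Y X w v"
    using L by (simp_all add: Omega_big_fob)
qed

context
  assumes defl: "is_deflative M"
begin

text \<open>The point where deflativity enters. Passing through p and i replaces \<open>a\<close> by
  its stabilizer map \<open>?g\<close>; up to a 2-cell \<open>a\<close> is \<open>?g oo ?s\<close>
  with \<open>?s\<close> stab-surjective, so the two spans act equally by
  \<open>far_deflate\<close>.\<close>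

lemma burn_pair_p:
  assumes Y: "zc Y" and X: "zc X" and v: "v : el M Y" and w: "w : big_el (Y ** X)"
  shows "burn_pair M Y X (Omega_p k (Y ** X) w) v = big_pair M Y X w v"
proof -
  note YX = zc_prod[OF Y X] and N = kfD(1)[OF M(1)] and B = big_pair_cls[OF Y X v]
  note p = Omega_p_big[OF YX] and i = Omega_i_class[OF YX]
  let ?C = "big_el (Y ** X)" and ?D = "burn_el (Y ** X)"
  let ?b = "\<lambda>w \<in> ?C. big_pair M Y X w v"
  have "(\<lambda>x \<in> el M X. x) (big_pair M Y X w v) = burn_pair M Y X (Omega_p k (Y ** X) w) v"
  proof (rule big_pair_eqI[OF Y X v N[OF X] lin_id[OF N[OF X]] _ _ w])
    have "compose ?C ?b (compose ?C (Omega_i k (Y ** X)) (Omega_p k (Y ** X))) = (\<lambda>w \<in> ?C. burn_pair M Y X (Omega_p k (Y ** X) w) v)"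
      by (rule ext) (simp add: compose_def restrict_def linD(1)[OF i(1)] linD(1)[OF p(1)] burn_pair_def)
    then show "(\<lambda>w \<in> ?C. burn_pair M Y X (Omega_p k (Y ** X) w) v) : lin k (Omega_big_ob k (Y ** X)) (fob M X)"
      using lin_comp[OF Obig_mod lin_comp[OF Obig_mod p(1) i(1)] B(2)] by simp
    fix A a assume a: "zc A" "oc A (Y ** X) a"
    note g = SIm_gmap[OF a(1) YX a(2)] and s = sim_cell_props[OF a(1) YX a(2)]
    note S = gmapD(1)[OF g] and g' = oc_gset[OF g]
    let ?S = "SIm A (Y ** X) a" and ?g = "gcell (SIm_map A (Y ** X) a)" and ?s = "sim_cell A (Y ** X) a"
    have "burn_pair M Y X (Omega_p k (Y ** X) (big_cls (Y ** X) A a)) v = far M (unc Y X ?S ?g) v"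
      unfolding burn_pair_def p(2)[OF a] Omega_i_burn[OF a(1) YX a(2)] by (rule B(3)[OF S g'])
    also have "... = far M (unc Y X A (?g oo ?s)) v"
      unfolding unc_def oo_assoc
      by (rule far_deflate[OF M(1) defl is_sp_unc[OF Y X S g'] s(1) a(1) s(2,3) v, symmetric])
    also have "... = far M (unc Y X A a) v" using uncurry_iso2[OF Y X a(1) s(4)] by simp
    finally show "(\<lambda>x \<in> el M X. x) (far M (unc Y X A a) v) = burn_pair M Y X (Omega_p k (Y ** X) (big_cls (Y ** X) A a)) v"
      using linD(1)[OF uncurry_far[OF Y X a] v] by simp
  qed
  then show ?thesis using B(1)[OF w] by simp
qed

lemma burn_pair_cls:
  assumes Y: "zc Y" and X: "zc X" and v: "v : el M Y" and a: "zc A" "oc A (Y ** X) a"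
  shows "burn_pair M Y X (burn_cls (Y ** X) A a) v = far M (unc Y X A a) v"
  using burn_pair_p[OF Y X v big_cls_in[OF a(1) zc_prod[OF Y X] a(2)]] Omega_p_big(2)[OF zc_prod[OF Y X] a] big_pair_cls(3)[OF Y X v a] by simp

lemma burn_pair_bilinear:
  assumes Y: "zc Y" and X: "zc X"
  shows "bilinear_map (Omega_ob k (Y ** X)) (fob M Y) (fob M X) (burn_pair M Y X)"
  using bilinD[OF big_pair_bilinear[OF Y X]] linD[OF Omega_i_class(1)[OF zc_prod[OF Y X]]]
  by (simp add: bilinear_map_def burn_pair_def)

text \<open>Trades a structure map of \<open>OM\<close> for one of \<open>OB\<close>, so that
  dinaturality and naturality of \<open>burn_pair\<close> follow from \<open>big_pair_pre\<close>
  and \<open>big_pair_post\<close>.\<close>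

lemma burn_pair_far:
  assumes s: "s : ar SpC" "sdom s = Y ** X" "scod s = Y' ** X'" and z: "zc Y" "zc X" "zc Y'" "zc X'"
    and w: "w : burn_el (Y ** X)" and v: "v : el M Y'"
  shows "burn_pair M Y' X' (far OM s w) v = big_pair M Y' X' (far OB s (Omega_i k (Y ** X) w)) v"
proof -
  note YX = zc_prod[OF z(1,2)]
  note i = linD(1)[OF Omega_i_class(1)[OF YX] w]
  have f: "far OB s (Omega_i k (Y ** X) w) : big_el (Y' ** X')"
    using linD(1)[OF kfD(2)[OF kf_Obig s(1)]] i s by (simp add: Omega_big_fob)
  show ?thesis using Omega_p_natural[OF s(1), of "Omega_i k (Y ** X) w"] i s Omega_p_i[OF YX w] burn_pair_p[OF z(3,4) v f] by simp
qed

lemma burn_act_mt: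
  assumes X: "zc X"
  shows "burn_act M X : lin k (mtensor_ob k OM M X) (fob M X)"
    and "zc Y ==> w : burn_el (Y ** X) ==> v : el M Y ==>
      burn_act M X (mt OM M X Y w v) = burn_pair M Y X w v"
proof -
  note N = kfD[OF M(1)] and O = kf_kd[OF kf_Om] and D = kf_kd[OF M(1)]
  have d: "dinatural OM M X (fob M X) (%Y. burn_pair M Y X)"
  proof (rule dinaturalI[OF O D X N(1)[OF X]])
    fix Y assume "zc Y" then show "bilinear_map (fob OM (Y ** X)) (fob M Y) (fob M X) (burn_pair M Y X)"
      using burn_pair_bilinear[OF _ X] by (simp add: Omega_fob)
  next
    fix f w v assume h: "f : ar SpC" "w : el OM (scod f ** X)" "v : el M (sdom f)"
    note z = ar_SpC_ob[OF h(1)]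
    have w: "w : burn_el (scod f ** X)" using h(2) by (simp add: Omega_fob)
    show "burn_pair M (sdom f) X (far OM (s_times (s_op f) (idn SpC X)) w) v = burn_pair M (scod f) X w (far M f v)"
      using burn_pair_far[of "s_times (s_op f) (idn SpC X)" "scod f" X "sdom f" X w v] h X z w
        big_pair_pre[OF X h(1,3) linD(1)[OF Omega_i_class(1)[OF zc_prod[OF z(2) X]] w]] by (simp add: burn_pair_def)
  qed
  note L = mt_lift[OF O D X N(1)[OF X] d]
  show "burn_act M X : lin k (mtensor_ob k OM M X) (fob M X)"
    "zc Y ==> w : burn_el (Y ** X) ==> v : el M Y ==>
      burn_act M X (mt OM M X Y w v) = burn_pair M Y X w v"
    using L X by (simp_all add: Omega_fob burn_act_def)
qed

lemma burn_act_nat: "burn_act M : nat_trans k (mtensor k OM M) M"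
proof (rule mtensor_nat_transI[OF kf_Om kf_kd[OF M(1)] kf_kd[OF M(1)] _ burn_act_mt(1)])
  fix s Y a v assume h: "s : ar SpC" "zc Y" "a : el OM (Y ** sdom s)" "v : el M Y"
  note z = ar_SpC_ob[OF h(1)]
  let ?t = "s_times (idn SpC Y) s"
  have a: "a : burn_el (Y ** sdom s)" using h(3) by (simp add: Omega_fob)
  have "far OM ?t a : burn_el (Y ** scod s)"
    using linD(1)[OF kfD(2)[OF kf_Om, of ?t], of a] h by (simp add: Omega_fob)
  then show "burn_act M (scod s) (mt OM M (scod s) Y (far OM ?t a) v) = far M s (burn_act M (sdom s) (mt OM M (sdom s) Y a v))"
    using burn_act_mt(2)[OF z(2) h(2) _ h(4)] burn_act_mt(2)[OF z(1) h(2) a h(4)]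
      burn_pair_far[of ?t Y "sdom s" Y "scod s" a v] h z a
      big_pair_post[OF h(2,1,4) linD(1)[OF Omega_i_class(1)[OF zc_prod[OF h(2) z(1)]] a]] by (simp add: burn_pair_def)
qed (auto simp: burn_act_def extensional_def)

lemma burn_act_unit:
  "nt_comp (mtensor k OB M) (burn_act M) (mtensor_map k OB M OM M (Omega_p k) (nt_id M)) = ell k M"
proof -
  note D = kf_kd[OF M(1)] and O = kf_kd[OF kf_Om] and B = kf_kd[OF kf_Obig]
  let ?m = "mtensor_map k OB M OM M (Omega_p k) (nt_id M)"
  note m = mtensor_map_mt[OF B D O D Omega_p_nat nt_id_nat[OF D]]
  have eq: "compose (carrier (mtensor_ob k OB M X)) (burn_act M X) (?m X) = ell k M X" if X: "zc X" for X
  proof (rule mt_ext[OF B D X kfD(1)[OF M(1) X]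
      lin_comp[OF mt_mod[OF B D X] m(1)[OF X] burn_act_mt(1)[OF X]] ell_mt(1)[OF X]])
    fix Y w v assume h: "zc Y" "w : el OB (Y ** X)" "v : el M Y"
    have w: "w : big_el (Y ** X)" using h(2) by (simp add: Omega_big_fob)
    note pw = linD(1)[OF Omega_p_big(1)[OF zc_prod[OF h(1) X]] w]
    show "compose (carrier (mtensor_ob k OB M X)) (burn_act M X) (?m X) (mt OB M X Y w v) = ell k M X (mt OB M X Y w v)"
      using mt_closed[OF B D X h] m(2)[OF X h] h(1,3) burn_act_mt(2)[OF X h(1) pw h(3)] burn_pair_p[OF h(1) X h(3) w] ell_mt(2)[OF X h(1) w h(3)]
      by (simp add: compose_def nt_id_def)
  qed
  then have "compose (carrier (mtensor_ob k OB M X)) (burn_act M X) (?m X) = ell k M X" if "X : ob SpC" for X using that by simp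
  then show ?thesis
    by (intro extensionalityI[of _ "ob SpC"]) (simp_all add: nt_comp_def ell_def[abs_def])
qed

end

end

text \<open>Every elementary tensor is in the image of p tensored with \<open>M\<close>, because
  \<open>w\<close> is p of \<open>Omega_i k (Y ** X) w\<close>.\<close>

lemma Omega_tensor_unique:
  assumes M: "is_kdiagram M" and P: "is_kdiagram P"
    and \<phi>: "\<phi> : nat_trans k (mtensor k OM M) P" and \<psi>: "\<psi> : nat_trans k (mtensor k OM M) P"
    and e: "nt_comp (mtensor k OB M) \<phi> (mtensor_map k OB M OM M (Omega_p k) (nt_id M)) =
      nt_comp (mtensor k OB M) \<psi> (mtensor_map k OB M OM M (Omega_p k) (nt_id M))"
  shows "\<phi> = \<psi>"
proof (rule extensionalityI[OF nat_transD(3)[OF \<phi>] nat_transD(3)[OF \<psi>]])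
  fix X assume "X : ob SpC"
  then have X: "zc X" by simp
  note O = kf_kd[OF kf_Om] and B = kf_kd[OF kf_Obig]
  note m = mtensor_map_mt[OF B M O M Omega_p_nat nt_id_nat[OF M] X]
  show "\<phi> X = \<psi> X"
  proof (rule mt_ext[OF O M X kdD(1)[OF P X] nat_transD(1)[OF \<phi> X, simplified] nat_transD(1)[OF \<psi> X, simplified]])
    fix Y w v assume h: "zc Y" "w : el OM (Y ** X)" "v : el M Y"
    note YX = zc_prod[OF h(1) X]
    have w: "w : burn_el (Y ** X)" using h(2) by (simp add: Omega_fob)
    have i: "Omega_i k (Y ** X) w : el OB (Y ** X)"
      using linD(1)[OF Omega_i_class(1)[OF YX] w] by (simp add: Omega_big_fob)
    have "mtensor_map k OB M OM M (Omega_p k) (nt_id M) X (mt OB M X Y (Omega_i k (Y ** X) w) v) = mt OM M X Y w v"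
      using m(2)[OF h(1) i h(3)] Omega_p_i[OF YX w] h by (simp add: nt_id_def)
    moreover from fun_cong[OF fun_cong[OF e, of X], of "mt OB M X Y (Omega_i k (Y ** X) w) v"]
    have "\<phi> X (mtensor_map k OB M OM M (Omega_p k) (nt_id M) X (mt OB M X Y (Omega_i k (Y ** X) w) v)) =
      \<psi> X (mtensor_map k OB M OM M (Omega_p k) (nt_id M) X (mt OB M X Y (Omega_i k (Y ** X) w) v))"
      using X mt_closed[OF B M X h(1) i h(3)] by (simp add: nt_comp_def compose_def)
    ultimately show "\<phi> X (mt OM M X Y w v) = \<psi> X (mt OM M X Y w v)" by simp
  qed
qed

text \<open>\<open>Omega_mult\<close> is given by a definite description. As \<open>OM\<close> is
  deflative and additive, its own action satisfies the description;
  \<open>Omega_tensor_unique\<close> gives uniqueness.\<close>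

lemma Omega_mult_eq: "Omega_mult k = burn_act OM"
  unfolding Omega_mult_def
proof (rule the_equality)
  note A = kf_Om Omega_additive Omega_deflative
  note D = kf_kd[OF A(1)]
  show 1: "burn_act OM : nat_trans k (mtensor k OM OM) OM &
      nt_comp (mtensor k OB OM) (burn_act OM)
       (mtensor_map k OB OM OM OM (Omega_p k) (nt_id OM)) = ell k OM"
    using burn_act_nat[OF A] burn_act_unit[OF A] by blast
  fix \<mu> assume "\<mu> : nat_trans k (mtensor k OM OM) OM &
      nt_comp (mtensor k OB OM) \<mu>
       (mtensor_map k OB OM OM OM (Omega_p k) (nt_id OM)) = ell k OM"
  then show "\<mu> = burn_act OM" using 1 by (intro Omega_tensor_unique[OF D D]) simp_all
qed

lemma big_pair_natural:
  fixes M :: "('k, 'm) kfctr" and N :: "('k, 'n) kfctr"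
  assumes M: "is_kfunctor k M" "is_additive M" and N: "is_kfunctor k N" "is_additive N" and \<eta>: "\<eta> : nat_trans k M N" and Y: "zc Y" and X: "zc X"
    and v: "v : el M Y" and w: "w : big_el (Y ** X)"
  shows "\<eta> X (big_pair M Y X w v) = big_pair N Y X w (\<eta> Y v)"
proof (rule big_pair_eqI[OF M Y X v kfD(1)[OF N(1) X] nat_transD(1)[OF \<eta> X] _ _ w])
  note ev = linD(1)[OF nat_transD(1)[OF \<eta> Y] v]
  note B = big_pair_cls[OF N Y X ev]
  show "(\<lambda>w \<in> big_el (Y ** X). big_pair N Y X w (\<eta> Y v)) : lin k (Omega_big_ob k (Y ** X)) (fob N X)"
    by (rule B(2))
  fix A a assume a: "zc A" "oc A (Y ** X) a"
  show "\<eta> X (far M (unc Y X A a) v) = big_pair N Y X (big_cls (Y ** X) A a) (\<eta> Y v)"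
    using nat_transD(2)[OF \<eta> sp_in[OF is_sp_unc[OF Y X a]]] v B(3)[OF a] by (simp add: unc_def)
qed

end

section \<open>Associativity of the action\<close>

lemma pair_proj: "fst_cell oo (pair_cell a b) = a" "snd_cell oo (pair_cell a b) = b"
  by (rule oc_eqI; simp)+

lemma s_rebracket_sp:
  assumes Z: "zc Z" and Y: "zc Y" and X: "zc X"
  defines "r \<equiv> pair_cell (pair_cell fst_cell (fst_cell oo snd_cell)) (snd_cell oo snd_cell)"
  shows "s_rebracket Z Y X = sp (Z ** (Y ** X)) (Z ** (Y ** X)) ((Z ** Y) ** X) r id_cell"
    and "is_sp (Z ** (Y ** X)) (Z ** (Y ** X)) ((Z ** Y) ** X) r id_cell"
proof -
  note YX = zc_prod[OF Y X] and ZY = zc_prod[OF Z Y]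
  note P = zc_prod[OF Z YX]
  let ?P = "Z ** (Y ** X)"
  have y: "oc ?P Y (fst_cell oo snd_cell)" and x: "oc ?P X (snd_cell oo snd_cell)"
    using oc_comp[OF P oc_snd oc_fst] oc_comp[OF P oc_snd oc_snd] .
  note zy = pair_one_cell[OF oc_fst y]
  show "s_rebracket Z Y X = sp ?P ?P ((Z ** Y) ** X) r id_cell"
    using c_comp[OF P YX Y oc_snd oc_fst] c_comp[OF P YX X oc_snd oc_snd]
      c_pair_eq[OF P Z Y oc_fst y] c_pair_eq[OF P ZY X zy x]
    by (simp add: s_rebracket_def Let_def c_fst_def c_snd_def sp_def r_def)
  show "is_sp ?P ?P ((Z ** Y) ** X) r id_cell"
    using P ZY X pair_one_cell[OF zy x] by (simp add: is_sp_def r_def oc_id)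
qed

lemma s_insert_sp:
  assumes Z: "zc Z" and Y: "zc Y"
  shows "s_insert Z Y = sp (Z ** Y) Z (Y ** (Z ** Y)) (pair_cell snd_cell id_cell) fst_cell"
    and "is_sp (Z ** Y) Z (Y ** (Z ** Y)) (pair_cell snd_cell id_cell) fst_cell"
proof -
  note ZY = zc_prod[OF Z Y]
  show "s_insert Z Y = sp (Z ** Y) Z (Y ** (Z ** Y)) (pair_cell snd_cell id_cell) fst_cell"
    using c_pair_eq[OF ZY Y ZY oc_snd oc_id] by (simp add: s_insert_def c_fst_def c_snd_def sp_def)
  show "is_sp (Z ** Y) Z (Y ** (Z ** Y)) (pair_cell snd_cell id_cell) fst_cell"
    using Z Y ZY by (simp add: is_sp_def oc_id)
qed

context base_ring
begin

text \<open>The class of the diagonal. As a span the diagonal is the identity, see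
  \<open>uncurry_diag\<close>, so this class acts as a unit.\<close>

definition diag_cls :: "zero_cell => 'k burn_elt" where
  "diag_cls X = burn_cls (X ** X) X (pair_cell id_cell id_cell)"

lemma diag_one_cell: "oc X (X ** X) (pair_cell id_cell id_cell)"
  by (rule pair_one_cell[OF oc_id oc_id])

lemma uncurry_diag: "unc X X X (pair_cell id_cell id_cell) = idn SpC X"
  by (simp add: unc_def pair_proj idn_SpC)

abbreviation dg where "dg N X \<equiv> mt OM N X X (diag_cls X)"

lemma diag_cls_in: "zc X ==> diag_cls X : burn_el (X ** X)"
  unfolding diag_cls_def by (rule burn_cls_in[OF _ zc_prod diag_one_cell])

lemma dg_linear:
  assumes "zc X" "is_kdiagram N"
  shows "restrict (dg N X) (el N X) : lin k (fob N X) (mtensor_ob k OM N X)"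
proof -
  interpret X: module k "fob N X" by (rule kdD(1)[OF assms(2,1)])
  show ?thesis
    by (rule linI) (use bilinD[OF mt_bilinear[OF kf_kd[OF kf_Om] assms(2,1,1)]] diag_cls_in[OF assms(1)] in "simp_all add: Omega_fob")
qed

lemma burn_tensor_ext:
  assumes N: "is_kdiagram N" and X: "zc X" and Q: "module k Q"
    and f: "f : lin k (mtensor_ob k OM N X) Q" and g: "g : lin k (mtensor_ob k OM N X) Q"
    and e: "!!Y A a v. zc Y ==> zc A ==> oc A (Y ** X) a ==> v : el N Y ==>
      f (mt OM N X Y (burn_cls (Y ** X) A a) v) = g (mt OM N X Y (burn_cls (Y ** X) A a) v)"
  shows "f = g"
proof (rule mt_ext[OF kf_kd[OF kf_Om] N X Q f g])
  fix Y w v assume h: "zc Y" "w : el OM (Y ** X)" "v : el N Y"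
  note YX = zc_prod[OF h(1) X]
  let ?C = "burn_el (Y ** X)"
  interpret W: module k "Omega_ob k (Y ** X)" by (rule Om_mod)
  have l: "(\<lambda>w \<in> ?C. f (mt OM N X Y w v)) : lin k (Omega_ob k (Y ** X)) Q"
    if f: "f : lin k (mtensor_ob k OM N X) Q" for f
    by (rule linI)
      (use linD[OF f] bilinD[OF mt_bilinear[OF kf_kd[OF kf_Om] N X h(1)]] h(3) in "simp_all add: Omega_fob")
  have "(\<lambda>w \<in> ?C. f (mt OM N X Y w v)) = (\<lambda>w \<in> ?C. g (mt OM N X Y w v))"
    by (rule Omega_ext[OF Q l[OF f] l[OF g]]) (use e[OF h(1) _ _ h(3)] burn_cls_in[OF _ YX] in simp)
  from fun_cong[OF this, of w] show "f (mt OM N X Y w v) = g (mt OM N X Y w v)"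
    using h(2) by (simp add: Omega_fob)
qed

text \<open>The co-Yoneda identity: every elementary tensor can be moved into the summand indexed by \<open>X\<close>.\<close>

lemma mt_diag:
  assumes N: "is_kdiagram N" and X: "zc X" and Y: "zc Y" and A: "zc A" and a: "oc A (Y ** X) a"
    and v: "v : el N Y"
  shows "mt OM N X Y (burn_cls (Y ** X) A a) v = dg N X (far N (unc Y X A a) v)"
proof -
  note XX = zc_prod[OF X X] and YX = zc_prod[OF Y X]
  let ?f = "unc Y X A a"
  have f: "?f : ar SpC" "sdom ?f = Y" "scod ?f = X" using is_sp_unc[OF Y X A a] by (simp_all add: unc_def)
  let ?t = "s_times (s_op ?f) (idn SpC X)"
  obtain B b where b: "zc B" "oc B (Y ** X) b" "unc Y X B b = unc X X X (pair_cell id_cell id_cell) o[SpC] ?f"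
    "far OB ?t (big_cls (X ** X) X (pair_cell id_cell id_cell)) = big_cls (Y ** X) B b"
    using big_pre[OF X X diag_one_cell f] .
  have "unc Y X B b = ?f" using b(3) SpC_id_left[OF f(1)] f(3) by (simp add: uncurry_diag)
  from uncurry_inj[OF Y X b(1) A b(2) a this]
  have "big_cls (Y ** X) B b = big_cls (Y ** X) A a" .
  moreover have t: "?t : ar SpC" "sdom ?t = X ** X" "scod ?t = Y ** X" using f X by simp_all
  ultimately have "far OM ?t (diag_cls X) = burn_cls (Y ** X) A a"
    using Omega_p_natural[OF t(1), of "big_cls (X ** X) X (pair_cell id_cell id_cell)"] big_cls_in[OF X XX diag_one_cell]
      Omega_p_big(2)[OF XX X diag_one_cell] Omega_p_big(2)[OF YX A a] b(4) by (simp add: diag_cls_def)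
  then show ?thesis
    using mt_wedge[OF kf_kd[OF kf_Om] N X f(1), of "diag_cls X" v] f v diag_cls_in[OF X] by (simp add: Omega_fob)
qed

context
  fixes M :: "('k, 'm) kfctr"
  assumes M: "is_kfunctor k M" "is_additive M" "is_deflative M"
begin

text \<open>By \<open>mt_diag\<close> the tensor of p[a] and v equals the tensor of the diagonal
  class and M(<a>)(v), and M(<a>)(v) is exactly its image under the action. So inserting the
  diagonal class is a left inverse of the action, which is therefore injective.\<close>

lemma burn_act_diag:
  assumes X: "zc X" and u: "u : carrier (mtensor_ob k OM M X)"
  shows "dg M X (burn_act M X u) = u"
proof -
  note O = kf_kd[OF kf_Om] and D = kf_kd[OF M(1)]
  note m = mt_mod[OF O D X]
  let ?C = "carrier (mtensor_ob k OM M X)"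
  note B = bilinD[OF mt_bilinear[OF O D X X]]
  interpret X: module k "fob M X" by (rule kfD(1)[OF M(1) X])
  have l: "(\<lambda>v \<in> el M X. dg M X v) : lin k (fob M X) (mtensor_ob k OM M X)"
    by (rule linI) (use B diag_cls_in[OF X] in "simp_all add: Omega_fob")
  note ac = burn_act_mt[OF M X]
  have "compose ?C (\<lambda>v \<in> el M X. dg M X v) (burn_act M X) = (\<lambda>u \<in> ?C. u)"
  proof (rule burn_tensor_ext[OF D X m lin_comp[OF m ac(1) l] lin_id[OF m]])
    fix Y A a v assume h: "zc Y" "zc A" "oc A (Y ** X) a" "v : el M Y"
    note w = burn_cls_in[OF h(2) zc_prod[OF h(1) X] h(3)]
    have "mt OM M X Y (burn_cls (Y ** X) A a) v : ?C" by (rule mt_closed[OF O D X h(1) _ h(4)]) (use w in "simp add: Omega_fob")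
    then show "compose ?C (\<lambda>v \<in> el M X. dg M X v) (burn_act M X) (mt OM M X Y (burn_cls (Y ** X) A a) v) =
      (\<lambda>u \<in> ?C. u) (mt OM M X Y (burn_cls (Y ** X) A a) v)"
      using ac(2)[OF h(1) w h(4)] burn_pair_cls[OF M h(1) X h(4,2,3)] linD(1)[OF uncurry_far[OF M(1,2) h(1) X h(2,3)] h(4)]
        mt_diag[OF D X h] by (simp add: compose_def)
  qed
  from fun_cong[OF this, of u] u show ?thesis using linD(1)[OF ac(1) u] by (simp add: compose_def)
qed

text \<open>The same one level up: acting twice, here \<open>\<psi>\<close>, is injective, with the
  left inverse that inserts the diagonal class twice. The outer tensor factor is brought to diagonal
  form by \<open>mt_diag\<close>, the inner one by \<open>burn_act_diag\<close>.\<close>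

lemma burn_act_diag2:
  assumes X: "zc X" and t: "t : carrier (mtensor_ob k OM (mtensor k OM M) X)"
  defines "\<psi> \<equiv> (%t. burn_act M X (mtensor_map k OM (mtensor k OM M) OM M (nt_id OM) (burn_act M) X t))"
  shows "mt OM (mtensor k OM M) X X (diag_cls X) (dg M X (\<psi> t)) = t"
proof -
  note O = kf_kd[OF kf_Om] and D = kf_kd[OF M(1)]
  note E = mtensor_kdiagram[OF kf_Om D]
  let ?N = "mtensor k OM M"
  let ?C = "carrier (mtensor_ob k OM ?N X)"
  note m = mt_mod[OF O E X] and m' = mt_mod[OF O D X]
  let ?f = "mtensor_map k OM ?N OM M (nt_id OM) (burn_act M) X"
  note F = mtensor_map_mt[OF O E O D nt_id_nat[OF O] burn_act_nat[OF M] X] and ac = burn_act_mt[OF M X]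
  note dc = diag_cls_in[OF X]
  note l1 = dg_linear[OF X D] and l2 = dg_linear[OF X E, simplified]
  let ?s1 = "restrict (dg M X) (el M X)" and ?s2 = "restrict (dg ?N X) (carrier (mtensor_ob k OM M X))"
  let ?h = "compose ?C ?s2 (compose ?C ?s1 (compose ?C (burn_act M X) ?f))"
  have "?h = (\<lambda>t \<in> ?C. t)"
  proof (rule burn_tensor_ext[OF E X m lin_comp[OF m lin_comp[OF m lin_comp[OF m F(1) ac(1)] l1] l2] lin_id[OF m]])
    fix Y A a v assume h: "zc Y" "zc A" "oc A (Y ** X) a" "v : el ?N Y"
    have "far ?N (unc Y X A a) : lin k (fob ?N Y) (fob ?N X)"
      using kdD(2)[OF E sp_in[OF is_sp_unc[OF h(1) X h(2,3)]]] by (simp add: unc_def)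
    from linD(1)[OF this h(4)]
    have u: "far ?N (unc Y X A a) v : carrier (mtensor_ob k OM M X)" (is "?u : _") by simp
    note e = mt_diag[OF E X h]
    have c: "dg ?N X ?u : ?C" by (rule mt_closed[OF O E X X]) (use dc u in "simp_all add: Omega_fob")
    have f: "?f (dg ?N X ?u) = dg M X (burn_act M X ?u)"
      using F(2)[OF X, of "diag_cls X" ?u] dc u zc_prod[OF X X] by (simp add: Omega_fob nt_id_def)
    note au = linD(1)[OF ac(1) u]
    have "burn_act M X (dg M X (burn_act M X ?u)) = burn_act M X ?u"
      using burn_act_diag[OF X u] by simp
    then show "?h (mt OM ?N X Y (burn_cls (Y ** X) A a) v) = (\<lambda>t \<in> ?C. t) (mt OM ?N X Y (burn_cls (Y ** X) A a) v)"
      unfolding e using c f au burn_act_diag[OF X u] u by (simp add: compose_def)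
  qed
  from fun_cong[OF this, of t] t show ?thesis
    using linD(1)[OF ac(1) linD(1)[OF F(1) t]] linD(1)[OF l1] by (simp add: compose_def \<psi>_def)
qed

text \<open>Both sides are M of one span from \<open>Y\<close> to \<open>X\<close> applied to
  \<open>c\<close>. Its apex is \<open>S\<close>, the homotopy pullback of \<open>A\<close> and
  \<open>B\<close> over \<open>Z\<close>, which the associativity constraint reaches in two steps
  through \<open>P'\<close>.\<close>

lemma burn_pair_assoc_cls:
  assumes z: "zc Z" "zc Y" "zc X" and A: "zc A" "oc A (Z ** (Y ** X)) \<alpha>"
    and B: "zc B" "oc B Z \<beta>" and c: "c : el M Y"
  shows "burn_pair M (Z ** Y) X (far OM (s_rebracket Z Y X) (burn_cls (Z ** (Y ** X)) A \<alpha>))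
      (burn_pair M Y (Z ** Y) (far OM (s_insert Z Y) (burn_cls Z B \<beta>)) c) =
    burn_pair M Y X (burn_pair OM Z (Y ** X) (burn_cls (Z ** (Y ** X)) A \<alpha>) (burn_cls Z B \<beta>)) c"
proof -
  note ZY = zc_prod[OF z(1,2)] and YX = zc_prod[OF z(2,3)]
  note P = zc_prod[OF z(1) YX]
  let ?P = "Z ** (Y ** X)"
  define r where "r = pair_cell (pair_cell fst_cell (fst_cell oo snd_cell)) (snd_cell oo snd_cell)"
  note R = s_rebracket_sp[OF z, folded r_def] and I = s_insert_sp[OF z(1,2)]
  have r1: "oc ?P ((Z ** Y) ** X) r" using R(2) by (simp add: is_sp_def)
  note ra = oc_comp[OF A r1]
  have 1: "far OM (s_rebracket Z Y X) (burn_cls ?P A \<alpha>) = burn_cls ((Z ** Y) ** X) A (r oo \<alpha>)"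
    unfolding R(1) by (rule burn_far[OF R(2) bpb_id[OF P A]])
  obtain P' p q where P': "bpb P' (Z ** Y) B Z fst_cell \<beta> p q" using bp_bpb[OF ZY B(1) z(1) oc_fst B(2)] by blast
  note p = bpbD[OF P']
  let ?ins = "(pair_cell snd_cell id_cell) oo p"
  have 2: "far OM (s_insert Z Y) (burn_cls Z B \<beta>) = burn_cls (Y ** (Z ** Y)) P' ?ins"
    unfolding I(1) by (rule burn_far[OF I(2) P'])
  have ins: "oc P' (Y ** (Z ** Y)) ?ins"
    by (rule oc_comp[OF p(1,7) pair_one_cell[OF oc_snd oc_id]])
  let ?d = "fst_cell oo (r oo \<alpha>)"
  have d: "oc A (Z ** Y) ?d" by (rule oc_comp[OF A(1) ra oc_fst])
  obtain S w u where S: "bpb S A P' (Z ** Y) ?d p w u" using bp_bpb[OF A(1) p(1) ZY d p(7)] by blast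
  note s = bpbD[OF S]
  have fd: "fst_cell oo ?d = fst_cell oo \<alpha>" by (rule oc_eqI) (simp_all add: r_def)
  have sd: "snd_cell oo ?d = fst_cell oo (snd_cell oo \<alpha>)" by (rule oc_eqI) (simp_all add: r_def)
  have sr: "snd_cell oo (r oo \<alpha>) = snd_cell oo (snd_cell oo \<alpha>)" by (rule oc_eqI) (simp_all add: r_def)
  \<comment> \<open>Pasting turns the pullback over \<open>Z ** Y\<close> into one over
    \<open>Z\<close>, which computes the product of the two classes in \<open>Omega\<close>.\<close>
  have S': "bpb S A B Z (fst_cell oo \<alpha>) \<beta> w (q oo u)" using bpb_paste[OF P' S] unfolding fd .
  note SA = is_sp_unc[OF z(1) YX A]
  note K = kfD[OF M(1)]
  have 3: "burn_pair OM Z (Y ** X) (burn_cls ?P A \<alpha>) (burn_cls Z B \<beta>) = burn_cls (Y ** X) S (snd_cell oo \<alpha> oo w)"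
    using burn_pair_cls[OF kf_Om Omega_additive Omega_deflative z(1) YX _ A, of "burn_cls Z B \<beta>"] burn_cls_in[OF B(1) z(1) B(2)] burn_far[OF SA S']
    by (simp add: Omega_fob unc_def)
  have sw: "oc S (Y ** X) (snd_cell oo \<alpha> oo w)"
    using oc_comp[OF s(1,7) oc_comp[OF A oc_snd]] .
  note u1 = is_sp_unc[OF ZY z(3) A(1) ra] and u2 = is_sp_unc[OF z(2) ZY p(1) ins]
  have i: "burn_pair M Y (Z ** Y) (burn_cls (Y ** (Z ** Y)) P' ?ins) c = far M (unc Y (Z ** Y) P' ?ins) c"
    by (rule burn_pair_cls[OF M z(2) ZY c p(1) ins])
  note ic = linD(1)[OF uncurry_far[OF M(1,2) z(2) ZY p(1) ins] c]
  have pi: "snd_cell oo ?ins = p" "fst_cell oo ?ins = snd_cell oo p" by (rule oc_eqI; simp)+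
  have 4: "unc (Z ** Y) X A (r oo \<alpha>) o[SpC] unc Y (Z ** Y) P' ?ins = unc Y X S (snd_cell oo \<alpha> oo w)"
  proof -
    have "unc (Z ** Y) X A (r oo \<alpha>) o[SpC] unc Y (Z ** Y) P' ?ins =
      sp S Y X ((snd_cell oo (r oo \<alpha>)) oo w) (snd_cell oo p oo u)"
      unfolding unc_def using sp_comp[OF u2 u1, of S u w] bpb_sym[OF S] by (simp add: pi)
    \<comment> \<open>Over \<open>S\<close> the \<open>Y\<close>-coordinate can be read through
      \<open>P'\<close> or through \<open>A\<close>; the 2-cell of the square identifies the two as
      morphisms of \<open>CC\<close>.\<close>
    also have "c_arr S Y (snd_cell oo p oo u) = c_arr S Y (snd_cell oo ?d oo w)"
      using c_arr_eqI[OF s(1) z(2) iso2_comp[OF s(1) ZY z(2) iso2_sym[OF s(1) ZY bpb_iso2[OF S]] iso2_refl[OF ZY z(2) oc_snd]]]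
      by (simp add: oo_assoc)
    then have "sp S Y X ((snd_cell oo (r oo \<alpha>)) oo w) (snd_cell oo p oo u) =
      unc Y X S (snd_cell oo \<alpha> oo w)"
      unfolding sp_def unc_def sr sd by (simp add: oo_assoc)
    finally show ?thesis .
  qed
  have "burn_pair M (Z ** Y) X (burn_cls ((Z ** Y) ** X) A (r oo \<alpha>)) (far M (unc Y (Z ** Y) P' ?ins) c) =
    far M (unc (Z ** Y) X A (r oo \<alpha>)) (far M (unc Y (Z ** Y) P' ?ins) c)"
    by (rule burn_pair_cls[OF M ZY z(3) ic A(1) ra])
  also have "... = far M (unc Y X S (snd_cell oo \<alpha> oo w)) c"
    unfolding 4[symmetric] by (rule K(4)[symmetric]) (use u1 u2 c in "simp_all add: unc_def")
  also have "... = burn_pair M Y X (burn_cls (Y ** X) S (snd_cell oo \<alpha> oo w)) c"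
    by (rule burn_pair_cls[OF M z(2,3) c s(1) sw, symmetric])
  finally show ?thesis unfolding 1 2 3 i .
qed

text \<open>Both sides are linear in \<open>a\<close> and in \<open>b\<close>, which reduces them to
  classes one variable at a time.\<close>

lemma burn_pair_assoc:
  assumes z: "zc Z" "zc Y" "zc X" and a: "a : burn_el (Z ** (Y ** X))"
    and b: "b : burn_el Z" and c: "c : el M Y"
  shows "burn_pair M (Z ** Y) X (far OM (s_rebracket Z Y X) a) (burn_pair M Y (Z ** Y) (far OM (s_insert Z Y) b) c) =
    burn_pair M Y X (burn_pair OM Z (Y ** X) a b) c"
proof -
  note ZY = zc_prod[OF z(1,2)] and YX = zc_prod[OF z(2,3)]
  let ?P = "Z ** (Y ** X)"
  let ?r = "far OM (s_rebracket Z Y X)" and ?i = "far OM (s_insert Z Y)"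
  have r: "?r : lin k (Omega_ob k ?P) (Omega_ob k ((Z ** Y) ** X))"
    unfolding s_rebracket_sp(1)[OF z] using Omega_far_linear[OF sp_in[OF s_rebracket_sp(2)[OF z]]] by simp
  have i: "?i : lin k (Omega_ob k Z) (Omega_ob k (Y ** (Z ** Y)))"
    unfolding s_insert_sp(1)[OF z(1,2)] using Omega_far_linear[OF sp_in[OF s_insert_sp(2)[OF z(1,2)]]] by simp
  note B1 = bilinD[OF burn_pair_bilinear[OF M ZY z(3)]] and B2 = bilinD[OF burn_pair_bilinear[OF M z(2) ZY]]
    and B3 = bilinD[OF burn_pair_bilinear[OF M z(2,3)]]
    and B4 = bilinD[OF burn_pair_bilinear[OF kf_Om Omega_additive Omega_deflative z(1) YX], unfolded Omega_fob]
  note r' = linD[OF r] and i' = linD[OF i]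
  note N = kfD(1)[OF M(1) z(3)]
  interpret Z: module k "Omega_ob k Z" by (rule Om_mod)
  interpret P: module k "Omega_ob k ?P" by (rule Om_mod)
  have 1: "burn_pair M (Z ** Y) X (?r (burn_cls ?P A \<alpha>)) (burn_pair M Y (Z ** Y) (?i b) c) = burn_pair M Y X (burn_pair OM Z (Y ** X) (burn_cls ?P A \<alpha>) b) c"
    if A: "zc A" "oc A ?P \<alpha>" for A \<alpha>
  proof -
    note w = burn_cls_in[OF A(1) zc_prod[OF z(1) YX] A(2)]
    have "(\<lambda>b \<in> burn_el Z. burn_pair M (Z ** Y) X (?r (burn_cls ?P A \<alpha>)) (burn_pair M Y (Z ** Y) (?i b) c)) =
      (\<lambda>b \<in> burn_el Z. burn_pair M Y X (burn_pair OM Z (Y ** X) (burn_cls ?P A \<alpha>) b) c)"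
      by (rule Omega_ext[where X = Z, OF N]; (rule linI)?)
        (use B1 B2 B3 B4 r' i' c w burn_pair_assoc_cls[OF z A _ _ c] burn_cls_in[OF _ z(1)] in simp_all)
    from fun_cong[OF this, of b] b show ?thesis by simp
  qed
  have "(\<lambda>a \<in> burn_el ?P. burn_pair M (Z ** Y) X (?r a) (burn_pair M Y (Z ** Y) (?i b) c)) =
      (\<lambda>a \<in> burn_el ?P. burn_pair M Y X (burn_pair OM Z (Y ** X) a b) c)"
    by (rule Omega_ext[where X = ?P, OF N]; (rule linI)?)
      (use B1 B2 B3 B4 r' i' b c 1 burn_cls_in[OF _ zc_prod[OF z(1) YX]] in simp_all)
  from fun_cong[OF this, of a] a show ?thesis by simp
qed

end

end

context base_ring
begin

text \<open>The map \<open>?g\<close> multiplies in \<open>Omega\<close>, acts on \<open>M\<close>,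
  and comes back by inserting the diagonal class twice. It is linear by construction. By
  \<open>key\<close> the formula of \<open>mtensor_assoc\<close> takes the same values on elementary
  tensors: the two ways of acting agree in \<open>M\<close>, and \<open>burn_act_diag2\<close>
  returns from there. Hence \<open>mtensor_assoc\<close> equals \<open>?g\<close>, and associativity
  is the fact that the inserted diagonal classes act trivially.\<close>

lemma burn_act_assoc:
  fixes M :: "('k, 'm) kfctr"
  assumes M: "is_kfunctor k M" "is_additive M" "is_deflative M" and X: "zc X"
    and t: "t : carrier (mtensor_ob k (mtensor k OM OM) M X)"
  shows "mtensor_assoc k OM OM M X t : carrier (mtensor_ob k OM (mtensor k OM M) X)"
    and "burn_act M X (mtensor_map k (mtensor k OM OM) M OM M (burn_act OM) (nt_id M) X t) =
      burn_act M X (mtensor_map k OM (mtensor k OM M) OM M (nt_id OM) (burn_act M) X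
        (mtensor_assoc k OM OM M X t))"
proof -
  let ?O = "Omega k" and ?OM = "mtensor k OM M" and ?OO = "mtensor k OM OM"
  note A = kf_Om Omega_additive Omega_deflative
  note O = kf_kd[OF A(1)] and D = kf_kd[OF M(1)]
  note E = mtensor_kdiagram[OF A(1) D] and E' = mtensor_kdiagram[OF A(1) O]
  let ?C = "carrier (mtensor_ob k ?OO M X)" and ?Q = "mtensor_ob k ?O ?OM X"
  note m = mt_mod[OF E' D X] and m' = mt_mod[OF O D X] and Q = mt_mod[OF O E X]
  let ?u = "mtensor_map k ?OO M ?O M (burn_act ?O) (nt_id M) X" and ?w = "mtensor_map k ?O ?OM ?O M (nt_id ?O) (burn_act M) X"
  note U = mtensor_map_mt[OF E' D O D burn_act_nat[OF A] nt_id_nat[OF D] X]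
    and W = mtensor_map_mt[OF O E O D nt_id_nat[OF O] burn_act_nat[OF M] X] and ac = burn_act_mt[OF M X]
  note dc = diag_cls_in[OF X]
  let ?s1 = "restrict (dg M X) (el M X)" and ?s2 = "restrict (dg ?OM X) (carrier (mtensor_ob k ?O M X))"
  note l1 = dg_linear[OF X D] and l2 = dg_linear[OF X E, simplified]
  let ?g = "compose ?C ?s2 (compose ?C ?s1 (compose ?C (burn_act M X) ?u))"
  have g: "?g : lin k (mtensor_ob k ?OO M X) ?Q"
    by (rule lin_comp[OF m lin_comp[OF m lin_comp[OF m U(1) ac(1)] l1] l2])
  let ?T = "%Y c Z a b. mtensor_in k ?O ?OM X (Z ** Y)
     (pure_tensor k (fob ?O ((Z ** Y) ** X)) (mtensor_ob k ?O M (Z ** Y)) (far ?O (s_rebracket Z Y X) a)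
       (mtensor_in k ?O M (Z ** Y) Y (pure_tensor k (fob ?O (Y ** (Z ** Y))) (fob M Y) (far ?O (s_insert Z Y) b) c)))"
  have key: "?T Y c Z a b = ?g (mt ?OO M X Y (mt ?O ?O (Y ** X) Z a b) c)"
    if Y: "zc Y" and Z: "zc Z" and a: "a : el ?O (Z ** (Y ** X))" and b: "b : el ?O Z"
      and c: "c : el M Y" for Y Z a b c
  proof -
    note YX = zc_prod[OF Y X] and ZY = zc_prod[OF Z Y]
    have a': "a : burn_el (Z ** (Y ** X))" and b': "b : burn_el Z" using a b by (simp_all add: Omega_fob)
    note R = s_rebracket_sp[OF Z Y X] and I = s_insert_sp[OF Z Y]
    have ra: "far ?O (s_rebracket Z Y X) a : burn_el ((Z ** Y) ** X)"
      unfolding R(1) using linD(1)[OF Omega_far_linear[OF sp_in[OF R(2)]]] a' by simp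
    have ib: "far ?O (s_insert Z Y) b : burn_el (Y ** (Z ** Y))"
      unfolding I(1) using linD(1)[OF Omega_far_linear[OF sp_in[OF I(2)]]] b' by simp
    let ?ib = "mt ?O M (Z ** Y) Y (far ?O (s_insert Z Y) b) c"
    have ibc: "?ib : carrier (mtensor_ob k ?O M (Z ** Y))"
      by (rule mt_closed[OF O D ZY Y]) (use ib c in "simp_all add: Omega_fob")
    have T: "?T Y c Z a b = mt ?O ?OM X (Z ** Y) (far ?O (s_rebracket Z Y X) a) ?ib" by (simp add: mt_def)
    have Tin: "?T Y c Z a b : carrier ?Q"
      unfolding T by (rule mt_closed[OF O E X ZY]) (use ra ibc in "simp_all add: Omega_fob")
    have "burn_act M X (?w (?T Y c Z a b)) = burn_act M X (mt ?O M X (Z ** Y) (far ?O (s_rebracket Z Y X) a) (burn_act M (Z ** Y) ?ib))"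
      unfolding T using W(2)[OF ZY, of "far ?O (s_rebracket Z Y X) a" ?ib] ra ibc zc_prod[OF ZY X] by (simp add: Omega_fob nt_id_def)
    also have "burn_act M (Z ** Y) ?ib = burn_pair M Y (Z ** Y) (far ?O (s_insert Z Y) b) c"
      by (rule burn_act_mt(2)[OF M ZY Y ib c])
    also have "burn_act M X (mt ?O M X (Z ** Y) (far ?O (s_rebracket Z Y X) a) (burn_pair M Y (Z ** Y) (far ?O (s_insert Z Y) b) c)) =
      burn_pair M (Z ** Y) X (far ?O (s_rebracket Z Y X) a) (burn_pair M Y (Z ** Y) (far ?O (s_insert Z Y) b) c)"
      by (rule ac(2)[OF ZY ra bilinD(1)[OF burn_pair_bilinear[OF M Y ZY] ib c]])
    also have "... = burn_pair M Y X (burn_pair ?O Z (Y ** X) a b) c" by (rule burn_pair_assoc[OF M Z Y X a' b' c])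
    finally have 1: "burn_act M X (?w (?T Y c Z a b)) = burn_pair M Y X (burn_pair ?O Z (Y ** X) a b) c" .
    let ?ab = "mt ?O ?O (Y ** X) Z a b"
    have ab: "?ab : el ?OO (Y ** X)" using mt_closed[OF O O YX Z a b] by simp
    have m_ab: "burn_act ?O (Y ** X) ?ab = burn_pair ?O Z (Y ** X) a b" by (rule burn_act_mt(2)[OF A YX Z a' b])
    have m_in: "burn_pair ?O Z (Y ** X) a b : burn_el (Y ** X)"
      using bilinD(1)[OF burn_pair_bilinear[OF A Z YX] a' b] by (simp add: Omega_fob)
    have "burn_act M X (?u (mt ?OO M X Y ?ab c)) = burn_act M X (mt ?O M X Y (burn_pair ?O Z (Y ** X) a b) c)"
      using U(2)[OF Y ab c] m_ab Y c by (simp add: nt_id_def)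
    also have "... = burn_pair M Y X (burn_pair ?O Z (Y ** X) a b) c" by (rule ac(2)[OF Y m_in c])
    finally have 2: "burn_act M X (?u (mt ?OO M X Y ?ab c)) = burn_act M X (?w (?T Y c Z a b))" using 1 by simp
    have abc: "mt ?OO M X Y ?ab c : ?C" by (rule mt_closed[OF E' D X Y ab c])
    have v: "burn_act M X (?u (mt ?OO M X Y ?ab c)) : el M X" by (rule linD(1)[OF ac(1) linD(1)[OF U(1) abc]])
    have "?g (mt ?OO M X Y ?ab c) = dg ?OM X (dg M X (burn_act M X (?u (mt ?OO M X Y ?ab c))))"
      using abc v linD(1)[OF l1 v] by (simp add: compose_def)
    also have "... = ?T Y c Z a b" unfolding 2 by (rule burn_act_diag2[OF M X Tin])
    finally show ?thesis by simp
  qed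
  have "mtensor_assoc k ?O ?O M X = mtensor_lift k ?OO M X ?Q
      (%Y. tensor_lift k (fob ?OO (Y ** X)) (fob M Y) ?Q
        (%w c. mtensor_lift k ?O ?O (Y ** X) ?Q
          (%Z. tensor_lift k (fob ?O (Z ** (Y ** X))) (fob ?O Z) ?Q (?T Y c Z)) w))"
    using X by (simp add: mtensor_assoc_def Let_def)
  also have "... = ?g"
  proof (rule mt_lift_tensor_eqI[OF E' D X Q g])
    fix Y w c assume Y: "zc Y" and w: "w : el ?OO (Y ** X)" and c: "c : el M Y"
    note YX = zc_prod[OF Y X]
    have w': "w : carrier (mtensor_ob k ?O ?O (Y ** X))" using w by simp
    interpret OOY: module k "mtensor_ob k ?O ?O (Y ** X)" by (rule mt_mod[OF O O YX])
    note b = bilinD[OF mt_bilinear[OF E' D X Y], simplified]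
    have l: "(\<lambda>w \<in> carrier (mtensor_ob k ?O ?O (Y ** X)). ?g (mt ?OO M X Y w c)) : lin k (mtensor_ob k ?O ?O (Y ** X)) ?Q"
      by (rule linI) (use b c linD[OF g] in simp_all)
    \<comment> \<open>The inner lift, in the variable \<open>w\<close>, is identified with
      \<open>?g\<close> in the same manner as the outer one.\<close>
    have "mtensor_lift k ?O ?O (Y ** X) ?Q (%Z. tensor_lift k (fob ?O (Z ** (Y ** X))) (fob ?O Z) ?Q (?T Y c Z)) =
      (\<lambda>w \<in> carrier (mtensor_ob k ?O ?O (Y ** X)). ?g (mt ?OO M X Y w c))"
    proof (rule mt_lift_tensor_eqI[OF O O YX Q l])
      fix Z a b assume h: "zc Z" "a : el ?O (Z ** (Y ** X))" "b : el ?O Z"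
      show "?T Y c Z a b = (\<lambda>w \<in> carrier (mtensor_ob k ?O ?O (Y ** X)). ?g (mt ?OO M X Y w c)) (mt ?O ?O (Y ** X) Z a b)"
        using key[OF Y h c] mt_closed[OF O O YX h] by simp
    qed
    then show "mtensor_lift k ?O ?O (Y ** X) ?Q (%Z. tensor_lift k (fob ?O (Z ** (Y ** X))) (fob ?O Z) ?Q (?T Y c Z)) w =
      ?g (mt ?OO M X Y w c)" using w' by simp
  qed
  finally have e: "mtensor_assoc k ?O ?O M X = ?g" .
  show "mtensor_assoc k ?O ?O M X t : carrier ?Q" unfolding e by (rule linD(1)[OF g t])
  note v = linD(1)[OF ac(1) linD(1)[OF U(1) t]]
  let ?v = "burn_act M X (?u t)"
  have s1: "dg M X ?v : carrier (mtensor_ob k ?O M X)" using linD(1)[OF l1 v] v by simp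
  have gt: "?g t = dg ?OM X (dg M X ?v)" using t v s1 by (simp add: compose_def)
  \<comment> \<open>The diagonal class acts by the identity span.\<close>
  have av: "burn_act M X (dg M X x) = x" if x: "x : el M X" for x
    using ac(2)[OF X dc x] burn_pair_cls[OF M X X x X diag_one_cell] kfD(3)[OF M(1) X x] by (simp add: diag_cls_def[symmetric] uncurry_diag)
  have "?w (?g t) = dg M X (burn_act M X (dg M X ?v))"
    unfolding gt using W(2)[OF X, of "diag_cls X" "dg M X ?v"] dc s1 zc_prod[OF X X] by (simp add: Omega_fob nt_id_def)
  then show "?v = burn_act M X (?w (mtensor_assoc k ?O ?O M X t))" unfolding e using av v by simp
qed

section \<open>Deflative Mackey functors versus modules over the Burnside functor\<close>

lemma deflative_green_module:
  fixes M :: "('k, 'm) kfctr"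
  assumes "is_mackey k M" "is_deflative M"
  shows "is_green_module k (Omega_green k) (M, burn_act M)"
proof -
  have M: "is_kfunctor k M" "is_additive M" "is_deflative M" using assms mackey_additive by (simp_all add: is_mackey_def)
  let ?OO = "mtensor k OM OM"
  have "nt_comp (mtensor k ?OO M) (burn_act M) (mtensor_map k ?OO M OM M (burn_act OM) (nt_id M)) =
     nt_comp (mtensor k ?OO M) (burn_act M) (nt_comp (mtensor k ?OO M)
       (mtensor_map k OM (mtensor k OM M) OM M (nt_id OM) (burn_act M)) (mtensor_assoc k OM OM M))"
    using burn_act_assoc(2)[OF M] by (auto simp: nt_comp_def compose_def intro!: restrict_ext)
  then show ?thesis
    unfolding is_green_module_def Omega_green_def Let_def
    using assms(1) burn_act_nat[OF M] burn_act_unit[OF M] Omega_mult_eq by simp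
qed

text \<open>\<open>val\<close> evaluates the unit law at a class of \<open>X ** X\<close>. For
  stab-surjective \<open>a\<close> the 1-cell \<open>?d oo a\<close> has the same class in
  \<open>Omega\<close> as the diagonal \<open>?d\<close>, while as spans they are \<open>a\<close>
  with itself and the identity; so both spans act equally on \<open>M\<close>.\<close>

lemma green_module_deflative:
  fixes M :: "('k, 'm) kfctr"
  assumes "is_green_module k (Omega_green k) (M, ac)"
  shows "is_mackey k M" "is_deflative M" "ac = burn_act M"
proof -
  have mk: "is_mackey k M" and ac: "ac : nat_trans k (mtensor k OM M) M"
    and unit: "nt_comp (mtensor k OB M) ac (mtensor_map k OB M OM M (Omega_p k) (nt_id M)) = ell k M"
    using assms unfolding is_green_module_def Omega_green_def Let_def by simp_all
  show "is_mackey k M" by (rule mk)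
  have M: "is_kfunctor k M" "is_additive M" using mk mackey_additive by (simp_all add: is_mackey_def)
  note O = kf_kd[OF kf_Om] and Bg = kf_kd[OF kf_Obig] and D = kf_kd[OF M(1)]
  have val: "ac X (mt OM M X X (burn_cls (X ** X) A a) v) = far M (unc X X A a) v"
    if X: "zc X" and a: "zc A" "oc A (X ** X) a" and v: "v : el M X" for X A a v
  proof -
    note XX = zc_prod[OF X X]
    note w = big_cls_in[OF a(1) XX a(2)]
    have w': "big_cls (X ** X) A a : el OB (X ** X)" using w by (simp add: Omega_big_fob)
    let ?t = "mt OB M X X (big_cls (X ** X) A a) v"
    have "mtensor_map k OB M OM M (Omega_p k) (nt_id M) X ?t = mt OM M X X (burn_cls (X ** X) A a) v"
      using mtensor_map_mt(2)[OF Bg D O D Omega_p_nat nt_id_nat[OF D] X X w' v] Omega_p_big(2)[OF XX a] X v by (simp add: nt_id_def)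
    moreover have "ell k M X ?t = far M (unc X X A a) v"
      using ell_mt(2)[OF M X X w v] big_pair_cls(3)[OF M X X v a] by simp
    ultimately show ?thesis
      using fun_cong[OF fun_cong[OF unit, of X], of ?t] X mt_closed[OF Bg D X X w' v] by (simp add: nt_comp_def compose_def)
  qed
  show defl: "is_deflative M"
    unfolding is_deflative_def
  proof (intro allI impI)
    fix W X a assume W: "zc W" and X: "zc X" and a: "oc W X a" and ss: "stab_surjective W X a"
    have fe: "full W X a" "eso W X a" using stab_surjective_iff[OF W X a] ss by simp_all
    have S: "is_sp W X X a a" using W X a by (simp add: is_sp_def)
    note XX = zc_prod[OF X X]
    let ?d = "pair_cell id_cell id_cell"
    note da = oc_comp[OF W a diag_one_cell]
    have b: "burn_cls (X ** X) W (?d oo a) = burn_cls (X ** X) X ?d"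
      by (rule burn_cls_stab[OF W X XX a diag_one_cell fe iso2_refl[OF W XX da]])
    have u: "unc X X W (?d oo a) = sp W X X a a"
      by (simp add: unc_def oo_assoc pair_proj)
    have "far M (sp W X X a a) v = v" if v: "v : el M X" for v
      using val[OF X W da v] val[OF X X diag_one_cell v] b u kfD(3)[OF M(1) X v] by (simp add: uncurry_diag)
    moreover have "far M (sp W X X a a) : extensional (el M X)"
      using linD(2)[OF kfD(2)[OF M(1) sp_in[OF S]]] by simp
    ultimately have "far M (sp W X X a a) = (\<lambda>x \<in> el M X. x)"
      by (intro extensionalityI[of _ "el M X"]) simp_all
    then show "far M (s_arr (c_arr W X a) (c_arr W X a)) = (\<lambda>x \<in> el M X. x)" by (simp add: sp_def)
  qed
  show "ac = burn_act M"
    by (rule Omega_tensor_unique[OF D D ac burn_act_nat[OF M defl]]) (simp add: unit burn_act_unit[OF M defl])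
qed

text \<open>The actions are built from the maps M(<a>), with which every natural transformation
  commutes.\<close>

lemma green_module_maps_eq:
  fixes M N :: "('k, 'm) kfctr"
  assumes "is_mackey k M" "is_deflative M" "is_mackey k N" "is_deflative N"
  shows "green_module_maps k (Omega_green k) (M, burn_act M) (N, burn_act N) = nat_trans k M N"
proof -
  have M: "is_kfunctor k M" "is_additive M" "is_deflative M" and N: "is_kfunctor k N" "is_additive N" "is_deflative N"
    using assms mackey_additive by (simp_all add: is_mackey_def)
  note O = kf_kd[OF kf_Om] and D = kf_kd[OF M(1)] and D' = kf_kd[OF N(1)]
  have "nt_comp (mtensor k OM M) \<eta> (burn_act M) =
    nt_comp (mtensor k OM M) (burn_act N) (mtensor_map k OM M OM N (nt_id OM) \<eta>)"
    if \<eta>: "\<eta> : nat_trans k M N" for \<eta>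
  proof -
    note F = mtensor_map_mt[OF O D O D' nt_id_nat[OF O] \<eta>]
    have "compose (carrier (mtensor_ob k OM M X)) (\<eta> X) (burn_act M X) =
      compose (carrier (mtensor_ob k OM M X)) (burn_act N X) (mtensor_map k OM M OM N (nt_id OM) \<eta> X)"
      if X: "zc X" for X
    proof (rule mt_ext[OF O D X kfD(1)[OF N(1) X]
        lin_comp[OF mt_mod[OF O D X] burn_act_mt(1)[OF M X] nat_transD(1)[OF \<eta> X]]
        lin_comp[OF mt_mod[OF O D X] F(1)[OF X] burn_act_mt(1)[OF N X]]])
      fix Y w v assume h: "zc Y" "w : el OM (Y ** X)" "v : el M Y"
      note YX = zc_prod[OF h(1) X]
      have w: "w : burn_el (Y ** X)" using h(2) by (simp add: Omega_fob)
      have "\<eta> X (burn_pair M Y X w v) = burn_pair N Y X w (\<eta> Y v)"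
        unfolding burn_pair_def
        by (rule big_pair_natural[OF M(1,2) N(1,2) \<eta> h(1) X h(3) linD(1)[OF Omega_i_class(1)[OF YX] w]])
      then show "compose (carrier (mtensor_ob k OM M X)) (\<eta> X) (burn_act M X) (mt OM M X Y w v) =
        compose (carrier (mtensor_ob k OM M X)) (burn_act N X) (mtensor_map k OM M OM N (nt_id OM) \<eta> X) (mt OM M X Y w v)"
        using mt_closed[OF O D X h] burn_act_mt(2)[OF M X h(1) w h(3)] F(2)[OF X h] YX w
          burn_act_mt(2)[OF N X h(1) w linD(1)[OF nat_transD(1)[OF \<eta> h(1)] h(3)]]
        by (simp add: compose_def nt_id_def Omega_fob)
    qed
    then show ?thesis by (simp add: nt_comp_def cong: restrict_cong)
  qed
  then show ?thesis by (auto simp: green_module_maps_def Omega_green_def Let_def)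
qed

section \<open>The two categories and the functors between them\<close>

lemma nt_comp_laws:
  assumes M: "is_kdiagram M" and \<eta>: "\<eta> : nat_trans k M N"
  shows "nt_comp M \<eta> (nt_id M) = \<eta>" and "nt_comp M (nt_id N) \<eta> = \<eta>"
    and "nt_comp M \<zeta> (nt_comp M \<theta> \<eta>) = nt_comp M (nt_comp N \<zeta> \<theta>) \<eta>"
proof -
  note l = linD(1,2)[OF nat_transD(1)[OF \<eta>]] and e = nat_transD(3)[OF \<eta>]
  have "compose (el M X) (\<eta> X) (\<lambda>x \<in> el M X. x) = \<eta> X" if "zc X" for X
    by (rule extensionalityI[of _ "el M X"]) (use l[OF that] in "simp_all add: compose_def")
  then show "nt_comp M \<eta> (nt_id M) = \<eta>"
    by (intro extensionalityI[OF _ e]) (simp_all add: nt_comp_def nt_id_def)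
  have "compose (el M X) (\<lambda>x \<in> el N X. x) (\<eta> X) = \<eta> X" if "zc X" for X
    by (rule extensionalityI[of _ "el M X"]) (use l[OF that] in "simp_all add: compose_def")
  then show "nt_comp M (nt_id N) \<eta> = \<eta>"
    by (intro extensionalityI[OF _ e]) (simp_all add: nt_comp_def nt_id_def)
  have "compose (el M X) (\<zeta> X) (compose (el M X) (\<theta> X) (\<eta> X)) = compose (el M X) (compose (el N X) (\<zeta> X) (\<theta> X)) (\<eta> X)"
    if "zc X" for X
    by (rule extensionalityI[of _ "el M X"]) (use l[OF that] in "simp_all add: compose_def")
  then show "nt_comp M \<zeta> (nt_comp M \<theta> \<eta>) = nt_comp M (nt_comp N \<zeta> \<theta>) \<eta>"
    by (intro extensionalityI[of _ "ob SpC"]) (simp_all add: nt_comp_def)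
qed

lemma deflative_cat_simps:
  "ob (deflative_mackey_cat k) = {M. is_mackey k M & is_deflative M}"
  "ar (deflative_mackey_cat k) = {(M, N, \<eta>). is_mackey k M & is_deflative M & is_mackey k N & is_deflative N & \<eta> : nat_trans k M N}"
  "src (deflative_mackey_cat k) (M, N, \<eta>) = M" "tgt (deflative_mackey_cat k) (M, N, \<eta>) = N"
  "idn (deflative_mackey_cat k) M = (M, M, nt_id M)"
  "cmp (deflative_mackey_cat k) (M', N', \<theta>) (M, N, \<eta>) = (M, N', nt_comp M \<theta> \<eta>)"
  by (auto simp: deflative_mackey_cat_def full_subcategory_def mackey_cat_def)

text \<open>The module category is the image of the deflative one under pairing \<open>M\<close>
  with \<open>burn_act M\<close>. The comparison functors, which add and forget this action, are
  therefore mutually inverse on objects and arrows.\<close>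

lemma green_cat_simps:
  "ob (green_module_cat k (Omega_green k)) = (%M. (M, burn_act M)) ` {M. is_mackey k M & is_deflative M}"
  "ar (green_module_cat k (Omega_green k)) =
    (%(M, N, \<eta>). ((M, burn_act M), (N, burn_act N), \<eta>)) ` ar (deflative_mackey_cat k)"
  "src (green_module_cat k (Omega_green k)) (m, n, \<eta>) = m" "tgt (green_module_cat k (Omega_green k)) (m, n, \<eta>) = n"
  "idn (green_module_cat k (Omega_green k)) m = (m, m, nt_id (fst m))"
  "cmp (green_module_cat k (Omega_green k)) (m', n', \<theta>) (m, n, \<eta>) = (m, n', nt_comp (fst m) \<theta> \<eta>)"
proof -
  show "ob (green_module_cat k (Omega_green k)) = (%M. (M, burn_act M)) ` {M. is_mackey k M & is_deflative M}"
    by (auto simp: green_module_cat_def deflative_green_module dest: green_module_deflative)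
  show "ar (green_module_cat k (Omega_green k)) = (%(M, N, \<eta>). ((M, burn_act M), (N, burn_act N), \<eta>)) ` ar (deflative_mackey_cat k)"
  proof (intro equalityI subsetI)
    fix t assume "t : ar (green_module_cat k (Omega_green k))"
    then obtain M ac N ac' \<eta> where t: "t = ((M, ac), (N, ac'), \<eta>)" "is_green_module k (Omega_green k) (M, ac)" "is_green_module k (Omega_green k) (N, ac')"
      "\<eta> : green_module_maps k (Omega_green k) (M, ac) (N, ac')" by (auto simp: green_module_cat_def)
    note m = green_module_deflative[OF t(2)] and n = green_module_deflative[OF t(3)]
    have "\<eta> : nat_trans k M N" using t(4) green_module_maps_eq[OF m(1,2) n(1,2)] m(3) n(3) by simp
    then have "(M, N, \<eta>) : ar (deflative_mackey_cat k)" using m n by (simp add: deflative_cat_simps)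
    then show "t : (%(M, N, \<eta>). ((M, burn_act M), (N, burn_act N), \<eta>)) ` ar (deflative_mackey_cat k)"
      using t(1) m(3) n(3) by (intro image_eqI[of _ _ "(M, N, \<eta>)"]) simp_all
  next
    fix t assume "t : (%(M, N, \<eta>). ((M, burn_act M), (N, burn_act N), \<eta>)) ` ar (deflative_mackey_cat k)"
    then obtain M N \<eta> where t: "t = ((M, burn_act M), (N, burn_act N), \<eta>)" "(M, N, \<eta>) : ar (deflative_mackey_cat k)" by auto
    then show "t : ar (green_module_cat k (Omega_green k))"
      using deflative_green_module[of M] deflative_green_module[of N] green_module_maps_eq[of M N] by (simp add: deflative_cat_simps green_module_cat_def)
  qed
qed (simp_all add: green_module_cat_def)

lemma deflative_category: "is_category (deflative_mackey_cat k :: (('k, 'm) kfctr, ('k, 'm) mackey_arrow) cat)"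
proof -
  have kd: "is_kdiagram M" if "is_mackey k M" for M :: "('k, 'm) kfctr"
    by (rule kf_kd) (use that in "simp add: is_mackey_def")
  show ?thesis
    unfolding is_category_def
    by (auto simp: deflative_cat_simps arrows_def nt_id_nat kd nt_comp_nat[OF kd] nt_comp_laws[OF kd])
qed

lemma green_category: "is_category (green_module_cat k (Omega_green k) ::
    (('k, 'k burn_elt, 'm) green_module, ('k, 'k burn_elt, 'm) green_module_arrow) cat)"
proof -
  have kd: "is_kdiagram M" if "is_mackey k M" for M :: "('k, 'm) kfctr"
    by (rule kf_kd) (use that in "simp add: is_mackey_def")
  show ?thesis
    unfolding is_category_def
    by (auto simp: green_cat_simps deflative_cat_simps arrows_def nt_id_nat kd nt_comp_nat[OF kd] nt_comp_laws[OF kd] image_iff)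
qed

end

text \<open>A composite of the comparison functors agrees with the identity on the objects and
  arrows of \<open>C\<close>, though not as a record of total functions; the identities still form a
  natural isomorphism.\<close>

lemma idn_natural_iso:
  assumes C: "is_category C" and F: "!!X. X : ob C ==> on_ob F X = X" "!!f. f : ar C ==> on_ar F f = f"
  shows "is_natural_iso C C id_functor F (idn C)" "is_natural_iso C C F id_functor (idn C)"
proof -
  note c = catD[OF C]
  have iso: "is_iso C (idn C X)" if X: "X : ob C" for X
    by (rule is_isoI[OF c(3)[OF X] c(3)[OF X] c(5)[OF c(3)[OF X]] c(5)[OF c(3)[OF X]]])
  have "idn C (tgt C f) o[C] f = f o[C] idn C (src C f)" if f: "f : ar C" for f
    using c(5,6)[of f "src C f" "tgt C f"] f by (simp add: arrows_def)
  then show "is_natural_iso C C id_functor F (idn C)" "is_natural_iso C C F id_functor (idn C)"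
    using c(3) iso F by (auto simp: is_natural_iso_def id_functor_def)
qed

theorem corollary5p7:
  fixes k :: "'k ring"
  assumes "cring k"
  shows "equivalent_categories
           (deflative_mackey_cat k :: (('k, 'm) kfctr, ('k, 'm) mackey_arrow) cat)
           (green_module_cat k (Omega_green k) ::
              (('k, 'k burn_elt, 'm) green_module, ('k, 'k burn_elt, 'm) green_module_arrow) cat)"
proof -
  interpret base_ring k by (rule base_ring.intro[OF assms])
  let ?C = "deflative_mackey_cat k :: (('k, 'm) kfctr, ('k, 'm) mackey_arrow) cat"
    and ?D = "green_module_cat k (Omega_green k) :: (('k, 'k burn_elt, 'm) green_module, ('k, 'k burn_elt, 'm) green_module_arrow) cat"
  define F :: "(('k, 'm) kfctr, ('k, 'm) mackey_arrow, ('k, 'k burn_elt, 'm) green_module, ('k, 'k burn_elt, 'm) green_module_arrow) fctr"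
    where "F = \<lparr> on_ob = (%M. (M, burn_act M)), on_ar = (%(M, N, \<eta>). ((M, burn_act M), (N, burn_act N), \<eta>)) \<rparr>"
  define G :: "(('k, 'k burn_elt, 'm) green_module, ('k, 'k burn_elt, 'm) green_module_arrow, ('k, 'm) kfctr, ('k, 'm) mackey_arrow) fctr"
    where "G = \<lparr> on_ob = fst, on_ar = (%(m, n, \<eta>). (fst m, fst n, \<eta>)) \<rparr>"
  have "is_functor ?C ?D F"
    unfolding is_functor_def by (auto simp: F_def green_cat_simps deflative_cat_simps arrows_def image_iff)
  moreover have "is_functor ?D ?C G"
    unfolding is_functor_def by (auto simp: G_def green_cat_simps deflative_cat_simps arrows_def)
  moreover have "is_natural_iso ?C ?C id_functor (comp_functor G F) (idn ?C)"
    by (rule idn_natural_iso(1)[OF deflative_category]) (auto simp: F_def G_def comp_functor_def)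
  moreover have "is_natural_iso ?D ?D (comp_functor F G) id_functor (idn ?D)"
    by (rule idn_natural_iso(2)[OF green_category]) (auto simp: F_def G_def comp_functor_def green_cat_simps)
  ultimately show ?thesis
    unfolding equivalent_categories_def using deflative_category green_category by blast
qed

end
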